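(* Let $N\geq 3$ and let $u$ be an $x_N$-monotone solution (as defined in the context). Then the coincidence set $\{u=0\}$ is a paraboloid.
   Context: A global solution of the obstacle problem is a function $u\in C^{1,1}_{\mathrm{loc}}(\mathbb{R}^N)$ with $\Delta u=\chi_{\{u>0\}}$ and $u\geq 0$ in $\mathbb{R}^N$; its coincidence set is $\mathcal C=\{u=0\}$. Write $x=(x',x_N)\in\mathbb{R}^{N-1}\times\mathbb{R}$. A global solution $u$ is called $x_N$-monotone if: (i) $\mathcal C$ has non-empty interior; (ii) $\mathcal C\subset\{x_N\geq 0\}$ and $0\in\partial\mathcal C$; (iii) $\partial_N u\leq 0$ in $\mathbb{R}^N$; (iv) $u(rx)/r^2\to p(x'):=\frac12 x'^TQx'$ in $C^{1,\alpha}_{\mathrm{loc}}(\mathbb{R}^N)$ as $r\to\infty$ for $\alpha\in(0,1)$, where $Q\in\mathbb{R}^{(N-1)\times(N-1)}$ is symmetric, positive definite, with $\operatorname{tr}(Q)=1$. A paraboloid is a set which, after a translation and a rotation, equals $\{(x',x_N): x_N\geq 0,\ x'\in\sqrt{x_N}E'\}$ with $E'\subset\mathbb{R}^{N-1}$ an ellipsoid centered at the origin, i.e. after a rotation $E'=\{y':\sum_{j=1}^{N-1}y_j^2/a_j^2\le 1\}$ with $a_j>0$. *)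

theory Defs
  imports "HOL-Analysis.Analysis"
begin

definition grad :: "(real^'n \<Rightarrow> real) \<Rightarrow> real^'n \<Rightarrow> real^'n" where
  "grad f x = (\<chi> i. frechet_derivative f (at x) (axis i 1))"

definition C11_loc :: "(real^'n \<Rightarrow> real) \<Rightarrow> bool" where
  "C11_loc u \<longleftrightarrow> (\<forall>x. u differentiable (at x)) \<and>
     (\<forall>R. \<exists>L. \<forall>y\<in>cball 0 R. \<forall>z\<in>cball 0 R. norm (grad u y - grad u z) \<le> L * dist y z)"

definition global_solution :: "(real^'n \<Rightarrow> real) \<Rightarrow> bool" where
  "global_solution u \<longleftrightarrow> C11_loc u \<and> (\<forall>x. u x \<ge> 0) \<and>
     (AE x in lebesgue. \<exists>H. (grad u has_derivative H) (at x) \<and>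
        (\<Sum>i\<in>UNIV. H (axis i 1) $ i) = indicator {y. u y > 0} x)"

definition coincidence_set :: "(real^'n \<Rightarrow> real) \<Rightarrow> (real^'n) set" where
  "coincidence_set u = {x. u x = 0}"

definition C1alpha_loc_tendsto :: "(real \<Rightarrow> real^'n \<Rightarrow> real) \<Rightarrow> (real^'n \<Rightarrow> real) \<Rightarrow> real \<Rightarrow> bool" where
  "C1alpha_loc_tendsto f p \<alpha> \<longleftrightarrow>
     (\<forall>R>0. \<forall>\<epsilon>>0. eventually (\<lambda>r. \<forall>x\<in>cball 0 R. \<forall>y\<in>cball 0 R.
         \<bar>f r x - p x\<bar> \<le> \<epsilon> \<and>
         norm (grad (f r) x - grad p x) \<le> \<epsilon> \<and>
         norm ((grad (f r) x - grad p x) - (grad (f r) y - grad p y)) \<le> \<epsilon> * dist x y powr \<alpha>) at_top)"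

text \<open>x_N-monotone solution; the distinguished coordinate x_N is the index k.
  The matrix Q on R^{N-1} = {x. x$k = 0} is encoded as an n x n matrix whose
  k-th row and column vanish; then p(x') = 1/2 x'^T Q x' equals 1/2 x.(Q x).\<close>
definition xN_monotone :: "'n \<Rightarrow> real^'n^'n \<Rightarrow> (real^'n \<Rightarrow> real) \<Rightarrow> bool" where
  "xN_monotone k Q u \<longleftrightarrow>
     global_solution u \<and>
     interior (coincidence_set u) \<noteq> {} \<and>
     coincidence_set u \<subseteq> {x. x $ k \<ge> 0} \<and> 0 \<in> frontier (coincidence_set u) \<and>
     (\<forall>x. frechet_derivative u (at x) (axis k 1) \<le> 0) \<and>
     (\<forall>i. Q $ k $ i = 0 \<and> Q $ i $ k = 0) \<and> transpose Q = Q \<and>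
     (\<forall>v. v $ k = 0 \<and> v \<noteq> 0 \<longrightarrow> v \<bullet> (Q *v v) > 0) \<and> trace Q = 1 \<and>
     (\<forall>\<alpha>. 0 < \<alpha> \<and> \<alpha> < 1 \<longrightarrow>
        C1alpha_loc_tendsto (\<lambda>r x. u (r *\<^sub>R x) / r\<^sup>2) (\<lambda>x. (1/2) * (x \<bullet> (Q *v x))) \<alpha>)"

text \<open>Paraboloid: after translation and rotation, {x. x_N >= 0, x' in sqrt(x_N) E'},
  E' an ellipsoid centred at 0; the rotation of E' is absorbed into the global one,
  so E' = {y'. sum_j y_j^2/a_j^2 <= 1}, and x' in sqrt(t) E' iff sum_j x_j^2/a_j^2 <= t.\<close>
definition paraboloid :: "(real^'n) set \<Rightarrow> bool" where
  "paraboloid S \<longleftrightarrow> (\<exists>(m::'n) (c::real^'n) (R::real^'n^'n) (a::'n \<Rightarrow> real).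
     rotation_matrix R \<and> (\<forall>j. j \<noteq> m \<longrightarrow> a j > 0) \<and>
     S = (\<lambda>x. c + R *v x) ` {x. x $ m \<ge> 0 \<and> (\<Sum>j\<in>UNIV - {m}. (x $ j)\<^sup>2 / (a j)\<^sup>2) \<le> x $ m})"

end

theory Submission
 imports Defs
begin

text \<open>The difference of two solutions satisfies mean value inequalities, and the two densities differ
 only on the coincidence sets, which lie in a thin tube around the axis and have little mass there.
 Hence away from the axis such a difference is nearly affine on a large ball. The explicit paraboloid
 solutions \<open>v m h\<close> (with size m and horizontal shift h; \<open>m = 0\<close> is the blow-down) can match an
 arbitrary slope, up to a sign that is excluded by monotonicity. So the distance E(R) of u to this
 family either contracts from radius K R to R by a factor of order \<open>1/K^2\<close>, or it is dominated by a
 constant, which persists to the radius R/K. As E(R) is of order at most \<open>R^(3/2)\<close>, it grows slower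
 than any prescribed power once K is large. A Liouville argument with the disjoint positive and negative parts
 then gives u - v a sign for every vertical translate of v, and sliding yields equality.\<close>

text \<open>The logarithm comes from the dimension of the axis. A potential of a density in a tube
  of width \<open>dlt * R\<close> becomes larger by a factor \<open>ln (1/dlt)\<close> when it is
  averaged over the axis, while the mean value gap of \<open>\<bar>u - v\<bar>\<close> keeps it
  bounded; so the density has mass of order \<open>1/ln (1/dlt)\<close>, in every dimension at least
  three. The initial bound \<open>R^(3/2)\<close> is obtained without explicit solutions:
  \<open>u x - u (x+e)\<close> is nonnegative, and in the half space below the set both terms are
  positive, so a Harnack type estimate makes it \<open>O(sqrt R)\<close>. The size m is measured
  through the vertical slope \<open>Y R m\<close> that it produces at scale R, because that slope
  varies slowly with R and is logarithmic in dimension three. The approximating family contains no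
  vertical translates. They act almost like constants, which is why constants are the one defect
  that does not contract, and they are restored only by the final sliding. Finally, the blow-down of
  u must belong to the family: semi-axes realizing a given Q are found by Brouwer's theorem.\<close>

notation scaleR (infixr "*." 75)

section \<open>Mean value inequalities\<close>

text \<open>The powers are matched so that the gradient of \<open>Psi\<close> at y is
  \<open>- Phi y *. y\<close>. The radius derivative of a \<open>Phi\<close>-average is then one
  integration by parts on the whole space, without surface integrals. \<open>Phi\<close> is still
  C^{1,1}, enough for a second order expansion in the centre.\<close>

definition Phi :: "'a::euclidean_space => real" where
 "Phi y = (max 0 (1-(norm y)^2))^2"

definition Psi :: "'a::euclidean_space => real" where
 "Psi y = (max 0 (1-(norm y)^2)) ^ 3/6"

lemma Phi_nonneg [simp]: "Phi y >= 0" and Psi_nonneg [simp]: "Psi y >= 0"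
 by (auto simp: Phi_def Psi_def)

lemma Phi_le_1: "Phi y <= 1"
proof -
 have "max 0 (1-(norm y)^2) <= 1" by auto
 thus ?thesis unfolding Phi_def by (simp add: power_le_one)
qed

lemma Psi_le: "Psi y <= 1/6"
proof -
 have "max 0 (1-(norm y)^2) <= 1" by auto
 hence "(max 0 (1-(norm y)^2)) ^ 3 <= 1" by (intro power_le_one) auto
 thus ?thesis unfolding Psi_def by simp
qed

lemma Phi_eq_0: "norm y >= 1 ==> Phi y = 0"
 and Psi_eq_0: "norm y >= 1 ==> Psi y = 0"
proof -
 assume "norm y >= 1"
 hence "max 0 (1-(norm y)^2) = 0" using one_le_power[of "norm y" 2] by linarith
 thus "Phi y = 0" "Psi y = 0" by (simp_all add: Phi_def Psi_def)
qed

lemma continuous_on_Phi [continuous_intros]: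
 "continuous_on S g ==> continuous_on S (%x. Phi (g x))"
 unfolding Phi_def by (intro continuous_intros)

lemma continuous_on_Psi [continuous_intros]:
 "continuous_on S g ==> continuous_on S (%x. Psi (g x))"
 unfolding Psi_def by (intro continuous_intros) auto

lemma Phi_measurable [measurable]: "Phi \<in> borel_measurable borel"
 by (intro borel_measurable_continuous_onI continuous_intros)

lemma Psi_measurable [measurable]: "Psi \<in> borel_measurable borel"
 by (intro borel_measurable_continuous_onI continuous_intros)

lemma has_real_derivative_max_cube:
 "((%s::real. (max 0 s) ^ 3) has_real_derivative 3*(max 0 s)^2) (at s)"
proof -
 consider "s < 0" | "s > 0" | "s = 0" by linarith
 thus ?thesis
 proof cases
  case 1
  have "((%s::real. 0) has_real_derivative 0) (at s)" by simp
  hence "((%s::real. (max 0 s) ^ 3) has_real_derivative 0) (at s)"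
   by (rule has_field_derivative_transform_within_open[where S = "{..<0}"]) (use 1 in auto)
  thus ?thesis using 1 by simp
 next
  case 2
  have "((%s::real. s ^ 3) has_real_derivative 3 * s^2) (at s)"
   by (auto intro!: derivative_eq_intros)
  hence "((%s::real. (max 0 s) ^ 3) has_real_derivative 3 * s^2) (at s)"
   by (rule has_field_derivative_transform_within_open[where S = "{0<..}"]) (use 2 in auto)
  thus ?thesis using 2 by simp
 next
  case 3
  have "((%h::real. (max 0 h) ^ 3/h) \<longlongrightarrow> 0) (at 0)"
  proof (rule Lim_null_comparison)
   show "\<forall>\<^sub>F h in at (0::real). norm ((max 0 h) ^ 3/h) <= h^2"
    by (rule always_eventually) (auto simp: max_def power3_eq_cube power2_eq_square)
   show "((%h::real. h\<^sup>2) \<longlongrightarrow> 0) (at 0)"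
    by (auto intro!: tendsto_eq_intros)
  qed
  thus ?thesis using 3 by (simp add: has_field_derivative_iff)
 qed
qed

lemma has_derivative_Psi: "(Psi has_derivative (%h. - (Phi y*(y \<bullet> h)))) (at y)"
proof -
 have 1: "((%y. 1-(norm y)^2) has_derivative (%h. - 2*(y \<bullet> h))) (at y)"
  unfolding power2_norm_eq_inner
  by (auto intro!: derivative_eq_intros simp: inner_commute)
 have 2: "((%s::real. (max 0 s) ^ 3) has_derivative (%h. h*(3*(max 0 (1-(norm y)^2))^2)))
      (at (1-(norm y)^2))"
  using has_real_derivative_max_cube[of "1-(norm y)^2"]
  by (simp add: has_field_derivative_def mult.commute[of _ "3*_"])
 have "((%y. (max 0 (1-(norm y)^2)) ^ 3) has_derivative
      (%h. (- 2*(y \<bullet> h))*(3*(max 0 (1-(norm y)^2))^2))) (at y)"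
  using diff_chain_at[OF 1 2] by (simp add: o_def)
 from has_derivative_mult_right[OF this, of "1/6"]
 show ?thesis
  unfolding Psi_def[abs_def] Phi_def by (simp add: mult.commute)
qed

text \<open>D is C^{1,1} locally with gradient G, and f is its Laplacian, read as the trace of the
  almost everywhere derivative of G. The density is an everywhere defined Borel function, so that it
  can be integrated against kernels directly.\<close>

definition lap :: "('a::euclidean_space => real) => ('a => 'a) => ('a => real) => bool" where
 "lap D G f \<longleftrightarrow> (ALL x. (D has_derivative (%h. G x \<bullet> h)) (at x)) \<and>
     (ALL R. EX L. ALL y:cball 0 R. ALL z:cball 0 R. norm (G y-G z) <= L*norm (y-z)) \<and>
     f \<in> borel_measurable borel \<and> (ALL R. EX K. ALL x:cball 0 R. \<bar>f x\<bar> <= K) \<and>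
     (AE x in lborel. EX H. (G has_derivative H) (at x) \<and> (\<Sum>b\<in>Basis. H b \<bullet> b) = f x)"

lemma lap_has_derivative: "lap D G f ==> (D has_derivative (%h. G x \<bullet> h)) (at x)"
 unfolding lap_def by blast

lemma lap_measurable: "lap D G f ==> f \<in> borel_measurable borel"
 unfolding lap_def by blast

lemma lap_bounded:
 assumes "lap D G f"
 shows "EX K>=0. ALL x. norm x <= R --> \<bar>f x\<bar> <= K"
proof -
 have "EX K. ALL x:cball 0 R. \<bar>f x\<bar> <= K" using assms unfolding lap_def by blast
 then obtain K where "ALL x:cball 0 R. \<bar>f x\<bar> <= K" by blast
 hence "\<bar>f x\<bar> <= \<bar>K\<bar>" if "norm x <= R" for x
  using that by (meson abs_ge_self mem_cball_0 order_trans)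
 thus ?thesis by (intro exI[of _ "\<bar>K\<bar>"]) auto
qed

lemma lap_lipschitz:
 assumes "lap D G f"
 shows "EX L>=0. ALL y z. norm y <= R --> norm z <= R --> norm (G y-G z) <= L*norm (y-z)"
proof -
 have "EX L. ALL y:cball 0 R. ALL z:cball 0 R. norm (G y-G z) <= L*norm (y-z)"
  using assms unfolding lap_def by blast
 then obtain L where L: "ALL y:cball 0 R. ALL z:cball 0 R. norm (G y-G z) <= L*norm (y-z)"
  by blast
 show ?thesis
 proof (intro exI[of _ "\<bar>L\<bar>"] conjI allI impI)
  fix y z :: 'a assume "norm y <= R" "norm z <= R"
  hence "norm (G y-G z) <= L*norm (y-z)" using L by simp
  also have "\<dots> <= \<bar>L\<bar>*norm (y-z)" by (intro mult_right_mono) auto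
  finally show "norm (G y-G z) <= \<bar>L\<bar>*norm (y-z)" .
 qed simp
qed

lemma lap_continuous_gradient:
 assumes "lap D G f" shows "continuous_on UNIV G"
proof -
 have "isCont G x" for x
 proof -
  obtain L where L: "L >= 0" "\<And>y z. norm y <= norm x+1 ==> norm z <= norm x+1 ==>
        norm (G y-G z) <= L*norm (y-z)"
   using lap_lipschitz[OF assms, of "norm x+1"] by blast
  have "L-lipschitz_on (cball 0 (norm x+1)) G"
   using L by (intro lipschitz_onI) (auto simp: dist_norm)
  hence "continuous_on (cball 0 (norm x+1)) G" by (rule lipschitz_on_continuous_on)
  hence "continuous_on (ball 0 (norm x+1)) G" by (rule continuous_on_subset) auto
  thus ?thesis by (simp add: continuous_on_eq_continuous_at)
 qed
 thus ?thesis by (simp add: continuous_on_eq_continuous_at)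
qed

lemma lap_continuous:
 assumes "lap D G f" shows "continuous_on UNIV D"
 using has_derivative_continuous[OF lap_has_derivative[OF assms]]
 by (simp add: continuous_on_eq_continuous_at)

lemma AE_lborel_affine:
 fixes x :: "'a::euclidean_space"
 assumes "s \<noteq> 0" and "AE z in lborel. P z"
 shows "AE y in lborel. P (x+s *. y)"
proof -
 obtain N where N: "{z. \<not> P z} \<subseteq> N" "N \<in> null_sets lborel"
  using assms(2) by (auto simp: eventually_ae_filter)
 have [measurable]: "N \<in> sets borel" using N by auto
 have "AE z in lborel. z \<notin> N" using N by (intro AE_not_in)
 hence "AE z in density (distr lborel borel (%y. x+s *. y)) (%_. \<bar>s\<bar>^DIM('a)). z \<notin> N"
  by (subst lborel_affine[OF assms(1), of x, symmetric])
 hence "AE z in distr lborel borel (%y. x+s *. y). z \<notin> N"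
  using assms(1) by (subst (asm) AE_density) auto
 hence "AE y in lborel. x+s *. y \<notin> N"
  by (subst (asm) AE_distr_iff) auto
 thus ?thesis by (rule eventually_mono) (use N in auto)
qed

text \<open>Integration by parts without any fundamental theorem for Lipschitz functions: the integral of a
 difference quotient vanishes by translation invariance, and the quotients converge dominatedly.\<close>

lemma integral_divergence_zero:
 fixes F :: "'a::euclidean_space => 'a" and d :: "'a => real"
 assumes L: "L >= 0" "\<And>y z. y \<in> cball 0 (R+2) ==> z \<in> cball 0 (R+2) ==> norm (F y-F z) <= L*norm (y-z)"
  and supp: "\<And>x. norm x > R ==> F x = 0" and R: "R >= 0"
  and cont: "continuous_on UNIV F"
  and d [measurable]: "d \<in> borel_measurable borel"
  and AE: "AE x in lborel. EX H. (F has_derivative H) (at x) \<and> (\<Sum>b\<in>Basis. H b \<bullet> b) = d x"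
 shows "integrable lborel d" "integral\<^sup>L lborel d = 0"
proof -
 define s where "s n x = (\<Sum>b\<in>Basis. ((F (x+(1/real (Suc n)) *. b)-F x) \<bullet> b)*real (Suc n))" for n x
 define w where "w x = L*DIM('a)*indicator (cball 0 (R+1)) x" for x :: 'a
 have Fm [measurable]: "F \<in> borel_measurable borel" using cont by (rule borel_measurable_continuous_onI)
 have Fint: "integrable lborel F"
 proof -
  have "integrable lborel (%x. indicator (cball 0 R) x *. F x)"
   using cont by (intro borel_integrable_compact) (auto intro: continuous_on_subset)
  moreover have "(%x. indicator (cball 0 R) x *. F x) = F"
   using supp by (auto simp: indicator_def fun_eq_iff not_le)
  ultimately show ?thesis by simp
 qed
 have shift: "integrable lborel (%x. F (x + c))" "integral\<^sup>L lborel (%x. F (x + c)) = integral\<^sup>L lborel F" for c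
 proof -
  have "integrable (distr lborel borel ((+) c)) F" using Fint lborel_distr_plus[of c] by simp
  thus "integrable lborel (%x. F (x + c))"
   by (subst (asm) integrable_distr_eq) (auto simp: add.commute)
  have "integral\<^sup>L (distr lborel borel ((+) c)) F = integral\<^sup>L lborel (%x. F (c+x))"
   by (subst integral_distr) auto
  thus "integral\<^sup>L lborel (%x. F (x + c)) = integral\<^sup>L lborel F"
   using lborel_distr_plus[of c] by (simp add: add.commute)
 qed
 have s0: "integral\<^sup>L lborel (s n) = 0" for n
 proof -
  have "integral\<^sup>L lborel (%x. (F (x+(1/real (Suc n)) *. b)-F x) \<bullet> b) = 0" for b
  proof -
   have "integral\<^sup>L lborel (%x. (F (x+(1/real (Suc n)) *. b)-F x) \<bullet> b) =
          (integral\<^sup>L lborel (%x. (F (x+(1/real (Suc n)) *. b)-F x))) \<bullet> b"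
    by (intro integral_inner_left) (use shift Fint in auto)
   also have "integral\<^sup>L lborel (%x. (F (x+(1/real (Suc n)) *. b)-F x)) = 0"
    using shift Fint by (subst Bochner_Integration.integral_diff) auto
   finally show ?thesis by simp
  qed
  thus ?thesis unfolding s_def
   by (subst Bochner_Integration.integral_sum) (use shift Fint in auto)
 qed
 have bound: "norm (s n x) <= w x" for n x
 proof (cases "x \<in> cball 0 (R+1)")
  case True
  have "\<bar>((F (x+(1/real (Suc n)) *. b)-F x) \<bullet> b)*real (Suc n)\<bar> <= L" if b: "b \<in> Basis" for b
  proof -
   have nb: "norm ((1/real (Suc n)) *. b) <= 1" using b by simp
   have "norm (F (x+(1/real (Suc n)) *. b)-F x) <= L*norm (x+(1/real (Suc n)) *. b-x)"
   proof (rule L(2))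
    show "x+(1/real (Suc n)) *. b \<in> cball 0 (R+2)"
     using norm_triangle_ineq[of x "(1/real (Suc n)) *. b"] nb True
     unfolding mem_cball_0 by linarith
    show "x \<in> cball 0 (R+2)" using True by auto
   qed
   also have "\<dots> = L/real (Suc n)" using b by simp
   finally have "norm (F (x+(1/real (Suc n)) *. b)-F x) <= L/real (Suc n)" .
   moreover have "\<bar>(F (x+(1/real (Suc n)) *. b)-F x) \<bullet> b\<bar> <= norm (F (x+(1/real (Suc n)) *. b)-F x)"
    using Cauchy_Schwarz_ineq2[of "F (x+(1/real (Suc n)) *. b)-F x" b] b by simp
   ultimately have "\<bar>(F (x+(1/real (Suc n)) *. b)-F x) \<bullet> b\<bar> <= L/real (Suc n)" by linarith
   hence "\<bar>(F (x+(1/real (Suc n)) *. b)-F x) \<bullet> b\<bar>*real (Suc n) <= L"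
    by (simp only: pos_le_divide_eq of_nat_0_less_iff zero_less_Suc)
   thus ?thesis by (simp only: abs_mult abs_of_nat)
  qed
  hence "\<bar>s n x\<bar> <= (\<Sum>b\<in>(Basis::'a set). L)" unfolding s_def
   by (intro order_trans[OF sum_abs sum_mono]) auto
  thus ?thesis using True by (simp add: w_def mult.commute)
 next
  case False
  hence x: "norm x > R+1" by auto
  have "F (x+(1/real (Suc n)) *. b) = 0" if "b \<in> Basis" for b
  proof (rule supp)
   have "norm ((1/real (Suc n)) *. b) <= 1" using that by simp
   thus "R < norm (x+(1/real (Suc n)) *. b)"
    using x norm_diff_ineq[of x "(1/real (Suc n)) *. b"] by linarith
  qed
  moreover have "F x = 0" using x by (intro supp) simp
  ultimately show ?thesis by (simp add: s_def w_def L(1))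
 qed
 have wint: "integrable lborel w" unfolding w_def
  by (intro integrable_mult_right integrable_real_indicator) (use emeasure_bounded_finite[OF bounded_cball, of "0::'a" "R+1"] in auto)
 have lim: "AE x in lborel. (%n. s n x) \<longlonglongrightarrow> d x"
  using AE
 proof eventually_elim
  case (elim x)
  then obtain H where H: "(F has_derivative H) (at x)" "(\<Sum>b\<in>Basis. H b \<bullet> b) = d x" by blast
  have "(%n. ((F (x+(1/real (Suc n)) *. b)-F x) \<bullet> b)*real (Suc n)) \<longlonglongrightarrow> H b \<bullet> b" for b
  proof -
   have lin: "linear H" using H(1) has_derivative_linear by blast
   have g: "((%t::real. x+t *. b) has_derivative (%t. t *. b)) (at 0)"
    by (auto intro!: derivative_eq_intros)
   have "((%t::real. F (x+t *. b) \<bullet> b) has_derivative (%t. H (t *. b) \<bullet> b)) (at 0)"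
    using has_derivative_inner_left[OF has_derivative_compose[OF g, of F H], of b] H(1) by simp
   moreover have "(%t::real. H (t *. b) \<bullet> b) = (%t. (H b \<bullet> b)*t)"
    using linear_cmul[OF lin] by (simp add: fun_eq_iff)
   ultimately have "((%t::real. F (x+t *. b) \<bullet> b) has_real_derivative H b \<bullet> b) (at 0)"
    by (simp add: has_field_derivative_def)
   hence "((%t::real. (F (x+t *. b) \<bullet> b-F x \<bullet> b)/t) \<longlongrightarrow> H b \<bullet> b) (at 0)"
    by (simp add: has_field_derivative_iff)
   moreover have "filterlim (%n. 1/real (Suc n)) (at 0) sequentially"
    by (rule filterlim_atI) (use LIMSEQ_inverse_real_of_nat in \<open>auto simp: inverse_eq_divide\<close>)
   ultimately have "(%n. (F (x+(1/real (Suc n)) *. b) \<bullet> b-F x \<bullet> b)/(1/real (Suc n))) \<longlonglongrightarrow> H b \<bullet> b"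
    by (rule filterlim_compose)
   thus ?thesis by (simp add: inner_diff_left)
  qed
  hence "(%n. s n x) \<longlonglongrightarrow> (\<Sum>b\<in>Basis. H b \<bullet> b)" unfolding s_def by (intro tendsto_sum)
  thus ?case using H by simp
 qed
 have sm: "s n \<in> borel_measurable lborel" for n unfolding s_def by measurable
 show "integrable lborel d"
  by (rule integrable_dominated_convergence[OF _ sm wint lim]) (use bound in auto)
 have "(%n. integral\<^sup>L lborel (s n)) \<longlonglongrightarrow> integral\<^sup>L lborel d"
  by (rule integral_dominated_convergence[OF _ sm wint lim]) (use bound in auto)
 thus "integral\<^sup>L lborel d = 0" using s0 LIMSEQ_unique[of "%n. 0::real"] by simp
qed

lemma Phi_support_cbox: "y \<notin> cbox (- One) One ==> Phi y = 0"
proof -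
 assume "y \<notin> cbox (- One) One"
 then obtain b where b: "b \<in> Basis" "\<not> (- 1 <= y \<bullet> b \<and> y \<bullet> b <= 1)"
  by (auto simp: mem_box inner_minus_left)
 hence "\<bar>y \<bullet> b\<bar> > 1" by linarith
 hence "norm y >= 1" using Basis_le_norm[OF b(1), of y] by linarith
 thus ?thesis by (rule Phi_eq_0)
qed

lemma integrable_Phi:
 fixes g :: "'a::euclidean_space => real"
 assumes "continuous_on UNIV g"
 shows "integrable lborel (%y. g y*Phi y)"
proof -
 have "integrable lborel (%y. indicator (cball 0 1) y *. (g y*Phi y))"
  by (intro borel_integrable_compact continuous_intros continuous_on_subset[OF assms]) auto
 moreover have "(%y. indicator (cball 0 1) y *. (g y*Phi y)) = (%y. g y*Phi y)"
 proof
  fix y :: 'a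
  show "indicator (cball 0 1) y *. (g y*Phi y) = g y*Phi y"
   by (cases "norm y <= 1") (auto simp: Phi_eq_0)
 qed
 ultimately show ?thesis by simp
qed

lemma integrable_Phi' [simp]: "integrable lborel (Phi :: 'a::euclidean_space => real)"
 using integrable_Phi[of "%_. 1"] by simp

text \<open>Passes to a fixed compact box, where continuity in a parameter and the Leibniz rule are
  applied in \<open>mean_value_derivative\<close>.\<close>

lemma has_integral_Phi:
 fixes g :: "'a::euclidean_space => real"
 assumes "continuous_on UNIV g"
 shows "((%y. g y*Phi y) has_integral (\<integral>y. g y*Phi y \<partial>lborel)) (cbox (- One) One)"
proof -
 have "((%y. g y*Phi y) has_integral (\<integral>y. g y*Phi y \<partial>lborel)) UNIV"
  by (rule has_integral_integral_lborel[OF integrable_Phi[OF assms]])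
 moreover have "(%y. if y \<in> cbox (- One) One then g y*Phi y else 0) = (%y. g y*Phi y)"
  by (rule ext) (metis Phi_support_cbox mult_zero_right)
 ultimately show ?thesis
  by (subst has_integral_restrict_UNIV[symmetric]) simp
qed

section \<open>Averages with weight \<open>Phi\<close>\<close>

definition bet :: "'a::euclidean_space itself => real" where
 "bet _ = (\<integral>y. Phi (y::'a) \<partial>lborel)"

lemma bet_pos: "bet TYPE('a::euclidean_space) > 0"
proof -
 have "(\<integral>y. (9/16)*indicator (ball (0::'a) (1/2)) y \<partial>lborel) <= (\<integral>y. Phi (y::'a) \<partial>lborel)"
 proof (rule integral_mono)
  show "integrable lborel (%y::'a. (9/16)*indicator (ball 0 (1/2)) y :: real)"
   by (intro integrable_mult_right integrable_real_indicator)
    (use emeasure_bounded_finite[OF bounded_ball, of "0::'a" "1/2"] in auto)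
  fix y :: 'a
  show "(9/16)*indicator (ball 0 (1/2)) y <= Phi y"
  proof (cases "y \<in> ball 0 (1/2)")
   case True
   hence "(norm y)\<^sup>2 <= (1/2)^2" by (intro power_mono) auto
   hence "3/4 <= max 0 (1-(norm y)^2)" by (simp add: power2_eq_square)
   hence "(3/4)\<^sup>2 <= Phi y" unfolding Phi_def by (rule power_mono) simp
   thus ?thesis using True by (simp add: power2_eq_square)
  qed auto
 qed auto
 moreover have "0 < (9/16)*measure lborel (ball (0::'a) (1/2))"
  using content_ball_pos[of "1/2" "0::'a"] by simp
 moreover have "(\<integral>y. (9/16)*indicator (ball (0::'a) (1/2)) y \<partial>lborel) = (9/16)*measure lborel (ball (0::'a) (1/2))"
  by simp
 ultimately show ?thesis unfolding bet_def by linarith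
qed

definition avg :: "('a::euclidean_space => real) => 'a => real => real" where
 "avg D x R = (\<integral>y. D (x+R *. y)*Phi y \<partial>lborel)/bet TYPE('a)"

lemma continuous_on_affine_compose:
 fixes g :: "'a::euclidean_space => 'b::topological_space"
 shows "continuous_on UNIV g ==> continuous_on UNIV (%y. g (x+R *. y))"
 by (rule continuous_on_compose2[of UNIV g]) (auto intro!: continuous_intros)

lemma integrable_avg:
 fixes D :: "'a::euclidean_space => real"
 assumes "continuous_on UNIV D"
 shows "integrable lborel (%y. D (x+R *. y)*Phi y)"
 by (intro integrable_Phi continuous_on_affine_compose assms)

lemma avg_const: "avg (%_. c) x R = (c::real)" for x :: "'a::euclidean_space"
 using bet_pos[where 'a='a] by (simp add: avg_def bet_def)

lemma avg_add:
 assumes "continuous_on UNIV D" "continuous_on UNIV E"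
 shows "avg (%x. D x+E x) x R = avg D x R+avg E x R"
 unfolding avg_def distrib_right
 by (subst Bochner_Integration.integral_add) (auto intro: integrable_avg assms simp: add_divide_distrib)

lemma avg_cmult: "avg (%x. c*D x) x R = c*avg D x R"
 unfolding avg_def by (simp add: mult.assoc)

lemma avg_mono:
 fixes x :: "'a::euclidean_space"
 assumes "continuous_on UNIV D" "continuous_on UNIV E"
  and "\<And>z. norm (z-x) <= \<bar>R\<bar> ==> D z <= E z"
 shows "avg D x R <= avg E x R"
 unfolding avg_def
proof (intro divide_right_mono integral_mono integrable_avg assms(1,2))
 fix y :: 'a
 show "D (x+R *. y)*Phi y <= E (x+R *. y)*Phi y"
 proof (cases "norm y >= 1")
  case False
  hence "norm (R *. y) <= \<bar>R\<bar>" by (simp add: mult_left_le)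
  thus ?thesis using assms(3)[of "x+R *. y"] by (intro mult_right_mono) auto
 qed (simp add: Phi_eq_0)
qed (use bet_pos[where 'a='a] in auto)

lemma avg_bound:
 fixes x :: "'a::euclidean_space"
 assumes "continuous_on UNIV D"
  and "\<And>z. norm (z-x) <= \<bar>R\<bar> ==> \<bar>D z\<bar> <= M"
 shows "\<bar>avg D x R\<bar> <= M"
proof -
 have "avg D x R <= avg (%_. M) x R" "avg (%_. - M) x R <= avg D x R"
  using assms(2) by (intro avg_mono assms(1) continuous_on_const; force simp: abs_le_iff)+
 thus ?thesis by (simp add: avg_const)
qed

lemma nn_integral_affine:
 fixes x :: "'a::euclidean_space"
 assumes "s > 0" and [measurable]: "h \<in> borel_measurable borel"
 shows "(\<integral>\<^sup>+z. h z \<partial>lborel) = ennreal (s ^ DIM('a))*(\<integral>\<^sup>+y. h (x+s *. y) \<partial>lborel)"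
proof -
 have "(\<integral>\<^sup>+z. h z \<partial>lborel) =
      (\<integral>\<^sup>+z. h z \<partial>density (distr lborel borel (%y. x+s *. y)) (%_. ennreal (\<bar>s\<bar>^DIM('a))))"
  using assms(1) by (subst lborel_affine[of s x, symmetric]) auto
 also have "\<dots> = (\<integral>\<^sup>+z. ennreal (s^DIM('a))*h z \<partial>(distr lborel borel (%y. x+s *. y)))"
  using assms(1) by (subst nn_integral_density) auto
 also have "\<dots> = (\<integral>\<^sup>+y. ennreal (s^DIM('a))*h (x+s *. y) \<partial>lborel)"
  by (subst nn_integral_distr) auto
 also have "\<dots> = ennreal (s ^ DIM('a))*(\<integral>\<^sup>+y. h (x+s *. y) \<partial>lborel)"
  by (rule nn_integral_cmult) auto
 finally show ?thesis .
qed

lemma Psi_lipschitz: "\<bar>Psi y-Psi z\<bar> <= norm (y-z)" for y z :: "'a::euclidean_space"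
proof -
 have "norm (Psi y-Psi z) <= 1*norm (y-z)"
 proof (rule differentiable_bound[of UNIV])
  fix x :: 'a
  show "(Psi has_derivative (%h. - (Phi x*(x \<bullet> h)))) (at x within UNIV)"
   using has_derivative_Psi[of x] by simp
  show "onorm (%h. - (Phi x*(x \<bullet> h))) <= 1"
  proof (rule onorm_le)
   fix h :: 'a
   have "Phi x*norm x <= 1"
   proof (cases "norm x >= 1")
    case False
    thus ?thesis using Phi_le_1[of x] mult_mono[of "Phi x" 1 "norm x" 1] by simp
   qed (simp add: Phi_eq_0)
   hence "Phi x*norm x*norm h <= 1*norm h" by (intro mult_right_mono) auto
   moreover have "Phi x*\<bar>x \<bullet> h\<bar> <= Phi x*(norm x*norm h)"
    by (intro mult_left_mono Cauchy_Schwarz_ineq2) auto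
   ultimately show "norm (- (Phi x*(x \<bullet> h))) <= 1*norm h"
    by (simp add: abs_mult mult.assoc)
  qed
 qed auto
 thus ?thesis by simp
qed

text \<open>The field \<open>Psi y *. G (x+s *. y)\<close> has divergence \<open>s * f (x+s *. y) *
  Psi y - (G (x+s *. y) \<bullet> y) * Phi y\<close>, and the integral of a compactly supported
  divergence vanishes.\<close>

lemma divergence_Psi:
 fixes D :: "'a::euclidean_space => real"
 assumes lap: "lap D G f" and s: "s > 0"
 shows "integrable lborel (%y. f (x+s *. y)*Psi y)"
  and "(\<integral>y. (G (x+s *. y) \<bullet> y)*Phi y \<partial>lborel) = s*(\<integral>y. f (x+s *. y)*Psi y \<partial>lborel)"
proof -
 have [measurable]: "f \<in> borel_measurable borel" using lap by (rule lap_measurable)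
 have Gc: "continuous_on UNIV G" using lap by (rule lap_continuous_gradient)
 define F where "F y = Psi y *. G (x+s *. y)" for y
 define d where "d y = s*(f (x+s *. y)*Psi y)-(G (x+s *. y) \<bullet> y)*Phi y" for y
 obtain L where L: "L >= 0" "\<And>y z. norm y <= norm x+s*3 ==> norm z <= norm x+s*3 ==>
      norm (G y-G z) <= L*norm (y-z)"
  using lap_lipschitz[OF lap, of "norm x+s*3"] by blast
 have "compact (G ` cball 0 (norm x+s*3))"
  by (intro compact_continuous_image continuous_on_subset[OF Gc]) auto
 then obtain B where "B > 0" and B: "\<And>z. norm z <= norm x+s*3 ==> norm (G z) <= B"
  using compact_imp_bounded bounded_pos by (metis image_eqI mem_cball_0)
 have in_ball: "norm (x+s *. y) <= norm x+s*3" if "norm y <= 3" for y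
  using norm_triangle_ineq[of x "s *. y"] that s by (simp add: order_trans)
 have Gsc: "continuous_on UNIV (%y. G (x+s *. y))"
  using Gc by (rule continuous_on_affine_compose)
 have Fc: "continuous_on UNIV F" unfolding F_def
  by (intro continuous_intros Gsc)
 have Flip: "norm (F y-F z) <= (L * s+B)*norm (y-z)"
  if "y \<in> cball 0 (1+2)" "z \<in> cball 0 (1+2)" for y z
 proof -
  have yz: "norm y <= 3" "norm z <= 3" using that by auto
  have "F y-F z = Psi y *. (G (x+s *. y)-G (x+s *. z))+(Psi y-Psi z) *. G (x+s *. z)"
   unfolding F_def by (simp add: algebra_simps)
  hence "norm (F y-F z) <= Psi y*norm (G (x+s *. y)-G (x+s *. z))+\<bar>Psi y-Psi z\<bar>*norm (G (x+s *. z))"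
   using norm_triangle_ineq[of "Psi y *. (G (x+s *. y)-G (x+s *. z))" "(Psi y-Psi z) *. G (x+s *. z)"] by simp
  also have "\<dots> <= 1*(L*(s*norm (y-z)))+norm (y-z)*B"
  proof (intro add_mono mult_mono)
   show "Psi y <= 1" using Psi_le[of y] by linarith
   have "norm (G (x+s *. y)-G (x+s *. z)) <= L*norm ((x+s *. y)-(x+s *. z))"
    by (intro L(2) in_ball yz)
   also have "(x+s *. y)-(x+s *. z) = s *. (y-z)" by (simp add: algebra_simps)
   finally show "norm (G (x+s *. y)-G (x+s *. z)) <= L*(s*norm (y-z))" using s by simp
   show "norm (G (x+s *. z)) <= B" by (intro B in_ball yz)
  qed (auto simp: Psi_lipschitz)
  finally show ?thesis by (simp add: algebra_simps)
 qed
 have AEd: "AE y in lborel. EX H. (F has_derivative H) (at y) \<and> (\<Sum>b\<in>Basis. H b \<bullet> b) = d y"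
 proof -
  have "AE y in lborel. EX H. (G has_derivative H) (at (x+s *. y)) \<and> (\<Sum>b\<in>Basis. H b \<bullet> b) = f (x+s *. y)"
   by (rule AE_lborel_affine) (use lap s in \<open>auto simp: lap_def\<close>)
  thus ?thesis
  proof (rule eventually_mono)
   fix y assume "EX H. (G has_derivative H) (at (x+s *. y)) \<and> (\<Sum>b\<in>Basis. H b \<bullet> b) = f (x+s *. y)"
   then obtain H where H: "(G has_derivative H) (at (x+s *. y))" "(\<Sum>b\<in>Basis. H b \<bullet> b) = f (x+s *. y)"
    by blast
   have lin: "linear H" using H(1) has_derivative_linear by blast
   have "((%y. x+s *. y) has_derivative (%h. s *. h)) (at y)"
    by (auto intro!: derivative_eq_intros)
   from has_derivative_compose[OF this H(1)]
   have "((%y. G (x+s *. y)) has_derivative (%h. H (s *. h))) (at y)" by simp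
   from has_derivative_scaleR[OF has_derivative_Psi this]
   have FD: "(F has_derivative (%h. Psi y *. H (s *. h)+(- (Phi y*(y \<bullet> h))) *. G (x+s *. y))) (at y)"
    unfolding F_def by simp
   have "(\<Sum>b\<in>Basis. (Psi y *. H (s *. b)+(- (Phi y*(y \<bullet> b))) *. G (x+s *. y)) \<bullet> b) =
          s*Psi y*(\<Sum>b\<in>Basis. H b \<bullet> b)-Phi y*(\<Sum>b\<in>Basis. (G (x+s *. y) \<bullet> b)*(y \<bullet> b))"
    by (simp add: linear_cmul[OF lin] inner_add_left inner_diff_left sum.distrib sum_subtractf sum_distrib_left algebra_simps)
   also have "\<dots> = d y" unfolding d_def H(2) euclidean_inner[symmetric] by simp
   finally show "EX H. (F has_derivative H) (at y) \<and> (\<Sum>b\<in>Basis. H b \<bullet> b) = d y" using FD by blast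
  qed
 qed
 have [measurable]: "(%y. G (x+s *. y)) \<in> borel_measurable borel"
  using Gsc by (rule borel_measurable_continuous_onI)
 have dm: "d \<in> borel_measurable borel" unfolding d_def by measurable
 have F0: "F y = 0" if "norm y > 1" for y using that by (simp add: F_def Psi_eq_0)
 have d: "integrable lborel d" "integral\<^sup>L lborel d = 0"
  using integral_divergence_zero[of "L * s+B" 1 F d] Flip F0 Fc dm AEd L(1) s \<open>B > 0\<close> by auto
 have gi: "integrable lborel (%y. (G (x+s *. y) \<bullet> y)*Phi y)"
  by (intro integrable_Phi continuous_intros Gsc)
 have "integrable lborel (%y. (d y+(G (x+s *. y) \<bullet> y)*Phi y)/s)"
  using d(1) gi by auto
 moreover have eq: "(%y. (d y+(G (x+s *. y) \<bullet> y)*Phi y)/s) = (%y. f (x+s *. y)*Psi y)"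
  using s by (simp add: d_def fun_eq_iff)
 ultimately show "integrable lborel (%y. f (x+s *. y)*Psi y)" by simp
 have "(\<integral>y. (d y+(G (x+s *. y) \<bullet> y)*Phi y)/s \<partial>lborel) = (\<integral>y. (G (x+s *. y) \<bullet> y)*Phi y \<partial>lborel)/s"
  using d gi by simp
 thus "(\<integral>y. (G (x+s *. y) \<bullet> y)*Phi y \<partial>lborel) = s*(\<integral>y. f (x+s *. y)*Psi y \<partial>lborel)"
  unfolding eq using s by (simp add: field_simps)
qed

text \<open>Here q is the radius derivative of the unnormalized average. Combined with
  \<open>divergence_Psi\<close>, the gap between average and centre value becomes a weighted
  integral of the Laplacian.\<close>

lemma mean_value_derivative:
 fixes D :: "'a::euclidean_space => real"
 fixes x :: 'a
 assumes lap: "lap D G f" and R: "R >= 0"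
 defines "q \<equiv> %s. \<integral>y. (G (x+s *. y) \<bullet> y)*Phi y \<partial>lborel"
 shows "continuous_on UNIV q"
  and "bet TYPE('a)*(avg D x R-D x) = integral {0..R} q"
proof -
 have Gc: "continuous_on UNIV G" using lap by (rule lap_continuous_gradient)
 have Dc: "continuous_on UNIV D" using lap by (rule lap_continuous)
 have Gsc: "continuous_on UNIV (%y. G (x+s *. y))" for s
  using Gc by (rule continuous_on_affine_compose)
 have q_eq: "q = (%s. integral (cbox (- One) One) (%y. (G (x+s *. y) \<bullet> y)*Phi y))"
 proof
  fix s
  have "((%y. (G (x+s *. y) \<bullet> y)*Phi y) has_integral q s) (cbox (- One) One)"
   unfolding q_def by (intro has_integral_Phi continuous_intros Gsc)
  thus "q s = integral (cbox (- One) One) (%y. (G (x+s *. y) \<bullet> y)*Phi y)"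
   by (simp add: integral_unique)
 qed
 have D_eq: "(%s. \<integral>y. D (x+s *. y)*Phi y \<partial>lborel) =
      (%s. integral (cbox (- One) One) (%y. D (x+s *. y)*Phi y))"
 proof
  fix s
  have "((%y. D (x+s *. y)*Phi y) has_integral (\<integral>y. D (x+s *. y)*Phi y \<partial>lborel)) (cbox (- One) One)"
   by (intro has_integral_Phi continuous_on_affine_compose Dc)
  thus "(\<integral>y. D (x+s *. y)*Phi y \<partial>lborel) = integral (cbox (- One) One) (%y. D (x+s *. y)*Phi y)"
   by (simp add: integral_unique)
 qed
 have cont2: "continuous_on (UNIV \<times> cbox (- One) One) (%(s, y). (G (x+s *. y) \<bullet> y)*Phi y)"
  unfolding split_beta
  by (intro continuous_intros continuous_on_compose2[OF Gc]) auto
 show qc: "continuous_on UNIV q"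
  unfolding q_eq by (rule integral_continuous_on_param[OF cont2])
 define B where "B s = (\<integral>y. D (x+s *. y)*Phi y \<partial>lborel)" for s
 have der: "(B has_vector_derivative q s) (at s)" for s
  unfolding B_def D_eq q_eq
 proof (rule leibniz_rule_vector_derivative[OF _ _ cont2])
  fix s y
  have "((%s::real. x+s *. y) has_derivative (%t. t *. y)) (at s)"
   by (auto intro!: derivative_eq_intros)
  from has_derivative_compose[OF this lap_has_derivative[OF lap]]
  have "((%s. D (x+s *. y)) has_derivative (%t. G (x+s *. y) \<bullet> (t *. y))) (at s)" .
  from has_derivative_mult_left[OF this, of "Phi y"]
  show "((%s. D (x+s *. y)*Phi y) has_vector_derivative (G (x+s *. y) \<bullet> y)*Phi y) (at s)"
   by (simp add: has_vector_derivative_def mult.assoc)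
 next
  fix s
  show "(%y. D (x+s *. y)*Phi y) integrable_on cbox (- One) One"
   using has_integral_Phi[OF continuous_on_affine_compose[OF Dc], of x s] by blast
 qed auto
 have "(q has_integral B R-B 0) {0..R}"
  by (rule fundamental_theorem_of_calculus[OF R]) (use der has_vector_derivative_at_within in blast)
 hence "integral {0..R} q = B R-B 0" by blast
 also have "B 0 = bet TYPE('a)*D x" unfolding B_def bet_def by simp
 also have "B R = bet TYPE('a)*avg D x R" unfolding B_def avg_def using bet_pos[where 'a='a] by simp
 finally show "bet TYPE('a)*(avg D x R-D x) = integral {0..R} q" by (simp add: algebra_simps)
qed

text \<open>A truncated fundamental solution: layers \<open>s^(1-n) * Psi (z/s)\<close> of radius s
  up to R, n being the dimension. Values in \<open>ennreal\<close> allow the order of integration to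
  be exchanged before anything is known to be finite.\<close>

definition kap :: "real => 'a::euclidean_space => ennreal" where
 "kap R z = (\<integral>\<^sup>+s. indicator {0<..R} s*ennreal (s/s ^ DIM('a)*Psi ((1/s) *. z)) \<partial>lborel)"

definition pot :: "('a::euclidean_space => real) => 'a => real => ennreal" where
 "pot h x R = (\<integral>\<^sup>+z. ennreal (h z) * kap R (z-x) \<partial>lborel)"

lemma kap_measurable [measurable]: "kap R \<in> borel_measurable borel"
 unfolding kap_def[abs_def] by measurable

lemma pot_mono:
 assumes "\<And>z. h z <= g z" shows "pot h x R <= pot g x R"
 unfolding pot_def by (intro nn_integral_mono mult_right_mono ennreal_leI assms) auto

text \<open>Tonelli, followed by the substitution \<open>z = x+s *. y\<close> in each layer; its
  Jacobian \<open>s^n\<close> cancels the normalization in \<open>kap\<close>.\<close>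

lemma pot_eq:
 fixes h :: "'a::euclidean_space => real"
 assumes [measurable]: "h \<in> borel_measurable borel" and h: "\<And>z. h z >= 0"
 shows "pot h x R = (\<integral>\<^sup>+s. indicator {0<..R} s*(ennreal s*(\<integral>\<^sup>+y. ennreal (h (x+s *. y)*Psi y) \<partial>lborel)) \<partial>lborel)"
proof -
 define k where "k s z = indicator {0<..R} s*ennreal (s/s ^ DIM('a)*Psi ((1/s) *. (z-x)))" for s and z :: 'a
 have km [measurable]: "(%(s, z). k s z) \<in> borel_measurable (lborel \<Otimes>\<^sub>M lborel)"
  unfolding k_def by measurable
 have km' [measurable]: "(%s. k s z) \<in> borel_measurable lborel" for z unfolding k_def by measurable
 have "pot h x R = (\<integral>\<^sup>+z. (\<integral>\<^sup>+s. ennreal (h z) * k s z \<partial>lborel) \<partial>lborel)"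
  unfolding pot_def kap_def k_def[symmetric] by (subst nn_integral_cmult) auto
 also have "\<dots> = (\<integral>\<^sup>+s. (\<integral>\<^sup>+z. ennreal (h z) * k s z \<partial>lborel) \<partial>lborel)"
  by (rule lborel_pair.Fubini') measurable
 also have "\<dots> = (\<integral>\<^sup>+s. indicator {0<..R} s*(ennreal s*(\<integral>\<^sup>+y. ennreal (h (x+s *. y)*Psi y) \<partial>lborel)) \<partial>lborel)"
 proof (rule nn_integral_cong)
  fix s :: real
  show "(\<integral>\<^sup>+z. ennreal (h z) * k s z \<partial>lborel) =
      indicator {0<..R} s*(ennreal s*(\<integral>\<^sup>+y. ennreal (h (x+s *. y)*Psi y) \<partial>lborel))"
  proof (cases "s \<in> {0<..R}")
   case True
   hence s: "s > 0" by simp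
   have "(\<integral>\<^sup>+z. ennreal (h z) * k s z \<partial>lborel) =
          ennreal (s ^ DIM('a))*(\<integral>\<^sup>+y. ennreal (h (x+s *. y)) * k s (x+s *. y) \<partial>lborel)"
    by (rule nn_integral_affine[OF s]) measurable
   also have "(\<integral>\<^sup>+y. ennreal (h (x+s *. y)) * k s (x+s *. y) \<partial>lborel) =
          (\<integral>\<^sup>+y. ennreal (s/s ^ DIM('a))*ennreal (h (x+s *. y)*Psi y) \<partial>lborel)"
    using True s h by (intro nn_integral_cong) (simp add: k_def ennreal_mult[symmetric] mult_ac)
   also have "\<dots> = ennreal (s/s ^ DIM('a))*(\<integral>\<^sup>+y. ennreal (h (x+s *. y)*Psi y) \<partial>lborel)"
    by (rule nn_integral_cmult) measurable
   also have "ennreal (s ^ DIM('a))*\<dots> = ennreal s*(\<integral>\<^sup>+y. ennreal (h (x+s *. y)*Psi y) \<partial>lborel)"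
    using s by (simp add: mult.assoc[symmetric] ennreal_mult[symmetric])
   finally show ?thesis using True by simp
  qed (simp add: k_def)
 qed
 finally show ?thesis .
qed

lemma mean_value_bound:
 fixes D :: "'a::euclidean_space => real"
 assumes lap: "lap D G f" and R: "R >= 0"
 shows "ennreal (bet TYPE('a)*\<bar>avg D x R-D x\<bar>) <= pot (%z. \<bar>f z\<bar>) x R"
proof -
 have fm [measurable]: "f \<in> borel_measurable borel" using lap by (rule lap_measurable)
 define q where "q s = (\<integral>y. (G (x+s *. y) \<bullet> y)*Phi y \<partial>lborel)" for s
 have qc: "continuous_on UNIV q" and q: "bet TYPE('a)*(avg D x R-D x) = integral {0..R} q"
  using mean_value_derivative[OF lap R, of x] unfolding q_def[abs_def] by auto
 have qi: "set_integrable lborel {0..R} q"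
  unfolding set_integrable_def
  by (intro borel_integrable_compact continuous_on_subset[OF qc]) auto
 have "bet TYPE('a)*\<bar>avg D x R-D x\<bar> = norm (LINT s:{0..R}|lborel. q s)"
  using bet_pos[where 'a='a] q set_borel_integral_eq_integral(2)[OF qi]
  by (simp add: abs_mult flip: q)
 hence "ennreal (bet TYPE('a)*\<bar>avg D x R-D x\<bar>) = ennreal (norm (LINT s:{0..R}|lborel. q s))" by simp
 also have "\<dots> <= (\<integral>\<^sup>+s. ennreal (norm (indicator {0..R} s *. q s)) \<partial>lborel)"
  unfolding set_lebesgue_integral_def
  by (rule integral_norm_bound_ennreal) (use qi in \<open>simp add: set_integrable_def\<close>)
 also have "\<dots> <= (\<integral>\<^sup>+s. indicator {0<..R} s*(ennreal s*(\<integral>\<^sup>+y. ennreal (\<bar>f (x+s *. y)\<bar>*Psi y) \<partial>lborel)) \<partial>lborel)"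
 proof (rule nn_integral_mono_AE)
  have "AE s in lborel. s \<noteq> (0::real)" by (rule AE_lborel_singleton)
  thus "AE s in lborel. ennreal (norm (indicator {0..R} s *. q s)) <=
       indicator {0<..R} s*(ennreal s*(\<integral>\<^sup>+y. ennreal (\<bar>f (x+s *. y)\<bar>*Psi y) \<partial>lborel))"
  proof (rule eventually_mono)
   fix s :: real assume s0: "s \<noteq> 0"
   show "ennreal (norm (indicator {0..R} s *. q s)) <=
       indicator {0<..R} s*(ennreal s*(\<integral>\<^sup>+y. ennreal (\<bar>f (x+s *. y)\<bar>*Psi y) \<partial>lborel))"
   proof (cases "s \<in> {0..R}")
    case True
    with s0 have s: "s > 0" "s <= R" by auto
    have "ennreal \<bar>\<integral>y. f (x+s *. y)*Psi y \<partial>lborel\<bar> <= (\<integral>\<^sup>+y. ennreal (\<bar>f (x+s *. y)\<bar>*Psi y) \<partial>lborel)"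
     using integral_norm_bound_ennreal[OF divergence_Psi(1)[OF lap s(1), of x]]
     by (simp add: abs_mult)
    hence "ennreal s*ennreal \<bar>\<integral>y. f (x+s *. y)*Psi y \<partial>lborel\<bar> <=
            ennreal s*(\<integral>\<^sup>+y. ennreal (\<bar>f (x+s *. y)\<bar>*Psi y) \<partial>lborel)"
     by (rule mult_left_mono) auto
    thus ?thesis
     using s True by (simp add: q_def divergence_Psi(2)[OF lap s(1), of x] abs_mult ennreal_mult)
   qed simp
  qed
 qed
 also have "\<dots> = pot (%z. \<bar>f z\<bar>) x R" by (rule pot_eq[symmetric]) auto
 finally show ?thesis .
qed

text \<open>Stated for a minorant h of the Laplacian because the intended D are the regularized
  absolute values, whose Laplacian has an additional nonnegative gradient term that is to be
  dropped.\<close>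

lemma mean_value_subharmonic:
 fixes D :: "'a::euclidean_space => real"
 assumes lap: "lap D G f" and R: "R >= 0"
  and [measurable]: "h \<in> borel_measurable borel" and h: "\<And>z. 0 <= h z" "\<And>z. h z <= f z"
 shows "D x <= avg D x R"
  and "pot h x R <= ennreal (bet TYPE('a)*(avg D x R-D x))"
proof -
 have fm [measurable]: "f \<in> borel_measurable borel" using lap by (rule lap_measurable)
 define q where "q s = (\<integral>y. (G (x+s *. y) \<bullet> y)*Phi y \<partial>lborel)" for s
 have qc: "continuous_on UNIV q" and q: "bet TYPE('a)*(avg D x R-D x) = integral {0..R} q"
  using mean_value_derivative[OF lap R, of x] unfolding q_def[abs_def] by auto
 have qi: "set_integrable lborel {0..R} q"
  unfolding set_integrable_def
  by (intro borel_integrable_compact continuous_on_subset[OF qc]) auto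
 have f0: "f z >= 0" for z using h[of z] by linarith
 have q_nonneg: "q s >= 0" if "s > 0" for s
  unfolding q_def divergence_Psi(2)[OF lap that, of x] using that f0
  by (intro mult_nonneg_nonneg integral_nonneg_AE) auto
 \<comment> \<open>The formula of \<open>divergence_Psi\<close> holds for positive radii only; the
   endpoint follows by continuity.\<close>
 have q0: "q 0 >= 0"
 proof (rule tendsto_lowerbound)
  have "isCont q 0" using qc by (simp add: continuous_on_eq_continuous_at)
  thus "(q \<longlongrightarrow> q 0) (at_right 0)" unfolding isCont_def by (rule filterlim_mono) (auto simp: at_le)
  show "\<forall>\<^sub>F s in at_right 0. 0 <= q s"
   using q_nonneg by (auto simp: eventually_at_filter)
 qed auto
 have qn: "q s >= 0" if "s >= 0" for s using q0 q_nonneg that by (cases "s = 0") auto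
 have "integral {0..R} q >= 0"
  using qn by (intro integral_nonneg) (auto intro: set_borel_integral_eq_integral(1)[OF qi])
 hence "avg D x R-D x >= 0" unfolding q[symmetric] using bet_pos[where 'a='a]
  by (simp add: zero_le_mult_iff)
 thus "D x <= avg D x R" by simp
 have "pot h x R = (\<integral>\<^sup>+s. indicator {0<..R} s*(ennreal s*(\<integral>\<^sup>+y. ennreal (h (x+s *. y)*Psi y) \<partial>lborel)) \<partial>lborel)"
  by (rule pot_eq) (auto simp: h)
 also have "\<dots> <= (\<integral>\<^sup>+s. ennreal (indicator {0..R} s *. q s) \<partial>lborel)"
 proof (rule nn_integral_mono)
  fix s :: real
  show "indicator {0<..R} s*(ennreal s*(\<integral>\<^sup>+y. ennreal (h (x+s *. y)*Psi y) \<partial>lborel)) <=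
        ennreal (indicator {0..R} s *. q s)"
  proof (cases "s \<in> {0<..R}")
   case True
   hence s: "s > 0" "s <= R" by auto
   have "(\<integral>\<^sup>+y. ennreal (h (x+s *. y)*Psi y) \<partial>lborel) <= (\<integral>\<^sup>+y. ennreal (f (x+s *. y)*Psi y) \<partial>lborel)"
    by (intro nn_integral_mono ennreal_leI mult_right_mono h) auto
   also have "\<dots> = ennreal (\<integral>y. f (x+s *. y)*Psi y \<partial>lborel)"
    by (rule nn_integral_eq_integral[OF divergence_Psi(1)[OF lap s(1)]]) (auto simp: f0)
   finally have "ennreal s*(\<integral>\<^sup>+y. ennreal (h (x+s *. y)*Psi y) \<partial>lborel) <=
          ennreal s*ennreal (\<integral>y. f (x+s *. y)*Psi y \<partial>lborel)" by (rule mult_left_mono) auto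
   also have "\<dots> = ennreal (q s)"
    unfolding q_def divergence_Psi(2)[OF lap s(1), of x] using s f0
    by (intro ennreal_mult[symmetric] integral_nonneg_AE) auto
   finally show ?thesis using s by simp
  qed simp
 qed
 also have "\<dots> = ennreal (LINT s:{0..R}|lborel. q s)"
  unfolding set_lebesgue_integral_def
  by (rule nn_integral_eq_integral) (use qi qn in \<open>auto simp: set_integrable_def indicator_def\<close>)
 also have "\<dots> = ennreal (bet TYPE('a)*(avg D x R-D x))"
  using set_borel_integral_eq_integral(2)[OF qi] q by simp
 finally show "pot h x R <= ennreal (bet TYPE('a)*(avg D x R-D x))" .
qed

lemma lap_diff:
 assumes u: "lap u G f" and v: "lap v H g"
 shows "lap (%x. u x-v x) (%x. G x-H x) (%x. f x-g x)"
 unfolding lap_def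
proof (intro conjI allI)
 fix x
 show "((%x. u x-v x) has_derivative (%h. (G x-H x) \<bullet> h)) (at x)"
  using has_derivative_diff[OF lap_has_derivative[OF u] lap_has_derivative[OF v]]
  by (simp add: inner_diff_left)
next
 fix R
 obtain L where "L >= 0" and L: "\<And>y z. norm y <= R ==> norm z <= R ==> norm (G y-G z) <= L*norm (y-z)"
   using lap_lipschitz[OF u, of R] by blast
 obtain M where "M >= 0" and M: "\<And>y z. norm y <= R ==> norm z <= R ==> norm (H y-H z) <= M*norm (y-z)"
   using lap_lipschitz[OF v, of R] by blast
 show "EX L. ALL y:cball 0 R. ALL z:cball 0 R. norm (G y-H y-(G z-H z)) <= L*norm (y-z)"
 proof (intro exI ballI)
  fix y z :: 'a assume "y \<in> cball 0 R" "z \<in> cball 0 R"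
  hence "norm (G y-G z) <= L*norm (y-z)" "norm (H y-H z) <= M*norm (y-z)"
   using L M by auto
  moreover have "norm (G y-H y-(G z-H z)) <= norm (G y-G z)+norm (H y-H z)"
   using norm_triangle_ineq4[of "G y-G z" "H y-H z"] by (simp add: algebra_simps)
  ultimately show "norm (G y-H y-(G z-H z)) <= (L+M)*norm (y-z)"
   by (simp add: algebra_simps)
 qed
next
 show "(%x. f x-g x) \<in> borel_measurable borel"
  using lap_measurable[OF u] lap_measurable[OF v] by measurable
next
 fix R
 obtain L where "L >= 0" and L: "\<And>y. norm y <= R ==> \<bar>f y\<bar> <= L" using lap_bounded[OF u, of R] by blast
 obtain M where "M >= 0" and M: "\<And>y. norm y <= R ==> \<bar>g y\<bar> <= M" using lap_bounded[OF v, of R] by blast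
 show "EX K. ALL x:cball 0 R. \<bar>f x-g x\<bar> <= K"
 proof (intro exI ballI)
  fix x :: 'a assume "x \<in> cball 0 R"
  hence "\<bar>f x\<bar> <= L" "\<bar>g x\<bar> <= M" using L M by auto
  thus "\<bar>f x-g x\<bar> <= L+M" by linarith
 qed
next
 have "AE x in lborel. EX A. (G has_derivative A) (at x) \<and> (\<Sum>b\<in>Basis. A b \<bullet> b) = f x"
  "AE x in lborel. EX B. (H has_derivative B) (at x) \<and> (\<Sum>b\<in>Basis. B b \<bullet> b) = g x"
  using u v unfolding lap_def by blast+
 thus "AE x in lborel. EX A. ((%x. G x-H x) has_derivative A) (at x) \<and> (\<Sum>b\<in>Basis. A b \<bullet> b) = f x-g x"
 proof eventually_elim
  case (elim x)
  then obtain A B where AB: "(G has_derivative A) (at x)" "(\<Sum>b\<in>Basis. A b \<bullet> b) = f x"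
   "(H has_derivative B) (at x)" "(\<Sum>b\<in>Basis. B b \<bullet> b) = g x" by blast
  thus ?case
   by (intro exI[of _ "%h. A h-B h"])
    (auto intro!: has_derivative_diff simp: inner_diff_left sum_subtractf)
 qed
qed

lemma lap_loc_bounded_gradient:
 fixes D :: "'a::euclidean_space => real"
 assumes "lap D G f"
 shows "EX B>0. (ALL z. norm z <= R --> norm (G z) <= B) \<and>
    (ALL y z. norm y <= R --> norm z <= R --> \<bar>D y-D z\<bar> <= B*norm (y-z))"
proof -
 have "compact (G ` cball 0 R)"
  by (intro compact_continuous_image continuous_on_subset[OF lap_continuous_gradient[OF assms]]) auto
 then obtain B where B: "B > 0" "ALL z:G ` cball 0 R. norm z <= B"
  using compact_imp_bounded bounded_pos by blast
 have GB: "norm (G z) <= B" if "norm z <= R" for z using B(2) that by simp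
 have "norm (D y-D z) <= B*norm (y-z)" if "norm y <= R" "norm z <= R" for y z
 proof (rule differentiable_bound[of "cball 0 R" D "%x h. G x \<bullet> h"])
  fix x :: 'a assume x: "x \<in> cball 0 R"
  show "(D has_derivative (%h. G x \<bullet> h)) (at x within cball 0 R)"
   using lap_has_derivative[OF assms] by (rule has_derivative_at_withinI)
  show "onorm (%h. G x \<bullet> h) <= B"
  proof (rule onorm_le)
   fix h :: 'a
   have "\<bar>G x \<bullet> h\<bar> <= norm (G x)*norm h" by (rule Cauchy_Schwarz_ineq2)
   also have "\<dots> <= B*norm h" using GB[of x] x by (intro mult_right_mono) auto
   finally show "norm (G x \<bullet> h) <= B*norm h" by simp
  qed
 qed (use that in auto)
 thus ?thesis using B(1) GB by (intro exI[of _ B]) auto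
qed

text \<open>The convex functions \<open>sqrt (D\<^sup>2 + eps\<^sup>2)\<close> of D stay in the class, which yields Kato's inequality for \<open>\<bar>D\<bar>\<close>.\<close>

lemma lap_sqrt:
 fixes D :: "'a::euclidean_space => real"
 assumes lap: "lap D G f" and e: "e > 0"
 defines "E \<equiv> %x. sqrt ((D x)^2+e^2)"
 shows "lap E (%x. (D x/E x) *. G x) (%x. D x * f x/E x+e^2*(G x \<bullet> G x)/E x ^ 3)"
proof -
 have [measurable]: "f \<in> borel_measurable borel" using lap by (rule lap_measurable)
 have Dc: "continuous_on UNIV D" using lap by (rule lap_continuous)
 have Gc: "continuous_on UNIV G" using lap by (rule lap_continuous_gradient)
 have [measurable]: "D \<in> borel_measurable borel" "G \<in> borel_measurable borel"
  using Dc Gc borel_measurable_continuous_onI by auto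
 have Epos: "E x > 0" for x using e by (simp add: E_def add_nonneg_pos)
 have E2: "E x*E x = (D x)^2+e^2" for x by (simp add: E_def)
 have Ee: "E x >= e" for x unfolding E_def using e by (intro real_le_rsqrt) auto
 have ED: "\<bar>D x\<bar> <= E x" for x unfolding E_def by (intro real_le_rsqrt) auto
 have Eder: "(E has_derivative (%h. (D x/E x)*(G x \<bullet> h))) (at x)" for x
 proof -
  have pos: "(D x)\<^sup>2+e^2 > 0" using e by (simp add: add_nonneg_pos)
  have "((%x. (D x)\<^sup>2+e^2) has_derivative (%h. 2*D x*(G x \<bullet> h))) (at x)"
   by (auto intro!: derivative_eq_intros lap_has_derivative[OF lap])
  from has_derivative_real_sqrt[OF pos this]
  show ?thesis unfolding E_def by (rule has_derivative_eq_rhs) (auto simp: field_simps)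
 qed
 have rder: "((%x. D x/E x) has_derivative (%h. e\<^sup>2/E x ^ 3*(G x \<bullet> h))) (at x)" for x
 proof -
  have "((%x. D x/E x) has_derivative
       (%h. - D x*(inverse (E x)*((D x/E x)*(G x \<bullet> h))*inverse (E x))+(G x \<bullet> h)/E x)) (at x)"
   by (rule has_derivative_divide[OF lap_has_derivative[OF lap] Eder]) (use Epos[of x] in simp)
  moreover have "- D x*(inverse (E x)*((D x/E x)*t)*inverse (E x))+t/E x = e^2/E x ^ 3*t" for t
  proof -
   have "- D x*(inverse (E x)*((D x/E x)*t)*inverse (E x))+t/E x = (E x*E x-(D x)^2)*t/E x ^ 3"
    using Epos[of x] by (simp add: field_simps power2_eq_square power3_eq_cube)
   thus ?thesis by (simp add: E2)
  qed
  ultimately show ?thesis by simp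
 qed
 show ?thesis
  unfolding lap_def
 proof (intro conjI allI)
  fix x
  show "(E has_derivative (%h. ((D x/E x) *. G x) \<bullet> h)) (at x)"
   using Eder[of x] by simp
 next
  fix R
  obtain B where B: "B > 0" "\<And>z. norm z <= R ==> norm (G z) <= B"
   "\<And>y z. norm y <= R ==> norm z <= R ==> \<bar>D y-D z\<bar> <= B*norm (y-z)"
   using lap_loc_bounded_gradient[OF lap, of R] by blast
  obtain L where "L >= 0" and L: "\<And>y z. norm y <= R ==> norm z <= R ==> norm (G y-G z) <= L*norm (y-z)"
   using lap_lipschitz[OF lap, of R] by blast
  have rlip: "norm (D y/E y-D z/E z) <= (B/e)*norm (y-z)" if "norm y <= R" "norm z <= R" for y z
  proof (rule differentiable_bound[of "cball 0 R"])
   fix x :: 'a assume x: "x \<in> cball 0 R"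
   show "((%x. D x/E x) has_derivative (%h. e\<^sup>2/E x ^ 3*(G x \<bullet> h))) (at x within cball 0 R)"
    using rder by (rule has_derivative_at_withinI)
   show "onorm (%h. e\<^sup>2/E x ^ 3*(G x \<bullet> h)) <= B/e"
   proof (rule onorm_le)
    fix h :: 'a
    have "e ^ 3 <= E x ^ 3" using Ee[of x] e by (intro power_mono) auto
    hence "e\<^sup>2/E x ^ 3 <= e^2/e ^ 3" using e Epos[of x] by (intro divide_left_mono) auto
    also have "\<dots> = 1/e" using e by (simp add: power2_eq_square power3_eq_cube)
    finally have 1: "e\<^sup>2/E x ^ 3 <= 1/e" .
    have 2: "\<bar>G x \<bullet> h\<bar> <= B*norm h"
     using Cauchy_Schwarz_ineq2[of "G x" h] B(2)[of x] x
     mult_right_mono[of "norm (G x)" B "norm h"] by simp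
    have "\<bar>e\<^sup>2/E x ^ 3*(G x \<bullet> h)\<bar> = e^2/E x ^ 3*\<bar>G x \<bullet> h\<bar>"
     using Epos[of x] by (simp add: abs_mult)
    also have "\<dots> <= (1/e)*(B*norm h)"
     using 1 2 Epos[of x] e by (intro mult_mono) auto
    finally show "norm (e^2/E x ^ 3*(G x \<bullet> h)) <= B/e*norm h" by simp
   qed
  qed (use that in auto)
  show "EX L. ALL y:cball 0 R. ALL z:cball 0 R. norm ((D y/E y) *. G y-(D z/E z) *. G z) <= L*norm (y-z)"
  proof (intro exI ballI)
   fix y z :: 'a assume "y \<in> cball 0 R" "z \<in> cball 0 R"
   hence yz: "norm y <= R" "norm z <= R" by auto
   have "(D y/E y) *. G y-(D z/E z) *. G z = (D y/E y) *. (G y-G z)+(D y/E y-D z/E z) *. G z"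
    by (simp add: algebra_simps)
   hence "norm ((D y/E y) *. G y-(D z/E z) *. G z) <=
          \<bar>D y/E y\<bar>*norm (G y-G z)+\<bar>D y/E y-D z/E z\<bar>*norm (G z)"
    using norm_triangle_ineq[of "(D y/E y) *. (G y-G z)" "(D y/E y-D z/E z) *. G z"] by simp
   also have "\<dots> <= 1*(L*norm (y-z))+((B/e)*norm (y-z))*B"
   proof (intro add_mono mult_mono)
    show "\<bar>D y/E y\<bar> <= 1" using ED[of y] Epos[of y] by (simp add: abs_divide)
    show "norm (G y-G z) <= L*norm (y-z)" using L yz by blast
    show "\<bar>D y/E y-D z/E z\<bar> <= (B/e)*norm (y-z)" using rlip yz by simp
    show "norm (G z) <= B" using B yz by blast
   qed (use B e in auto)
   finally show "norm ((D y/E y) *. G y-(D z/E z) *. G z) <= (L+B/e*B)*norm (y-z)"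
    by (simp add: algebra_simps)
  qed
 next
  have [measurable]: "E \<in> borel_measurable borel" unfolding E_def by measurable
  show "(%x. D x * f x/E x+e^2*(G x \<bullet> G x)/E x ^ 3) \<in> borel_measurable borel" by measurable
 next
  fix R
  obtain B where B: "B > 0" "\<And>z. norm z <= R ==> norm (G z) <= B"
   "\<And>y z. norm y <= R ==> norm z <= R ==> \<bar>D y-D z\<bar> <= B*norm (y-z)"
   using lap_loc_bounded_gradient[OF lap, of R] by blast
  obtain K where K: "K >= 0" "\<And>z. norm z <= R ==> \<bar>f z\<bar> <= K" using lap_bounded[OF lap, of R] by blast
  show "EX K. ALL x:cball 0 R. \<bar>D x * f x/E x+e^2*(G x \<bullet> G x)/E x ^ 3\<bar> <= K"
  proof (intro exI ballI)
   fix x :: 'a assume "x \<in> cball 0 R"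
   hence x: "norm x <= R" by simp
   have "\<bar>D x * f x/E x\<bar> = (\<bar>D x\<bar>/E x)*\<bar>f x\<bar>" using Epos[of x] by (simp add: abs_mult)
   also have "\<dots> <= 1*K" using ED[of x] Epos[of x] K x by (intro mult_mono) auto
   finally have 1: "\<bar>D x * f x/E x\<bar> <= K" by simp
   have "norm (G x)*norm (G x) <= B*B" using B x by (intro mult_mono) auto
   hence 2: "G x \<bullet> G x <= B^2" by (simp add: power2_eq_square dot_square_norm)
   have "e ^ 3 <= E x ^ 3" using Ee[of x] e by (intro power_mono) auto
   hence "e\<^sup>2*(G x \<bullet> G x)/E x ^ 3 <= e^2*B^2/e ^ 3"
    using 2 e Epos[of x] by (intro frac_le mult_left_mono) auto
   moreover have "e\<^sup>2*(G x \<bullet> G x)/E x ^ 3 >= 0" using Epos[of x] by simp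
   ultimately show "\<bar>D x * f x/E x+e^2*(G x \<bullet> G x)/E x ^ 3\<bar> <= K+e^2*B^2/e ^ 3"
    using 1 by linarith
  qed
 next
  have "AE x in lborel. EX A. (G has_derivative A) (at x) \<and> (\<Sum>b\<in>Basis. A b \<bullet> b) = f x"
   using lap unfolding lap_def by blast
  thus "AE x in lborel. EX A. ((%x. (D x/E x) *. G x) has_derivative A) (at x) \<and>
        (\<Sum>b\<in>Basis. A b \<bullet> b) = D x * f x/E x+e^2*(G x \<bullet> G x)/E x ^ 3"
  proof eventually_elim
   case (elim x)
   then obtain A where A: "(G has_derivative A) (at x)" "(\<Sum>b\<in>Basis. A b \<bullet> b) = f x" by blast
   have "((%x. (D x/E x) *. G x) has_derivative
          (%h. (D x/E x) *. A h+(e^2/E x ^ 3*(G x \<bullet> h)) *. G x)) (at x)"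
    by (rule has_derivative_scaleR[OF rder A(1)])
   moreover have "(\<Sum>b\<in>Basis. ((D x/E x) *. A b+(e^2/E x ^ 3*(G x \<bullet> b)) *. G x) \<bullet> b) =
          (D x/E x)*(\<Sum>b\<in>Basis. A b \<bullet> b)+e^2/E x ^ 3*(\<Sum>b\<in>Basis. (G x \<bullet> b)*(G x \<bullet> b))"
    by (simp add: inner_add_left sum.distrib sum_distrib_left mult.assoc)
   moreover have "\<dots> = D x * f x/E x+e^2*(G x \<bullet> G x)/E x ^ 3"
    unfolding A(2) euclidean_inner[symmetric] by simp
   ultimately show ?case
    by (intro exI[of _ "%h. (D x/E x) *. A h+(e^2/E x ^ 3*(G x \<bullet> h)) *. G x"]) simp
  qed
 qed
qed

section \<open>Solutions and differences of two solutions\<close>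

definition sol :: "('a::euclidean_space => real) => bool" where
 "sol u \<longleftrightarrow> (ALL x. u x >= 0) \<and> (EX G. lap u G (indicator {x. u x > 0}))"

text \<open>The absolute value of the Laplacian of \<open>u - v\<close>. For solutions, where it is
  nonzero exactly one of u and v vanishes, so the Laplacian of \<open>u - v\<close> has the sign of
  \<open>u - v\<close>.\<close>

definition den :: "('a::euclidean_space => real) => ('a => real) => 'a => real" where
 "den u v z = \<bar>indicator {x. u x > 0} z-indicator {x. v x > 0} z\<bar>"

lemma sol_continuous: "sol u ==> continuous_on UNIV u"
 unfolding sol_def using lap_continuous by blast

lemma sol_nonneg: "sol u ==> u x >= 0"
 unfolding sol_def by blast

lemma den_nonneg [simp]: "den u v z >= 0" and den_le_1: "den u v z <= 1"
 by (auto simp: den_def indicator_def)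

lemma den_cases: "sol u ==> sol v ==> den u v z \<noteq> 0 ==> u z = 0 \<or> v z = 0"
 using sol_nonneg[of u z] sol_nonneg[of v z] by (auto simp: den_def indicator_def split: if_splits)

lemma den_measurable:
 assumes "sol u" "sol v" shows "den u v \<in> borel_measurable borel"
proof -
 have [measurable]: "u \<in> borel_measurable borel" "v \<in> borel_measurable borel"
  using sol_continuous assms borel_measurable_continuous_onI by auto
 show ?thesis unfolding den_def[abs_def] by measurable
qed

context
 fixes u v :: "'a::euclidean_space => real"
 assumes u: "sol u" and v: "sol v"
begin

lemma diff_continuous: "continuous_on UNIV (%x. u x-v x)"
 by (intro continuous_intros sol_continuous u v)

lemma diff_mean:
 assumes "R >= 0"
 shows "ennreal (bet TYPE('a)*\<bar>avg (%x. u x-v x) x R-(u x-v x)\<bar>) <= pot (den u v) x R"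
proof -
 obtain G H where "lap u G (indicator {x. u x > 0})" "lap v H (indicator {x. v x > 0})"
  using u v unfolding sol_def by blast
 from mean_value_bound[OF lap_diff[OF this] assms, of x] show ?thesis unfolding den_def .
qed

text \<open>Since \<open>(u-v)\<close> times its Laplacian is
  \<open>\<bar>u-v\<bar> * den u v\<close>, Kato's inequality loses nothing: the Laplacian of
  \<open>\<bar>u-v\<bar>\<close> is at least the full density. For the regularization with parameter
  \<open>e n\<close>, the minorants \<open>h n\<close> increase to \<open>den u v\<close>, and
  monotone convergence concludes.\<close>

lemma diff_abs:
 assumes R: "R >= 0"
 shows "\<bar>u x-v x\<bar> <= avg (%x. \<bar>u x-v x\<bar>) x R"
  and "pot (den u v) x R <= ennreal (bet TYPE('a)*(avg (%x. \<bar>u x-v x\<bar>) x R-\<bar>u x-v x\<bar>))"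
proof -
 obtain G H where GH: "lap u G (indicator {x. u x > 0})" "lap v H (indicator {x. v x > 0})"
  using u v unfolding sol_def by blast
 define D where "D x = u x-v x" for x
 define f where "f x = (indicator {x. u x > 0} x-indicator {x. v x > 0} x :: real)" for x
 have lapD: "lap D (%x. G x-H x) f" unfolding D_def[abs_def] f_def[abs_def] by (rule lap_diff[OF GH])
 have Dc: "continuous_on UNIV D" using diff_continuous by (simp add: D_def[abs_def])
 have [measurable]: "D \<in> borel_measurable borel" using Dc by (rule borel_measurable_continuous_onI)
 have Df: "D z * f z = \<bar>D z\<bar>*den u v z" for z
  using sol_nonneg[OF u, of z] sol_nonneg[OF v, of z] by (auto simp: D_def f_def den_def indicator_def)
 \<comment> \<open>On the zero set of D both indicators agree; the limit of \<open>h n\<close>,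
   which is zero there, therefore misses no part of the density.\<close>
 have D0: "den u v z = 0" if "D z = 0" for z using that by (auto simp: D_def den_def indicator_def)
 note [measurable] = den_measurable[OF u v]
 define e where "e n = 1/real (Suc n)" for n
 have epos: "e n > 0" for n by (simp add: e_def)
 define E where "E n x = sqrt ((D x)^2+(e n)^2)" for n x
 define h where "h n z = \<bar>D z\<bar>*den u v z/E n z" for n z
 have Epos: "E n z > 0" for n z using epos[of n] by (simp add: E_def add_nonneg_pos)
 have EgeD: "\<bar>D z\<bar> <= E n z" for n z unfolding E_def by (intro real_le_rsqrt) auto
 have EleD: "E n z <= \<bar>D z\<bar>+e n" for n z
  unfolding E_def using sqrt_sum_squares_le_sum_abs[of "D z" "e n"] epos[of n] by simp
 have Ec: "continuous_on UNIV (E n)" for n unfolding E_def[abs_def] by (intro continuous_intros Dc)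
 have [measurable]: "E n \<in> borel_measurable borel" for n using Ec by (rule borel_measurable_continuous_onI)
 have avgE: "avg (E n) x R <= avg (%x. \<bar>D x\<bar>) x R+e n" for n
 proof -
  have "avg (E n) x R <= avg (%x. \<bar>D x\<bar>+e n) x R"
   by (intro avg_mono Ec continuous_intros Dc EleD)
  also have "\<dots> = avg (%x. \<bar>D x\<bar>) x R+e n"
   by (subst avg_add) (auto intro!: continuous_intros Dc simp: avg_const)
  finally show ?thesis .
 qed
 have key: "E n x <= avg (E n) x R" "pot (h n) x R <= ennreal (bet TYPE('a)*(avg (E n) x R-E n x))" for n
 proof -
  have l: "lap (E n) (%x. (D x/E n x) *. (G x-H x))
        (%x. D x * f x/E n x+(e n)^2*((G x-H x) \<bullet> (G x-H x))/E n x ^ 3)"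
   unfolding E_def[abs_def] by (rule lap_sqrt[OF lapD epos])
  have 1: "h n \<in> borel_measurable borel" unfolding h_def[abs_def] by measurable
  have 2: "0 <= h n z" for z unfolding h_def using Epos[of n z] by simp
  have 3: "h n z <= D z * f z/E n z+(e n)^2*((G z-H z) \<bullet> (G z-H z))/E n z ^ 3" for z
   unfolding h_def Df using Epos[of n z] by simp
  show "E n x <= avg (E n) x R" "pot (h n) x R <= ennreal (bet TYPE('a)*(avg (E n) x R-E n x))"
   using mean_value_subharmonic[OF l R 1 2 3] by auto
 qed
 have e0: "e \<longlonglongrightarrow> 0" unfolding e_def[abs_def] using LIMSEQ_inverse_real_of_nat by (simp add: inverse_eq_divide)
 have "\<bar>D x\<bar> <= avg (%x. \<bar>D x\<bar>) x R+e n" for n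
  using EgeD[of x n] key(1)[of n] avgE[of n] by linarith
 hence "\<bar>D x\<bar> <= avg (%x. \<bar>D x\<bar>) x R+0"
  by (intro LIMSEQ_le_const[OF tendsto_add[OF tendsto_const e0]]) auto
 thus "\<bar>u x-v x\<bar> <= avg (%x. \<bar>u x-v x\<bar>) x R" by (simp add: D_def)
 define A where "A = avg (%x. \<bar>D x\<bar>) x R-\<bar>D x\<bar>"
 have hbound: "pot (h n) x R <= ennreal (bet TYPE('a)*(A+e n))" for n
 proof (rule order_trans[OF key(2)], intro ennreal_leI mult_left_mono)
  show "avg (E n) x R-E n x <= A+e n" using avgE[of n] EgeD[of x n] by (simp add: A_def)
 qed (use bet_pos[where 'a='a] in auto)
 have hmono: "h n z <= h m z" if "n <= m" for n m z
 proof -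
  have "e m <= e n" using that by (simp add: e_def field_simps)
  hence "E m z <= E n z" unfolding E_def using epos[of m] by (intro real_sqrt_le_mono add_left_mono power_mono) auto
  thus ?thesis unfolding h_def using Epos[of m z] by (intro divide_left_mono) auto
 qed
 have hlim: "(%n. h n z) \<longlonglongrightarrow> den u v z" for z
 proof (cases "D z = 0")
  case True thus ?thesis using D0 by (simp add: h_def)
 next
  case False
  have "(%n. \<bar>D z\<bar>*den u v z/E n z) \<longlonglongrightarrow> \<bar>D z\<bar>*den u v z/sqrt ((D z)^2+0^2)"
   unfolding E_def by (intro tendsto_intros e0) (use False in auto)
  thus ?thesis using False by (simp add: h_def[abs_def])
 qed
 have "pot (den u v) x R = (\<integral>\<^sup>+z. (SUP n. ennreal (h n z) * kap R (z-x)) \<partial>lborel)"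
  unfolding pot_def
 proof (rule nn_integral_cong)
  fix z
  have "(%n. ennreal (h n z)) \<longlonglongrightarrow> ennreal (den u v z)" using hlim by (intro tendsto_ennrealI)
  moreover have "(%n. ennreal (h n z)) \<longlonglongrightarrow> (SUP n. ennreal (h n z))"
   by (intro LIMSEQ_SUP) (auto simp: mono_def intro!: ennreal_leI hmono)
  ultimately have "ennreal (den u v z) = (SUP n. ennreal (h n z))" by (rule LIMSEQ_unique)
  thus "ennreal (den u v z) * kap R (z-x) = (SUP n. ennreal (h n z) * kap R (z-x))"
   by (simp add: SUP_mult_right_ennreal)
 qed
 also have "\<dots> = (SUP n. pot (h n) x R)"
  unfolding pot_def
  by (rule nn_integral_monotone_convergence_SUP)
   (auto simp: mono_def le_fun_def h_def[abs_def, symmetric] intro!: mult_right_mono ennreal_leI hmono, simp add: h_def)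
 also have "\<dots> <= ennreal (bet TYPE('a)*A)"
 proof (rule SUP_least)
  fix n
  have "pot (h n) x R <= ennreal (bet TYPE('a)*(A+e m))" if "m >= n" for m
   using pot_mono[of "h n" "h m" x R] hmono[OF that] hbound[of m] order_trans by blast
  moreover have "(%m. ennreal (bet TYPE('a)*(A+e m))) \<longlonglongrightarrow> ennreal (bet TYPE('a)*(A+0))"
   by (intro tendsto_ennrealI tendsto_intros e0)
  ultimately show "pot (h n) x R <= ennreal (bet TYPE('a)*A)"
   by (intro LIMSEQ_le_const[of "%m. ennreal (bet TYPE('a)*(A+e m))"]) auto
 qed
 finally show "pot (den u v) x R <= ennreal (bet TYPE('a)*(avg (%x. \<bar>u x-v x\<bar>) x R-\<bar>u x-v x\<bar>))"
  by (simp add: A_def D_def)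
qed

text \<open>The mean value gap of D is bounded by the potential of the density, and that potential
  is bounded by the gap of \<open>\<bar>D\<bar>\<close>. Adding the two inequalities gives the
  sub-mean value property of \<open>D + \<bar>D\<bar>\<close>, twice the positive part.\<close>

lemma diff_pos:
 assumes R: "R >= 0"
 shows "max 0 (u x-v x) <= avg (%x. max 0 (u x-v x)) x R"
proof -
 define D where "D x = u x-v x" for x
 have Dc: "continuous_on UNIV D" using diff_continuous by (simp add: D_def[abs_def])
 have "ennreal (bet TYPE('a)*\<bar>avg D x R-D x\<bar>) <= ennreal (bet TYPE('a)*(avg (%x. \<bar>D x\<bar>) x R-\<bar>D x\<bar>))"
  using order_trans[OF diff_mean[OF R] diff_abs(2)[OF R]] by (simp add: D_def[abs_def])
 moreover have nn: "bet TYPE('a)*(avg (%x. \<bar>D x\<bar>) x R-\<bar>D x\<bar>) >= 0"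
  using diff_abs(1)[OF R, of x] bet_pos[where 'a='a] by (simp add: D_def[abs_def])
 ultimately have "bet TYPE('a)*\<bar>avg D x R-D x\<bar> <= bet TYPE('a)*(avg (%x. \<bar>D x\<bar>) x R-\<bar>D x\<bar>)"
  by (simp add: ennreal_le_iff)
 hence "\<bar>avg D x R-D x\<bar> <= avg (%x. \<bar>D x\<bar>) x R-\<bar>D x\<bar>"
  using bet_pos[where 'a='a] by simp
 hence "D x+\<bar>D x\<bar> <= avg D x R+avg (%x. \<bar>D x\<bar>) x R" by linarith
 also have "\<dots> = avg (%x. D x+\<bar>D x\<bar>) x R"
  by (rule avg_add[symmetric]) (auto intro!: continuous_intros Dc)
 also have "(%x. D x+\<bar>D x\<bar>) = (%x. 2*max 0 (D x))" by (auto simp: max_def)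
 also have "avg \<dots> x R = 2*avg (%x. max 0 (D x)) x R" by (rule avg_cmult)
 finally have "2*max 0 (D x) <= 2*avg (%x. max 0 (D x)) x R" by (simp add: max_def)
 thus ?thesis by (simp add: D_def)
qed

end

lemma kap_eq_0:
 fixes z :: "'a::euclidean_space"
 assumes "norm z >= R" shows "kap R z = 0"
proof -
 have "indicator {0<..R} s*ennreal (s/s ^ DIM('a)*Psi ((1/s) *. z)) = 0" for s
 proof (cases "s \<in> {0<..R}")
  case True
  hence "norm ((1/s) *. z) >= 1" using assms by (simp add: field_simps)
  thus ?thesis by (simp add: Psi_eq_0)
 qed simp
 thus ?thesis unfolding kap_def by (simp only: nn_integral_const mult_zero_left)
qed

text \<open>Layers with \<open>s <= norm z\<close> do not reach z, and every other layer contributes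
  at most \<open>d^(1-n)\<close>.\<close>

lemma kap_upper:
 fixes z :: "'a::euclidean_space"
 assumes d: "0 < d" "d <= norm z" and R: "R >= 0"
 shows "kap R z <= ennreal (R*(d/d ^ DIM('a)))"
proof -
 obtain n where n: "DIM('a) = Suc n" using DIM_positive[where 'a='a] gr0_conv_Suc by blast
 have "kap R z <= (\<integral>\<^sup>+s. ennreal (d/d ^ DIM('a))*indicator {0<..R} s \<partial>lborel)"
  unfolding kap_def
 proof (rule nn_integral_mono)
  fix s :: real
  show "indicator {0<..R} s*ennreal (s/s ^ DIM('a)*Psi ((1/s) *. z)) <=
        ennreal (d/d ^ DIM('a))*indicator {0<..R} s"
  proof (cases "s \<in> {0<..R} \<and> norm z < s")
   case True
   hence s: "0 < s" "d <= s" using d by auto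
   have "s/s ^ DIM('a)*Psi ((1/s) *. z) <= s/s ^ DIM('a)*1"
    using Psi_le[of "(1/s) *. z"] s by (intro mult_left_mono) auto
   also have "\<dots> = 1/s ^ n" using s n by simp
   also have "\<dots> <= 1/d ^ n" using s d by (intro divide_left_mono power_mono) auto
   also have "\<dots> = d/d ^ DIM('a)" using d n by simp
   finally show ?thesis using True by (auto intro!: ennreal_leI)
  next
   case False
   then consider "s \<notin> {0<..R}" | "s > 0" "norm z >= s" by force
   thus ?thesis
   proof cases
    case 2
    hence "norm ((1/s) *. z) >= 1" by (simp add: field_simps)
    thus ?thesis by (simp add: Psi_eq_0)
   qed simp
  qed
 qed
 also have "\<dots> = ennreal (d/d ^ DIM('a))*ennreal R"
  using R by (subst nn_integral_cmult_indicator) auto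
 also have "\<dots> = ennreal (R*(d/d ^ DIM('a)))" using R d by (simp add: ennreal_mult[symmetric] mult.commute)
 finally show ?thesis .
qed

text \<open>The layers with s between \<open>2*r\<close> and \<open>4*r\<close> suffice: there z/s
  lies in the ball of radius 1/2, where \<open>Psi\<close> is at least 1/16.\<close>

lemma kap_lower:
 fixes z :: "'a::euclidean_space"
 assumes r: "0 < r" "norm z <= r" "4*r <= R"
 shows "ennreal ((4*r)^2/(4*r) ^ DIM('a)/32) <= kap R z"
proof -
 obtain n where n: "DIM('a) = Suc n" using DIM_positive[where 'a='a] gr0_conv_Suc by blast
 have "ennreal ((4*r)^2/(4*r) ^ DIM('a)/32) = (\<integral>\<^sup>+s. ennreal ((4*r)/(4*r) ^ DIM('a)/16)*indicator {2*r..4*r} s \<partial>lborel)"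
  using r by (subst nn_integral_cmult_indicator) (auto simp: ennreal_mult[symmetric] power2_eq_square field_simps)
 also have "\<dots> <= kap R z"
  unfolding kap_def
 proof (rule nn_integral_mono)
  fix s :: real
  show "ennreal ((4*r)/(4*r) ^ DIM('a)/16)*indicator {2*r..4*r} s <=
        indicator {0<..R} s*ennreal (s/s ^ DIM('a)*Psi ((1/s) *. z))"
  proof (cases "s \<in> {2*r..4*r}")
   case True
   hence s: "2*r <= s" "s <= 4*r" "0 < s" "s <= R" using r by auto
   define w where "w = (1/s) *. z"
   have "norm w <= 1/2" unfolding w_def using s r by (simp add: field_simps)
   hence "(norm w)\<^sup>2 <= (1/2)^2" by (intro power_mono) auto
   hence "(norm w)\<^sup>2 <= 1/4" by (simp add: power2_eq_square)
   hence a: "3/4 <= max 0 (1-(norm ((1/s) *. z))^2)" unfolding w_def[symmetric] by linarith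
   have "(3/4) ^ 3/6 <= Psi ((1/s) *. z)"
    unfolding Psi_def by (rule divide_right_mono[OF power_mono[OF a]]) auto
   hence P: "1/16 <= Psi ((1/s) *. z)" by (simp add: power3_eq_cube)
   have "(4*r)/(4*r) ^ DIM('a)/16 = (1/(4*r) ^ n)*(1/16)" using r n by simp
   also have "\<dots> <= (1/s ^ n)*Psi ((1/s) *. z)"
    using s r P by (intro mult_mono divide_left_mono power_mono) auto
   also have "\<dots> = s/s ^ DIM('a)*Psi ((1/s) *. z)" using s n by simp
   finally show ?thesis using True s by (auto intro!: ennreal_leI)
  qed simp
 qed
 finally show ?thesis .
qed

section \<open>Differences of solutions with coincidence sets in a thin tube\<close>

definition perp :: "'a::euclidean_space => 'a => 'a" where
 "perp e x = x-(x \<bullet> e) *. e"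

lemma perp_add: "perp e (x+y) = perp e x+perp e y"
 and perp_diff: "perp e (x-y) = perp e x-perp e y"
 and perp_scaleR: "perp e (r *. x) = r *. perp e x"
 and perp_minus: "perp e (- x) = - perp e x"
 and perp_zero [simp]: "perp e 0 = 0"
 by (simp_all add: perp_def inner_simps algebra_simps)

lemma perp_self: "norm e = 1 ==> perp e e = 0"
 by (simp add: perp_def norm_eq_1)

lemma norm_perp_sq: assumes "norm e = 1" shows "(norm (perp e x))\<^sup>2 = (norm x)^2-(x \<bullet> e)^2"
proof -
 have "e \<bullet> e = 1" using assms by (simp add: norm_eq_1)
 thus ?thesis
  unfolding power2_norm_eq_inner
  by (simp add: perp_def inner_simps inner_commute power2_eq_square)
qed

lemma norm_perp_le: assumes "norm e = 1" shows "norm (perp e x) <= norm x"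
proof -
 have "(norm (perp e x))\<^sup>2 <= (norm x)^2" using norm_perp_sq[OF assms, of x] by simp
 thus ?thesis by (simp add: power2_le_iff_abs_le)
qed

lemma abs_inner_unit_le: "norm e = 1 ==> \<bar>x \<bullet> e\<bar> <= norm x"
 using Cauchy_Schwarz_ineq2[of x e] by simp

lemma continuous_on_perp [continuous_intros]:
 "continuous_on S g ==> continuous_on S (%x. perp e (g x))"
 unfolding perp_def by (intro continuous_intros)

text \<open>At distance tau the kernel is at least of order \<open>tau^(2-n)\<close>, hence of order
  \<open>R^(3-n)/tau\<close> for \<open>tau <= R\<close>. Along a line at distance
  \<open>dlt * R\<close> from z this integrates to a logarithm.\<close>

lemma kap_line_lower:
 fixes e z :: "'a::euclidean_space"
 assumes dim: "DIM('a) >= 3" and e: "norm e = 1" and R: "R > 0" and dlt: "0 < dlt" "dlt <= 1/16"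
  and z: "norm z <= R" "norm (perp e z) <= dlt * R"
 shows "ennreal ((2*R)^3/(2*R) ^ DIM('a)/512*ln (1/dlt)) <=
    (\<integral>\<^sup>+t. indicator {-R..R} t * kap (2*R) (z-t *. e) \<partial>lborel)"
proof -
 obtain m where m: "DIM('a) = m+3" using dim le_Suc_ex by (metis add.commute)
 define K where "K = (2*R)^3/(2*R) ^ DIM('a)/256"
 have Kpos: "K > 0" using R by (simp add: K_def)
 \<comment> \<open>The direction from the foot of z towards the middle of the segment, so that the
   points used stay in \<open>{-R..R}\<close>.\<close>
 define c :: real where "c = (if z \<bullet> e >= 0 then -1 else 1)"
 have c: "\<bar>c\<bar> = 1" "c \<noteq> 0" by (auto simp: c_def)
 define g where "g t = indicator {-R..R} t * kap (2*R) (z-t *. e)" for t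
 have gm: "g \<in> borel_measurable borel" unfolding g_def[abs_def] by measurable
 have ze: "\<bar>z \<bullet> e\<bar> <= R" using abs_inner_unit_le[OF e, of z] z by simp
 have pt: "ennreal (K/tau)*indicator {dlt*R..R/4} tau <= g (z \<bullet> e + c*tau)" for tau
 proof (cases "tau \<in> {dlt*R..R/4}")
  case True
  hence t: "dlt * R <= tau" "tau <= R/4" "0 < tau" using dlt R by (auto intro: less_le_trans[of 0 "dlt * R"])
  have inR: "z \<bullet> e + c*tau \<in> {-R..R}" using ze t by (auto simp: c_def)
  have eq: "z-(z \<bullet> e + c*tau) *. e = perp e z-(c*tau) *. e"
   by (simp add: perp_def algebra_simps)
  have "norm (z-(z \<bullet> e + c*tau) *. e) <= norm (perp e z)+norm ((c*tau) *. e)"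
   unfolding eq by (rule norm_triangle_ineq4)
  also have "norm ((c*tau) *. e) = tau" using e c t by (simp add: abs_mult)
  finally have n: "norm (z-(z \<bullet> e + c*tau) *. e) <= 2*tau" using z t by linarith
  have "ennreal ((4*(2*tau))^2/(4*(2*tau)) ^ DIM('a)/32) <= kap (2*R) (z-(z \<bullet> e + c*tau) *. e)"
   by (rule kap_lower) (use n t in auto)
  moreover have "K/tau <= (4*(2*tau))^2/(4*(2*tau)) ^ DIM('a)/32"
  proof -
   have "K/tau = (1/(2*R) ^ m)*(1/(256*tau))"
    using R by (simp add: K_def m power_add)
   also have "\<dots> <= (1/(8*tau) ^ m)*(1/(256*tau))"
    using t R by (intro mult_right_mono divide_left_mono power_mono mult_pos_pos zero_less_power) auto
   also have "\<dots> = (8*tau)^2/(8*tau) ^ DIM('a)/32"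
    using t by (simp add: m power_add power2_eq_square power3_eq_cube field_simps)
   finally show ?thesis by (simp add: mult.assoc[symmetric])
  qed
  ultimately have "ennreal (K/tau) <= kap (2*R) (z-(z \<bullet> e + c*tau) *. e)"
   by (meson ennreal_leI order_trans)
  thus ?thesis using True inR by (simp add: g_def)
 qed simp
 have le: "dlt * R <= R/4" using dlt R by (simp add: mult_right_mono[of dlt "1/4" R])
 have "ennreal ((2*R)^3/(2*R) ^ DIM('a)/512*ln (1/dlt)) <= ennreal (K*ln (R/4)-K*ln (dlt * R))"
 proof (rule ennreal_leI)
  have "ln (R/4)-ln (dlt * R) = ln (1/dlt)-ln 4"
   using R dlt by (simp add: ln_div ln_mult)
  \<comment> \<open>Half of the logarithm absorbs the \<open>ln 4\<close> caused by stopping at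
    \<open>R/4\<close>; this fixes the threshold 1/16 for \<open>dlt\<close>.\<close>
  moreover have "ln (4::real)*2 <= ln (1/dlt)"
  proof -
   have "ln (4::real)*2 = ln (4*4)" by (subst ln_mult) auto
   also have "\<dots> <= ln (1/dlt)" using dlt by (subst ln_le_cancel_iff) (auto simp: field_simps)
   finally show ?thesis .
  qed
  ultimately have "ln (1/dlt)/2 <= ln (R/4)-ln (dlt * R)" by linarith
  hence "K*(ln (1/dlt)/2) <= K*(ln (R/4)-ln (dlt * R))" using Kpos by simp
  moreover have "(2*R)^3/(2*R) ^ DIM('a)/512*ln (1/dlt) = K*(ln (1/dlt)/2)"
   by (simp add: K_def)
  ultimately show "(2*R)^3/(2*R) ^ DIM('a)/512*ln (1/dlt) <= K*ln (R/4)-K*ln (dlt * R)"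
   by (simp only: right_diff_distrib)
 qed
 also have "\<dots> = (\<integral>\<^sup>+tau. ennreal (K/tau)*indicator {dlt*R..R/4} tau \<partial>lborel)"
 proof (rule nn_integral_FTC_Icc[symmetric])
  show "(%x. K/x) \<in> borel_measurable borel" by measurable
  fix x assume "x \<in> {dlt * R..R/4}"
  hence x: "x > 0" using dlt R by (auto intro: less_le_trans[of 0 "dlt * R"])
  show "((%x. K*ln x) has_real_derivative K/x) (at x)"
   using x by (auto intro!: derivative_eq_intros)
  show "0 <= K/x" using x Kpos by simp
 qed (use le in auto)
 also have "\<dots> <= (\<integral>\<^sup>+tau. g (z \<bullet> e + c*tau) \<partial>lborel)" by (intro nn_integral_mono pt)
 also have "\<dots> = (\<integral>\<^sup>+t. g t \<partial>lborel)"
  using nn_integral_real_affine[OF gm c(2), of "z \<bullet> e"] c(1) by simp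
 finally show ?thesis by (simp add: g_def)
qed

text \<open>A thin tube carries little mass: average the mean value inequality for \<open>\<bar>u - v\<bar>\<close> over centres on the
 axis of the tube.\<close>

lemma mass_bound:
 fixes u v :: "'a::euclidean_space => real"
 assumes dim: "DIM('a) >= 3" and e: "norm e = 1" and R: "R > 0" and dlt: "0 < dlt" "dlt <= 1/16"
  and u: "sol u" and v: "sol v" and M: "M >= 0"
  and bd: "\<And>x. norm x <= 3 * R ==> \<bar>u x-v x\<bar> <= M"
  and tube: "\<And>x. norm x <= R ==> u x = 0 \<or> v x = 0 ==> norm (perp e x) <= dlt * R"
 shows "(\<integral>\<^sup>+z. ennreal (den u v z)*indicator (cball 0 R) z \<partial>lborel) <=
    ennreal (512*bet TYPE('a)*M*((2*R) ^ DIM('a)/(2*R)^2)/ln (1/dlt))"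
proof -
 note [measurable] = den_measurable[OF u v]
 have [measurable]: "cball (0::'a) R \<in> sets borel" by simp
 define c where "c = (2*R)^3/(2*R) ^ DIM('a)/512*ln (1/dlt)"
 have lnpos: "ln (1/dlt) > 0" using dlt by (simp add: ln_gt_zero_iff)
 have cpos: "c > 0" using R lnpos by (simp add: c_def)
 define m where "m = (\<integral>\<^sup>+z. ennreal (den u v z)*indicator (cball 0 R) z \<partial>lborel)"
 have "ennreal c*m = (\<integral>\<^sup>+z. ennreal c*(ennreal (den u v z)*indicator (cball 0 R) z) \<partial>lborel)"
  unfolding m_def by (rule nn_integral_cmult[symmetric]) measurable
 also have "\<dots> <= (\<integral>\<^sup>+z. (\<integral>\<^sup>+t. ennreal (den u v z)*(indicator {-R..R} t * kap (2*R) (z-t *. e)) \<partial>lborel) \<partial>lborel)"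
 proof (rule nn_integral_mono)
  fix z :: 'a
  have eq: "(\<integral>\<^sup>+t. ennreal (den u v z)*(indicator {-R..R} t * kap (2*R) (z-t *. e)) \<partial>lborel) =
        ennreal (den u v z)*(\<integral>\<^sup>+t. indicator {-R..R} t * kap (2*R) (z-t *. e) \<partial>lborel)"
   by (rule nn_integral_cmult) measurable
  show "ennreal c*(ennreal (den u v z)*indicator (cball 0 R) z) <=
        (\<integral>\<^sup>+t. ennreal (den u v z)*(indicator {-R..R} t * kap (2*R) (z-t *. e)) \<partial>lborel)"
  proof (cases "den u v z \<noteq> 0 \<and> z \<in> cball 0 R")
   case True
   hence "norm z <= R" "norm (perp e z) <= dlt * R"
    using tube[of z] den_cases[OF u v, of z] by auto
   from kap_line_lower[OF dim e R dlt this]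
   have "ennreal c <= (\<integral>\<^sup>+t. indicator {-R..R} t * kap (2*R) (z-t *. e) \<partial>lborel)"
    unfolding c_def .
   hence "ennreal (den u v z)*ennreal c <=
          ennreal (den u v z)*(\<integral>\<^sup>+t. indicator {-R..R} t * kap (2*R) (z-t *. e) \<partial>lborel)"
    by (rule mult_left_mono) simp
   thus ?thesis using True unfolding eq by (simp add: mult.commute)
  next
   case False
   hence "ennreal c*(ennreal (den u v z)*indicator (cball 0 R) z) = 0"
    by (auto simp: indicator_def)
   thus ?thesis by (simp only: zero_le)
  qed
 qed
 \<comment> \<open>After the exchange the inner integral is the potential centred at
   \<open>t *. e\<close>, to which \<open>diff_abs\<close> applies; the ball of radius
   \<open>2*R\<close> around such a centre lies in the ball of radius \<open>3*R\<close>.\<close>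
 also have "\<dots> = (\<integral>\<^sup>+t. (\<integral>\<^sup>+z. ennreal (den u v z)*(indicator {-R..R} t * kap (2*R) (z-t *. e)) \<partial>lborel) \<partial>lborel)"
  by (rule lborel_pair.Fubini'[symmetric]) measurable
 also have "\<dots> <= (\<integral>\<^sup>+t. ennreal (bet TYPE('a)*M)*indicator {-R..R} t \<partial>lborel)"
 proof (rule nn_integral_mono)
  fix t :: real
  show "(\<integral>\<^sup>+z. ennreal (den u v z)*(indicator {-R..R} t * kap (2*R) (z-t *. e)) \<partial>lborel) <=
        ennreal (bet TYPE('a)*M)*indicator {-R..R} t"
  proof (cases "t \<in> {-R..R}")
   case True
   have "pot (den u v) (t *. e) (2*R) <=
          ennreal (bet TYPE('a)*(avg (%x. \<bar>u x-v x\<bar>) (t *. e) (2*R)-\<bar>u (t *. e)-v (t *. e)\<bar>))"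
    using R by (intro diff_abs(2) u v) auto
   also have "\<dots> <= ennreal (bet TYPE('a)*M)"
   proof (intro ennreal_leI mult_left_mono)
    have "\<bar>avg (%x. \<bar>u x-v x\<bar>) (t *. e) (2*R)\<bar> <= M"
    proof (rule avg_bound)
     show "continuous_on UNIV (%x. \<bar>u x-v x\<bar>)"
      by (intro continuous_intros sol_continuous u v)
     fix z assume z: "norm (z-t *. e) <= \<bar>2*R\<bar>"
     have "norm (t *. e) <= R" using True e by auto
     hence "norm z <= 3 * R" using z R norm_triangle_sub[of z "t *. e"] by linarith
     thus "\<bar>\<bar>u z-v z\<bar>\<bar> <= M" using bd by simp
    qed
    thus "avg (%x. \<bar>u x-v x\<bar>) (t *. e) (2*R)-\<bar>u (t *. e)-v (t *. e)\<bar> <= M" by linarith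
   qed (use bet_pos[where 'a='a] in auto)
   finally show ?thesis using True by (simp add: pot_def)
  qed simp
 qed
 also have "\<dots> = ennreal (bet TYPE('a)*M*(2 * R))"
  using R M bet_pos[where 'a='a] by (subst nn_integral_cmult_indicator) (auto simp: ennreal_mult[symmetric])
 finally have main: "ennreal c*m <= ennreal (bet TYPE('a)*M*(2 * R))" .
 have "m <= ennreal (bet TYPE('a)*M*(2 * R)/c)"
 proof (cases m rule: ennreal_cases)
  case (real r)
  have "c*r <= bet TYPE('a)*M*(2 * R)"
   using main real cpos R M bet_pos[where 'a='a] by (simp add: ennreal_mult[symmetric] ennreal_le_iff)
  hence "r <= bet TYPE('a)*M*(2 * R)/c" using cpos by (simp add: pos_le_divide_eq mult.commute)
  thus ?thesis using real by (simp add: ennreal_leI)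
 next
  case top
  thus ?thesis using main cpos by (simp add: ennreal_mult_top top_unique)
 qed
 also have "bet TYPE('a)*M*(2 * R)/c = 512*bet TYPE('a)*M*((2*R) ^ DIM('a)/(2*R)^2)/ln (1/dlt)"
  using R lnpos by (simp add: c_def power2_eq_square power3_eq_cube mult_ac)
 finally show ?thesis unfolding m_def .
qed

section \<open>Dependence of averages on their centre\<close>

lemma max0_square_taylor:
 fixes p q :: real
 shows "\<bar>(max 0 q)\<^sup>2-(max 0 p)^2-2*max 0 p*(q-p)\<bar> <= (q-p)^2"
proof -
 consider "p >= 0" "q >= 0" | "p >= 0" "q < 0" | "p < 0" "q >= 0" | "p < 0" "q < 0" by linarith
 thus ?thesis
 proof cases
  case 1
  have "q\<^sup>2-p^2-2 * p*(q-p) = (q-p)^2" by algebra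
  thus ?thesis using 1 by simp
 next
  case 2
  have "p*q <= 0" using 2 by (simp add: mult_nonneg_nonpos)
  hence "p * p-2 * p*q >= 0" unfolding mult.assoc using zero_le_square[of p] by linarith
  thus ?thesis using 2 by (simp add: power2_eq_square algebra_simps)
 next
  case 3
  have "p*q <= 0" "p * p >= 0" using 3 by (simp_all add: mult_nonpos_nonneg)
  thus ?thesis using 3 by (simp add: power2_eq_square algebra_simps)
 next
  case 4 thus ?thesis by simp
 qed
qed

lemma Phi_taylor:
 fixes a y :: "'a::euclidean_space"
 assumes a: "norm a <= 1"
 shows "\<bar>Phi (y-a)-Phi y-4*max 0 (1-(norm y)^2)*(y \<bullet> a)\<bar> <= 27*(norm a)^2*indicator (cball 0 2) y"
proof (cases "norm y <= 2")
 case True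
 define P where "P = 1-(norm y)^2"
 define Q where "Q = 1-(norm (y-a))^2"
 have QP: "Q-P = 2*(y \<bullet> a)-(norm a)^2"
  unfolding P_def Q_def power2_norm_eq_inner by (simp add: inner_simps inner_commute)
 have mP: "max 0 P <= 1" "max 0 P >= 0" by (auto simp: P_def)
 have "\<bar>y \<bullet> a\<bar> <= norm y*norm a" by (rule Cauchy_Schwarz_ineq2)
 also have "\<dots> <= 2*norm a" using True by (intro mult_right_mono) auto
 finally have ya: "\<bar>y \<bullet> a\<bar> <= 2*norm a" .
 have a2: "(norm a)\<^sup>2 <= norm a" using a by (simp add: power2_eq_square mult_left_le)
 have "\<bar>Q-P\<bar> <= 5*norm a" unfolding QP using ya a2 zero_le_power2[of "norm a"] by linarith
 hence "\<bar>Q-P\<bar>^2 <= (5*norm a)^2" by (rule power_mono) simp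
 hence 1: "(Q-P)\<^sup>2 <= 25*(norm a)^2" by (simp add: power_mult_distrib)
 have 2: "max 0 P*(norm a)^2 <= (norm a)^2" using mP by (simp add: mult_left_le_one_le)
 have 3: "max 0 P*(norm a)^2 >= 0" using mP by simp
 \<comment> \<open>The error has two sources: the quadratic remainder of the squared positive part,
   at most 25 times the square of \<open>norm a\<close>, and the quadratic part of
   \<open>Q-P\<close>, contributing 2; hence the constant 27.\<close>
 have "Phi (y-a)-Phi y-4*max 0 P*(y \<bullet> a) =
      ((max 0 Q)^2-(max 0 P)^2-2*max 0 P*(Q-P))-2*(max 0 P*(norm a)^2)"
  unfolding QP Phi_def by (simp add: P_def Q_def algebra_simps)
 hence "\<bar>Phi (y-a)-Phi y-4*max 0 P*(y \<bullet> a)\<bar> <= 27*(norm a)^2"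
  using max0_square_taylor[of Q P] 1 2 3 by linarith
 thus ?thesis using True by (simp add: P_def)
next
 case False
 hence "norm (y-a) >= 1" using norm_triangle_ineq2[of y a] a by linarith
 moreover have "max 0 (1-(norm y)^2) = 0" using one_le_power[of "norm y" 2] False by auto
 moreover have "norm y >= 1" using False by simp
 ultimately show ?thesis by (simp add: Phi_eq_0)
qed

lemma integrable_compact_support:
 fixes h :: "'a::euclidean_space => 'b::euclidean_space"
 assumes "continuous_on UNIV h" "\<And>y. norm y > r ==> h y = 0"
 shows "integrable lborel h"
proof -
 have "integrable lborel (%y. indicator (cball 0 r) y *. h y)"
  by (intro borel_integrable_compact continuous_on_subset[OF assms(1)]) auto
 moreover have "(%y. indicator (cball 0 r) y *. h y) = h"
  using assms(2) by (auto simp: fun_eq_iff indicator_def not_le)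
 ultimately show ?thesis by simp
qed

lemma lborel_integral_shift:
 fixes h :: "'a::euclidean_space => 'b::euclidean_space"
 assumes [measurable]: "h \<in> borel_measurable borel"
 shows "(\<integral>y. h (y + c) \<partial>lborel) = (\<integral>y. h y \<partial>lborel)"
proof -
 have "integral\<^sup>L (distr lborel borel ((+) c)) h = (\<integral>y. h (c+y) \<partial>lborel)"
  by (subst integral_distr) auto
 thus ?thesis using lborel_distr_plus[of c] by (simp add: add.commute)
qed

lemma avg_shift:
 fixes D :: "'a::euclidean_space => real"
 assumes D: "continuous_on UNIV D" and rho: "rho > 0"
 shows "avg D x rho = (\<integral>y. D (x0+rho *. y)*Phi (y-(1/rho) *. (x-x0)) \<partial>lborel)/bet TYPE('a)"
proof -
 define a where "a = (1/rho) *. (x-x0)"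
 have x: "x = x0+rho *. a" using rho by (simp add: a_def)
 have c: "continuous_on UNIV (%y. D (x0+rho *. y)*Phi (y-a))"
  by (intro continuous_intros continuous_on_affine_compose D)
 have "(\<integral>y. D (x0+rho *. (y+a))*Phi (y+a-a) \<partial>lborel) = (\<integral>y. D (x0+rho *. y)*Phi (y-a) \<partial>lborel)"
  by (rule lborel_integral_shift[of "%y. D (x0+rho *. y)*Phi (y-a)"])
   (rule borel_measurable_continuous_onI[OF c])
 moreover have "(%y. D (x0+rho *. (y+a))*Phi (y+a-a)) = (%y. D (x+rho *. y)*Phi y)"
  by (simp add: x algebra_simps)
 ultimately show ?thesis unfolding avg_def a_def by simp
qed

definition taylor_const :: "'a::euclidean_space itself => real => bool" where
 "taylor_const _ C \<longleftrightarrow>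
    (ALL (D::'a => real) x0 rho M. continuous_on UNIV D --> rho > 0 -->
     (ALL z. norm (z-x0) <= 2*rho --> \<bar>D z\<bar> <= M) -->
     (EX a g. \<bar>a\<bar> <= M \<and> norm g <= C*M/rho \<and>
       (ALL x. norm (x-x0) <= rho --> \<bar>avg D x rho-(a+g \<bullet> (x-x0))\<bar> <= C*M*(norm (x-x0)/rho)^2)))"

text \<open>By \<open>avg_shift\<close>, a change of the centre only translates the kernel, so the
  expansion is that of \<open>Phi\<close>. No regularity of the averaged function enters, and the
  constant depends on the dimension alone.\<close>

lemma avg_taylor:
 "EX C>0. taylor_const TYPE('a::euclidean_space) C"
proof -
 define V where "V = measure lborel (cball (0::'a) 2)"
 define b where "b = bet TYPE('a)"
 have b: "b > 0" using bet_pos by (simp add: b_def)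
 define C where "C = 27*V/b+1"
 have V0: "V >= 0" by (simp add: V_def)
 have Cpos: "C > 0" using V0 b by (simp add: C_def add_nonneg_pos)
 show ?thesis unfolding taylor_const_def
 proof (rule exI[of _ C], intro conjI Cpos allI impI)
  fix D :: "'a => real" and x0 :: 'a and rho M :: real
  assume D: "continuous_on UNIV D" and rho: "rho > 0" and bd: "ALL z. norm (z-x0) <= 2*rho --> \<bar>D z\<bar> <= M"
  define E where "E y = D (x0+rho *. y)" for y
  have Ec: "continuous_on UNIV E" unfolding E_def by (rule continuous_on_affine_compose[OF D])
  have M0: "M >= 0" using bd[rule_format, of x0] rho by force
  have Ebd: "\<bar>E y\<bar> <= M" if "norm y <= 2" for y
   unfolding E_def using bd[rule_format, of "x0+rho *. y"] that rho by (simp add: mult.commute[of rho] mult_right_mono)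
  define m where "m y = 4*max 0 (1-(norm y)^2)" for y :: 'a
  have mc: "continuous_on UNIV m" unfolding m_def[abs_def] by (intro continuous_intros)
  have m0: "m y = 0" if "norm y > 1" for y
   using one_le_power[of "norm y" 2] that by (auto simp: m_def)
  define G where "G y = (E y*m y) *. y" for y
  have Gi: "integrable lborel G"
   by (rule integrable_compact_support[of _ 1]) (auto simp: G_def[abs_def] m0 intro!: continuous_intros Ec mc)
  define g where "g = (1/(b*rho)) *. (\<integral>y. G y \<partial>lborel)"
  define a where "a = avg D x0 rho"
  have iV: "integrable lborel (%y::'a. c*indicator (cball 0 2) y :: real)" for c
   using emeasure_bounded_finite[OF bounded_cball, of "0::'a" 2] by (intro integrable_mult_right integrable_real_indicator) auto
  have intV: "(\<integral>y. c*indicator (cball (0::'a) 2) y \<partial>lborel) = c*V" for c :: real by (simp add: V_def)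
  have ga: "norm g <= C*M/rho"
  proof -
   have "norm (\<integral>y. G y \<partial>lborel) <= (\<integral>y. norm (G y) \<partial>lborel)" by (rule integral_norm_bound)
   also have "\<dots> <= (\<integral>y. (4*M)*indicator (cball (0::'a) 2) y \<partial>lborel)"
   proof (rule integral_mono)
    fix y :: 'a
    show "norm (G y) <= (4*M)*indicator (cball 0 2) y"
    proof (cases "norm y <= 1")
     case True
     have "\<bar>E y\<bar>*(\<bar>m y\<bar>*norm y) <= M*(4*1)"
      using True Ebd[of y] M0 by (intro mult_mono) (auto simp: m_def)
     thus ?thesis using True by (simp add: G_def abs_mult mult.assoc)
    qed (use m0[of y] M0 in \<open>simp add: G_def\<close>)
   qed (use Gi iV in auto)
   also have "\<dots> = (4*M)*V" by (rule intV)
   finally have 1: "norm (\<integral>y. G y \<partial>lborel) <= 4*M*V" .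
   have "norm g = norm (\<integral>y. G y \<partial>lborel)/(b*rho)" using b rho by (simp add: g_def)
   also have "\<dots> <= (4*M*V)/(b*rho)" using 1 b rho by (intro divide_right_mono) auto
   also have "\<dots> = (4*V/b)*M/rho" by simp
   also have "\<dots> <= C*M/rho" using M0 V0 b rho by (intro divide_right_mono mult_right_mono) (auto simp: C_def field_simps)
   finally show ?thesis .
  qed
  show "EX a g. \<bar>a\<bar> <= M \<and> norm g <= C*M/rho \<and>
       (ALL x. norm (x-x0) <= rho --> \<bar>avg D x rho-(a+g \<bullet> (x-x0))\<bar> <= C*M*(norm (x-x0)/rho)^2)"
  proof (intro exI[of _ a] exI[of _ g] conjI ga allI impI)
   show "\<bar>a\<bar> <= M" unfolding a_def by (rule avg_bound[OF D]) (use bd rho in auto)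
  next
   fix x assume x: "norm (x-x0) <= rho"
   define s where "s = (1/rho) *. (x-x0)"
   have ns: "norm s <= 1" "norm s = norm (x-x0)/rho" using x rho by (auto simp: s_def)
   define r where "r y = Phi (y-s)-Phi y-m y*(y \<bullet> s)" for y
   have rb: "\<bar>r y\<bar> <= 27*(norm s)^2*indicator (cball 0 2) y" for y
    using Phi_taylor[OF ns(1), of y] by (simp add: r_def m_def)
   have i1: "integrable lborel (%y. E y*Phi y)" by (rule integrable_Phi[OF Ec])
   have i2: "integrable lborel (%y. G y \<bullet> s)" using Gi by simp
   have i3: "integrable lborel (%y. E y*r y)"
   proof (rule integrable_compact_support[of _ 2])
    show "continuous_on UNIV (%y. E y*r y)" unfolding r_def by (intro continuous_intros Ec mc)
    show "E y*r y = 0" if "norm y > 2" for y using rb[of y] that by simp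
   qed
   have "b*avg D x rho = (\<integral>y. E y*Phi (y-s) \<partial>lborel)"
    using avg_shift[OF D rho, of x x0] b by (simp add: E_def s_def b_def)
   also have "(%y. E y*Phi (y-s)) = (%y. E y*Phi y+G y \<bullet> s+E y*r y)"
    by (auto simp: r_def G_def algebra_simps)
   also have "(\<integral>y. E y*Phi y+G y \<bullet> s+E y*r y \<partial>lborel) =
          (\<integral>y. E y*Phi y \<partial>lborel)+(\<integral>y. G y \<bullet> s \<partial>lborel)+(\<integral>y. E y*r y \<partial>lborel)"
    using i1 i2 i3 by simp
   also have "(\<integral>y. G y \<bullet> s \<partial>lborel) = (\<integral>y. G y \<partial>lborel) \<bullet> s" using Gi by (intro integral_inner_left) auto
   also have "\<dots> = b*(g \<bullet> (x-x0))" using b rho by (simp add: g_def s_def)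
   also have "(\<integral>y. E y*Phi y \<partial>lborel) = b*a" using b by (simp add: a_def avg_def E_def b_def)
   finally have eq: "b*(avg D x rho-(a+g \<bullet> (x-x0))) = (\<integral>y. E y*r y \<partial>lborel)"
    by (simp add: algebra_simps)
   have "norm (\<integral>y. E y*r y \<partial>lborel) <= (\<integral>y. norm (E y*r y) \<partial>lborel)" by (rule integral_norm_bound)
   also have "\<dots> <= (\<integral>y. (M*(27*(norm s)^2))*indicator (cball (0::'a) 2) y \<partial>lborel)"
   proof (rule integral_mono)
    fix y :: 'a
    show "norm (E y*r y) <= (M*(27*(norm s)^2))*indicator (cball 0 2) y"
    proof (cases "norm y <= 2")
     case True
     hence "\<bar>E y\<bar>*\<bar>r y\<bar> <= M*(27*(norm s)^2)"
      using Ebd[of y] rb[of y] M0 by (intro mult_mono) auto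
     thus ?thesis using True by (simp add: abs_mult)
    qed (use rb[of y] in simp)
   qed (use i3 iV in auto)
   also have "\<dots> = M*(27*(norm s)^2)*V" by (rule intV)
   finally have "b*\<bar>avg D x rho-(a+g \<bullet> (x-x0))\<bar> <= M*(27*(norm s)^2)*V"
    unfolding eq[symmetric] using b by (simp add: abs_mult)
   hence "\<bar>avg D x rho-(a+g \<bullet> (x-x0))\<bar> <= (M*(27*(norm s)^2)*V)/b"
    using b by (simp add: pos_le_divide_eq mult.commute)
   also have "\<dots> = (27*V/b)*M*(norm s)^2" by simp
   also have "\<dots> <= C*M*(norm s)^2" using M0 by (intro mult_right_mono) (auto simp: C_def)
   finally show "\<bar>avg D x rho-(a+g \<bullet> (x-x0))\<bar> <= C*M*(norm (x-x0)/rho)^2"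
    by (simp add: ns(2))
  qed
 qed
qed

definition second_diff_const :: "'a::euclidean_space itself => real => bool" where
 "second_diff_const _ C \<longleftrightarrow>
    (ALL (u::'a => real) v x0 rho M. sol u --> sol v --> rho > 0 -->
     (ALL z. norm (z-x0) <= 2*rho --> \<bar>u z-v z\<bar> <= M) -->
     (AE z in lborel. norm (z-x0) <= 2*rho --> den u v z = 0) -->
     (ALL s. norm s <= rho --> \<bar>(u (x0+s)-v (x0+s))+(u (x0-s)-v (x0-s))-2*(u x0-v x0)\<bar> <= C*M*(norm s/rho)^2))"

text \<open>Where the density vanishes almost everywhere, the difference equals its averages of
  radius rho near \<open>x0\<close> and inherits their expansion. The affine part cancels in a
  symmetric second difference.\<close>

lemma diff_harmonic_taylor:
 "EX C>0. second_diff_const TYPE('a::euclidean_space) C"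
proof -
 obtain C where C: "C > 0" "taylor_const TYPE('a) C"
  using avg_taylor by blast
 show ?thesis unfolding second_diff_const_def
 proof (intro exI[of _ "2*C"] conjI allI impI)
  show "2*C > 0" using C by simp
  fix u v :: "'a => real" and x0 s :: 'a and rho M :: real
  assume u: "sol u" and v: "sol v" and rho: "rho > 0"
   and bd: "ALL z. norm (z-x0) <= 2*rho --> \<bar>u z-v z\<bar> <= M"
   and den0: "AE z in lborel. norm (z-x0) <= 2*rho --> den u v z = 0" and s: "norm s <= rho"
  define D where "D x = u x-v x" for x
  have Dc: "continuous_on UNIV D" using diff_continuous[OF u v] by (simp add: D_def[abs_def])
  obtain a g where ag: "ALL x. norm (x-x0) <= rho --> \<bar>avg D x rho-(a+g \<bullet> (x-x0))\<bar> <= C*M*(norm (x-x0)/rho)^2"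
   using C(2)[unfolded taylor_const_def, rule_format, OF Dc rho, of x0 M] bd by (auto simp: D_def)
  have mv: "avg D x rho = D x" if "norm (x-x0) <= rho" for x
  proof -
   have "AE z in lborel. ennreal (den u v z) * kap rho (z-x) = 0"
    using den0
   proof (rule eventually_mono)
    fix z assume z: "norm (z-x0) <= 2*rho --> den u v z = 0"
    show "ennreal (den u v z) * kap rho (z-x) = 0"
    proof (cases "norm (z-x) >= rho")
     case False
     hence "norm (z-x0) <= 2*rho" using that norm_triangle_ineq[of "z-x" "x-x0"] by simp
     thus ?thesis using z by simp
    qed (simp add: kap_eq_0)
   qed
   hence "pot (den u v) x rho = (\<integral>\<^sup>+(z::'a). 0 \<partial>lborel)" unfolding pot_def by (intro nn_integral_cong_AE)
   hence "pot (den u v) x rho = 0" by simp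
   hence "ennreal (bet TYPE('a)*\<bar>avg D x rho-D x\<bar>) <= 0"
    using diff_mean[OF u v, of rho x] rho by (simp add: D_def[abs_def])
   hence "bet TYPE('a)*\<bar>avg D x rho-D x\<bar> <= 0" by (simp add: ennreal_eq_0_iff)
   thus ?thesis using bet_pos[where 'a='a] by (simp add: mult_le_0_iff)
  qed
  define t where "t = C*M*(norm s/rho)^2"
  have "\<bar>D (x0+s)-(a+g \<bullet> s)\<bar> <= t"
   using ag[rule_format, of "x0+s"] mv[of "x0+s"] s by (simp add: t_def)
  moreover have "\<bar>D (x0-s)-(a-g \<bullet> s)\<bar> <= t"
   using ag[rule_format, of "x0-s"] mv[of "x0-s"] s by (simp add: t_def)
  moreover have "D x0 = a" using ag[rule_format, of x0] mv[of x0] rho by simp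
  ultimately have "\<bar>D (x0+s)+D (x0-s)-2*D x0\<bar> <= 2*t" by linarith
  thus "\<bar>(u (x0+s)-v (x0+s))+(u (x0-s)-v (x0-s))-2*(u x0-v x0)\<bar> <= 2*C*M*(norm s/rho)^2"
   by (simp add: D_def t_def mult.assoc)
 qed
qed

section \<open>Affine approximation away from the axis\<close>

definition affine_const :: "'a::euclidean_space itself => real => bool" where
 "affine_const _ C \<longleftrightarrow>
    (ALL (u::'a => real) v e rho dlt eta M. sol u --> sol v --> norm e = 1 --> rho > 0 -->
     0 < dlt --> dlt <= 1/16 --> 0 < eta --> eta <= 1 -->
     (ALL x. norm x <= 6*rho --> \<bar>u x-v x\<bar> <= M) -->
     (ALL x. norm x <= 2*rho --> u x = 0 \<or> v x = 0 --> norm (perp e x) <= 2*dlt*rho) -->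
     (EX a g. \<bar>a\<bar> <= M \<and> norm g <= C*M/rho \<and>
       (ALL x. norm x <= rho --> norm (perp e x) >= (eta+2*dlt)*rho -->
         \<bar>(u x-v x)-(a+g \<bullet> x)\<bar> <= C*M*((norm x/rho)^2+(1/eta) ^ DIM('a)/ln (1/dlt)))))"

text \<open>The average of the difference is affine up to a quadratic error. The difference itself
  deviates from its average by at most the potential of the density: at distance
  \<open>eta*rho\<close> from the tube the kernel is bounded by \<open>kap_upper\<close>, and the
  mass is of order \<open>1/ln (1/dlt)\<close> by \<open>mass_bound\<close>.\<close>

lemma diff_affine_approx:
 assumes dim: "DIM('a::euclidean_space) >= 3"
 shows "EX C>0. affine_const TYPE('a::euclidean_space) C"
proof -
 obtain C where C: "C > 0" "taylor_const TYPE('a) C"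
  using avg_taylor by blast
 define b where "b = bet TYPE('a)"
 have b: "b > 0" using bet_pos by (simp add: b_def)
 \<comment> \<open>The factor of \<open>mass_bound\<close> at radius \<open>2*rho\<close>, where
   \<open>(4*rho)^n/(4*rho)^2\<close> appears.\<close>
 define C1 :: real where "C1 = 512*4 ^ DIM('a)/16"
 define C' where "C' = max C C1"
 have C'pos: "C' > 0" and CC: "C <= C'" "C1 <= C'" using C by (auto simp: C'_def)
 show ?thesis unfolding affine_const_def
 proof (rule exI[of _ C'], intro conjI C'pos allI impI)
  fix u v :: "'a => real" and e :: 'a and rho dlt eta M :: real
  assume u: "sol u" and v: "sol v" and e: "norm e = 1" and rho: "rho > 0"
   and dlt: "0 < dlt" "dlt <= 1/16" and eta: "0 < eta" "eta <= 1"
   and bd: "ALL x. norm x <= 6*rho --> \<bar>u x-v x\<bar> <= M"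
   and tube: "ALL x. norm x <= 2*rho --> u x = 0 \<or> v x = 0 --> norm (perp e x) <= 2*dlt*rho"
  define D where "D x = u x-v x" for x
  have Dc: "continuous_on UNIV D" using diff_continuous[OF u v] by (simp add: D_def[abs_def])
  have M0: "M >= 0" using bd[rule_format, of 0] rho by force
  have lnpos: "ln (1/dlt) > 0" using dlt by (simp add: ln_gt_zero_iff)
  note [measurable] = den_measurable[OF u v]
  have [measurable]: "cball (0::'a) (2*rho) \<in> sets borel" by simp
  obtain a g where ag: "\<bar>a\<bar> <= M" "norm g <= C*M/rho"
   "ALL x. norm x <= rho --> \<bar>avg D x rho-(a+g \<bullet> x)\<bar> <= C*M*(norm x/rho)^2"
   using C(2)[unfolded taylor_const_def, rule_format, OF Dc rho, of 0 M] bd rho by (auto simp: D_def)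
  have mass: "(\<integral>\<^sup>+z. ennreal (den u v z)*indicator (cball 0 (2*rho)) z \<partial>lborel) <=
       ennreal (512*b*M*((2*(2*rho)) ^ DIM('a)/(2*(2*rho))^2)/ln (1/dlt))" (is "?m <= ennreal ?mu")
   unfolding b_def
  proof (rule mass_bound[OF dim e _ dlt u v M0])
   show "0 < 2*rho" using rho by simp
   show "\<bar>u x-v x\<bar> <= M" if "norm x <= 3*(2*rho)" for x using bd that by simp
   show "norm (perp e x) <= dlt*(2*rho)" if "norm x <= 2*rho" "u x = 0 \<or> v x = 0" for x
    using tube[rule_format, of x] that by simp
  qed
  have near: "\<bar>D x-avg D x rho\<bar> <= C1*M*((1/eta) ^ DIM('a)/ln (1/dlt))"
   if x: "norm x <= rho" "norm (perp e x) >= (eta+2*dlt)*rho" for x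
  proof -
   define d where "d = eta*rho"
   have d: "d > 0" using eta rho by (simp add: d_def)
   define K where "K = rho*(d/d ^ DIM('a))"
   have K0: "K >= 0" using rho d by (simp add: K_def)
   have "pot (den u v) x rho <= (\<integral>\<^sup>+z. ennreal K*(ennreal (den u v z)*indicator (cball 0 (2*rho)) z) \<partial>lborel)"
    unfolding pot_def
   proof (rule nn_integral_mono)
    fix z :: 'a
    show "ennreal (den u v z) * kap rho (z-x) <= ennreal K*(ennreal (den u v z)*indicator (cball 0 (2*rho)) z)"
    proof (cases "den u v z = 0 \<or> norm (z-x) >= rho")
     case False
     hence z: "norm z <= 2*rho" using x norm_triangle_ineq[of "z-x" x] by simp
     have "norm (perp e z) <= 2*dlt*rho" using tube z den_cases[OF u v, of z] False by blast
     hence "norm (perp e x)-norm (perp e z) >= d" using x(2) unfolding d_def distrib_right by linarith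
     moreover have "norm (perp e x)-norm (perp e z) <= norm (perp e (z-x))"
      unfolding perp_diff using norm_triangle_ineq2[of "perp e x" "perp e z"] by (simp add: norm_minus_commute)
     ultimately have "d <= norm (z-x)" using norm_perp_le[OF e, of "z-x"] by linarith
     hence "kap rho (z-x) <= ennreal K" unfolding K_def using d rho by (intro kap_upper) auto
     hence "ennreal (den u v z) * kap rho (z-x) <= ennreal (den u v z)*ennreal K" by (rule mult_left_mono) simp
     thus ?thesis using z by (simp add: mult.commute)
    qed (auto simp: kap_eq_0)
   qed
   also have "\<dots> = ennreal K*?m" by (rule nn_integral_cmult) measurable
   also have "\<dots> <= ennreal K*ennreal ?mu" using mass by (rule mult_left_mono) simp
   also have "\<dots> = ennreal (K*?mu)"
    using K0 by (rule ennreal_mult'[symmetric])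
   finally have "pot (den u v) x rho <= ennreal (K*?mu)" .
   hence "ennreal (b*\<bar>avg D x rho-D x\<bar>) <= ennreal (K*?mu)"
    using order_trans[OF diff_mean[OF u v, of rho x]] rho by (simp add: D_def[abs_def] b_def)
   moreover have "K*?mu >= 0" using K0 b M0 rho lnpos by (intro mult_nonneg_nonneg divide_nonneg_nonneg) auto
   ultimately have "b*\<bar>avg D x rho-D x\<bar> <= K*?mu" by (simp add: ennreal_le_iff)
   also have "K*?mu = b*(C1*M*(rho ^ DIM('a)/rho*(d/d ^ DIM('a)))/ln (1/dlt))"
    using rho by (simp add: K_def C1_def power_mult_distrib power2_eq_square field_simps)
   also have "rho ^ DIM('a)/rho*(d/d ^ DIM('a)) = (1/eta) ^ DIM('a)*eta"
    using rho eta by (simp add: d_def power_mult_distrib field_simps)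
   finally have "b*\<bar>avg D x rho-D x\<bar> <= b*(C1*M*((1/eta) ^ DIM('a)*eta)/ln (1/dlt))"
    by (simp only: times_divide_eq_right)
   hence "\<bar>avg D x rho-D x\<bar> <= C1*M*((1/eta) ^ DIM('a)*eta)/ln (1/dlt)"
    using b by (simp only: mult_le_cancel_left_pos)
   also have "\<dots> <= C1*M*((1/eta) ^ DIM('a)*1)/ln (1/dlt)"
    using eta M0 lnpos by (intro divide_right_mono mult_left_mono) (auto simp: C1_def)
   finally show ?thesis by (simp add: abs_minus_commute)
  qed
  show "EX a g. \<bar>a\<bar> <= M \<and> norm g <= C'*M/rho \<and>
       (ALL x. norm x <= rho --> norm (perp e x) >= (eta+2*dlt)*rho -->
         \<bar>(u x-v x)-(a+g \<bullet> x)\<bar> <= C'*M*((norm x/rho)^2+(1/eta) ^ DIM('a)/ln (1/dlt)))"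
  proof (intro exI[of _ a] exI[of _ g] conjI ag(1) allI impI)
   have "C*M/rho <= C'*M/rho" using CC M0 rho by (intro divide_right_mono mult_right_mono) auto
   thus "norm g <= C'*M/rho" using ag(2) by linarith
   fix x assume x: "norm x <= rho" "norm (perp e x) >= (eta+2*dlt)*rho"
   have "C*M*(norm x/rho)^2 <= C'*M*(norm x/rho)^2" using CC M0 by (intro mult_right_mono) auto
   moreover have "C1*M*((1/eta) ^ DIM('a)/ln (1/dlt)) <= C'*M*((1/eta) ^ DIM('a)/ln (1/dlt))"
    using CC M0 eta lnpos by (intro mult_right_mono) auto
   ultimately show "\<bar>(u x-v x)-(a+g \<bullet> x)\<bar> <= C'*M*((norm x/rho)^2+(1/eta) ^ DIM('a)/ln (1/dlt))"
    using near[OF x] ag(3)[rule_format, OF x(1)] unfolding D_def distrib_left by linarith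
  qed
 qed
qed

text \<open>The tubes decrease to a segment of the line through e, which is a null set in dimension
  at least two.\<close>

lemma tube_measure_small:
 fixes e :: "'a::euclidean_space"
 assumes dim: "DIM('a) >= 2" and e: "norm e = 1" and eps: "eps > 0"
 shows "EX eta>0. eta <= 1 \<and> measure lborel {w \<in> cball 0 2. norm (perp e w) <= eta} < eps"
proof -
 define T where "T n = {w \<in> cball 0 2. norm (perp e w) <= 1/real (Suc n)}" for n
 have closed: "closed (T n)" for n
 proof -
  have "T n = cball 0 2 \<inter> {w. norm (perp e w) <= 1/real (Suc n)}" by (auto simp: T_def)
  moreover have "closed {w. norm (perp e w) <= 1/real (Suc n)}"
   by (intro closed_Collect_le continuous_intros)
  ultimately show ?thesis by (simp add: closed_Int)
 qed
 have dec: "decseq T"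
 proof (rule decseq_SucI)
  fix n
  have "1/real (Suc (Suc n)) <= 1/real (Suc n)" by (simp add: field_simps)
  thus "T (Suc n) \<subseteq> T n" unfolding T_def by (auto intro: order_trans)
 qed
 have fin: "emeasure lborel (T n) \<noteq> \<infinity>" for n
 proof -
  have "bounded (T n)" by (rule bounded_subset[of "cball 0 2"]) (auto simp: T_def)
  thus ?thesis using emeasure_bounded_finite[of "T n"] by auto
 qed
 have lim: "(%n. measure lborel (T n)) \<longlonglongrightarrow> measure lborel (\<Inter>n. T n)"
  by (rule Lim_measure_decseq) (use closed dec fin in auto)
 have "(\<Inter>n. T n) \<subseteq> span {e}"
 proof
  fix w assume w: "w \<in> (\<Inter>n. T n)"
  have "norm (perp e w) <= 0"
  proof (rule LIMSEQ_le_const)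
   show "(%n. 1/real (Suc n)) \<longlonglongrightarrow> 0" using LIMSEQ_inverse_real_of_nat by (simp add: inverse_eq_divide)
   show "EX N. ALL n>=N. norm (perp e w) <= 1/real (Suc n)" using w by (auto simp: T_def)
  qed
  hence "w = (w \<bullet> e) *. e" by (simp add: perp_def)
  thus "w \<in> span {e}" by (metis span_base span_mul singletonI)
 qed
 moreover have "negligible (span {e})"
  by (rule negligible_lowdim) (use dim in \<open>simp add: dim_span\<close>)
 ultimately have "negligible (\<Inter>n. T n)" by (meson negligible_subset)
 hence "measure lebesgue (\<Inter>n. T n) = 0" by (rule negligible_imp_measure0)
 moreover have "(\<Inter>n. T n) \<in> sets borel" using closed by (intro borel_closed closed_INT) auto
 ultimately have "measure lborel (\<Inter>n. T n) = 0" by simp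
 hence "(%n. measure lborel (T n)) \<longlonglongrightarrow> 0" using lim by simp
 hence "eventually (%n. measure lborel (T n) < eps) sequentially"
  using eps by (rule order_tendstoD(2))
 then obtain n where n: "measure lborel (T n) < eps"
  by (auto simp: eventually_sequentially)
 show ?thesis
  by (rule exI[of _ "1/real (Suc n)"]) (use n in \<open>auto simp: T_def\<close>)
qed

abbreviation near_axis :: "'a::euclidean_space => real => real => bool" where
 "near_axis e eps eta \<equiv>
    ALL (u::'a => real) v R X Y. sol u --> sol v --> R > 0 -->
     (ALL x. norm x <= 2 * R --> norm (perp e x) >= eta * R --> \<bar>u x-v x\<bar> <= X) -->
     (ALL x. norm x <= 2 * R --> \<bar>u x-v x\<bar> <= Y) --> 0 <= X -->
     (ALL x. norm x <= R --> \<bar>u x-v x\<bar> <= X+eps*Y)"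

text \<open>The affine estimate says nothing close to the axis. The sub-mean value property of
  \<open>\<bar>u-v\<bar>\<close> recovers this region: the thin tube has a small share of the
  averaging ball, so only a crude bound Y is needed inside it.\<close>

lemma diff_near_axis:
 fixes e :: "'a::euclidean_space"
 assumes dim: "DIM('a) >= 2" and e: "norm e = 1" and eps: "eps > 0"
 shows "EX eta>0. eta <= 1 \<and> near_axis e eps eta"
proof -
 define b where "b = bet TYPE('a)"
 have b: "b > 0" using bet_pos by (simp add: b_def)
 obtain eta where eta: "eta > 0" "eta <= 1" and small: "measure lborel {w \<in> cball (0::'a) 2. norm (perp e w) <= eta} < eps*b"
  using tube_measure_small[OF dim e, of "eps*b"] eps b by auto
 define T where "T = {w \<in> cball (0::'a) 2. norm (perp e w) <= eta}"
 have "closed T"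
 proof -
  have "T = cball 0 2 \<inter> {w. norm (perp e w) <= eta}" by (auto simp: T_def)
  moreover have "closed {w. norm (perp e w) <= eta}"
   by (intro closed_Collect_le continuous_intros)
  ultimately show ?thesis by (simp add: closed_Int)
 qed
 hence Tm [measurable]: "T \<in> sets borel" by simp
 have "bounded T" by (rule bounded_subset[of "cball 0 2"]) (auto simp: T_def)
 hence Tfin: "emeasure lborel T < \<infinity>" by (rule emeasure_bounded_finite)
 show ?thesis
 proof (rule exI[of _ eta], intro conjI eta allI impI)
  fix u v :: "'a => real" and R X Y :: real and x :: 'a
  assume u: "sol u" and v: "sol v" and R: "R > 0"
   and far: "ALL x. norm x <= 2 * R --> norm (perp e x) >= eta * R --> \<bar>u x-v x\<bar> <= X"
   and all: "ALL x. norm x <= 2 * R --> \<bar>u x-v x\<bar> <= Y"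
   and X: "0 <= X" and x: "norm x <= R"
  define D where "D x = \<bar>u x-v x\<bar>" for x
  have Dc: "continuous_on UNIV D" unfolding D_def[abs_def]
   by (intro continuous_intros sol_continuous u v)
  have Y: "Y >= 0" using all[rule_format, of 0] R by force
  define s where "s = (1/R) *. x"
  have ns: "norm s <= 1" using x R by (simp add: s_def field_simps)
  have shift: "(\<integral>y. indicator T (y+s) \<partial>lborel) = measure lborel T"
   using lborel_integral_shift[of "indicator T :: 'a => real" s] by simp
  have Ti: "integrable lborel (%y. indicator T (y+s) :: real)"
  proof -
   have "integrable (distr lborel borel ((+) s)) (indicator T :: 'a => real)"
    using Tfin lborel_distr_plus[of s] by (simp add: integrable_real_indicator)
   thus ?thesis by (subst (asm) integrable_distr_eq) (auto simp: add.commute)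
  qed
  have "b*avg D x R = (\<integral>y. D (x+R *. y)*Phi y \<partial>lborel)" using b by (simp add: avg_def b_def)
  also have "\<dots> <= (\<integral>y. X*Phi y+Y*indicator T (y+s) \<partial>lborel)"
  proof (rule integral_mono)
   show "integrable lborel (%y. D (x+R *. y)*Phi y)" by (rule integrable_avg[OF Dc])
   show "integrable lborel (%y. X*Phi y+Y*indicator T (y+s))" using Ti by simp
   fix y :: 'a
   show "D (x+R *. y)*Phi y <= X*Phi y+Y*indicator T (y+s)"
   proof (cases "norm y <= 1")
    case True
    have Ry: "norm (R *. y) <= R" using True R by (simp add: mult_left_le)
    have n2: "norm (x+R *. y) <= 2 * R" using norm_triangle_ineq[of x "R *. y"] Ry x by linarith
    have eq: "x+R *. y = R *. (y+s)" using R by (simp add: s_def algebra_simps)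
    show ?thesis
    proof (cases "y+s \<in> T")
     case True
     have "D (x+R *. y)*Phi y <= Y*1"
      using all n2 Y Phi_le_1[of y] by (intro mult_mono) (auto simp: D_def)
     thus ?thesis using True mult_nonneg_nonneg[OF X Phi_nonneg[of y]] by simp
    next
     case False
     have "norm (y+s) <= 2" using norm_triangle_ineq[of y s] True ns by linarith
     hence "norm (perp e (y+s)) > eta" using False by (auto simp: T_def)
     hence "norm (perp e (x+R *. y)) >= eta * R" unfolding eq perp_scaleR using R by (simp add: mult.commute)
     hence "D (x+R *. y) <= X" using far n2 by (simp add: D_def)
     thus ?thesis using False by (simp add: mult_right_mono)
    qed
   qed (use Y in \<open>simp add: Phi_eq_0\<close>)
  qed
  also have "\<dots> = X*b+Y*measure lborel T" using Ti shift by (simp add: b_def bet_def)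
  also have "\<dots> <= X*b+Y*(eps*b)" using small Y by (intro add_left_mono mult_left_mono) (auto simp: T_def)
  finally have "b*avg D x R <= b*(X+eps*Y)" by (simp add: algebra_simps)
  hence "avg D x R <= X+eps*Y" using b by (simp only: mult_le_cancel_left_pos)
  thus "\<bar>u x-v x\<bar> <= X+eps*Y"
   using diff_abs(1)[OF u v, of R x] R by (simp add: D_def[abs_def])
 qed
qed

text \<open>For a nonnegative function, a pointwise comparison of two rescaled weights compares the
  averages. With \<open>diff_abs\<close> and \<open>diff_mean\<close> this supplies the Harnack type
  step in \<open>G_recursive\<close>.\<close>

lemma avg_compare:
 fixes g :: "'a::euclidean_space => real"
 assumes g: "continuous_on UNIV g" "\<And>z. g z >= 0" and R: "R > 0" and S: "S > 0" and K: "K >= 0"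
  and le: "\<And>z. Phi ((1/R) *. (z-x)) <= K*Phi ((1/S) *. (z-x0))"
 shows "avg g x R <= K*(S/R) ^ DIM('a)*avg g x0 S"
proof -
 define b where "b = bet TYPE('a)"
 have b: "b > 0" using bet_pos by (simp add: b_def)
 have [measurable]: "g \<in> borel_measurable borel" using g(1) by (rule borel_measurable_continuous_onI)
 have scale: "ennreal (rho ^ DIM('a)*(b*avg g y rho)) = (\<integral>\<^sup>+z. ennreal (g z*Phi ((1/rho) *. (z-y))) \<partial>lborel)"
  if "rho > 0" for y and rho :: real
 proof -
  have "(\<integral>\<^sup>+z. ennreal (g z*Phi ((1/rho) *. (z-y))) \<partial>lborel) =
        ennreal (rho ^ DIM('a))*(\<integral>\<^sup>+w. ennreal (g (y+rho *. w)*Phi ((1/rho) *. (y+rho *. w-y))) \<partial>lborel)"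
   by (rule nn_integral_affine[OF that]) measurable
  also have "(\<integral>\<^sup>+w. ennreal (g (y+rho *. w)*Phi ((1/rho) *. (y+rho *. w-y))) \<partial>lborel) =
        (\<integral>\<^sup>+w. ennreal (g (y+rho *. w)*Phi w) \<partial>lborel)"
   using that by simp
  also have "\<dots> = ennreal (\<integral>w. g (y+rho *. w)*Phi w \<partial>lborel)"
   by (rule nn_integral_eq_integral[OF integrable_avg[OF g(1)]]) (use g(2) in auto)
  also have "(\<integral>w. g (y+rho *. w)*Phi w \<partial>lborel) = b*avg g y rho" using b by (simp add: avg_def b_def)
  finally show ?thesis using that by (simp add: ennreal_mult')
 qed
 have avg0: "avg g y rho >= 0" for y rho
  unfolding avg_def using g(2) bet_pos[where 'a='a] by (intro divide_nonneg_pos integral_nonneg_AE) auto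
 have "ennreal (R ^ DIM('a)*(b*avg g x R)) <= (\<integral>\<^sup>+z. ennreal K*ennreal (g z*Phi ((1/S) *. (z-x0))) \<partial>lborel)"
  unfolding scale[OF R]
 proof (rule nn_integral_mono)
  fix z
  have "g z*Phi ((1/R) *. (z-x)) <= g z*(K*Phi ((1/S) *. (z-x0)))"
   by (rule mult_left_mono[OF le g(2)])
  thus "ennreal (g z*Phi ((1/R) *. (z-x))) <= ennreal K*ennreal (g z*Phi ((1/S) *. (z-x0)))"
   using K by (simp add: ennreal_mult'[symmetric] ennreal_leI mult_ac)
 qed
 also have "\<dots> = ennreal K*ennreal (S ^ DIM('a)*(b*avg g x0 S))"
  unfolding scale[OF S] by (rule nn_integral_cmult) measurable
 also have "\<dots> = ennreal (K*(S ^ DIM('a)*(b*avg g x0 S)))" using K by (rule ennreal_mult'[symmetric])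
 finally have "R ^ DIM('a)*(b*avg g x R) <= K*(S ^ DIM('a)*(b*avg g x0 S))"
  using K S b avg0 by (simp add: ennreal_le_iff)
 hence "b*(R ^ DIM('a)*avg g x R) <= b*(K*(S ^ DIM('a)*avg g x0 S))" by (simp add: mult_ac)
 hence "R ^ DIM('a)*avg g x R <= K*(S ^ DIM('a)*avg g x0 S)" using b by (simp only: mult_le_cancel_left_pos)
 thus ?thesis using R by (simp add: power_divide pos_le_divide_eq mult_ac)
qed

section \<open>Translates of solutions\<close>

lemma lap_translate:
 assumes "lap u G f" shows "lap (%x. u (x+a)) (%x. G (x+a)) (%x. f (x+a))"
proof -
 have [measurable]: "f \<in> borel_measurable borel" using assms by (rule lap_measurable)
 have nb: "norm (y+a) <= R+norm a" if "norm y <= R" for y R using norm_triangle_ineq[of y a] that by linarith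
 have tr: "((%x. x+a) has_derivative (%h. h)) (at x)" for x by (auto intro!: derivative_eq_intros)
 show ?thesis unfolding lap_def
 proof (intro conjI allI)
  fix x
  show "((%x. u (x+a)) has_derivative (%h. G (x+a) \<bullet> h)) (at x)"
   using has_derivative_compose[OF tr lap_has_derivative[OF assms]] by simp
 next
  fix R
  obtain L where L: "L >= 0" "ALL y z. norm y <= R+norm a --> norm z <= R+norm a --> norm (G y-G z) <= L*norm (y-z)"
   using lap_lipschitz[OF assms, of "R+norm a"] by blast
  show "EX L. ALL y:cball 0 R. ALL z:cball 0 R. norm (G (y+a)-G (z+a)) <= L*norm (y-z)"
  proof (intro exI ballI)
   fix y z :: 'a assume "y \<in> cball 0 R" "z \<in> cball 0 R"
   thus "norm (G (y+a)-G (z+a)) <= L*norm (y-z)"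
    using L(2)[rule_format, of "y+a" "z+a"] nb by simp
  qed
 next
  show "(%x. f (x+a)) \<in> borel_measurable borel" by measurable
 next
  fix R
  obtain K where K: "ALL x. norm x <= R+norm a --> \<bar>f x\<bar> <= K" using lap_bounded[OF assms, of "R+norm a"] by blast
  show "EX K. ALL x:cball 0 R. \<bar>f (x+a)\<bar> <= K" using K nb by (intro exI[of _ K]) auto
 next
  have "AE y in lborel. EX H. (G has_derivative H) (at (a+1 *. y)) \<and> (\<Sum>b\<in>Basis. H b \<bullet> b) = f (a+1 *. y)"
   by (rule AE_lborel_affine) (use assms in \<open>auto simp: lap_def\<close>)
  thus "AE x in lborel. EX H. ((%x. G (x+a)) has_derivative H) (at x) \<and> (\<Sum>b\<in>Basis. H b \<bullet> b) = f (x+a)"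
  proof (rule eventually_mono)
   fix y assume "EX H. (G has_derivative H) (at (a+1 *. y)) \<and> (\<Sum>b\<in>Basis. H b \<bullet> b) = f (a+1 *. y)"
   then obtain H where H: "(G has_derivative H) (at (y+a))" "(\<Sum>b\<in>Basis. H b \<bullet> b) = f (y+a)"
    by (auto simp: add.commute)
   show "EX H. ((%x. G (x+a)) has_derivative H) (at y) \<and> (\<Sum>b\<in>Basis. H b \<bullet> b) = f (y+a)"
    using has_derivative_compose[OF tr H(1)] H(2) by blast
  qed
 qed
qed

lemma sol_translate: assumes "sol u" shows "sol (%x. u (x+a))"
proof -
 obtain G where "lap u G (indicator {x. u x > 0})" using assms unfolding sol_def by blast
 moreover have "(%x. indicator {x. u x > 0} (x+a) :: real) = indicator {x. u (x+a) > 0}"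
  by (auto simp: indicator_def fun_eq_iff)
 ultimately have "lap (%x. u (x+a)) (%x. G (x+a)) (indicator {x. u (x+a) > 0})"
  using lap_translate[of u G "indicator {x. u x > 0}" a] by simp
 thus ?thesis using assms unfolding sol_def by blast
qed

section \<open>Distance to the blow-down\<close>

lemma sum_three_halves:
 fixes x :: real
 assumes "x > 0"
 shows "(\<Sum>i=1..n. 1/((x+real i) * sqrt (x+real i))) <= 2/sqrt x"
proof -
 have step: "1/((y+1) * sqrt (y+1)) <= 2/sqrt y-2/sqrt (y+1)" if "y > 0" for y :: real
 proof -
  define s where "s = sqrt y" define t where "t = sqrt (y+1)"
  have st: "s > 0" "t > 0" "s <= t" "s * s = y" "t*t = y+1" using that by (auto simp: s_def t_def)
  have d: "t-s = 1/(t+s)"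
  proof -
   have "(t-s)*(t+s) = 1" using st by (simp add: algebra_simps)
   thus ?thesis using st by (simp add: field_simps)
  qed
  have "2/s-2/t = 2*(t-s)/(s*t)" using st by (simp add: field_simps)
  also have "\<dots> = 2/((t+s)*(s*t))" unfolding d by simp
  also have "\<dots> >= 2/((2*t)*(t*t))"
   using st by (intro divide_left_mono mult_mono mult_pos_pos) auto
  finally show ?thesis unfolding s_def[symmetric] t_def[symmetric] st(5)[symmetric] using st(2) by (simp add: mult_ac)
 qed
 have "(\<Sum>i=1..n. 1/((x+real i) * sqrt (x+real i))) <= 2/sqrt x-2/sqrt (x+real n)"
 proof (induction n)
  case (Suc n)
  have "1/((x+real (Suc n)) * sqrt (x+real (Suc n))) <= 2/sqrt (x+real n)-2/sqrt (x+real (Suc n))"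
   using step[of "x+real n"] assms by (simp add: add_ac)
  thus ?case using Suc by simp
 qed simp
 moreover have "2/sqrt (x+real n) >= 0" using assms by simp
 ultimately show ?thesis by linarith
qed

lemma sum_inverse_sqrt: "(\<Sum>i=1..n. 1/sqrt (real i)) <= 2 * sqrt (real n)"
proof (induction n)
 case (Suc n)
 define s where "s = sqrt (real n)" define t where "t = sqrt (real (Suc n))"
 have st: "s >= 0" "t > 0" "s <= t" "s * s = real n" "t*t = real n+1" by (auto simp: s_def t_def)
 have "1 = (t-s)*(t+s)" using st by (simp add: algebra_simps)
 also have "\<dots> <= (t-s)*(2*t)" using st by (intro mult_left_mono) auto
 finally have "1/t <= 2*(t-s)" using st by (simp add: field_simps)
 thus ?case using Suc by (simp add: s_def t_def)
qed simp

text \<open>The blow-down p enters only through its growth transversal to the axis and its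
  invariance along e. By the invariance, increments of u and of \<open>u - p\<close> along e
  coincide.\<close>

locale profile =
 fixes e :: "'a::euclidean_space" and u p :: "'a => real" and c0 C0 :: real
 assumes dim: "DIM('a) >= 3" and e: "norm e = 1" and u: "sol u" and p: "sol p"
  and mono: "t >= 0 ==> u (x+t *. e) <= u x"
  and c0: "c0 > 0" and p_lower: "c0*(norm (perp e x))^2 <= p x"
  and p_upper: "p x <= C0*(norm (perp e x))^2" and p_shift: "p (x+t *. e) = p x"
  and conv: "eps > 0 ==> EX R0>0. ALL R>=R0. ALL x. norm x <= R --> \<bar>u x-p x\<bar> <= eps * R^2"
  and below: "x \<bullet> e < 0 ==> u x > 0"
begin

text \<open>A unit decrement along e. It is nonnegative by monotonicity, it is a difference of two
  solutions, and its density vanishes in the half space below height -1.\<close>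

definition g :: "'a => real" where "g x = u x-u (x+e)"

definition G :: "real => real" where "G R = Sup (g ` cball 0 R)"

lemma u_shift: "sol (%x. u (x+e))"
 by (rule sol_translate[OF u])

lemma g_nonneg: "g x >= 0"
 using mono[of 1 x] by (simp add: g_def)

lemma g_continuous: "continuous_on UNIV g"
 unfolding g_def[abs_def] by (rule diff_continuous[OF u u_shift])

lemma g_le_G: assumes "norm x <= R" shows "g x <= G R"
 unfolding G_def
proof (rule cSup_upper)
 have "compact (g ` cball 0 R)"
  by (intro compact_continuous_image continuous_on_subset[OF g_continuous]) auto
 thus "bdd_above (g ` cball 0 R)" by (intro bounded_imp_bdd_above compact_imp_bounded)
qed (use assms in auto)

lemma G_le: assumes "R >= 0" "\<And>x. norm x <= R ==> g x <= B" shows "G R <= B"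
 unfolding G_def by (rule cSup_least) (use assms in auto)

lemma G_nonneg: "R >= 0 ==> G R >= 0"
 using g_nonneg[of 0] g_le_G[of 0 R] by simp

lemma G_mono: "0 <= R ==> R <= S ==> G R <= G S"
 by (rule G_le) (auto intro: g_le_G)

lemma C0_pos: "C0 > 0"
proof -
 obtain w where "w \<noteq> 0" "orthogonal e w"
  using orthogonal_to_vector_exists[of e] dim by auto
 hence w: "w \<noteq> 0" "w \<bullet> e = 0" by (auto simp: orthogonal_def inner_commute)
 hence "perp e w = w" by (simp add: perp_def)
 hence "c0*(norm w)^2 <= C0*(norm w)^2" using p_lower[of w] p_upper[of w] by simp
 thus ?thesis using w c0 by (simp add: mult_le_cancel_right)
qed

text \<open>At a zero of u the value of p is \<open>o(R^2)\<close>, while p controls the squared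
  distance to the axis from below.\<close>

lemma u_zero_tube:
 assumes "dlt > 0"
 shows "EX R0>0. ALL R>=R0. ALL x. norm x <= R --> u x = 0 --> norm (perp e x) <= dlt * R"
proof -
 obtain R0 where R0: "R0 > 0" "ALL R>=R0. ALL x. norm x <= R --> \<bar>u x-p x\<bar> <= (c0*dlt^2) * R^2"
  using conv[of "c0*dlt^2"] c0 assms by auto
 show ?thesis
 proof (rule exI[of _ R0], intro conjI R0 allI impI)
  fix R x assume R: "R0 <= R" and x: "norm x <= R" "u x = 0"
  have "p x <= c0*dlt^2 * R^2" using R0(2)[rule_format, OF R x(1)] x(2) by linarith
  hence "c0*(norm (perp e x))^2 <= c0*(dlt * R)^2" using p_lower[of x] by (simp add: power_mult_distrib)
  hence "(norm (perp e x))\<^sup>2 <= (dlt * R)^2" using c0 by simp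
  thus "norm (perp e x) <= dlt * R" by (rule power2_le_imp_le) (use R R0 assms in auto)
 qed
qed

text \<open>At a point \<open>x0\<close> below the origin at distance \<open>R/A\<close>, g is at
  most \<open>G (R/A)\<close>. The density of g stays away from \<open>x0\<close> and has little
  mass, so the average of g over a large ball around \<open>x0\<close> is hardly larger than
  \<open>g x0\<close>; by the sub-mean value property that average controls g on the ball of radius
  R. It is essential that \<open>C1\<close> does not depend on A.\<close>

lemma G_recursive:
 "EX C1>0. ALL A th. A >= 1 --> th > 0 --> (EX R0>0. ALL R>=R0. G R <= C1*G (R/A)+th*G (32 * R))"
proof -
 define b where "b = bet TYPE('a)"
 have b: "b > 0" using bet_pos by (simp add: b_def)
 define C1 :: real where "C1 = 2*8 ^ DIM('a)"
 have "C1 > 0" by (simp add: C1_def)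
 moreover have "EX R0>0. ALL R>=R0. G R <= C1*G (R/A)+th*G (32 * R)"
  if A: "A >= 1" and th: "th > 0" for A th :: real
 proof -
 define CA :: real where "CA = 8*(2*A) ^ DIM('a)*(512*18 ^ DIM('a))"
 have CA: "CA > 0" using A by (simp add: CA_def)
 \<comment> \<open>Small enough that the mass term, after multiplication by \<open>C1\<close>, is at
   most \<open>th * G (32 * R)\<close>.\<close>
 define dlt where "dlt = min (1/16) (exp (- (C1*CA/th)))"
 have dlt: "0 < dlt" "dlt <= 1/16" by (auto simp: dlt_def)
 have lnpos: "ln (1/dlt) > 0" using dlt by (simp add: ln_gt_zero_iff)
 have lnbig: "C1*CA/ln (1/dlt) <= th"
 proof -
  have "dlt <= exp (- (C1*CA/th))" by (simp add: dlt_def)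
  hence "ln dlt <= - (C1*CA/th)" using dlt by (metis ln_exp ln_le_cancel_iff exp_gt_zero)
  hence "C1*CA/th <= ln (1/dlt)" using dlt by (simp add: ln_div)
  thus ?thesis using th lnpos by (simp add: field_simps)
 qed
 obtain R0 where R0: "R0 > 0" "ALL R>=R0. ALL x. norm x <= R --> u x = 0 --> norm (perp e x) <= (dlt/2) * R"
  using u_zero_tube[of "dlt/2"] dlt by auto
 define R1 where "R1 = max R0 (max 1 (2*A))"
 have "G R <= C1*G (R/A)+th*G (32 * R)" if R: "R >= R1" for R
 proof -
  have Rb: "R >= R0" "R >= 1" "R >= 2*A" using R by (auto simp: R1_def)
  define r where "r = R/A"
  have r: "r >= 2" "r <= R" "r > 0" using A Rb by (auto simp: r_def field_simps mult_left_le)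
  define x0 where "x0 = - (r *. e)"
  have nx0: "norm x0 = r" using e r by (simp add: x0_def)
  have tube: "norm (perp e x) <= dlt*(9 * R)" if x: "norm x <= 9 * R" "u x = 0 \<or> u (x+e) = 0" for x
  proof -
   \<comment> \<open>A zero of the translate at x is a zero of u at \<open>x+e\<close>, which has
     the same distance to the axis.\<close>
   obtain y where y: "u y = 0" "norm y <= norm x+1" "perp e y = perp e x"
   proof (cases "u x = 0")
    case True thus ?thesis by (intro that[of x]) auto
   next
    case False
    thus ?thesis using x e norm_triangle_ineq[of x e]
     by (intro that[of "x+e"]) (auto simp: perp_add perp_self)
   qed
   have "norm y <= 10 * R" using y(2) x(1) Rb by linarith
   hence "norm (perp e y) <= (dlt/2)*(10 * R)"
    using R0(2)[rule_format, of "10 * R" y] y(1) Rb by simp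
   also have "\<dots> <= dlt*(9 * R)" using dlt Rb by simp
   finally show ?thesis using y by simp
  qed
  have den_low: "x \<bullet> e >= -1" if "den u (%x. u (x+e)) x \<noteq> 0" for x
  proof (rule ccontr)
   assume "\<not> x \<bullet> e >= -1"
   hence "x \<bullet> e < 0" "(x+e) \<bullet> e < 0" using e by (auto simp: inner_add_left norm_eq_1)
   hence "u x > 0" "u (x+e) > 0" using below by auto
   thus False using den_cases[OF u u_shift that] by auto
  qed
  note [measurable] = den_measurable[OF u u_shift]
  have [measurable]: "cball (0::'a) (9 * R) \<in> sets borel" by simp
  have mass: "(\<integral>\<^sup>+z. ennreal (den u (%x. u (x+e)) z)*indicator (cball 0 (9*R)) z \<partial>lborel) <=
       ennreal (512*bet TYPE('a)*G (32 * R)*((2*(9*R)) ^ DIM('a)/(2*(9*R))^2)/ln (1/dlt))" (is "?m <= ennreal ?mu")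
  proof (rule mass_bound[OF dim e _ dlt u u_shift])
   show "0 < 9 * R" "0 <= G (32 * R)" using Rb by (auto intro: G_nonneg)
   show "\<bar>u x-u (x+e)\<bar> <= G (32 * R)" if "norm x <= 3*(9 * R)" for x
    using g_le_G[of x "32 * R"] g_nonneg[of x] that Rb by (simp add: g_def)
   show "norm (perp e x) <= dlt*(9 * R)" if "norm x <= 9 * R" "u x = 0 \<or> u (x+e) = 0" for x
    using tube that by blast
  qed
  define d where "d = r/2"
  have d: "d > 0" using r by (simp add: d_def)
  define K where "K = (8 * R)*(d/d ^ DIM('a))"
  have K0: "K >= 0" using Rb d by (simp add: K_def)
  have "pot (den u (%x. u (x+e))) x0 (8*R) <=
        (\<integral>\<^sup>+z. ennreal K*(ennreal (den u (%x. u (x+e)) z)*indicator (cball 0 (9*R)) z) \<partial>lborel)"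
   unfolding pot_def
  proof (rule nn_integral_mono)
   fix z :: 'a
   show "ennreal (den u (%x. u (x+e)) z) * kap (8*R) (z-x0) <=
          ennreal K*(ennreal (den u (%x. u (x+e)) z)*indicator (cball 0 (9*R)) z)"
   proof (cases "den u (%x. u (x+e)) z = 0 \<or> norm (z-x0) >= 8 * R")
    case False
    hence z: "norm z <= 9 * R" using nx0 r norm_triangle_ineq[of "z-x0" x0] by simp
    have "z \<bullet> e >= -1" using den_low False by blast
    moreover have "(z-x0) \<bullet> e = z \<bullet> e+r" using e by (simp add: x0_def inner_simps norm_eq_1)
    \<comment> \<open>The density lives at heights at least -1, so its distance to \<open>x0\<close>
      is at least \<open>r-1\<close>, and \<open>r >= 2\<close> makes this at least
      \<open>r/2\<close>.\<close>
    ultimately have "d <= (z-x0) \<bullet> e" using r by (simp add: d_def)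
    hence "d <= norm (z-x0)" using abs_inner_unit_le[OF e, of "z-x0"] by linarith
    hence "kap (8*R) (z-x0) <= ennreal K" unfolding K_def using d Rb by (intro kap_upper) auto
    hence "ennreal (den u (%x. u (x+e)) z) * kap (8*R) (z-x0) <= ennreal (den u (%x. u (x+e)) z)*ennreal K"
     by (rule mult_left_mono) simp
    thus ?thesis using z by (simp add: mult.commute)
   qed (auto simp: kap_eq_0)
  qed
  also have "\<dots> = ennreal K*?m" by (rule nn_integral_cmult) measurable
  also have "\<dots> <= ennreal K*ennreal ?mu" using mass by (rule mult_left_mono) simp
  also have "\<dots> = ennreal (K*?mu)" using K0 by (rule ennreal_mult'[symmetric])
  finally have "ennreal (b*\<bar>avg g x0 (8*R)-g x0\<bar>) <= ennreal (K*?mu)"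
   using order_trans[OF diff_mean[OF u u_shift, of "8 * R" x0]] Rb by (simp add: g_def[abs_def] b_def)
  moreover have "K*?mu >= 0"
   using K0 bet_pos[where 'a='a] G_nonneg[of "32 * R"] Rb lnpos by (intro mult_nonneg_nonneg divide_nonneg_nonneg) auto
  ultimately have "b*\<bar>avg g x0 (8*R)-g x0\<bar> <= K*?mu" by (simp add: ennreal_le_iff)
  also have "K*?mu = b*((8*(512*18 ^ DIM('a))*G (32 * R)/ln (1/dlt))*(R*(d/d ^ DIM('a))*(R ^ DIM('a)/(18 * R)^2)))"
   using Rb by (simp add: K_def b_def power_mult_distrib mult_ac)
  also have "\<dots> <= b*((8*(512*18 ^ DIM('a))*G (32 * R)/ln (1/dlt))*((2*A) ^ DIM('a)))"
  proof (intro mult_left_mono)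
   have "R*(d/d ^ DIM('a))*(R ^ DIM('a)/(18 * R)^2) = (R/d) ^ DIM('a)*(d/(324 * R))"
    using Rb d by (simp add: power_divide power2_eq_square field_simps)
   also have "R/d = 2*A" using A Rb by (simp add: d_def r_def)
   also have "(2*A) ^ DIM('a)*(d/(324 * R)) <= (2*A) ^ DIM('a)*1"
    using A Rb r by (intro mult_left_mono) (auto simp: d_def)
   finally show "R*(d/d ^ DIM('a))*(R ^ DIM('a)/(18 * R)^2) <= (2*A) ^ DIM('a)" by simp
  qed (use b G_nonneg[of "32 * R"] Rb lnpos in auto)
  also have "\<dots> = b*(CA*G (32 * R)/ln (1/dlt))" by (simp add: CA_def mult_ac)
  finally have "\<bar>avg g x0 (8*R)-g x0\<bar> <= CA*G (32 * R)/ln (1/dlt)" using b by (simp only: mult_le_cancel_left_pos)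
  moreover have "g x0 <= G (R/A)" using nx0 by (intro g_le_G) (simp add: r_def)
  ultimately have av: "avg g x0 (8*R) <= G (R/A)+CA*G (32 * R)/ln (1/dlt)" by linarith
  have "g x <= C1*(G (R/A)+CA*G (32 * R)/ln (1/dlt))" if x: "norm x <= R" for x
  proof -
   have "\<bar>u x-u (x+e)\<bar> <= avg (%x. \<bar>u x-u (x+e)\<bar>) x R"
    using Rb by (intro diff_abs(1) u u_shift) auto
   hence "g x <= avg g x R" using g_nonneg by (simp add: g_def[symmetric])
   also have "\<dots> <= 2*(8 * R/R) ^ DIM('a)*avg g x0 (8*R)"
   proof (rule avg_compare[OF g_continuous g_nonneg])
    fix z
    show "Phi ((1/R) *. (z-x)) <= 2*Phi ((1/(8*R)) *. (z-x0))"
    proof (cases "norm (z-x) >= R")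
     case True
     moreover have "norm ((1/R) *. (z-x)) = norm (z-x)/R" using Rb by simp
     ultimately have "norm ((1/R) *. (z-x)) >= 1" using Rb by simp
     thus ?thesis by (simp add: Phi_eq_0)
    next
     case False
     have "norm (z-x0) <= norm (z-x)+norm x+norm x0"
      using norm_triangle_ineq[of "z-x" x] norm_triangle_ineq4[of z x0] by simp
     hence "norm (z-x0) <= 3 * R" using False x nx0 r by linarith
     moreover have "norm ((1/(8*R)) *. (z-x0)) = norm (z-x0)/(8*R)" using Rb by simp
     ultimately have n: "norm ((1/(8*R)) *. (z-x0)) <= 3/8" using Rb by (simp add: pos_divide_le_eq)
     define w where "w = (1/(8*R)) *. (z-x0)"
     have "(norm w)\<^sup>2 <= (3/8)^2" unfolding w_def using n by (intro power_mono) auto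
     hence "(norm w)\<^sup>2 <= 9/64" by (simp add: power2_eq_square)
     hence "3/4 <= max 0 (1-(norm w)^2)" by linarith
     hence "(3/4)\<^sup>2 <= Phi w" unfolding Phi_def by (rule power_mono) simp
     hence "1 <= 2*Phi w" by (simp add: power2_eq_square)
     thus ?thesis using Phi_le_1[of "(1/R) *. (z-x)"] by (simp add: w_def)
    qed
   qed (use Rb in auto)
   also have "\<dots> = C1*avg g x0 (8*R)" using Rb by (simp add: C1_def)
   also have "\<dots> <= C1*(G (R/A)+CA*G (32 * R)/ln (1/dlt))" using av by (intro mult_left_mono) (auto simp: C1_def)
   finally show ?thesis .
  qed
  hence "G R <= C1*(G (R/A)+CA*G (32 * R)/ln (1/dlt))" using Rb by (intro G_le) auto
  also have "\<dots> = C1*G (R/A)+(C1*CA/ln (1/dlt))*G (32 * R)" by (simp add: algebra_simps)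
  also have "\<dots> <= C1*G (R/A)+th*G (32 * R)"
   using lnbig G_nonneg[of "32 * R"] Rb by (intro add_left_mono mult_right_mono) auto
  finally show ?thesis .
 qed
 moreover have "R1 > 0" by (simp add: R1_def)
 ultimately show ?thesis by blast
 qed
 ultimately show ?thesis by blast
qed

text \<open>Starting from the a priori quadratic bound, every use of \<open>G_recursive\<close>
  halves the quadratic part and reproduces the term \<open>F * sqrt R\<close>; the quadratic part
  disappears in the limit.\<close>

lemma G_growth: "EX F>0. EX R0>=1. ALL R>=R0. G R <= F * sqrt R"
proof -
 obtain C1 where C1: "C1 > 0"
  "ALL A th. A >= 1 --> th > 0 --> (EX R0>0. ALL R>=R0. G R <= C1*G (R/A)+th*G (32 * R))"
  using G_recursive by blast
 \<comment> \<open>Gives \<open>C1/sqrt A <= 1/4\<close> and \<open>C1/A^2 <= 1/4\<close>, so the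
   inner term loses a factor 4 in both parts. For the outer term, \<open>th = 1/4096\<close> turns
   \<open>32^2 = 1024\<close> into 1/4.\<close>
 define A where "A = (4*C1+1)^2"
 have sA: "sqrt A = 4*C1+1" using C1 by (simp add: A_def)
 have A1: "A >= 1" using C1 by (simp add: A_def power2_eq_square algebra_simps)
 have A4: "C1/sqrt A <= 1/4" "C1/A^2 <= 1/4"
 proof -
  show "C1/sqrt A <= 1/4" unfolding sA using C1 by (simp add: field_simps)
  have "4*C1 <= sqrt A" by (simp add: sA)
  also have "sqrt A <= A" using A1 real_sqrt_le_mono[of A "A*A"] mult_left_mono[of 1 A A] by simp
  also have "A <= A^2" using A1 by (simp add: power2_eq_square)
  finally show "C1/A^2 <= 1/4" using A1 by (simp add: field_simps)
 qed
 obtain R0 where R0: "R0 > 0" "ALL R>=R0. G R <= C1*G (R/A)+(1/4096)*G (32 * R)"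
  using C1(2)[rule_format, OF A1, of "1/4096"] by auto
 obtain R1 where R1: "R1 > 0" "ALL R>=R1. ALL x. norm x <= R --> \<bar>u x-p x\<bar> <= 1 * R^2"
  using conv[of 1] by auto
 define R2 where "R2 = max 1 (max R0 R1)"
 have R2: "R2 >= 1" "R2 >= R0" "R2 >= R1" by (auto simp: R2_def)
 define K0 where "K0 = C0+1"
 have K0: "K0 > 0" using C0_pos by (simp add: K0_def)
 have apriori: "G R <= K0 * R^2" if "R >= R2" for R
 proof (rule G_le)
  show "R >= 0" using that R2 by simp
  fix x :: 'a assume x: "norm x <= R"
  have "\<bar>u x-p x\<bar> <= 1 * R^2" using R1(2) x that R2 by auto
  moreover have "C0*(norm (perp e x))^2 <= C0 * R^2"
   using x norm_perp_le[OF e, of x] C0_pos by (intro mult_left_mono power_mono) auto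
  hence "p x <= C0 * R^2" using p_upper[of x] by linarith
  moreover have "g x <= u x" using sol_nonneg[OF u, of "x+e"] by (simp add: g_def)
  ultimately show "g x <= K0 * R^2" unfolding K0_def distrib_right by linarith
 qed
 define F where "F = 4*C1*G R2+1"
 have F: "F > 0" using C1 G_nonneg[of R2] R2 by (simp add: F_def add_nonneg_pos)
 have ind: "G R <= F * sqrt R+(1/2) ^ n*(K0 * R^2)" if "R >= R2" for R n
  using that
 proof (induction n arbitrary: R)
  case 0
  hence "F * sqrt R >= 0" using F R2 by simp
  thus ?case using apriori[OF 0] by simp
 next
  case (Suc n)
  have Rp: "R >= 1" using Suc.prems R2 by simp
  define q where "q = (1/2::real) ^ n"
  have q: "q >= 0" by (simp add: q_def)
  have 1: "C1*G (R/A) <= (1/4)*(F * sqrt R)+(1/4)*(q*(K0 * R^2))"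
  proof (cases "R/A >= R2")
   case True
   have "C1*G (R/A) <= C1*(F * sqrt (R/A)+q*(K0*(R/A)^2))"
    using Suc.IH[OF True] C1 by (intro mult_left_mono) (auto simp: q_def)
   also have "\<dots> = (C1/sqrt A)*(F * sqrt R)+(C1/A^2)*(q*(K0 * R^2))"
    by (simp add: real_sqrt_divide power_divide algebra_simps)
   also have "\<dots> <= (1/4)*(F * sqrt R)+(1/4)*(q*(K0 * R^2))"
    using A4 F K0 q Rp by (intro add_mono mult_right_mono) auto
   finally show ?thesis .
  next
   case False
   hence "G (R/A) <= G R2" using A1 Rp by (intro G_mono) auto
   hence "C1*G (R/A) <= C1*G R2" using C1 by simp
   also have "\<dots> <= (1/4)*(F*1)" by (simp add: F_def)
   also have "\<dots> <= (1/4)*(F * sqrt R)" using F Rp by (intro mult_left_mono) auto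
   also have "\<dots> <= (1/4)*(F * sqrt R)+(1/4)*(q*(K0 * R^2))" using K0 q by simp
   finally show ?thesis .
  qed
  have "G (32 * R) <= F * sqrt (32 * R)+q*(K0*(32 * R)^2)"
   using Suc.IH[of "32 * R"] Suc.prems Rp by (simp add: q_def)
  also have "sqrt (32 * R) <= sqrt (36 * R)" using Rp by simp
  also have "sqrt (36 * R) = 6 * sqrt R" using real_sqrt_mult[of 36 R] real_sqrt_unique[of 6 36] by simp
  finally have 2: "G (32 * R) <= 6*(F * sqrt R)+1024*(q*(K0 * R^2))"
   using F by (simp add: power_mult_distrib mult_ac)
  have nn: "F * sqrt R >= 0" "q*(K0 * R^2) >= 0" using F Rp K0 q by auto
  have "G R <= C1*G (R/A)+(1/4096)*G (32 * R)" using R0(2) Suc.prems R2 by simp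
  hence "G R <= F * sqrt R+(1/2)*(q*(K0 * R^2))" using 1 2 nn by linarith
  thus ?case by (simp add: q_def)
 qed
 have "G R <= F * sqrt R" if R: "R >= R2" for R
 proof -
  have "(%n. F * sqrt R+(1/2) ^ n*(K0 * R^2)) \<longlonglongrightarrow> F * sqrt R+0*(K0 * R^2)"
   by (intro tendsto_intros LIMSEQ_realpow_zero) auto
  thus ?thesis using ind[OF R] by (intro LIMSEQ_le_const[of "%n. F * sqrt R+(1/2) ^ n*(K0 * R^2)"]) auto
 qed
 thus ?thesis using F R2 by blast
qed

lemma p_pos_AE: "AE z in lborel. p z > 0"
proof -
 have "negligible (span {e})"
  by (rule negligible_lowdim) (use dim in \<open>simp add: dim_span\<close>)
 hence "span {e} \<in> null_sets lebesgue" by (simp add: negligible_iff_null_sets)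
 hence "span {e} \<in> null_sets lborel" using closed_span[of "{e}"] by (auto simp: null_sets_def)
 hence "AE z in lborel. z \<notin> span {e}" by (rule AE_not_in)
 thus ?thesis
 proof (rule eventually_mono)
  fix z assume z: "z \<notin> span {e}"
  have "perp e z \<noteq> 0"
  proof
   assume "perp e z = 0"
   hence "z = (z \<bullet> e) *. e" by (simp add: perp_def)
   thus False using z by (metis span_base span_mul singletonI)
  qed
  hence "c0*(norm (perp e z))^2 > 0" using c0 by simp
  thus "p z > 0" using p_lower[of z] by linarith
 qed
qed

section \<open>Second differences of \<open>u - p\<close> and growth of order 3/2\<close>

definition w :: "'a => real" where "w x = u x-p x"

definition sd :: "('a => real) => 'a => 'a => real" where
 "sd f x s = f (x+s) + f (x-s)-2 * f x"

lemma w_step: "w (x-e) = w x+g (x-e)"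
 using p_shift[of "x-e" 1] by (simp add: w_def g_def)

text \<open>In the cone below the origin g has no density in a ball of radius comparable to
  \<open>norm x0\<close>. Its second differences are thus of order
  \<open>G * (norm s)^2/(norm x0)^2\<close>, and \<open>G\<close> is
  \<open>O(sqrt R)\<close>.\<close>

lemma sd_g:
 "EX B>0. EX R0>=1. ALL x0 s. x0 \<bullet> e <= - norm x0/2 --> norm x0 >= R0 --> norm s <= norm x0/8 -->
     \<bar>sd g x0 s\<bar> <= B*(norm s)^2/(norm x0 * sqrt (norm x0))"
proof -
 obtain C where C: "C > 0" "second_diff_const TYPE('a) C"
  using diff_harmonic_taylor by blast
 obtain F R1 where F: "F > 0" "R1 >= 1" "ALL R>=R1. G R <= F * sqrt R" using G_growth by blast
 show ?thesis
 proof (rule exI[of _ "128*C*F"], intro conjI exI[of _ "max R1 5"] allI impI)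
  show "128*C*F > 0" using C F by simp
  show "max R1 5 >= 1" by simp
  fix x0 s :: 'a assume x0: "x0 \<bullet> e <= - norm x0/2" "norm x0 >= max R1 5" and s: "norm s <= norm x0/8"
  define n where "n = norm x0"
  have n: "n >= R1" "n >= 5" using x0 by (auto simp: n_def)
  have loc: "z \<bullet> e < -1" "norm z <= 2*n" if "norm (z-x0) <= 2*(n/8)" for z
  proof -
   have "z \<bullet> e = x0 \<bullet> e+(z-x0) \<bullet> e" by (simp add: inner_diff_left)
   also have "\<dots> <= - n/2+n/4" using x0 that abs_inner_unit_le[OF e, of "z-x0"] by (simp add: n_def)
   finally show "z \<bullet> e < -1" using n by simp
   show "norm z <= 2*n" using norm_triangle_ineq[of "z-x0" x0] that n by (simp add: n_def)
  qed
  have "\<bar>sd g x0 s\<bar> <= C*(2*F * sqrt n)*(norm s/(n/8))^2"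
   unfolding sd_def g_def
  proof (rule C(2)[unfolded second_diff_const_def, rule_format, OF u u_shift])
   show "n/8 > 0" using n by simp
   fix z assume z: "norm (z-x0) <= 2*(n/8)"
   have "g z <= G (2*n)" using loc[OF z] by (intro g_le_G)
   also have "\<dots> <= F * sqrt (2*n)" using F(3) n F(2) by simp
   also have "sqrt (2*n) <= sqrt (4*n)" using n by simp
   also have "sqrt (4*n) = 2 * sqrt n" by (simp add: real_sqrt_mult)
   finally have "g z <= 2*F * sqrt n" using F by (simp add: mult_ac)
   thus "\<bar>u z-u (z+e)\<bar> <= 2*F * sqrt n" using g_nonneg[of z] by (simp add: g_def)
  next
   show "AE z in lborel. norm (z-x0) <= 2*(n/8) --> den u (%x. u (x+e)) z = 0"
   proof (rule AE_I2, rule impI)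
    fix z assume z: "norm (z-x0) <= 2*(n/8)"
    have "z \<bullet> e < 0" "(z+e) \<bullet> e < 0" using loc[OF z] e by (auto simp: inner_add_left norm_eq_1)
    hence "u z > 0" "u (z+e) > 0" using below by auto
    thus "den u (%x. u (x+e)) z = 0" by (simp add: den_def)
   qed
  qed (use s in \<open>simp add: n_def\<close>)
  also have "\<dots> = 128*C*F*(norm s)^2 * sqrt n/(n*n)" using n by (simp add: power2_eq_square)
  also have "\<dots> = 128*C*F*(norm s)^2*(sqrt n/(n*n))" by simp
  also have "sqrt n/(n*n) = 1/(n * sqrt n)"
  proof -
   have "n = sqrt n * sqrt n" using n by simp
   thus ?thesis using n by (simp add: field_simps)
  qed
  finally show "\<bar>sd g x0 s\<bar> <= 128*C*F*(norm s)^2/(norm x0 * sqrt (norm x0))"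
   by (simp add: n_def)
 qed
qed

text \<open>The difference \<open>w\<close> also has no density in the cone, up to the axis, which
  is a null set. The blow-down condition gives \<open>w = o(R^2)\<close>, so the second differences
  are small far out.\<close>

lemma sd_w_far:
 assumes "eps > 0"
 shows "EX R0>=1. ALL x0 s. x0 \<bullet> e <= - norm x0/2 --> norm x0 >= R0 --> norm s <= norm x0/8 -->
     \<bar>sd w x0 s\<bar> <= eps*(norm s)^2"
proof -
 obtain C where C: "C > 0" "second_diff_const TYPE('a) C"
  using diff_harmonic_taylor by blast
 define eps' where "eps' = eps/(256*C)"
 have "eps' > 0" using assms C by (simp add: eps'_def)
 then obtain R1 where R1: "R1 > 0" "ALL R>=R1. ALL x. norm x <= R --> \<bar>u x-p x\<bar> <= eps' * R^2"
  using conv by blast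
 show ?thesis
 proof (intro exI[of _ "max R1 5"] conjI allI impI)
  show "max R1 5 >= 1" by simp
  fix x0 s :: 'a assume x0: "x0 \<bullet> e <= - norm x0/2" "norm x0 >= max R1 5" and s: "norm s <= norm x0/8"
  define n where "n = norm x0"
  have n: "n >= R1" "n >= 5" using x0 by (auto simp: n_def)
  have loc: "z \<bullet> e < 0" "norm z <= 2*n" if "norm (z-x0) <= 2*(n/8)" for z
  proof -
   have "z \<bullet> e = x0 \<bullet> e+(z-x0) \<bullet> e" by (simp add: inner_diff_left)
   also have "\<dots> <= - n/2+n/4" using x0 that abs_inner_unit_le[OF e, of "z-x0"] by (simp add: n_def)
   finally show "z \<bullet> e < 0" using n by simp
   show "norm z <= 2*n" using norm_triangle_ineq[of "z-x0" x0] that n by (simp add: n_def)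
  qed
  have "\<bar>sd w x0 s\<bar> <= C*(eps'*(2*n)^2)*(norm s/(n/8))^2"
   unfolding sd_def w_def
  proof (rule C(2)[unfolded second_diff_const_def, rule_format, OF u p])
   show "n/8 > 0" using n by simp
   show "\<bar>u z-p z\<bar> <= eps'*(2*n)^2" if "norm (z-x0) <= 2*(n/8)" for z
    using R1(2)[rule_format, of "2*n" z] loc[OF that] n by simp
   show "AE z in lborel. norm (z-x0) <= 2*(n/8) --> den u p z = 0"
    using p_pos_AE
   proof (rule eventually_mono, intro impI)
    fix z assume z: "p z > 0" "norm (z-x0) <= 2*(n/8)"
    thus "den u p z = 0" using below[of z] loc by (simp add: den_def)
   qed
  qed (use s in \<open>simp add: n_def\<close>)
  also have "\<dots> = eps*(norm s)^2" using n C by (simp add: power2_eq_square eps'_def)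
  finally show "\<bar>sd w x0 s\<bar> <= eps*(norm s)^2" .
 qed
qed

text \<open>Moving down by unit steps changes \<open>sd w\<close> by \<open>sd g\<close>, and along
  this ray \<open>sd w\<close> tends to zero by \<open>sd_w_far\<close>. Its value at
  \<open>x0\<close> is therefore controlled by the sum of the \<open>sd g\<close>, a convergent
  series with exponent 3/2 and sum of order \<open>1/sqrt (norm x0)\<close>.\<close>

lemma sd_w:
 "EX B>0. EX R0>=1. ALL x0 s. x0 \<bullet> e <= - norm x0/2 --> norm x0 >= R0 --> norm s <= norm x0/16 -->
     \<bar>sd w x0 s\<bar> <= B*(norm s)^2/sqrt (norm x0)"
proof -
 obtain B R0 where B: "B > 0" "R0 >= 1" "ALL x0 s. x0 \<bullet> e <= - norm x0/2 --> norm x0 >= R0 --> norm s <= norm x0/8 -->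
     \<bar>sd g x0 s\<bar> <= B*(norm s)^2/(norm x0 * sqrt (norm x0))"
  using sd_g by blast
 show ?thesis
 proof (rule exI[of _ "4*B"], intro conjI exI[of _ "2 * R0"] allI impI)
  show "4*B > 0" "2 * R0 >= 1" using B by auto
  fix x0 s :: 'a assume x0: "x0 \<bullet> e <= - norm x0/2" "norm x0 >= 2 * R0" and s: "norm s <= norm x0/16"
  define a where "a = norm x0/2"
  have a: "a > 0" "a >= R0" using x0 B by (auto simp: a_def)
  define X where "X i = x0-real i *. e" for i
  have Xe: "X i \<bullet> e = x0 \<bullet> e-real i" for i using e by (simp add: X_def inner_simps norm_eq_1)
  have nX: "norm (X i) >= a+real i" for i
   using abs_inner_unit_le[OF e, of "X i"] Xe[of i] x0(1) by (simp add: a_def)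
  have Xcone: "X i \<bullet> e <= - norm (X i)/2" for i
  proof -
   have "norm (X i) <= norm x0+real i"
    unfolding X_def using norm_triangle_ineq4[of x0 "real i *. e"] e by simp
   thus ?thesis using Xe[of i] x0(1) by simp
  qed
  have sg: "\<bar>sd g (X i) s\<bar> <= B*(norm s)^2*(1/((a+real i) * sqrt (a+real i)))" for i
  proof -
   have "\<bar>sd g (X i) s\<bar> <= B*(norm s)^2/(norm (X i) * sqrt (norm (X i)))"
    using B(3) Xcone[of i] nX[of i] a s by (auto simp: a_def)
   also have "\<dots> <= B*(norm s)^2/((a+real i) * sqrt (a+real i))"
    using nX[of i] a B(1) by (intro divide_left_mono mult_mono mult_pos_pos) (auto intro: add_pos_nonneg order_trans[of 0 a] simp: less_le_trans[of 0 "a+real i"])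
   finally show ?thesis by simp
  qed
  have tele: "sd w (X n) s = sd w x0 s+(\<Sum>i=1..n. sd g (X i) s)" for n
  proof (induction n)
   case 0 thus ?case by (simp add: X_def)
  next
   case (Suc n)
   have eqs: "X (Suc n)+s = X n+s-e" "X (Suc n)-s = X n-s-e" "X (Suc n) = X n-e"
    by (simp_all add: X_def algebra_simps)
   have "sd w (X (Suc n)) s = sd w (X n) s+sd g (X (Suc n)) s"
    unfolding sd_def eqs(1,2) unfolding eqs(3) w_step by simp
   thus ?case using Suc by simp
  qed
  have sum: "\<bar>\<Sum>i=1..n. sd g (X i) s\<bar> <= B*(norm s)^2*(2/sqrt a)" for n
  proof -
   have "\<bar>\<Sum>i=1..n. sd g (X i) s\<bar> <= (\<Sum>i=1..n. B*(norm s)^2*(1/((a+real i) * sqrt (a+real i))))"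
    by (intro order_trans[OF sum_abs sum_mono] sg)
   also have "\<dots> = B*(norm s)^2*(\<Sum>i=1..n. 1/((a+real i) * sqrt (a+real i)))"
    by (rule sum_distrib_left[symmetric])
   also have "\<dots> <= B*(norm s)^2*(2/sqrt a)"
    using B(1) sum_three_halves[OF a(1), of n] by (intro mult_left_mono) auto
   finally show ?thesis .
  qed
  have "\<bar>sd w x0 s\<bar> <= B*(norm s)^2*(2/sqrt a)+eps" if "eps > 0" for eps
  proof -
   define eps' where "eps' = eps/((norm s)^2+1)"
   have e': "eps' > 0" "eps'*(norm s)^2 <= eps"
   proof -
    have pos: "(norm s)\<^sup>2+1 > 0" using zero_le_power2[of "norm s"] by linarith
    show "eps' > 0" using that pos by (simp add: eps'_def)
    have "eps*(norm s)^2 <= eps*((norm s)^2+1)" using that by simp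
    thus "eps'*(norm s)^2 <= eps" using pos by (simp add: eps'_def pos_divide_le_eq)
   qed
   obtain R1 where R1: "R1 >= 1" "ALL x0 s. x0 \<bullet> e <= - norm x0/2 --> norm x0 >= R1 --> norm s <= norm x0/8 -->
          \<bar>sd w x0 s\<bar> <= eps'*(norm s)^2"
    using sd_w_far[OF e'(1)] by blast
   obtain n :: nat where n: "real n >= R1" using real_arch_simple by blast
   have "norm (X n) >= R1" "norm s <= norm (X n)/8" using nX[of n] n s a(1) of_nat_0_le_iff[of n, where 'a=real] unfolding a_def by linarith+
   hence "\<bar>sd w (X n) s\<bar> <= eps'*(norm s)^2" using R1(2) Xcone[of n] by blast
   thus ?thesis using tele[of n] sum[of n] e'(2) by linarith
  qed
  hence "\<bar>sd w x0 s\<bar> <= B*(norm s)^2*(2/sqrt a)" by (rule field_le_epsilon)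
  also have "\<dots> <= B*(norm s)^2*(4/sqrt (norm x0))"
  proof (rule mult_left_mono)
   have "sqrt (norm x0) <= sqrt (4*a)" by (simp add: a_def)
   also have "\<dots> = 2 * sqrt a" by (simp add: real_sqrt_mult)
   finally have "sqrt (norm x0) <= 2 * sqrt a" .
   moreover have "sqrt (norm x0) > 0" using a by (simp add: a_def)
   ultimately show "2/sqrt a <= 4/sqrt (norm x0)" using a by (simp add: field_simps)
  qed (use B in auto)
  finally show "\<bar>sd w x0 s\<bar> <= 4*B*(norm s)^2/sqrt (norm x0)"
   by (simp add: mult_ac)
 qed
qed

text \<open>Double summation along a ray: second differences of order \<open>i^(-1/2)\<close> give
  first differences of order \<open>i^(1/2)\<close> and values of order
  \<open>i^(3/2)\<close>.\<close>

lemma w_cone: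
 "EX K>0. EX R0>=1. ALL x. x \<bullet> e <= - norm x/2 --> norm x >= R0 --> \<bar>w x\<bar> <= K*(norm x * sqrt (norm x))"
proof -
 obtain B R0 where B: "B > 0" "R0 >= 1" "ALL x0 s. x0 \<bullet> e <= - norm x0/2 --> norm x0 >= R0 --> norm s <= norm x0/16 -->
     \<bar>sd w x0 s\<bar> <= B*(norm s)^2/sqrt (norm x0)"
  using sd_w by blast
 obtain N :: nat where N: "real N >= 2 * R0" "N >= 16"
 proof -
  obtain m :: nat where "real m >= 2 * R0" using real_arch_simple by blast
  thus thesis by (intro that[of "m+16"]) auto
 qed
 have wc: "continuous_on UNIV w" unfolding w_def[abs_def] by (rule diff_continuous[OF u p])
 have "compact (w ` cball 0 (real N+1))"
  by (intro compact_continuous_image continuous_on_subset[OF wc]) auto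
 then obtain W where W: "W > 0" "ALL y:w ` cball 0 (real N+1). norm y <= W"
  using compact_imp_bounded bounded_pos by blast
 define K1 where "K1 = 2*W+4*B"
 define K where "K = 4*(W+K1)"
 have K1: "K1 > 0" using W B by (simp add: K1_def)
 show ?thesis
 proof (rule exI[of _ K], intro conjI exI[of _ "real N+1"] allI impI)
  show "K > 0" "real N+1 >= 1" using W K1 by (auto simp: K_def)
  fix x assume x: "x \<bullet> e <= - norm x/2" "norm x >= real N+1"
  \<comment> \<open>An integer number of steps reaches x exactly, each of length between 1/2 and
    1.\<close>
  define n where "n = nat \<lceil>norm x\<rceil>"
  have n: "real n >= norm x" "real n <= norm x+1"
  proof -
   have "real n = of_int \<lceil>norm x\<rceil>" unfolding n_def using norm_ge_zero[of x] by (simp add: le_ceiling_iff)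
   thus "real n >= norm x" "real n <= norm x+1" by linarith+
  qed
  have nN: "n >= N+1" using n x(2) by linarith
  have npos: "real n > 0" using nN by simp
  define a where "a = (1/real n) *. x"
  have na: "norm a <= 1" "norm a >= 1/2"
  proof -
   have "norm a = norm x/real n" by (simp add: a_def)
   moreover have "real n <= 2*norm x" using n x(2) by linarith
   ultimately show "norm a <= 1" "norm a >= 1/2" using n npos
    by (simp_all add: pos_divide_le_eq pos_le_divide_eq)
  qed
  have ae: "a \<bullet> e <= - norm a/2" using x(1) npos by (simp add: a_def field_simps)
  define c where "c i = w (real i *. a)" for i
  have step: "\<bar>c (Suc i)-2 * c i + c (i-1)\<bar> <= 2*B*(1/sqrt (real i))" if i: "i >= N" for i
  proof -
   have i16: "i >= 16" using i N by simp
   have "\<bar>sd w (real i *. a) a\<bar> <= B*(norm a)^2/sqrt (norm (real i *. a))"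
   proof (rule B(3)[rule_format])
    show "(real i *. a) \<bullet> e <= - norm (real i *. a)/2"
     using ae mult_left_mono[OF ae, of "real i"] by simp
    have "real i*norm a >= (2 * R0)*(1/2)" using N i na B by (intro mult_mono) auto
    thus "R0 <= norm (real i *. a)" by simp
    have "16*norm a <= real i*norm a" using i16 by (intro mult_right_mono) auto
    thus "norm a <= norm (real i *. a)/16" by simp
   qed
   also have "\<dots> <= B*1/(sqrt (real i)/2)"
   proof (intro frac_le mult_left_mono)
    show "(norm a)\<^sup>2 <= 1" using na by (simp add: power_le_one)
    have "real i/4 <= norm (real i *. a)" using na(2) mult_left_mono[OF na(2), of "real i"] by simp
    hence "sqrt (real i/4) <= sqrt (norm (real i *. a))" by (rule real_sqrt_le_mono)
    thus "sqrt (real i)/2 <= sqrt (norm (real i *. a))" by (simp add: real_sqrt_divide)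
   qed (use B i16 in auto)
   finally have "\<bar>sd w (real i *. a) a\<bar> <= 2*B*(1/sqrt (real i))" by (simp add: mult.commute)
   moreover have "sd w (real i *. a) a = c (Suc i)-2 * c i + c (i-1)"
   proof -
    have "real i *. a-a = real (i-1) *. a" using i16 by (simp add: of_nat_diff algebra_simps)
    moreover have "real i *. a+a = real (Suc i) *. a" by (simp add: algebra_simps)
    ultimately show ?thesis by (simp add: sd_def c_def)
   qed
   ultimately show ?thesis by simp
  qed
  have cW: "\<bar>c i\<bar> <= W" if "i <= N+1" for i
  proof -
   have "real i*norm a <= (real N+1)*1" using that na by (intro mult_mono) auto
   thus ?thesis using W(2) by (simp add: c_def)
  qed
  have d: "\<bar>c (Suc i)-c i\<bar> <= 2*W+2*B*(\<Sum>j=1..i. 1/sqrt (real j))" if "i >= N" for i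
   using that
  proof (induction i rule: dec_induct)
   case base
   have "\<bar>c (Suc N)-c N\<bar> <= 2*W" using cW[of N] cW[of "Suc N"] by simp
   moreover have "2*B*(\<Sum>j=1..N. 1/sqrt (real j)) >= 0" using B by (simp add: sum_nonneg)
   ultimately show ?case by linarith
  next
   case (step i)
   have "\<bar>c (Suc (Suc i))-2 * c (Suc i) + c i\<bar> <= 2*B*(1/sqrt (real (Suc i)))"
    using \<open>\<And>i. N \<le> i \<Longrightarrow> \<bar>c (Suc i) - 2 * c i + c (i - 1)\<bar> \<le> 2 * B * (1 / sqrt (real i))\<close>[of "Suc i"] step.hyps by simp
   thus ?case using step.IH by (simp add: distrib_left)
  qed
  have d': "\<bar>c (Suc i)-c i\<bar> <= K1 * sqrt (real n)" if i: "i >= N" "i < n" for i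
  proof -
   have "2*B*(\<Sum>j=1..i. 1/sqrt (real j)) <= 2*B*(2 * sqrt (real i))"
    using sum_inverse_sqrt[of i] B by (intro mult_left_mono) auto
   also have "\<dots> <= 4*B * sqrt (real n)" using i B by simp
   finally have 1: "2*B*(\<Sum>j=1..i. 1/sqrt (real j)) <= 4*B * sqrt (real n)" .
   have "2*W*1 <= 2*W * sqrt (real n)" using W npos nN by (intro mult_left_mono) auto
   thus ?thesis using d[OF i(1)] 1 by (simp add: K1_def distrib_right)
  qed
  have csum: "\<bar>c i\<bar> <= W+real i*(K1 * sqrt (real n))" if "i >= N" "i <= n" for i
   using that
  proof (induction i rule: dec_induct)
   case base
   have "real N*(K1 * sqrt (real n)) >= 0" using K1 by simp
   thus ?case using cW[of N] by simp
  next
   case (step i)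
   hence "\<bar>c (Suc i)\<bar> <= \<bar>c i\<bar>+K1 * sqrt (real n)" using d'[of i] by linarith
   moreover have "real (Suc i)*(K1 * sqrt (real n)) = real i*(K1 * sqrt (real n))+K1 * sqrt (real n)"
    by (simp add: algebra_simps)
   ultimately show ?case using step by linarith
  qed
  have "w x = c n" using npos by (simp add: c_def a_def)
  hence "\<bar>w x\<bar> <= W+real n*(K1 * sqrt (real n))" using csum[of n] nN by simp
  also have "\<dots> <= W*(real n * sqrt (real n))+K1*(real n * sqrt (real n))"
  proof -
   have "1 <= real n * sqrt (real n)" using npos nN mult_mono[of 1 "real n" 1 "sqrt (real n)"] by simp
   hence "W*1 <= W*(real n * sqrt (real n))" using W by (intro mult_left_mono) auto
   thus ?thesis by (simp add: mult_ac)
  qed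
  also have "\<dots> = (W+K1)*(real n * sqrt (real n))" by (simp add: distrib_right)
  also have "\<dots> <= (W+K1)*((2*norm x)*(2 * sqrt (norm x)))"
  proof (intro mult_left_mono mult_mono)
   show 1: "real n <= 2*norm x" using n x(2) by linarith
   have "real n <= 4*norm x" using 1 by simp
   hence "sqrt (real n) <= sqrt (4*norm x)" by (rule real_sqrt_le_mono)
   thus "sqrt (real n) <= 2 * sqrt (norm x)" by (simp add: real_sqrt_mult)
  qed (use W K1 in auto)
  also have "\<dots> = K*(norm x * sqrt (norm x))" by (simp add: K_def)
  finally show "\<bar>w x\<bar> <= K*(norm x * sqrt (norm x))" .
 qed
qed

text \<open>From any point of the ball of radius R, about \<open>3*R\<close> unit steps downwards
  lead into the cone. Each step changes w by a value of g, of order \<open>sqrt R\<close>.\<close>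

lemma w_growth:
 "EX K>0. EX R0>=1. ALL R>=R0. ALL x. norm x <= R --> \<bar>u x-p x\<bar> <= K*(R * sqrt R)"
proof -
 obtain K R0 where K: "K > 0" "R0 >= 1"
  "ALL x. x \<bullet> e <= - norm x/2 --> norm x >= R0 --> \<bar>w x\<bar> <= K*(norm x * sqrt (norm x))"
  using w_cone by blast
 obtain F R1 where F: "F > 0" "R1 >= 1" "ALL R>=R1. G R <= F * sqrt R" using G_growth by blast
 show ?thesis
 proof (rule exI[of _ "15*K+12*F"], intro conjI exI[of _ "max R0 R1"] allI impI)
  show "15*K+12*F > 0" "max R0 R1 >= 1" using K F by auto
  fix R :: real and x :: 'a assume R: "R >= max R0 R1" and x: "norm x <= R"
  have R1: "R >= 1" "R >= R0" "R >= R1" using R K by auto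
  define n where "n = nat \<lceil>3 * R\<rceil>"
  have n: "real n >= 3 * R" "real n <= 4 * R"
  proof -
   have "real n = of_int \<lceil>3 * R\<rceil>" unfolding n_def using R1 by (simp add: le_ceiling_iff)
   thus "real n >= 3 * R" "real n <= 4 * R" using R1 by linarith+
  qed
  define y where "y = x-real n *. e"
  have ye: "y \<bullet> e = x \<bullet> e-real n" using e by (simp add: y_def inner_simps norm_eq_1)
  have ny: "norm y <= 5 * R" "norm y <= R+real n"
   using norm_triangle_ineq4[of x "real n *. e"] e x n by (auto simp: y_def)
  have nyl: "norm y >= R0"
   using abs_inner_unit_le[OF e, of y] abs_inner_unit_le[OF e, of x] ye x n R1 by linarith
  have cone: "y \<bullet> e <= - norm y/2"
   using ye abs_inner_unit_le[OF e, of x] ny(2) x n by linarith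
  have tele: "w (x-real m *. e) = w x+(\<Sum>i=1..m. g (x-real i *. e))" for m
  proof (induction m)
   case (Suc m)
   have "x-real (Suc m) *. e = (x-real m *. e)-e" by (simp add: algebra_simps)
   hence "w (x-real (Suc m) *. e) = w (x-real m *. e)+g (x-real (Suc m) *. e)"
    by (simp only: w_step)
   thus ?case using Suc by (simp del: of_nat_Suc)
  qed simp
  have gs: "g (x-real i *. e) <= 3*F * sqrt R" if "i \<in> {1..n}" for i
  proof -
   have "norm (x-real i *. e) <= 5 * R"
    using norm_triangle_ineq4[of x "real i *. e"] e x n that by auto
   hence "g (x-real i *. e) <= G (5 * R)" by (rule g_le_G)
   also have "\<dots> <= F * sqrt (5 * R)" using F(3) R1 by simp
   also have "sqrt (5 * R) <= sqrt (9 * R)" using R1 by simp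
   also have "sqrt (9 * R) = 3 * sqrt R" using real_sqrt_mult[of 9 R] real_sqrt_unique[of 3 9] by simp
   finally show ?thesis using F by (simp add: mult_ac)
  qed
  have "(\<Sum>i=1..n. g (x-real i *. e)) <= real n*(3*F * sqrt R)"
   using sum_bounded_above[of "{1..n}" "%i. g (x-real i *. e)" "3*F * sqrt R"] gs by simp
  also have "\<dots> <= (4 * R)*(3*F * sqrt R)" using n F R1 by (intro mult_right_mono) auto
  finally have s1: "(\<Sum>i=1..n. g (x-real i *. e)) <= 12*F*(R * sqrt R)" by (simp add: mult_ac)
  have s0: "(\<Sum>i=1..n. g (x-real i *. e)) >= 0" by (intro sum_nonneg g_nonneg)
  have "\<bar>w y\<bar> <= K*(norm y * sqrt (norm y))" using K(3) cone nyl by blast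
  also have "\<dots> <= K*((5 * R)*(3 * sqrt R))"
  proof (intro mult_left_mono mult_mono ny(1))
   have "sqrt (norm y) <= sqrt (9 * R)" using ny(1) R1 by simp
   also have "sqrt (9 * R) = 3 * sqrt R" using real_sqrt_mult[of 9 R] real_sqrt_unique[of 3 9] by simp
   finally show "sqrt (norm y) <= 3 * sqrt R" .
  qed (use K R1 in auto)
  also have "\<dots> = 15*K*(R * sqrt R)" by simp
  finally have "\<bar>w x\<bar> <= 15*K*(R * sqrt R)+12*F*(R * sqrt R)"
   using tele[of n] s0 s1 by (simp add: y_def)
  thus "\<bar>u x-p x\<bar> <= (15*K+12*F)*(R * sqrt R)" by (simp add: w_def distrib_right)
 qed
qed

end

section \<open>Explicit paraboloid solutions\<close>

lemma has_derivative_quadratic_bound: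
 fixes f :: "'a::euclidean_space => real"
 assumes "r > 0" and b: "\<And>y. norm (y-x) <= r ==> \<bar>f y-f x-a \<bullet> (y-x)\<bar> <= K*(norm (y-x))^2"
 shows "(f has_derivative (%h. a \<bullet> h)) (at x)"
proof (rule has_derivativeI_sandwich[OF assms(1)])
 show "bounded_linear (%h. a \<bullet> h)" by (rule bounded_linear_inner_right)
 show "((%y. K*norm (y-x)) \<longlongrightarrow> 0) (at x)"
  by (auto intro!: tendsto_eq_intros)
 fix y assume y: "y \<in> UNIV" "y \<noteq> x" "dist y x < r"
 hence "\<bar>f y-f x-a \<bullet> (y-x)\<bar> <= K*(norm (y-x))^2" by (intro b) (simp add: dist_norm)
 thus "norm (f y-f x-a \<bullet> (y-x))/norm (y-x) <= K*norm (y-x)"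
  using y by (simp add: pos_divide_le_eq power2_eq_square mult.assoc)
qed

lemma has_derivative_caratheodory:
 fixes f :: "'a::euclidean_space => real" and Q :: "'a => 'a"
 assumes r: "r > 0" and eq: "\<And>y. norm (y-x) < r ==> f y-f x = Q y \<bullet> (y-x)" and Q: "isCont Q x"
 shows "(f has_derivative (%h. Q x \<bullet> h)) (at x)"
proof (rule has_derivativeI_sandwich[OF r])
 show "bounded_linear (%h. Q x \<bullet> h)" by (rule bounded_linear_inner_right)
 show "((%y. norm (Q y-Q x)) \<longlongrightarrow> 0) (at x)"
  using Q unfolding isCont_def by (auto intro!: tendsto_eq_intros)
 fix y assume y: "y \<in> UNIV" "y \<noteq> x" "dist y x < r"
 have "f y-f x-Q x \<bullet> (y-x) = (Q y-Q x) \<bullet> (y-x)"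
  using eq[of y] y by (simp add: dist_norm inner_diff_left)
 hence "\<bar>f y-f x-Q x \<bullet> (y-x)\<bar> <= norm (Q y-Q x)*norm (y-x)"
  by (simp only: Cauchy_Schwarz_ineq2)
 thus "norm (f y-f x-Q x \<bullet> (y-x))/norm (y-x) <= norm (Q y-Q x)"
  using y by (simp add: pos_divide_le_eq)
qed

lemma integral_upto_deriv:
 fixes g :: "real => real"
 assumes "continuous_on {0..} g" "l > 0"
 shows "((%l. integral {0..l} g) has_real_derivative g l) (at l)"
proof -
 have "((%x. integral {0..x} g) has_real_derivative g l) (at l within {0..l+1})"
  using assms by (intro integral_has_real_derivative) (auto intro: continuous_on_subset)
 moreover have "at l within {0..l+1} = at l" by (rule at_within_interior) (use assms in simp)
 ultimately show ?thesis by (simp only:)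
qed

lemma integral_upto_diff:
 fixes g :: "real => real"
 assumes g: "continuous_on {0..} g" and l: "0 <= l" "l <= m"
 shows "integral {0..m} g-integral {0..l} g = integral {l..m} g"
proof -
 have "g integrable_on {0..m}"
  by (rule integrable_continuous_interval) (auto intro: continuous_on_subset[OF g])
 thus ?thesis using Henstock_Kurzweil_Integration.integral_combine[of 0 l m g] l by simp
qed

lemma integral_upto_bounds:
 fixes g :: "real => real"
 assumes g: "continuous_on {0..} g" and l: "0 <= l" "l <= m"
 shows "(\<And>s. l <= s ==> s <= m ==> g s <= K) ==> integral {0..m} g-integral {0..l} g <= K*(m-l)"
  and "(\<And>s. l <= s ==> s <= m ==> K <= g s) ==> K*(m-l) <= integral {0..m} g-integral {0..l} g"
proof -
 have gi: "g integrable_on {l..m}"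
  by (rule integrable_continuous_interval) (use l in \<open>auto intro: continuous_on_subset[OF g]\<close>)
 have c: "integral {l..m} (%_. K) = K*(m-l)" using l by simp
 {
  assume "\<And>s. l <= s ==> s <= m ==> g s <= K"
  hence "integral {l..m} g <= integral {l..m} (%_. K)" using gi by (intro integral_le) auto
  thus "integral {0..m} g-integral {0..l} g <= K*(m-l)"
   unfolding integral_upto_diff[OF g l] c .
 }
 {
  assume "\<And>s. l <= s ==> s <= m ==> K <= g s"
  hence "integral {l..m} (%_. K) <= integral {l..m} g" using gi by (intro integral_le) auto
  thus "K*(m-l) <= integral {0..m} g-integral {0..l} g"
   unfolding integral_upto_diff[OF g l] c .
 }
qed

text \<open>An orthonormal basis split into the axis e and horizontal directions W. Working with
  abstract vectors lets an eigenbasis of Q be used without rotating u.\<close>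

locale frame =
 fixes e :: "'a::euclidean_space" and W :: "'a set"
 assumes e: "norm e = 1" and finW: "finite W" and eW: "e \<notin> W" and cardW: "card W >= 2"
  and unit: "j \<in> W ==> norm j = 1" and orth: "pairwise orthogonal (insert e W)"
  and span: "span (insert e W) = UNIV"
begin

lemma ee [simp]: "e \<bullet> e = 1" using e by (simp add: norm_eq_1)

lemma jj [simp]: "j \<in> W ==> j \<bullet> j = 1" using unit by (simp add: norm_eq_1)

lemma je [simp]: "j \<in> W ==> j \<bullet> e = 0" "j \<in> W ==> e \<bullet> j = 0"
 using orth eW by (auto simp: pairwise_def orthogonal_def)

lemma jk: "j \<in> W ==> k \<in> W ==> j \<noteq> k ==> j \<bullet> k = 0"
 using orth by (auto simp: pairwise_def orthogonal_def)

lemma expand: "(\<Sum>j\<in>W. (x \<bullet> j) *. j)+(x \<bullet> e) *. e = x"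
proof -
 have "(\<Sum>i\<in>insert e W. (x \<bullet> i) *. i) = x"
  by (rule orthonormal_basis_expand[OF orth]) (use e unit span finW in auto)
 thus ?thesis using finW eW by (simp add: add.commute)
qed

lemma inner_frame: "x \<bullet> y = (\<Sum>j\<in>W. (x \<bullet> j)*(y \<bullet> j))+(x \<bullet> e)*(y \<bullet> e)"
proof -
 have "x \<bullet> y = x \<bullet> ((\<Sum>j\<in>W. (y \<bullet> j) *. j)+(y \<bullet> e) *. e)" by (simp only: expand)
 thus ?thesis by (simp add: inner_add_right inner_sum_right mult.commute)
qed

lemma perp_frame: "(norm (perp e x))\<^sup>2 = (\<Sum>j\<in>W. (x \<bullet> j)\<^sup>2)"
proof -
 have "(norm (perp e x))\<^sup>2 = x \<bullet> x-(x \<bullet> e)^2"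
  using norm_perp_sq[OF e, of x] by (simp only: power2_norm_eq_inner[of x])
 thus ?thesis using inner_frame[of x x] unfolding power2_eq_square[of "_ \<bullet> _"] by linarith
qed

lemma trace_frame:
 assumes "linear H"
 shows "(\<Sum>b\<in>Basis. H b \<bullet> b) = (\<Sum>j\<in>W. H j \<bullet> j)+H e \<bullet> e"
proof -
 have Hx: "H x = (\<Sum>b\<in>Basis. (x \<bullet> b) *. H b)" for x
  using linear_sum[OF assms, of "%b. (x \<bullet> b) *. b" Basis] linear_cmul[OF assms]
  by (simp add: euclidean_representation)
 have key: "(\<Sum>b\<in>Basis. (H b \<bullet> i)*(b \<bullet> i)) = H i \<bullet> i" for i
 proof -
  have "H i \<bullet> i = (\<Sum>b\<in>Basis. (i \<bullet> b)*(H b \<bullet> i))"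
   by (subst Hx) (simp only: inner_sum_left inner_scaleR_left)
  thus ?thesis by (simp add: inner_commute[of _ i] mult.commute)
 qed
 have "(\<Sum>b\<in>Basis. H b \<bullet> b) = (\<Sum>b\<in>Basis. (\<Sum>j\<in>W. (H b \<bullet> j)*(b \<bullet> j))+(H b \<bullet> e)*(b \<bullet> e))"
  by (intro sum.cong refl inner_frame)
 also have "\<dots> = (\<Sum>j\<in>W. \<Sum>b\<in>Basis. (H b \<bullet> j)*(b \<bullet> j))+(\<Sum>b\<in>Basis. (H b \<bullet> e)*(b \<bullet> e))"
  by (simp add: sum.distrib) (rule sum.swap)
 finally show ?thesis by (simp only: key)
qed

end

text \<open>The numbers \<open>b j\<close> are squared semi-axes at height one of the model set,
  which is \<open>{x. T x 0 <= 0}\<close> in the notation below.\<close>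

locale parab = frame e W for e :: "'a::euclidean_space" and W :: "'a set" +
 fixes b :: "'a => real"
 assumes b: "j \<in> W ==> b j > 0"
begin

text \<open>The classical potential of a paraboloid in confocal form. \<open>T x s = 0\<close> is
  the confocal paraboloid with parameter s: with \<open>s/4\<close> as vertical shift all of them
  share their foci. \<open>U x l\<close> is c times the integral of \<open>T x s * f s\<close> over
  \<open>{0..l}\<close>, split into its coefficients, and c normalizes the Laplacian to 1.\<close>

definition f :: "real => real" where "f s = 1/sqrt (\<Prod>j\<in>W. b j+s)"
definition I :: "'a => real => real" where "I j l = integral {0..l} (%s. f s/(b j+s))"
definition I0 :: "real => real" where "I0 l = integral {0..l} f"
definition I1 :: "real => real" where "I1 l = integral {0..l} (%s. s * f s)"
definition c :: real where "c = 1/(4 * f 0)"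
definition T :: "'a => real => real" where "T x s = (\<Sum>j\<in>W. (x \<bullet> j)\<^sup>2/(b j+s))-x \<bullet> e-s/4"
definition U :: "'a => real => real" where
 "U x l = c*((\<Sum>j\<in>W. I j l*(x \<bullet> j)^2)-I0 l*(x \<bullet> e)-I1 l/4)"

lemma bs: "j \<in> W ==> s >= 0 ==> b j+s > 0"
 using b[of j] by linarith

lemma prod_pos: "s >= 0 ==> (\<Prod>j\<in>W. b j+s) > 0"
 by (intro prod_pos ballI bs)

lemma f_pos: "s >= 0 ==> f s > 0"
 using prod_pos[of s] by (simp add: f_def)

lemma c_pos: "c > 0"
 using f_pos[of 0] by (simp add: c_def)

lemma f_antimono: assumes "0 <= s" "s <= t" shows "f t <= f s"
proof -
 have "(\<Prod>j\<in>W. b j+s) <= (\<Prod>j\<in>W. b j+t)"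
  by (rule prod_mono) (use assms b in \<open>auto intro: less_imp_le add_nonneg_nonneg\<close>)
 thus ?thesis unfolding f_def using prod_pos[OF assms(1)]
  by (intro divide_left_mono real_sqrt_le_mono mult_pos_pos) auto
qed

lemma f_cont: "continuous_on {0..} f"
proof -
 have "continuous_on {0..} (%s. 1/sqrt (\<Prod>j\<in>W. b j+s))"
  by (intro continuous_intros) (use prod_pos in \<open>auto simp: less_imp_neq[symmetric] order_less_imp_not_eq2\<close>)
 thus ?thesis by (simp add: f_def[abs_def])
qed

lemma fj_cont: "j \<in> W ==> continuous_on {0..} (%s. f s/(b j+s))"
 by (intro continuous_intros f_cont) (use bs in \<open>auto simp: order_less_imp_not_eq2\<close>)

lemma sf_cont: "continuous_on {0..} (%s. s * f s)"
 by (intro continuous_intros f_cont)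

lemma I_0 [simp]: "I j 0 = 0" "I0 0 = 0" "I1 0 = 0"
 by (simp_all add: I_def I0_def I1_def)

lemma f_deriv:
 assumes "s >= 0"
 shows "(f has_real_derivative-(f s*(\<Sum>j\<in>W. 1/(b j+s))/2)) (at s)"
proof -
 define P where "P s = (\<Prod>j\<in>W. b j+s)" for s
 have Ps: "P s > 0" using prod_pos[OF assms] by (simp add: P_def)
 have dP: "(P has_real_derivative P s*(\<Sum>j\<in>W. 1/(b j+s))) (at s)"
 proof -
  have "(P has_real_derivative (\<Sum>j\<in>W. 1*(\<Prod>i\<in>W - {j}. b i+s))) (at s)"
   unfolding P_def[abs_def]
   by (rule has_field_derivative_prod) (auto intro!: derivative_eq_intros)
  moreover have "(\<Sum>j\<in>W. 1*(\<Prod>i\<in>W - {j}. b i+s)) = P s*(\<Sum>j\<in>W. 1/(b j+s))"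
   unfolding sum_distrib_left
  proof (rule sum.cong[OF refl])
   fix j assume j: "j \<in> W"
   have "P s = (b j+s)*(\<Prod>i\<in>W - {j}. b i+s)"
    unfolding P_def using finW j by (rule prod.remove)
   thus "1*(\<Prod>i\<in>W - {j}. b i+s) = P s*(1/(b j+s))" using bs[OF j assms] by simp
  qed
  ultimately show ?thesis by simp
 qed
 have "((%s. 1/sqrt (P s)) has_real_derivative-(1/sqrt (P s)*(\<Sum>j\<in>W. 1/(b j+s))/2)) (at s)"
  using Ps by (auto intro!: derivative_eq_intros dP simp: field_simps)
 thus ?thesis by (simp add: f_def[abs_def] P_def)
qed

text \<open>The logarithmic derivative of f is minus half the sum of the \<open>1/(b j+s)\<close>,
  so the sum of the integrands is a total derivative. In \<open>G_deriv\<close> this cancels all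
  dependence of the Laplacian on the point.\<close>

lemma sum_I: assumes "l >= 0" shows "(\<Sum>j\<in>W. I j l) = 2*(f 0-f l)"
proof -
 have "((%s. - (f s*(\<Sum>j\<in>W. 1/(b j+s))/2)) has_integral (f l-f 0)) {0..l}"
  by (rule fundamental_theorem_of_calculus[OF assms])
   (use f_deriv in \<open>auto simp: has_real_derivative_iff_has_vector_derivative[symmetric] intro: has_field_derivative_at_within\<close>)
 note has_integral_mult_right[OF this, of "-2"]
 moreover have "(%s. - 2*- (f s*(\<Sum>j\<in>W. 1/(b j+s))/2)) = (%s. \<Sum>j\<in>W. f s/(b j+s))"
 proof
  fix s
  have "- 2*- (f s*(\<Sum>j\<in>W. 1/(b j+s))/2) = f s*(\<Sum>j\<in>W. 1/(b j+s))" by simp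
  thus "- 2*- (f s*(\<Sum>j\<in>W. 1/(b j+s))/2) = (\<Sum>j\<in>W. f s/(b j+s))"
   by (simp only: sum_distrib_left times_divide_eq_right mult_1_right)
 qed
 ultimately have 1: "((%s. \<Sum>j\<in>W. f s/(b j+s)) has_integral (2*(f 0-f l))) {0..l}"
  by simp
 have "((%s. \<Sum>j\<in>W. f s/(b j+s)) has_integral (\<Sum>j\<in>W. I j l)) {0..l}"
  unfolding I_def
  by (intro has_integral_sum finW integrable_integral integrable_continuous_interval continuous_on_subset[OF fj_cont]) auto
 from has_integral_unique[OF this 1] show ?thesis .
qed

lemma I_lip:
 assumes "0 <= l" "l <= m"
 shows "j \<in> W ==> 0 <= I j m-I j l" "j \<in> W ==> I j m-I j l <= (f 0/b j)*(m-l)"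
  "0 <= I0 m-I0 l" "I0 m-I0 l <= f 0*(m-l)"
proof -
 {
  assume j: "j \<in> W"
  have 1: "0 <= f s/(b j+s)" "f s/(b j+s) <= f 0/b j" if "l <= s" for s
  proof -
   have s: "s >= 0" using that assms by simp
   show "0 <= f s/(b j+s)" using f_pos[OF s] bs[OF j s] by simp
   show "f s/(b j+s) <= f 0/b j"
    using f_antimono[of 0 s] f_pos[OF s] f_pos[of 0] b[OF j] s by (intro frac_le) auto
  qed
  have "0*(m-l) <= I j m-I j l" unfolding I_def
   by (rule integral_upto_bounds(2)[OF fj_cont[OF j] assms]) (use 1 in auto)
  thus "0 <= I j m-I j l" by simp
  show "I j m-I j l <= (f 0/b j)*(m-l)" unfolding I_def
   by (rule integral_upto_bounds(1)[OF fj_cont[OF j] assms]) (use 1 in auto)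
 }
 have "0*(m-l) <= I0 m-I0 l" unfolding I0_def
  by (rule integral_upto_bounds(2)[OF f_cont assms]) (use assms f_pos in \<open>auto intro: less_imp_le\<close>)
 thus "0 <= I0 m-I0 l" by simp
 show "I0 m-I0 l <= f 0*(m-l)" unfolding I0_def
  by (rule integral_upto_bounds(1)[OF f_cont assms]) (use assms f_antimono[of 0] in auto)
qed

lemma U_diff:
 assumes "0 <= l" "l <= m"
 shows "U x m-U x l = c*integral {l..m} (%s. T x s * f s)"
proof -
 have int: "g integrable_on {l..m}" if "continuous_on {0..} g" for g :: "real => real"
  by (rule integrable_continuous_interval) (use assms that in \<open>auto intro: continuous_on_subset\<close>)
 have hi: "(g has_integral (integral {0..m} g-integral {0..l} g)) {l..m}" if "continuous_on {0..} g" for g :: "real => real"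
  unfolding integral_upto_diff[OF that assms] by (rule integrable_integral[OF int[OF that]])
 have "((%s. (\<Sum>j\<in>W. (f s/(b j+s))*(x \<bullet> j)^2)-f s*(x \<bullet> e)-(s * f s)*(1/4)) has_integral
      ((\<Sum>j\<in>W. (I j m-I j l)*(x \<bullet> j)^2)-(I0 m-I0 l)*(x \<bullet> e)-(I1 m-I1 l)*(1/4))) {l..m}"
  unfolding I_def I0_def I1_def
  by (intro has_integral_diff has_integral_sum has_integral_mult_left hi fj_cont f_cont sf_cont finW)
 moreover have "(%s. (\<Sum>j\<in>W. (f s/(b j+s))*(x \<bullet> j)^2)-f s*(x \<bullet> e)-(s * f s)*(1/4)) = (%s. T x s * f s)"
 proof
  fix s
  have "(\<Sum>j\<in>W. (f s/(b j+s))*(x \<bullet> j)^2) = f s*(\<Sum>j\<in>W. (x \<bullet> j)\<^sup>2/(b j+s))"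
   by (simp add: sum_distrib_left)
  thus "(\<Sum>j\<in>W. (f s/(b j+s))*(x \<bullet> j)^2)-f s*(x \<bullet> e)-(s * f s)*(1/4) = T x s * f s"
   unfolding T_def by (simp only:) (simp add: algebra_simps)
 qed
 ultimately have "integral {l..m} (%s. T x s * f s) =
      (\<Sum>j\<in>W. (I j m-I j l)*(x \<bullet> j)^2)-(I0 m-I0 l)*(x \<bullet> e)-(I1 m-I1 l)*(1/4)"
  by (simp add: integral_unique)
 moreover have "(\<Sum>j\<in>W. (I j m-I j l)*(x \<bullet> j)^2) = (\<Sum>j\<in>W. I j m*(x \<bullet> j)^2)-(\<Sum>j\<in>W. I j l*(x \<bullet> j)^2)"
  by (simp add: left_diff_distrib sum_subtractf)
 ultimately show ?thesis unfolding U_def by (simp only:) (simp add: field_simps)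
qed

text \<open>The sum decreases in s; keeping the term \<open>s/4\<close> on both sides records a
  decrease at rate at least 1/4, from which sign, uniqueness and Lipschitz statements about
  \<open>lam\<close> follow.\<close>

lemma T_decr: assumes "0 <= s" "s <= t" shows "T x t+t/4 <= T x s+s/4"
proof -
 have "(\<Sum>j\<in>W. (x \<bullet> j)\<^sup>2/(b j+t)) <= (\<Sum>j\<in>W. (x \<bullet> j)\<^sup>2/(b j+s))"
  using assms b bs by (intro sum_mono divide_left_mono mult_pos_pos) auto
 thus ?thesis unfolding T_def by linarith
qed

lemma T_cont: "continuous_on {0..} (T x)"
 unfolding T_def by (intro continuous_intros) (use bs in \<open>auto simp: order_less_imp_not_eq2\<close>)

lemma T_far: assumes "s >= 8*norm x" shows "T x s <= 0"
proof (cases "x = 0")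
 case True thus ?thesis using assms by (simp add: T_def)
next
 case False
 hence s: "s > 0" using assms zero_less_norm_iff[of x] by linarith
 have "(\<Sum>j\<in>W. (x \<bullet> j)\<^sup>2/(b j+s)) <= (\<Sum>j\<in>W. (x \<bullet> j)\<^sup>2/s)"
  using s b by (intro sum_mono divide_left_mono mult_pos_pos) (auto intro: less_imp_le add_pos_pos)
 also have "\<dots> = (norm (perp e x))^2/s" by (simp add: perp_frame sum_divide_distrib)
 also have "\<dots> <= (norm x)^2/s" using s norm_perp_le[OF e, of x] by (intro divide_right_mono power_mono) auto
 also have "\<dots> <= norm x"
 proof -
  have "norm x*norm x <= norm x * s" using assms by (intro mult_left_mono) (auto intro: order_trans[of _ "8*norm x"])
  thus ?thesis using s by (simp add: pos_divide_le_eq power2_eq_square)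
 qed
 finally show ?thesis unfolding T_def using abs_inner_unit_le[OF e, of x] assms by linarith
qed

text \<open>If \<open>T x 0 <= 0\<close>, the parameter is 0; otherwise a zero exists because T is
  nonpositive from \<open>8*norm x\<close> on.\<close>

lemma lam_exists: "EX s>=0. T x s <= 0 \<and> (s > 0 --> T x s = 0)"
proof (cases "T x 0 <= 0")
 case True thus ?thesis by (intro exI[of _ 0]) auto
next
 case False
 have "EX s>=0. s <= 8*norm x \<and> T x s = 0"
  by (rule IVT2') (use False T_far[of x "8*norm x"] continuous_on_subset[OF T_cont] in auto)
 thus ?thesis by auto
qed

text \<open>The confocal parameter of the paraboloid through x, set to 0 on the model coincidence
  set. The rate in \<open>T_decr\<close> makes it unique.\<close>

definition lam :: "'a => real" where "lam x = (SOME s. s >= 0 \<and> T x s <= 0 \<and> (s > 0 --> T x s = 0))"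

lemma lam: "lam x >= 0" "T x (lam x) <= 0" "lam x > 0 ==> T x (lam x) = 0"
proof -
 have "lam x >= 0 \<and> T x (lam x) <= 0 \<and> (lam x > 0 --> T x (lam x) = 0)"
  unfolding lam_def by (rule someI_ex[OF lam_exists])
 thus "lam x >= 0" "T x (lam x) <= 0" "lam x > 0 ==> T x (lam x) = 0" by simp_all
qed

lemma lam_pos_iff: "lam x > 0 \<longleftrightarrow> T x 0 > 0"
proof
 assume "lam x > 0"
 thus "T x 0 > 0" using T_decr[of 0 "lam x" x] lam(3)[of x] by linarith
next
 assume "T x 0 > 0"
 thus "lam x > 0" using lam(1,2)[of x] by (cases "lam x = 0") auto
qed

lemma lam_le: "lam x <= 8*norm x"
proof (rule ccontr)
 assume a: "\<not> ?thesis"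
 hence "T x (lam x)+lam x/4 <= T x (8*norm x)+8*norm x/4" by (intro T_decr) auto
 moreover have "lam x > 0" using a norm_ge_zero[of x] by linarith
 ultimately show False using lam(3)[of x] T_far[of x "8*norm x"] a by linarith
qed

definition V :: "'a => real" where "V x = U x (lam x)"

lemma Tf_integrable: "l >= 0 ==> (%s. T x s * f s) integrable_on {l..m}"
 by (rule integrable_continuous_interval)
  (auto intro!: continuous_intros continuous_on_subset[OF T_cont] continuous_on_subset[OF f_cont])

text \<open>\<open>T x s * f s\<close> is nonnegative before \<open>lam x\<close> and nonpositive
  afterwards, so \<open>lam x\<close> maximizes \<open>U x\<close>. Thus V is an upper envelope of
  functions quadratic in x.\<close>

lemma U_le_V: assumes "l >= 0" shows "U x l <= V x"
proof (cases "l <= lam x")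
 case True
 show ?thesis
 proof (cases "lam x = 0")
  case True
  thus ?thesis using \<open>l \<le> lam x\<close> assms by (simp add: V_def)
 next
  case False
  hence T0: "T x (lam x) = 0" using lam(1,3)[of x] by simp
  have "integral {l..lam x} (%s. T x s * f s) >= 0"
  proof (rule integral_nonneg[OF Tf_integrable[OF assms]])
   fix s assume s: "s \<in> {l..lam x}"
   have "T x s >= 0" using T_decr[of s "lam x" x] s assms T0 by auto
   thus "0 <= T x s * f s" using f_pos[of s] s assms by simp
  qed
  hence "U x (lam x)-U x l >= 0" using U_diff[OF assms True, of x] c_pos by simp
  thus ?thesis by (simp add: V_def)
 qed
next
 case False
 hence le: "lam x <= l" by simp
 have "integral {lam x..l} (%s. - (T x s * f s)) >= 0"
 proof (rule integral_nonneg)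
  show "(%s. - (T x s * f s)) integrable_on {lam x..l}"
   by (intro integrable_neg Tf_integrable lam)
  fix s assume s: "s \<in> {lam x..l}"
  have "T x s <= 0" using T_decr[of "lam x" s x] s lam(1,2)[of x] by auto
  thus "0 <= - (T x s * f s)" using f_pos[of s] s lam(1)[of x] by (simp add: mult_nonpos_nonneg)
 qed
 hence "U x l-U x (lam x) <= 0" using U_diff[OF lam(1) le, of x] c_pos
  by (simp add: mult_le_0_iff)
 thus ?thesis by (simp add: V_def)
qed

lemma V_nonneg: "V x >= 0"
 using U_le_V[of 0 x] by (simp add: U_def)

lemma V_zero_iff: "V x = 0 \<longleftrightarrow> T x 0 <= 0"
proof
 assume "T x 0 <= 0"
 hence "lam x = 0" using lam_pos_iff[of x] lam(1)[of x] by auto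
 thus "V x = 0" by (simp add: V_def U_def)
next
 assume V0: "V x = 0"
 show "T x 0 <= 0"
 proof (rule ccontr)
  assume "\<not> T x 0 <= 0"
  hence l: "lam x > 0" using lam_pos_iff[of x] by simp
  have "(lam x/8 * f (lam x))*(lam x/2) <= integral {0..lam x/2} (%s. T x s * f s)"
  proof -
   have "integral {0..lam x/2} (%_. lam x/8 * f (lam x)) <= integral {0..lam x/2} (%s. T x s * f s)"
   proof (rule integral_le)
    show "(%s. T x s * f s) integrable_on {0..lam x/2}" by (rule Tf_integrable) simp
    fix s assume s: "s \<in> {0..lam x/2}"
    have "0 <= s" "s <= lam x/2" using s by auto
    hence "T x s >= lam x/8" using T_decr[of s "lam x" x] lam(3)[OF l] l by linarith
    moreover have "f s >= f (lam x)" using f_antimono[of s "lam x"] s l by auto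
    ultimately show "lam x/8 * f (lam x) <= T x s * f s"
     using l f_pos[of "lam x"] f_pos[of s] s by (intro mult_mono) auto
   qed auto
   thus ?thesis using l by (simp add: mult_ac)
  qed
  moreover have "(lam x/8 * f (lam x))*(lam x/2) > 0" using l f_pos[of "lam x"] by simp
  ultimately have "integral {0..lam x/2} (%s. T x s * f s) > 0" by linarith
  hence "U x (lam x/2)-U x 0 > 0" using U_diff[of 0 "lam x/2" x] l c_pos by simp
  hence "V x > 0" using U_le_V[of "lam x/2" x] l by (simp add: U_def)
  thus False using V0 by simp
 qed
qed

text \<open>The gradient of \<open>U\<close> in x with the parameter l frozen.\<close>

definition Gr :: "'a => real => 'a" where
 "Gr x l = c *. ((\<Sum>j\<in>W. (2*I j l*(x \<bullet> j)) *. j)-I0 l *. e)"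

lemma Gr_inner: "Gr x l \<bullet> h = c*((\<Sum>j\<in>W. 2*I j l*(x \<bullet> j)*(h \<bullet> j))-I0 l*(h \<bullet> e))"
 unfolding Gr_def inner_scaleR_left inner_diff_left inner_sum_left by (simp add: inner_commute)

lemma U_expand: "U y l-U x l = Gr x l \<bullet> (y-x) + c*(\<Sum>j\<in>W. I j l*((y-x) \<bullet> j)^2)"
proof -
 define S1 where "S1 = (\<Sum>j\<in>W. I j l*(x \<bullet> j)^2)"
 define S2 where "S2 = (\<Sum>j\<in>W. 2*I j l*(x \<bullet> j)*((y-x) \<bullet> j))"
 define S3 where "S3 = (\<Sum>j\<in>W. I j l*((y-x) \<bullet> j)^2)"
 have "I j l*(y \<bullet> j)^2 = I j l*(x \<bullet> j)^2+2*I j l*(x \<bullet> j)*((y-x) \<bullet> j)+I j l*((y-x) \<bullet> j)^2" for j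
  by (simp add: inner_diff_left power2_eq_square algebra_simps)
 hence Sy: "(\<Sum>j\<in>W. I j l*(y \<bullet> j)^2) = S1+S2+S3"
  by (simp add: sum.distrib S1_def S2_def S3_def)
 have "U y l = c*(S1+S2+S3-I0 l*(y \<bullet> e)-I1 l/4)" unfolding U_def Sy ..
 moreover have "U x l = c*(S1-I0 l*(x \<bullet> e)-I1 l/4)" unfolding U_def S1_def ..
 moreover have "Gr x l \<bullet> (y-x) = c*(S2-I0 l*(y \<bullet> e-x \<bullet> e))"
  unfolding Gr_inner S2_def by (simp add: inner_diff_left)
 ultimately show ?thesis unfolding S3_def[symmetric] by (simp add: algebra_simps)
qed

lemma abs_inner_j: "j \<in> W ==> \<bar>x \<bullet> j\<bar> <= norm x"
 using Cauchy_Schwarz_ineq2[of x j] unit by simp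

text \<open>At \<open>s = lam x\<close> the value of T at x is zero, while at y it is at most
  \<open>(lam y-s)/4\<close>. The gap is bounded by the Lipschitz constant of T in x.\<close>

lemma lam_lipschitz_aux:
 assumes "norm x <= R" "norm y <= R" "lam y < lam x"
 shows "lam x-lam y <= 4*((\<Sum>j\<in>W. 2 * R/b j)+1)*norm (x-y)"
proof -
 define s where "s = lam x"
 have s: "s > 0" "s >= lam y" using assms(3) lam(1)[of y] by (auto simp: s_def)
 have Ty: "T y s <= lam y/4-s/4" using T_decr[of "lam y" s y] s lam(1,2)[of y] by linarith
 have Tx: "T x s = 0" using lam(3)[of x] s by (simp add: s_def)
 have "(\<Sum>j\<in>W. (x \<bullet> j)\<^sup>2/(b j+s))-(\<Sum>j\<in>W. (y \<bullet> j)\<^sup>2/(b j+s)) <= (\<Sum>j\<in>W. 2 * R/b j*norm (x-y))"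
  unfolding sum_subtractf[symmetric]
 proof (rule sum_mono)
  fix j assume j: "j \<in> W"
  have "(x \<bullet> j)\<^sup>2-(y \<bullet> j)^2 = ((x-y) \<bullet> j)*(x \<bullet> j+y \<bullet> j)"
   by (simp add: power2_eq_square inner_diff_left algebra_simps)
  also have "\<dots> <= \<bar>(x-y) \<bullet> j\<bar>*\<bar>x \<bullet> j+y \<bullet> j\<bar>" using abs_ge_self[of "((x-y) \<bullet> j)*(x \<bullet> j+y \<bullet> j)"] by (simp add: abs_mult)
  also have "\<dots> <= norm (x-y)*(2 * R)"
   using abs_inner_j[OF j, of "x-y"] abs_inner_j[OF j, of x] abs_inner_j[OF j, of y] assms
   by (intro mult_mono) auto
  finally have 1: "(x \<bullet> j)\<^sup>2-(y \<bullet> j)^2 <= norm (x-y)*(2 * R)" .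
  have R: "R >= 0" using assms(1) norm_ge_zero[of x] by linarith
  have "(x \<bullet> j)\<^sup>2/(b j+s)-(y \<bullet> j)^2/(b j+s) <= norm (x-y)*(2 * R)/(b j+s)"
   unfolding diff_divide_distrib[symmetric] using 1 bs[OF j, of s] s by (intro divide_right_mono) auto
  also have "\<dots> <= norm (x-y)*(2 * R)/b j"
   using R b[OF j] s by (intro divide_left_mono) auto
  finally show "(x \<bullet> j)\<^sup>2/(b j+s)-(y \<bullet> j)^2/(b j+s) <= 2 * R/b j*norm (x-y)"
   by (simp add: mult_ac)
 qed
 also have "\<dots> = (\<Sum>j\<in>W. 2 * R/b j)*norm (x-y)" by (rule sum_distrib_right[symmetric])
 finally have "T x s-T y s <= (\<Sum>j\<in>W. 2 * R/b j)*norm (x-y)+norm (x-y)"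
  using abs_inner_unit_le[OF e, of "x-y"] by (simp add: T_def inner_diff_left)
 hence "s/4-lam y/4 <= (\<Sum>j\<in>W. 2 * R/b j)*norm (x-y)+norm (x-y)" using Tx Ty by linarith
 thus ?thesis by (simp add: s_def algebra_simps)
qed

lemma lam_lipschitz:
 assumes "norm x <= R" "norm y <= R"
 shows "\<bar>lam x-lam y\<bar> <= 4*((\<Sum>j\<in>W. 2 * R/b j)+1)*norm (x-y)"
proof -
 have R: "R >= 0" using assms(1) norm_ge_zero[of x] by linarith
 have "(\<Sum>j\<in>W. 2 * R/b j) >= 0" using b R by (intro sum_nonneg) (simp add: less_imp_le)
 hence nn: "4*((\<Sum>j\<in>W. 2 * R/b j)+1)*norm (x-y) >= 0" by simp
 consider "lam y < lam x" | "lam x < lam y" | "lam x = lam y" by linarith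
 thus ?thesis
 proof cases
  case 1 thus ?thesis using lam_lipschitz_aux[OF assms 1] by simp
 next
  case 2 thus ?thesis using lam_lipschitz_aux[OF assms(2,1) 2] by (simp add: norm_minus_commute)
 next
  case 3 thus ?thesis using nn by simp
 qed
qed

lemma lam_cont: "isCont lam x"
proof -
 define K where "K = 4*((\<Sum>j\<in>W. 2*(norm x+1)/b j)+1)"
 have "((%y. K*norm (y-x)) \<longlongrightarrow> 0) (at x)" by (auto intro!: tendsto_eq_intros)
 moreover have "\<forall>\<^sub>F y in at x. norm (lam y-lam x) <= K*norm (y-x)"
  unfolding eventually_at
 proof (intro exI[of _ 1] conjI ballI impI)
  fix y assume "y \<noteq> x \<and> dist y x < 1"
  hence "norm y <= norm x+1" using norm_triangle_ineq2[of y x] by (simp add: dist_norm)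
  thus "norm (lam y-lam x) <= K*norm (y-x)"
   using lam_lipschitz[of y "norm x+1" x] by (simp add: K_def)
 qed simp
 ultimately have "((%y. lam y-lam x) \<longlongrightarrow> 0) (at x)" by (rule Lim_null_comparison[rotated])
 thus ?thesis unfolding isCont_def by (rule LIM_zero_cancel)
qed

definition G :: "'a => 'a" where "G x = Gr x (lam x)"

lemma I_abs_lip:
 assumes "0 <= l" "0 <= m"
 shows "j \<in> W ==> \<bar>I j m-I j l\<bar> <= (f 0/b j)*\<bar>m-l\<bar>"
  and "\<bar>I0 m-I0 l\<bar> <= f 0*\<bar>m-l\<bar>"
proof -
 consider "l <= m" | "m <= l" by linarith
 thus "j \<in> W ==> \<bar>I j m-I j l\<bar> <= (f 0/b j)*\<bar>m-l\<bar>"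
 proof cases
  case 1 thus "j \<in> W ==> ?thesis" using I_lip(1,2)[of l m j] assms by auto
 next
  case 2 thus "j \<in> W ==> ?thesis" using I_lip(1,2)[of m l j] assms by auto
 qed
 consider "l <= m" | "m <= l" by linarith
 thus "\<bar>I0 m-I0 l\<bar> <= f 0*\<bar>m-l\<bar>"
 proof cases
  case 1 thus ?thesis using I_lip(3,4)[of l m] assms by auto
 next
  case 2 thus ?thesis using I_lip(3,4)[of m l] assms by auto
 qed
qed

lemma Gr_lip:
 assumes "norm x <= R" "norm y <= R" "0 <= l" "l <= L" "0 <= m" "m <= L"
 shows "norm (Gr x l-Gr y m) <=
    c*(\<Sum>j\<in>W. 2*(f 0/b j))*(L*norm (x-y)+R*\<bar>l-m\<bar>) + c * f 0*\<bar>l-m\<bar>"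
proof -
 have R: "R >= 0" using assms(1) norm_ge_zero[of x] by linarith
 have L: "L >= 0" using assms by linarith
 have trm: "norm ((2*I j l*(x \<bullet> j)) *. j-(2*I j m*(y \<bullet> j)) *. j) <= 2*(f 0/b j)*(L*norm (x-y)+R*\<bar>l-m\<bar>)"
  if j: "j \<in> W" for j
 proof -
  have fb: "f 0/b j >= 0" using f_pos[of 0] b[OF j] by simp
  have Il: "\<bar>I j l\<bar> <= (f 0/b j)*L"
   using I_abs_lip(1)[of 0 l j] j assms fb mult_left_mono[of l L "f 0/b j"] by simp
  have "I j l*(x \<bullet> j)-I j m*(y \<bullet> j) = I j l*((x-y) \<bullet> j)+(I j l-I j m)*(y \<bullet> j)"
   by (simp add: inner_diff_left algebra_simps)
  hence "\<bar>I j l*(x \<bullet> j)-I j m*(y \<bullet> j)\<bar> <= \<bar>I j l\<bar>*\<bar>(x-y) \<bullet> j\<bar>+\<bar>I j l-I j m\<bar>*\<bar>y \<bullet> j\<bar>"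
   using abs_triangle_ineq[of "I j l*((x-y) \<bullet> j)" "(I j l-I j m)*(y \<bullet> j)"] by (simp add: abs_mult)
  also have "\<dots> <= ((f 0/b j)*L)*norm (x-y)+((f 0/b j)*\<bar>l-m\<bar>) * R"
   using Il I_abs_lip(1)[of m l j] j assms abs_inner_j[OF j, of "x-y"] abs_inner_j[OF j, of y] fb L
   by (intro add_mono mult_mono) auto
  finally have "\<bar>I j l*(x \<bullet> j)-I j m*(y \<bullet> j)\<bar> <= (f 0/b j)*(L*norm (x-y)+R*\<bar>l-m\<bar>)"
   by (simp add: algebra_simps)
  moreover have "(2*I j l*(x \<bullet> j)) *. j-(2*I j m*(y \<bullet> j)) *. j = (2*(I j l*(x \<bullet> j)-I j m*(y \<bullet> j))) *. j"
   by (simp add: algebra_simps)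
  ultimately show ?thesis using unit[OF j] by (simp add: abs_mult)
 qed
 have eq: "Gr x l-Gr y m = c *. ((\<Sum>j\<in>W. (2*I j l*(x \<bullet> j)) *. j-(2*I j m*(y \<bullet> j)) *. j)-(I0 l-I0 m) *. e)"
  by (simp add: Gr_def sum_subtractf algebra_simps)
 have "norm ((\<Sum>j\<in>W. (2*I j l*(x \<bullet> j)) *. j-(2*I j m*(y \<bullet> j)) *. j)-(I0 l-I0 m) *. e) <=
      (\<Sum>j\<in>W. 2*(f 0/b j)*(L*norm (x-y)+R*\<bar>l-m\<bar>)) + f 0*\<bar>l-m\<bar>"
  using I_abs_lip(2)[of m l] assms e
  by (intro order_trans[OF norm_triangle_ineq4] add_mono order_trans[OF norm_sum sum_mono] trm) auto
 hence "c*norm ((\<Sum>j\<in>W. (2*I j l*(x \<bullet> j)) *. j-(2*I j m*(y \<bullet> j)) *. j)-(I0 l-I0 m) *. e) <=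
      c*((\<Sum>j\<in>W. 2*(f 0/b j)*(L*norm (x-y)+R*\<bar>l-m\<bar>)) + f 0*\<bar>l-m\<bar>)"
  using c_pos by (intro mult_left_mono) auto
 also have "\<dots> = c*(\<Sum>j\<in>W. 2*(f 0/b j))*(L*norm (x-y)+R*\<bar>l-m\<bar>) + c * f 0*\<bar>l-m\<bar>"
  unfolding sum_distrib_right[symmetric] by (simp add: distrib_left mult.assoc)
 finally show ?thesis unfolding eq using c_pos by simp
qed

lemma Gr_lam_lip:
 "EX K>=0. ALL x y z. norm x <= R --> norm y <= R --> norm z <= R -->
     norm (Gr x (lam x)-Gr z (lam y)) <= K*(norm (x-z)+norm (x-y))"
proof (cases "R >= 0")
 case True
 define S where "S = c*(\<Sum>j\<in>W. 2*(f 0/b j))"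
 define K1 where "K1 = 4*((\<Sum>j\<in>W. 2 * R/b j)+1)"
 have S: "S >= 0" unfolding S_def using c_pos f_pos[of 0] b by (intro mult_nonneg_nonneg sum_nonneg) (auto simp: less_imp_le)
 have K1: "K1 >= 0" unfolding K1_def using True b by (intro mult_nonneg_nonneg add_nonneg_nonneg sum_nonneg) (auto simp: less_imp_le)
 have cf: "c * f 0 >= 0" using c_pos f_pos[of 0] by simp
 define K where "K = S*(8 * R)+(S * R + c * f 0)*K1"
 have K: "K >= 0" using S K1 cf True by (simp add: K_def)
 show ?thesis
 proof (rule exI[of _ K], intro conjI K allI impI)
  fix x y z :: 'a assume xyz: "norm x <= R" "norm y <= R" "norm z <= R"
  have "norm (Gr x (lam x)-Gr z (lam y)) <= S*((8 * R)*norm (x-z)+R*\<bar>lam x-lam y\<bar>) + c * f 0*\<bar>lam x-lam y\<bar>"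
   unfolding S_def by (rule Gr_lip) (use xyz lam(1) lam_le[of x] lam_le[of y] in auto)
  also have "\<dots> = S*(8 * R)*norm (x-z)+(S * R + c * f 0)*\<bar>lam x-lam y\<bar>" by (simp add: algebra_simps)
  also have "\<dots> <= S*(8 * R)*norm (x-z)+(S * R + c * f 0)*(K1*norm (x-y))"
   using lam_lipschitz[OF xyz(1,2)] S cf True by (intro add_left_mono mult_left_mono) (auto simp: K1_def)
  also have "\<dots> <= K*norm (x-z)+K*norm (x-y)"
   unfolding K_def mult.assoc[symmetric] using S K1 cf True by (intro add_mono mult_right_mono) auto
  finally show "norm (Gr x (lam x)-Gr z (lam y)) <= K*(norm (x-z)+norm (x-y))" by (simp add: distrib_left)
 qed
next
 case False
 hence "\<not> norm x <= R" for x :: 'a using norm_ge_zero[of x] by linarith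
 thus ?thesis by (intro exI[of _ 0]) auto
qed

text \<open>Envelope argument: \<open>V y-V x\<close> lies between the increments of U with
  parameter \<open>lam x\<close> and with parameter \<open>lam y\<close>, which differ
  quadratically. Differentiability of \<open>lam\<close> is not involved, so the free boundary needs
  no separate case.\<close>

lemma V_deriv: "(V has_derivative (%h. G x \<bullet> h)) (at x)"
proof -
 define R where "R = norm x+1"
 obtain K where K: "K >= 0" "ALL x y z. norm x <= R --> norm y <= R --> norm z <= R -->
     norm (Gr x (lam x)-Gr z (lam y)) <= K*(norm (x-z)+norm (x-y))"
  using Gr_lam_lip[of R] by blast
 define S where "S = c*(\<Sum>j\<in>W. (f 0/b j)*(8 * R))"
 have S: "S >= 0" unfolding S_def using c_pos f_pos[of 0] b
  by (intro mult_nonneg_nonneg sum_nonneg) (auto simp: less_imp_le R_def)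
 have quad: "0 <= c*(\<Sum>j\<in>W. I j (lam z)*(h \<bullet> j)^2)" "c*(\<Sum>j\<in>W. I j (lam z)*(h \<bullet> j)^2) <= S*(norm h)^2"
  if z: "norm z <= R" for z h
 proof -
  have I0': "I j (lam z) >= 0" "I j (lam z) <= (f 0/b j)*(8 * R)" if "j \<in> W" for j
  proof -
   show "I j (lam z) >= 0" using I_lip(1)[of 0 "lam z" j] that lam(1)[of z] by simp
   have "I j (lam z) <= (f 0/b j)*lam z" using I_lip(2)[of 0 "lam z" j] that lam(1)[of z] by simp
   also have "\<dots> <= (f 0/b j)*(8 * R)" using lam_le[of z] z f_pos[of 0] b[OF that] by (intro mult_left_mono) auto
   finally show "I j (lam z) <= (f 0/b j)*(8 * R)" .
  qed
  show "0 <= c*(\<Sum>j\<in>W. I j (lam z)*(h \<bullet> j)^2)" using I0' c_pos by (intro mult_nonneg_nonneg sum_nonneg) auto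
  have "(\<Sum>j\<in>W. I j (lam z)*(h \<bullet> j)^2) <= (\<Sum>j\<in>W. ((f 0/b j)*(8 * R))*(norm h)^2)"
  proof (rule sum_mono)
   fix j assume j: "j \<in> W"
   have "(h \<bullet> j)\<^sup>2 <= (norm h)^2" using power_mono[OF abs_inner_j[OF j, of h], of 2] by simp
   thus "I j (lam z)*(h \<bullet> j)^2 <= ((f 0/b j)*(8 * R))*(norm h)^2"
    using I0'[OF j] by (intro mult_mono) auto
  qed
  hence "c*(\<Sum>j\<in>W. I j (lam z)*(h \<bullet> j)^2) <= c*(\<Sum>j\<in>W. ((f 0/b j)*(8 * R))*(norm h)^2)"
   using c_pos by (intro mult_left_mono) auto
  thus "c*(\<Sum>j\<in>W. I j (lam z)*(h \<bullet> j)^2) <= S*(norm h)^2"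
   by (simp add: S_def sum_distrib_right mult.assoc)
 qed
 show ?thesis
 proof (rule has_derivative_quadratic_bound[where r = 1 and K = "K+S"])
  fix y assume y: "norm (y-x) <= 1"
  have n: "norm x <= R" "norm y <= R" using y norm_triangle_ineq2[of y x] by (auto simp: R_def)
  have lo: "V y-V x >= G x \<bullet> (y-x)"
   using U_le_V[OF lam(1)[of x], of y] U_expand[of y "lam x" x] quad(1)[OF n(1), of "y-x"] by (simp add: V_def G_def)
  have "V y-V x <= U y (lam y)-U x (lam y)" using U_le_V[OF lam(1)[of y], of x] by (simp add: V_def)
  also have "\<dots> <= Gr x (lam y) \<bullet> (y-x)+S*(norm (y-x))^2"
   using U_expand[of y "lam y" x] quad(2)[OF n(2), of "y-x"] by simp
  also have "Gr x (lam y) \<bullet> (y-x) = G x \<bullet> (y-x)+(Gr x (lam y)-Gr x (lam x)) \<bullet> (y-x)"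
   by (simp add: G_def inner_diff_left)
  also have "(Gr x (lam y)-Gr x (lam x)) \<bullet> (y-x) <= K*norm (y-x)*norm (y-x)"
  proof -
   have "norm (Gr x (lam y)-Gr x (lam x)) <= K*norm (y-x)"
    using K(2)[rule_format, of x y x] n by (simp add: norm_minus_commute)
   thus ?thesis
    using norm_cauchy_schwarz[of "Gr x (lam y)-Gr x (lam x)" "y-x"] mult_right_mono[of "norm (Gr x (lam y)-Gr x (lam x))" "K*norm (y-x)" "norm (y-x)"]
    by simp
  qed
  finally have "V y-V x-G x \<bullet> (y-x) <= (K+S)*(norm (y-x))^2"
   by (simp add: power2_eq_square algebra_simps)
  thus "\<bar>V y-V x-G x \<bullet> (y-x)\<bar> <= (K+S)*(norm (y-x))^2" using lo by simp
 qed simp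
qed

lemma T0_cont: "continuous_on UNIV (%x. T x 0)"
 unfolding T_def by (intro continuous_intros) (use b in \<open>auto simp: order_less_imp_not_eq2\<close>)

text \<open>Subtracting the equations \<open>T y (lam y) = 0\<close> and
  \<open>T x (lam x) = 0\<close> gives an exact factorization
  \<open>lam y-lam x = Q y \<bullet> (y-x)\<close> with Q continuous at x, a Caratheodory
  derivative.\<close>

lemma lam_deriv:
 assumes "lam x > 0"
 defines "N \<equiv> (\<Sum>j\<in>W. (2*(x \<bullet> j)/(b j+lam x)) *. j)-e"
 defines "M \<equiv> (\<Sum>j\<in>W. (x \<bullet> j)\<^sup>2/(b j+lam x)^2)+1/4"
 shows "(lam has_derivative (%h. (1/M)*(N \<bullet> h))) (at x)"
proof -
 define Den where "Den y = (\<Sum>j\<in>W. (x \<bullet> j)\<^sup>2/((b j+lam y)*(b j+lam x)))+1/4" for y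
 define Q where "Q y = (1/Den y) *. ((\<Sum>j\<in>W. ((y \<bullet> j+x \<bullet> j)/(b j+lam y)) *. j)-e)" for y
 have blam: "b j+lam y > 0" if "j \<in> W" for j y using bs[OF that lam(1)] .
 have Den_pos: "Den y > 0" for y
  unfolding Den_def by (intro add_nonneg_pos sum_nonneg divide_nonneg_pos mult_pos_pos blam) auto
 have Q_inner: "Q y \<bullet> h = (1/Den y)*((\<Sum>j\<in>W. ((y \<bullet> j+x \<bullet> j)/(b j+lam y))*(h \<bullet> j))-h \<bullet> e)" for y h
  unfolding Q_def inner_scaleR_left inner_diff_left inner_sum_left by (simp only: inner_commute[of _ h])
 have "\<forall>\<^sub>F y in at x. lam y > 0"
  using lam_cont[of x] assms(1) unfolding isCont_def by (rule order_tendstoD(1))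
 then obtain r where r: "r > 0" "\<And>y. y \<noteq> x ==> dist y x < r ==> lam y > 0"
  unfolding eventually_at by auto
 have "(lam has_derivative (%h. Q x \<bullet> h)) (at x)"
 proof (rule has_derivative_caratheodory[OF r(1)])
  fix y assume "norm (y-x) < r"
  hence ly: "lam y > 0" using r(2)[of y] assms(1) by (cases "y = x") (auto simp: dist_norm)
  have z: "T y (lam y) = 0" "T x (lam x) = 0" using lam(3) ly assms(1) by auto
  have trm: "(y \<bullet> j)\<^sup>2/(b j+lam y)-(x \<bullet> j)^2/(b j+lam x) =
        ((y \<bullet> j+x \<bullet> j)/(b j+lam y))*((y-x) \<bullet> j)-(lam y-lam x)*((x \<bullet> j)^2/((b j+lam y)*(b j+lam x)))"
   if j: "j \<in> W" for j
   using blam[OF j, of y] blam[OF j, of x]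
   by (simp add: divide_simps inner_diff_left) (simp add: power2_eq_square algebra_simps)
  have "0 = T y (lam y)-T x (lam x)" using z by simp
  also have "\<dots> = (\<Sum>j\<in>W. (y \<bullet> j)\<^sup>2/(b j+lam y)-(x \<bullet> j)^2/(b j+lam x))-(y-x) \<bullet> e-(lam y-lam x)/4"
   unfolding T_def by (simp add: sum_subtractf inner_diff_left diff_divide_distrib)
  also have "(\<Sum>j\<in>W. (y \<bullet> j)\<^sup>2/(b j+lam y)-(x \<bullet> j)^2/(b j+lam x)) =
        (\<Sum>j\<in>W. ((y \<bullet> j+x \<bullet> j)/(b j+lam y))*((y-x) \<bullet> j))-(lam y-lam x)*(\<Sum>j\<in>W. (x \<bullet> j)\<^sup>2/((b j+lam y)*(b j+lam x)))"
   unfolding sum_distrib_left sum_subtractf[symmetric] by (rule sum.cong[OF refl trm])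
  finally have "(lam y-lam x)*Den y = (\<Sum>j\<in>W. ((y \<bullet> j+x \<bullet> j)/(b j+lam y))*((y-x) \<bullet> j))-(y-x) \<bullet> e"
   unfolding Den_def distrib_left by linarith
  also have "\<dots> = Den y*(Q y \<bullet> (y-x))"
   using Den_pos[of y] unfolding Q_inner by simp
  finally show "lam y-lam x = Q y \<bullet> (y-x)" using Den_pos[of y] by simp
 next
  show "isCont Q x"
   unfolding Q_def[abs_def] Den_def[abs_def]
   by (intro continuous_intros lam_cont)
    (use blam[of _ x] Den_pos[of x] in \<open>auto simp: Den_def order_less_imp_not_eq2\<close>)
 qed
 moreover have "Q x = (1/M) *. N"
 proof -
  have "Den x = M" unfolding Den_def M_def power2_eq_square ..
  thus ?thesis unfolding Q_def N_def by (simp only: mult_2)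
 qed
 ultimately show ?thesis by (simp only: inner_scaleR_left)
qed

text \<open>Frozen coefficients contribute twice the sum of the \<open>I j\<close>, that is
  \<open>4*(f 0-f (lam x))\<close>; the derivative of \<open>lam\<close> contributes
  \<open>4*f (lam x)\<close>, because \<open>4*M\<close> is exactly the sum of squares
  \<open>4*S\<close> plus 1. Together they give \<open>c*4*f 0 = 1\<close>.\<close>

lemma G_deriv:
 assumes l: "lam x > 0"
 shows "EX H. (G has_derivative H) (at x) \<and> (\<Sum>b\<in>Basis. H b \<bullet> b) = 1"
proof -
 define N where "N = (\<Sum>j\<in>W. (2*(x \<bullet> j)/(b j+lam x)) *. j)-e"
 define M where "M = (\<Sum>j\<in>W. (x \<bullet> j)\<^sup>2/(b j+lam x)^2)+1/4"
 define l' where "l' h = (1/M)*(N \<bullet> h)" for h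
 have Mpos: "M > 0" unfolding M_def by (intro add_nonneg_pos sum_nonneg) auto
 have ld: "(lam has_derivative l') (at x)" unfolding l'_def[abs_def] N_def M_def by (rule lam_deriv[OF l])
 have Ij: "((%y. I j (lam y)) has_derivative (%h. l' h*(f (lam x)/(b j+lam x)))) (at x)" if j: "j \<in> W" for j
 proof -
  have "(I j has_real_derivative f (lam x)/(b j+lam x)) (at (lam x))"
   unfolding I_def[abs_def] by (rule integral_upto_deriv[OF fj_cont[OF j] l])
  hence "(I j has_derivative (%h. h*(f (lam x)/(b j+lam x)))) (at (lam x))"
  proof -
   have eq: "(%h. h * k) = (*) k" for k :: real by (simp add: fun_eq_iff)
   show ?thesis using \<open>(I j has_real_derivative f (lam x) / (b j + lam x)) (at (lam x))\<close>
    unfolding eq has_field_derivative_def .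
  qed
  from has_derivative_compose[OF ld this] show ?thesis .
 qed
 have I0d: "((%y. I0 (lam y)) has_derivative (%h. l' h * f (lam x))) (at x)"
 proof -
  have "(I0 has_real_derivative f (lam x)) (at (lam x))"
   unfolding I0_def[abs_def] by (rule integral_upto_deriv[OF f_cont l])
  hence "(I0 has_derivative (%h. h * f (lam x))) (at (lam x))"
   by (simp add: has_field_derivative_def mult.commute[of _ "f (lam x)"])
  from has_derivative_compose[OF ld this] show ?thesis .
 qed
 define H where "H h = c *. ((\<Sum>j\<in>W. (2*I j (lam x)*(h \<bullet> j)+2*(l' h*(f (lam x)/(b j+lam x)))*(x \<bullet> j)) *. j)-(l' h * f (lam x)) *. e)" for h
 have GH: "(G has_derivative H) (at x)"
  unfolding G_def[abs_def] Gr_def H_def[abs_def]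
  by (intro has_derivative_scaleR_right has_derivative_diff has_derivative_sum has_derivative_scaleR_left
    has_derivative_mult[where f = "%y. 2*I _ (lam y)" and f' = "%h. 2*(l' h*(f (lam x)/(b _+lam x)))"]
    has_derivative_mult_right Ij I0d has_derivative_inner_left has_derivative_ident)
 have lin: "linear H" using GH has_derivative_linear by blast
 have l'j: "l' j = (1/M)*(2*(x \<bullet> j)/(b j+lam x))" if j: "j \<in> W" for j
 proof -
  have "N \<bullet> j = (\<Sum>i\<in>W. (2*(x \<bullet> i)/(b i+lam x))*(i \<bullet> j))" using j by (simp add: N_def inner_diff_left inner_sum_left)
  also have "\<dots> = (\<Sum>i\<in>W. if i = j then 2*(x \<bullet> j)/(b j+lam x) else 0)"
   by (rule sum.cong[OF refl]) (use j jk in auto)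
  also have "\<dots> = 2*(x \<bullet> j)/(b j+lam x)" using finW j by simp
  finally show ?thesis by (simp add: l'_def)
 qed
 have l'e: "l' e = - (1/M)" by (simp add: l'_def N_def inner_diff_left inner_sum_left)
 have Hj: "H j \<bullet> j = c*(2*I j (lam x) + f (lam x)/M*(4*((x \<bullet> j)^2/(b j+lam x)^2)))" if j: "j \<in> W" for j
 proof -
  have "H j \<bullet> j = c*(\<Sum>i\<in>W. (2*I i (lam x)*(j \<bullet> i)+2*(l' j*(f (lam x)/(b i+lam x)))*(x \<bullet> i))*(i \<bullet> j))"
   using j by (simp add: H_def inner_diff_left inner_sum_left)
  also have "(\<Sum>i\<in>W. (2*I i (lam x)*(j \<bullet> i)+2*(l' j*(f (lam x)/(b i+lam x)))*(x \<bullet> i))*(i \<bullet> j)) =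
      (\<Sum>i\<in>W. if i = j then 2*I j (lam x)+2*(l' j*(f (lam x)/(b j+lam x)))*(x \<bullet> j) else 0)"
   by (rule sum.cong[OF refl]) (use j jk in auto)
  also have "\<dots> = 2*I j (lam x)+2*(l' j*(f (lam x)/(b j+lam x)))*(x \<bullet> j)" using finW j by simp
  finally show ?thesis unfolding l'j[OF j] by (simp add: power2_eq_square mult_ac)
 qed
 have He: "H e \<bullet> e = c*(f (lam x)/M)"
  unfolding H_def inner_scaleR_left inner_diff_left inner_sum_left l'e by simp
 have "(\<Sum>b\<in>Basis. H b \<bullet> b) = c*(2*(\<Sum>j\<in>W. I j (lam x)) + f (lam x)/M*(4*(\<Sum>j\<in>W. (x \<bullet> j)\<^sup>2/(b j+lam x)^2))) + c*(f (lam x)/M)"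
  unfolding trace_frame[OF lin] He
  by (simp only: sum.cong[OF refl Hj] sum_distrib_left[symmetric] sum.distrib)
 also have "\<dots> = c*(4*(f 0-f (lam x)) + f (lam x)/M*(4*M))"
 proof -
  define S where "S = (\<Sum>j\<in>W. (x \<bullet> j)\<^sup>2/(b j+lam x)^2)"
  define k where "k = f (lam x)/M"
  have "4*M = 4*S+1" by (simp add: M_def S_def)
  thus ?thesis unfolding sum_I[OF lam(1)] S_def[symmetric] k_def[symmetric] by (simp add: algebra_simps)
 qed
 also have "\<dots> = 1" using Mpos f_pos[of 0] by (simp add: c_def)
 finally show ?thesis using GH by blast
qed

lemma V_sol: "sol V"
 unfolding sol_def
proof (intro conjI allI V_nonneg)
 have Vc: "continuous_on UNIV V"
  using has_derivative_continuous[OF V_deriv] by (simp add: continuous_on_eq_continuous_at)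
 have pos: "V x > 0 \<longleftrightarrow> T x 0 > 0" for x using V_nonneg[of x] V_zero_iff[of x] by linarith
 define S where "S = {x. T x 0 = 0}"
 have Sc: "closed S" unfolding S_def by (intro closed_Collect_eq T0_cont continuous_intros)
 \<comment> \<open>A ray from e meets the free boundary at most once. The restriction of T is a
   quadratic in t with values product of roots \<open>-1/alf\<close>, so there is at most one
   nonnegative root.\<close>
 have "negligible S"
 proof (rule starlike_negligible[OF Sc, of e])
  fix t x assume *: "e+t *. x \<in> S" "0 <= t" "e+x \<in> S"
  define alf where "alf = (\<Sum>j\<in>W. (x \<bullet> j)\<^sup>2/b j)"
  have alf: "alf >= 0" unfolding alf_def using b by (intro sum_nonneg) (simp add: less_imp_le)
  have Tt: "T (e+t *. x) 0 = t^2*alf-1-t*(x \<bullet> e)" for t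
   by (simp add: T_def alf_def inner_add_left power_mult_distrib sum_distrib_left)
  have 1: "t\<^sup>2*alf-1-t*(x \<bullet> e) = 0" "alf-1-x \<bullet> e = 0"
   using * Tt[of t] Tt[of 1] by (auto simp: S_def)
  hence "(t-1)*(alf*t+1) = 0"
   by algebra
  moreover have "alf*t+1 > 0" using alf *(2) by (simp add: add_nonneg_pos)
  ultimately show "t = 1" by auto
 qed
 hence "S \<in> null_sets lebesgue" by (simp add: negligible_iff_null_sets)
 hence "S \<in> null_sets lborel" using Sc by (auto simp: null_sets_def)
 hence AE: "AE x in lborel. x \<notin> S" by (rule AE_not_in)
 show "EX G. lap V G (indicator {x. 0 < V x})"
 proof (rule exI[of _ G], unfold lap_def, intro conjI allI V_deriv)
  fix R
  obtain K where K: "ALL x y z. norm x <= R --> norm y <= R --> norm z <= R -->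
        norm (Gr x (lam x)-Gr z (lam y)) <= K*(norm (x-z)+norm (x-y))"
   using Gr_lam_lip[of R] by blast
  show "EX L. ALL y:cball 0 R. ALL z:cball 0 R. norm (G y-G z) <= L*norm (y-z)"
  proof (intro exI ballI)
   fix y z :: 'a assume "y \<in> cball 0 R" "z \<in> cball 0 R"
   thus "norm (G y-G z) <= (2*K)*norm (y-z)"
    using K[rule_format, of y z z] by (simp add: G_def)
  qed
 next
  have [measurable]: "V \<in> borel_measurable borel" using Vc by (rule borel_measurable_continuous_onI)
  show "(indicator {x. 0 < V x} :: 'a => real) \<in> borel_measurable borel" by measurable
 next
  show "EX K. ALL x:cball 0 R. \<bar>indicator {x. 0 < V x} x :: real\<bar> <= K" for R
   by (intro exI[of _ 1]) (auto simp: indicator_def)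
 next
  show "AE x in lborel. EX H. (G has_derivative H) (at x) \<and> (\<Sum>b\<in>Basis. H b \<bullet> b) = indicator {x. 0 < V x} x"
   using AE
  proof (rule eventually_mono)
   fix x assume "x \<notin> S"
   then consider "T x 0 > 0" | "T x 0 < 0" unfolding S_def by force
   thus "EX H. (G has_derivative H) (at x) \<and> (\<Sum>b\<in>Basis. H b \<bullet> b) = indicator {x. 0 < V x} x"
   proof cases
    case 1
    thus ?thesis using G_deriv[of x] lam_pos_iff[of x] pos[of x] by simp
   next
    case 2
    have op: "open {x. T x 0 < 0}" by (intro open_Collect_less T0_cont continuous_intros)
    have G0: "0 = G y" if "y \<in> {x. T x 0 < 0}" for y
    proof -
     have "lam y = 0" using that lam_pos_iff[of y] lam(1)[of y] by auto
     thus ?thesis by (simp add: G_def Gr_def)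
    qed
    have "((%_. 0) has_derivative (%_. 0)) (at x)" by simp
    hence "(G has_derivative (%_. 0)) (at x)"
     by (rule has_derivative_transform_within_open[OF _ op]) (use 2 G0 in auto)
    thus ?thesis using 2 pos[of x] by (intro exI[of _ "%_. 0"]) auto
   qed
  qed
 qed
qed

end

section \<open>Dilations of solutions\<close>

lemma lap_scale:
 fixes u :: "'a::euclidean_space => real"
 assumes "lap u G f" and m: "m > 0"
 shows "lap (%x. m\<^sup>2*u ((1/m) *. x)) (%x. m *. G ((1/m) *. x)) (%x. f ((1/m) *. x))"
proof -
 have [measurable]: "f \<in> borel_measurable borel" using assms(1) by (rule lap_measurable)
 have nb: "norm ((1/m) *. y) <= (1/m) * R" if "norm y <= R" for y :: 'a and R
  using mult_left_mono[OF that, of "1/m"] m by simp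
 have tr: "((%x::'a. (1/m) *. x) has_derivative (%h. (1/m) *. h)) (at x)" for x by (auto intro!: derivative_eq_intros)
 show ?thesis unfolding lap_def
 proof (intro conjI allI)
  fix x
  have "((%x. u ((1/m) *. x)) has_derivative (%h. G ((1/m) *. x) \<bullet> ((1/m) *. h))) (at x)"
   by (rule has_derivative_compose[OF tr lap_has_derivative[OF assms(1)]])
  from has_derivative_mult_right[OF this, of "m\<^sup>2"]
  show "((%x. m\<^sup>2*u ((1/m) *. x)) has_derivative (%h. (m *. G ((1/m) *. x)) \<bullet> h)) (at x)"
   using m by (simp add: power2_eq_square)
 next
  fix R
  obtain L where L: "L >= 0" "ALL y z. norm y <= (1/m) * R --> norm z <= (1/m) * R --> norm (G y-G z) <= L*norm (y-z)"
   using lap_lipschitz[OF assms(1), of "(1/m) * R"] by blast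
  show "EX L. ALL y:cball 0 R. ALL z:cball 0 R. norm (m *. G ((1/m) *. y)-m *. G ((1/m) *. z)) <= L*norm (y-z)"
  proof (intro exI ballI)
   fix y z :: 'a assume "y \<in> cball 0 R" "z \<in> cball 0 R"
   hence "norm (G ((1/m) *. y)-G ((1/m) *. z)) <= L*norm ((1/m) *. y-(1/m) *. z)"
    using L(2)[rule_format, of "(1/m) *. y" "(1/m) *. z"] nb by simp
   hence "m*norm (G ((1/m) *. y)-G ((1/m) *. z)) <= m*(L*norm ((1/m) *. (y-z)))"
    using m by (simp add: scaleR_diff_right)
   also have "m*(L*norm ((1/m) *. (y-z))) = L*norm (y-z)" using m by simp
   also have "m*norm (G ((1/m) *. y)-G ((1/m) *. z)) = norm (m *. G ((1/m) *. y)-m *. G ((1/m) *. z))"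
    using m by (simp add: scaleR_diff_right[symmetric])
   finally show "norm (m *. G ((1/m) *. y)-m *. G ((1/m) *. z)) <= L*norm (y-z)" .
  qed
 next
  show "(%x. f ((1/m) *. x)) \<in> borel_measurable borel" by measurable
 next
  fix R
  obtain K where K: "ALL x. norm x <= (1/m) * R --> \<bar>f x\<bar> <= K" using lap_bounded[OF assms(1), of "(1/m) * R"] by blast
  show "EX K. ALL x:cball 0 R. \<bar>f ((1/m) *. x)\<bar> <= K" using K nb by (intro exI[of _ K]) auto
 next
  have "AE y in lborel. EX H. (G has_derivative H) (at (0+(1/m) *. y)) \<and> (\<Sum>b\<in>Basis. H b \<bullet> b) = f (0+(1/m) *. y)"
   by (rule AE_lborel_affine) (use assms in \<open>auto simp: lap_def\<close>)
  thus "AE x in lborel. EX H. ((%x. m *. G ((1/m) *. x)) has_derivative H) (at x) \<and> (\<Sum>b\<in>Basis. H b \<bullet> b) = f ((1/m) *. x)"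
  proof (rule eventually_mono)
   fix y assume "EX H. (G has_derivative H) (at (0+(1/m) *. y)) \<and> (\<Sum>b\<in>Basis. H b \<bullet> b) = f (0+(1/m) *. y)"
   then obtain H where H: "(G has_derivative H) (at ((1/m) *. y))" "(\<Sum>b\<in>Basis. H b \<bullet> b) = f ((1/m) *. y)"
    by auto
   have lin: "linear H" using H(1) has_derivative_linear by blast
   have "((%x. m *. G ((1/m) *. x)) has_derivative (%h. m *. H ((1/m) *. h))) (at y)"
    by (rule has_derivative_scaleR_right[OF has_derivative_compose[OF tr H(1)]])
   moreover have "(%h. m *. H ((1/m) *. h)) = H" using m by (simp add: linear_cmul[OF lin])
   ultimately show "EX H. ((%x. m *. G ((1/m) *. x)) has_derivative H) (at y) \<and> (\<Sum>b\<in>Basis. H b \<bullet> b) = f ((1/m) *. y)"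
    using H(2) by auto
  qed
 qed
qed

lemma sol_scale: assumes "sol u" "m > 0" shows "sol (%x. m\<^sup>2*u ((1/m) *. x))"
proof -
 obtain G where "lap u G (indicator {x. u x > 0})" using assms unfolding sol_def by blast
 moreover have "(%x. indicator {x. u x > 0} ((1/m) *. x) :: real) = indicator {x. m\<^sup>2*u ((1/m) *. x) > 0}"
  using assms(2) by (auto simp: indicator_def fun_eq_iff zero_less_mult_iff)
 ultimately have "lap (%x. m\<^sup>2*u ((1/m) *. x)) (%x. m *. G ((1/m) *. x)) (indicator {x. m\<^sup>2*u ((1/m) *. x) > 0})"
  using lap_scale[of u G "indicator {x. u x > 0}" m] assms(2) by simp
 thus ?thesis using assms(1) unfolding sol_def by auto
qed

section \<open>Growth of the coefficient integrals and the blow-down of the model\<close>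

context parab
begin

text \<open>Two horizontal directions exist, and each of their factors under the root is at least
  \<open>bta*(1+s)\<close>; the remaining factors stay above their value at 0.\<close>

lemma f_decay: "EX K>0. ALL s>=0. f s <= K/(1+s)"
proof -
 obtain j1 where j1: "j1 \<in> W" using cardW by fastforce
 have "card (W - {j1}) >= 1" using cardW finW j1 by simp
 then obtain j2 where j2: "j2 \<in> W" "j2 \<noteq> j1" by (metis DiffE card.empty equals0I insertI1 not_one_le_zero)
 define bta where "bta = min 1 (min (b j1) (b j2))"
 define rho where "rho = (\<Prod>j\<in>W - {j1} - {j2}. b j)"
 have bta: "bta > 0" "bta <= 1" "bta <= b j1" "bta <= b j2" using b j1 j2 by (auto simp: bta_def)
 have rho: "rho > 0" unfolding rho_def using b by (intro Groups_Big.linordered_semidom_class.prod_pos) auto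
 show ?thesis
 proof (rule exI[of _ "1/(bta * sqrt rho)"], intro conjI allI impI)
  show "1/(bta * sqrt rho) > 0" using bta rho by simp
  fix s :: real assume s: "s >= 0"
  have "bta * s <= s" using mult_right_mono[OF bta(2) s] by simp
  hence b1: "bta*(1+s) <= b j1+s" "bta*(1+s) <= b j2+s"
   using bta unfolding distrib_left by linarith+
  have rhos: "rho <= (\<Prod>j\<in>W - {j1} - {j2}. b j+s)"
   unfolding rho_def
  proof (rule prod_mono)
   fix j assume "j \<in> W - {j1} - {j2}"
   thus "0 <= b j \<and> b j <= b j+s" using b[of j] s by simp
  qed
  have "(\<Prod>j\<in>W. b j+s) = (b j1+s)*(\<Prod>j\<in>W - {j1}. b j+s)"
   by (rule prod.remove[OF finW j1])
  also have "(\<Prod>j\<in>W - {j1}. b j+s) = (b j2+s)*(\<Prod>j\<in>W - {j1} - {j2}. b j+s)"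
   by (rule prod.remove) (use finW j2 in auto)
  also have "(b j1+s)*((b j2+s)*(\<Prod>j\<in>W - {j1} - {j2}. b j+s)) >= (bta*(1+s))*((bta*(1+s))*rho)"
  proof (intro mult_mono b1 rhos)
   show "0 <= b j1+s" "0 <= b j2+s" using bta s by auto
   show "0 <= bta*(1+s)*rho" "0 <= rho" using bta s rho by auto
  qed
  finally have "(bta*(1+s))\<^sup>2*rho <= (\<Prod>j\<in>W. b j+s)" by (simp add: power2_eq_square mult_ac)
  hence "sqrt ((bta*(1+s))^2*rho) <= sqrt (\<Prod>j\<in>W. b j+s)" by (rule real_sqrt_le_mono)
  moreover have "sqrt ((bta*(1+s))^2*rho) = bta*(1+s) * sqrt rho" using bta s by (simp add: real_sqrt_mult)
  ultimately have "f s <= 1/(bta*(1+s) * sqrt rho)"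
   unfolding f_def using bta s rho prod_pos[OF s] by (intro divide_left_mono mult_pos_pos) auto
  thus "f s <= 1/(bta * sqrt rho)/(1+s)" by (simp add: mult_ac)
 qed
qed

lemma I0_mono: "0 <= l ==> l <= m ==> I0 l <= I0 m"
 using I_lip(3)[of l m] by simp

lemma I0_ge: assumes "t >= 0" shows "t * f t <= I0 t"
proof -
 have "f t*(t-0) <= I0 t-I0 0" unfolding I0_def
  by (rule integral_upto_bounds(2)[OF f_cont]) (use assms f_antimono in auto)
 thus ?thesis by (simp add: mult.commute)
qed

lemma I0_pos: "t > 0 ==> I0 t > 0"
 using I0_ge[of t] f_pos[of t] mult_pos_pos[of t "f t"] by linarith

lemma I0_diff_le: assumes "0 <= l" "l <= m" shows "I0 m-I0 l <= f l*(m-l)"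
 unfolding I0_def by (rule integral_upto_bounds(1)[OF f_cont assms]) (use assms f_antimono in auto)

lemma I0_diff_ge: assumes "0 <= l" "l <= m" shows "f m*(m-l) <= I0 m-I0 l"
 unfolding I0_def by (rule integral_upto_bounds(2)[OF f_cont assms]) (use assms f_antimono in auto)

lemma I0_scale: assumes "t >= 0" "k >= 1" shows "I0 (k*t) <= k*I0 t"
proof -
 have "t <= k*t" using assms mult_right_mono[of 1 k t] by simp
 hence "I0 (k*t)-I0 t <= f t*(k*t-t)" using assms by (intro I0_diff_le) auto
 also have "\<dots> = (k-1)*(t * f t)" by (simp add: algebra_simps)
 also have "\<dots> <= (k-1)*I0 t" using I0_ge[OF assms(1)] assms by (intro mult_left_mono) auto
 finally show ?thesis by (simp add: algebra_simps)
qed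

lemma I1_diff_le:
 assumes "0 <= l" "l <= m" "\<And>s. l <= s ==> s <= m ==> s * f s <= K"
 shows "I1 m-I1 l <= K*(m-l)"
 unfolding I1_def by (rule integral_upto_bounds(1)[OF sf_cont assms(1,2)]) (use assms in auto)

lemma I1_mono: assumes "0 <= l" "l <= m" shows "I1 l <= I1 m"
proof -
 have "0*(m-l) <= I1 m-I1 l" unfolding I1_def
  by (rule integral_upto_bounds(2)[OF sf_cont assms]) (use assms in \<open>simp add: less_imp_le[OF f_pos]\<close>)
 thus ?thesis by simp
qed

lemma I1_nonneg: "l >= 0 ==> I1 l >= 0"
 using I1_mono[of 0 l] by simp

lemma I1_le: assumes "l >= 0" shows "I1 l <= l*I0 l"
proof -
 have "(%s. s * f s) integrable_on {0..l}" "(%s. l * f s) integrable_on {0..l}"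
  by (auto intro!: integrable_continuous_interval continuous_intros continuous_on_subset[OF f_cont])
 hence "integral {0..l} (%s. s * f s) <= integral {0..l} (%s. l * f s)"
  by (rule integral_le) (auto intro!: mult_right_mono less_imp_le[OF f_pos])
 thus ?thesis by (simp add: I1_def I0_def)
qed

lemma I0_cont: "continuous_on {0..} I0"
proof (rule continuous_on_subset[of "{0..}"])
 show "continuous_on {0..} I0"
 proof (rule lipschitz_on_continuous_on)
  show "(f 0)-lipschitz_on {0..} I0"
  proof (rule lipschitz_onI)
   fix x y :: real assume "x \<in> {0..}" "y \<in> {0..}"
   thus "dist (I0 x) (I0 y) <= f 0*dist x y" using I_abs_lip(2)[of y x] by (simp add: dist_real_def)
  qed (use f_pos[of 0] in auto)
 qed
qed auto

text \<open>Holds whether or not \<open>I0\<close> is bounded, so dimension three (logarithmic growth) needs no separate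
 treatment.\<close>

lemma slow_variation:
 assumes "eps > 0"
 shows "EX s0>=1. ALL s>=s0. s * f s <= eps*I0 s"
proof (cases "EX B. ALL s>=0. I0 s <= B")
 case True
 then obtain B where B: "ALL s>=0. I0 s <= B" by blast
 define S where "S = Sup (I0 ` {0..})"
 have bdd: "bdd_above (I0 ` {0..})" using B by (auto simp: bdd_above_def)
 define dlt where "dlt = eps*I0 1/2"
 have dlt: "dlt > 0" using assms I0_pos[of 1] by (simp add: dlt_def)
 have "EX t:{0..}. S-dlt < I0 t"
  using less_cSup_iff[of "I0 ` {0..}" "S-dlt"] bdd dlt by (auto simp: S_def)
 then obtain t where t: "t >= 0" "S-dlt < I0 t" by auto
 show ?thesis
 proof (rule exI[of _ "max 1 (2*t)"], intro conjI allI impI)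
  show "max 1 (2*t) >= 1" by simp
  fix s assume s: "s >= max 1 (2*t)"
  have "f s*(s-s/2) <= I0 s-I0 (s/2)" using s by (intro I0_diff_ge) auto
  moreover have "I0 s <= S" unfolding S_def using s bdd by (intro cSup_upper) auto
  moreover have "I0 t <= I0 (s/2)" using s t by (intro I0_mono) auto
  ultimately have "f s*(s-s/2) <= dlt" using t by linarith
  hence "s * f s <= eps*I0 1" by (simp add: dlt_def algebra_simps)
  also have "\<dots> <= eps*I0 s" using s assms by (intro mult_left_mono I0_mono) auto
  finally show "s * f s <= eps*I0 s" .
 qed
next
 case False
 obtain K where K: "K > 0" "ALL s>=0. f s <= K/(1+s)" using f_decay by blast
 obtain t where t: "t >= 0" "I0 t > K/eps" using False by (meson not_le)
 show ?thesis
 proof (rule exI[of _ "max 1 t"], intro conjI allI impI)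
  show "max 1 t >= 1" by simp
  fix s assume s: "s >= max 1 t"
  have "s * f s <= s*(K/(1+s))" using K s by (intro mult_left_mono) auto
  also have "\<dots> <= K" using K s by (simp add: field_simps)
  also have "K <= eps*I0 t" using t assms by (simp add: field_simps)
  also have "\<dots> <= eps*I0 s" using s t assms by (intro mult_left_mono I0_mono) auto
  finally show "s * f s <= eps*I0 s" .
 qed
qed

text \<open>A crude bound valid in every dimension considered, from \<open>f s <= K/(1+s)\<close>
  and \<open>2 * sqrt s <= 1+s\<close>. It provides continuity at size zero.\<close>

lemma I0_sqrt_bound: "EX K>0. ALL t>=0. I0 t <= K * sqrt t"
proof -
 obtain K where K: "K > 0" "ALL s>=0. f s <= K/(1+s)" using f_decay by blast
 have "I0 t <= K * sqrt t" if t: "t >= 0" for t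
 proof (cases "t = 0")
  case False
  hence tp: "0 < t" using t by simp
  have "K * sqrt 0-I0 0 <= K * sqrt t-I0 t"
  proof (rule DERIV_nonneg_imp_increasing_open[OF t])
   fix s :: real assume s: "0 < s" "s < t"
   have d: "((%s. K * sqrt s-I0 s) has_real_derivative K*(inverse (sqrt s)/2)-f s) (at s)"
    unfolding I0_def[abs_def]
    by (intro DERIV_diff DERIV_cmult DERIV_real_sqrt integral_upto_deriv f_cont s)
   have "0 <= (1-sqrt s)^2" by simp
   hence "2 * sqrt s <= 1+s" using s by (simp add: power2_eq_square algebra_simps)
   hence "K/(1+s) <= K/(2 * sqrt s)" using K s by (intro divide_left_mono) auto
   hence "f s <= K*(inverse (sqrt s)/2)" using K(2)[rule_format, of s] s by (simp add: inverse_eq_divide)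
   thus "EX y. ((%s. K * sqrt s-I0 s) has_real_derivative y) (at s) \<and> 0 <= y" using d by force
  next
   show "continuous_on {0..t} (%s. K * sqrt s-I0 s)"
    by (intro continuous_intros continuous_on_subset[OF I0_cont]) auto
  qed
  thus ?thesis by simp
 qed simp
 thus ?thesis using K(1) by blast
qed

text \<open>The integrals over the whole half line, written as suprema. They are, up to c, the
  coefficients of the quadratic blow-down p of V.\<close>

definition Iinf :: "'a => real" where "Iinf j = Sup (I j ` {0..})"
definition p :: "'a => real" where "p x = c*(\<Sum>j\<in>W. Iinf j*(x \<bullet> j)^2)"

text \<open>The integrand is at most a constant times \<open>1/(b j+s)^2\<close>, whose primitive is
  compared with \<open>I j\<close> by monotonicity.\<close>

lemma I_tail_pre:
 "EX K>0. ALL j:W. ALL l m. 0 <= l --> l <= m --> I j m-I j l <= K/(b j+l)"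
proof -
 obtain K where K: "K > 0" "ALL s>=0. f s <= K/(1+s)" using f_decay by blast
 define B where "B = 1+(\<Sum>j\<in>W. b j)"
 have B: "b j <= B" "B >= 1" if "j \<in> W" for j
  using member_le_sum[of j W b] that finW b by (auto simp: B_def sum_nonneg less_imp_le)
 have Bp: "B > 0" unfolding B_def using b by (intro add_pos_nonneg sum_nonneg) (auto simp: less_imp_le)
 have "I j m-I j l <= (K*B)/(b j+l)" if j: "j \<in> W" and l: "0 <= l" "l <= m" for j l m
 proof -
  have fb: "f s/(b j+s) <= K*B*(1/(b j+s)^2)" if s: "s >= 0" for s
  proof -
   have "b j+s <= B*(1+s)" using B[OF j] s mult_right_mono[of 1 B s] by (simp add: distrib_left)
   hence "K/(1+s) <= K*B/(b j+s)"
    using K s bs[OF j s] Bp by (simp add: divide_simps mult_ac)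
   hence "f s <= K*B/(b j+s)" using K s by (meson order_trans)
   hence "f s/(b j+s) <= K*B/(b j+s)/(b j+s)" using bs[OF j s] by (intro divide_right_mono) auto
   thus ?thesis by (simp add: power2_eq_square)
  qed
  have "(- (K*B/(b j+l)))-I j l <= (- (K*B/(b j+m)))-I j m"
  proof (rule DERIV_nonneg_imp_increasing_open[OF l(2)])
   fix s :: real assume s: "l < s" "s < m"
   have "((%s. (- (K*B/(b j+s)))-I j s) has_real_derivative K*B*(1/(b j+s)^2)-f s/(b j+s)) (at s)"
    unfolding I_def[abs_def]
   proof (intro DERIV_diff integral_upto_deriv fj_cont[OF j])
    show "((%s. - (K*B/(b j+s))) has_real_derivative K*B*(1/(b j+s)^2)) (at s)"
     using bs[OF j, of s] s l by (auto intro!: derivative_eq_intros simp: power2_eq_square)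
   qed (use s l in auto)
   thus "EX y. ((%s. (- (K*B/(b j+s)))-I j s) has_real_derivative y) (at s) \<and> 0 <= y"
    using fb[of s] s l by force
  next
   have "continuous_on {0..} (I j)"
   proof (rule lipschitz_on_continuous_on)
    show "(f 0/b j)-lipschitz_on {0..} (I j)"
    proof (rule lipschitz_onI)
     fix x y :: real assume "x \<in> {0..}" "y \<in> {0..}"
     thus "dist (I j x) (I j y) <= (f 0/b j)*dist x y" using I_abs_lip(1)[of y x j] j by (simp add: dist_real_def)
    qed (use f_pos[of 0] b[OF j] in auto)
   qed
   thus "continuous_on {l..m} (%s. (- (K*B/(b j+s)))-I j s)"
    using bs[OF j] l by (intro continuous_intros) (auto intro: continuous_on_subset simp: order_less_imp_not_eq2)
  qed
  hence "I j m-I j l <= K*B/(b j+l)-K*B/(b j+m)" by simp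
  moreover have "K*B/(b j+m) >= 0" using K Bp bs[OF j, of m] l by simp
  ultimately show ?thesis by linarith
 qed
 moreover have "K*B > 0" using K Bp by simp
 ultimately show ?thesis by blast
qed

lemma I_tail:
 "EX K>0. ALL j:W. ALL l>=0. 0 <= Iinf j-I j l \<and> Iinf j-I j l <= K/(b j+l)"
proof -
 obtain K where K: "K > 0" "ALL j:W. ALL l m. 0 <= l --> l <= m --> I j m-I j l <= K/(b j+l)"
  using I_tail_pre by blast
 have "0 <= Iinf j-I j l \<and> Iinf j-I j l <= K/(b j+l)" if j: "j \<in> W" and l: "l >= 0" for j l
 proof -
  have ub: "I j m <= I j l+K/(b j+l)" if "m >= 0" for m
  proof (cases "l <= m")
   case True thus ?thesis using K(2) j l by force
  next
   case False
   hence "I j m <= I j l" using I_lip(1)[of m l j] that j by simp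
   moreover have "K/(b j+l) >= 0" using K bs[OF j l] by simp
   ultimately show ?thesis by linarith
  qed
  have bdd: "bdd_above (I j ` {0..})" using ub by (auto simp: bdd_above_def)
  have "I j l <= Iinf j" unfolding Iinf_def using bdd l by (intro cSup_upper) auto
  moreover have "Iinf j <= I j l+K/(b j+l)" unfolding Iinf_def using ub by (intro cSup_least) auto
  ultimately show ?thesis by linarith
 qed
 thus ?thesis using K(1) by blast
qed

lemma Iinf_pos: assumes "j \<in> W" shows "Iinf j > 0"
proof -
 obtain K where K: "ALL j:W. ALL l>=0. 0 <= Iinf j-I j l \<and> Iinf j-I j l <= K/(b j+l)" using I_tail by blast
 have "(f 1/(b j+1))*(1-0) <= I j 1-I j 0" unfolding I_def
 proof (rule integral_upto_bounds(2)[OF fj_cont[OF assms]])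
  fix s :: real assume "0 <= s" "s <= 1"
  thus "f 1/(b j+1) <= f s/(b j+s)"
   using f_antimono[of s 1] f_pos[of s] bs[OF assms, of s] by (intro frac_le) auto
 qed auto
 moreover have "f 1/(b j+1) > 0" using f_pos[of 1] bs[OF assms, of 1] by simp
 ultimately have "I j 1 > 0" by simp
 moreover have "I j 1 <= Iinf j" using K[rule_format, OF assms, of 1] by simp
 ultimately show ?thesis by linarith
qed

text \<open>The limit of \<open>sum_I\<close>, since f tends to zero. It expresses that p has
  Laplacian 1.\<close>

lemma sum_Iinf: "c*(2*(\<Sum>j\<in>W. Iinf j)) = 1"
proof -
 obtain K where K: "K > 0" "ALL j:W. ALL l>=0. 0 <= Iinf j-I j l \<and> Iinf j-I j l <= K/(b j+l)" using I_tail by blast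
 obtain K' where K': "K' > 0" "ALL s>=0. f s <= K'/(1+s)" using f_decay by blast
 have lim0: "((%n. k/(x+real n)) \<longlongrightarrow> 0) sequentially" for k x :: real
  by (rule real_tendsto_divide_at_top[OF tendsto_const filterlim_tendsto_add_at_top[OF tendsto_const filterlim_real_sequentially]])
 have "(%n. I j (real n)) \<longlonglongrightarrow> Iinf j" if j: "j \<in> W" for j
 proof (rule tendsto_sandwich)
  show "(%n. Iinf j-K/(b j+real n)) \<longlonglongrightarrow> Iinf j" using tendsto_diff[OF tendsto_const lim0[of K "b j"]] by simp
  show "(%n. Iinf j) \<longlonglongrightarrow> Iinf j" by simp
 qed (use K j in \<open>auto intro!: always_eventually simp: algebra_simps\<close>)
 hence "(%n. \<Sum>j\<in>W. I j (real n)) \<longlonglongrightarrow> (\<Sum>j\<in>W. Iinf j)" by (intro tendsto_sum)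
 moreover have "(%n. \<Sum>j\<in>W. I j (real n)) = (%n. 2*(f 0-f (real n)))" by (simp add: sum_I)
 moreover have "(%n. 2*(f 0-f (real n))) \<longlonglongrightarrow> 2*(f 0-0)"
 proof -
  have "(%n. f (real n)) \<longlonglongrightarrow> 0"
  proof (rule tendsto_sandwich[OF _ _ tendsto_const lim0[of K' 1]])
   show "\<forall>\<^sub>F n in sequentially. 0 <= f (real n)" by (simp add: less_imp_le[OF f_pos])
   show "\<forall>\<^sub>F n in sequentially. f (real n) <= K'/(1+real n)" using K' by simp
  qed
  thus ?thesis by (intro tendsto_intros)
 qed
 ultimately have "(\<Sum>j\<in>W. Iinf j) = 2 * f 0" using LIMSEQ_unique[of "%n. 2*(f 0-f (real n))"] by simp
 thus ?thesis using f_pos[of 0] by (simp add: c_def)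
qed

end

section \<open>Dependence on the parameters\<close>

text \<open>A one-sided form of Cauchy's mean value theorem with Y as clock. Derivatives are
  required in the open interval only, since the parameter 0 is a mere point of continuity.\<close>

lemma derivative_domination:
 fixes F Y :: "real => real"
 assumes cont: "continuous_on {0..tau} F" "continuous_on {0..tau} Y"
  and F: "\<And>m. 0 < m ==> m < tau ==> (F has_real_derivative F' m) (at m)"
  and Y: "\<And>m. 0 < m ==> m < tau ==> (Y has_real_derivative Y' m) (at m)"
  and le: "\<And>m. 0 < m ==> m < tau ==> \<bar>F' m\<bar> <= K*Y' m"
  and mm: "0 <= m" "m <= m'" "m' <= tau"
 shows "\<bar>F m'-F m\<bar> <= K*(Y m'-Y m)"
proof -
 have sub: "continuous_on {m..m'} F" "continuous_on {m..m'} Y"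
  using cont mm by (auto intro: continuous_on_subset)
 have "K*Y m-F m <= K*Y m'-F m'"
 proof (rule DERIV_nonneg_imp_increasing_open[OF mm(2)])
  fix t assume t: "m < t" "t < m'"
  have "((%t. K*Y t-F t) has_real_derivative K*Y' t-F' t) (at t)"
   using t mm by (intro DERIV_diff DERIV_cmult F Y) auto
  moreover have "K*Y' t-F' t >= 0" using le[of t] t mm by auto
  ultimately show "EX y. ((%t. K*Y t-F t) has_real_derivative y) (at t) \<and> 0 <= y" by blast
 qed (intro continuous_intros sub)
 moreover have "K*Y m+F m <= K*Y m'+F m'"
 proof (rule DERIV_nonneg_imp_increasing_open[OF mm(2)])
  fix t assume t: "m < t" "t < m'"
  have "((%t. K*Y t+F t) has_real_derivative K*Y' t+F' t) (at t)"
   using t mm by (intro DERIV_add DERIV_cmult F Y) auto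
  moreover have "K*Y' t+F' t >= 0" using le[of t] t mm by auto
  ultimately show "EX y. ((%t. K*Y t+F t) has_real_derivative y) (at t) \<and> 0 <= y" by blast
 qed (intro continuous_intros sub)
 ultimately show ?thesis by (simp add: right_diff_distrib abs_le_iff)
qed

context parab
begin

definition Gp :: "'a => 'a" where "Gp x = (\<Sum>j\<in>W. (2 * c*Iinf j*(x \<bullet> j)) *. j)"

lemma Gp_inner: "Gp x \<bullet> h = c*(\<Sum>j\<in>W. 2*Iinf j*(x \<bullet> j)*(h \<bullet> j))"
 unfolding Gp_def inner_sum_left sum_distrib_left by (simp add: inner_commute[of _ h] mult_ac)

lemma Gp_sym: "Gp x \<bullet> h = Gp h \<bullet> x"
 unfolding Gp_inner by (simp add: mult_ac)

lemma linear_Gp: "linear Gp"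
 by (rule linearI) (simp_all add: Gp_def inner_add_left sum.distrib scaleR_sum_right algebra_simps)

lemma p_expand: "p (x+h) = p x+Gp x \<bullet> h+p h"
proof -
 have "Iinf j*((x+h) \<bullet> j)^2 = Iinf j*(x \<bullet> j)^2+2*Iinf j*(x \<bullet> j)*(h \<bullet> j)+Iinf j*(h \<bullet> j)^2" for j
  by (simp add: inner_add_left power2_eq_square algebra_simps)
 thus ?thesis unfolding p_def Gp_inner by (simp add: sum.distrib distrib_left)
qed

lemma p_minus [simp]: "p (- h) = p h"
 by (simp add: p_def)

lemma p_scale: "p (r *. x) = r^2 * p x"
 by (simp add: p_def power_mult_distrib sum_distrib_left mult_ac)

lemma p_nonneg: "p x >= 0"
 unfolding p_def using c_pos by (intro mult_nonneg_nonneg sum_nonneg) (auto intro: less_imp_le[OF Iinf_pos])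

lemma p_bounds: "EX c0>0. EX C0>0. ALL x. c0*(norm (perp e x))^2 <= p x \<and> p x <= C0*(norm (perp e x))^2"
proof -
 have Wne: "W \<noteq> {}" using cardW by auto
 define m where "m = Min (Iinf ` W)"
 define M where "M = (\<Sum>j\<in>W. Iinf j)"
 have m: "m > 0" "\<And>j. j \<in> W ==> m <= Iinf j" using Wne finW Iinf_pos by (auto simp: m_def)
 have M: "\<And>j. j \<in> W ==> Iinf j <= M" unfolding M_def using finW Iinf_pos by (intro member_le_sum) (auto intro: less_imp_le)
 obtain j where "j \<in> W" using Wne by blast
 hence Mp: "M > 0" using M[of j] Iinf_pos[of j] by linarith
 show ?thesis
 proof (rule exI[of _ "c*m"], rule conjI, use c_pos m in simp, rule exI[of _ "c*M"], intro conjI allI)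
  show "c*M > 0" using c_pos Mp by simp
  fix x
  have "(\<Sum>j\<in>W. m*(x \<bullet> j)^2) <= (\<Sum>j\<in>W. Iinf j*(x \<bullet> j)^2)" using m by (intro sum_mono mult_right_mono) auto
  thus "c*m*(norm (perp e x))^2 <= p x" unfolding p_def perp_frame sum_distrib_left[symmetric] mult.assoc
   using c_pos by (intro mult_left_mono) auto
  have "(\<Sum>j\<in>W. Iinf j*(x \<bullet> j)^2) <= (\<Sum>j\<in>W. M*(x \<bullet> j)^2)" using M by (intro sum_mono mult_right_mono) auto
  thus "p x <= c*M*(norm (perp e x))^2" unfolding p_def perp_frame sum_distrib_left[symmetric] mult.assoc
   using c_pos by (intro mult_left_mono) auto
 qed
qed

lemma p_shift: "p (x+t *. e) = p x"
 by (simp add: p_def inner_add_left)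

lemma p_deriv: "(p has_derivative (%h. Gp x \<bullet> h)) (at x)"
proof -
 obtain C0 where C0: "C0 > 0" "ALL x. p x <= C0*(norm (perp e x))^2" using p_bounds by blast
 show ?thesis
 proof (rule has_derivative_quadratic_bound[where r = 1 and K = C0])
  fix y
  have "p y-p x-Gp x \<bullet> (y-x) = p (y-x)" using p_expand[of x "y-x"] by simp
  moreover have "p (y-x) <= C0*(norm (y-x))^2"
   using C0 norm_perp_le[OF e, of "y-x"] by (meson less_imp_le mult_left_mono norm_ge_zero order_trans power_mono)
  ultimately show "\<bar>p y-p x-Gp x \<bullet> (y-x)\<bar> <= C0*(norm (y-x))^2" using p_nonneg[of "y-x"] by simp
 qed simp
qed

lemma dim_ge_2: "DIM('a) >= 2"
proof -
 have "independent (insert e W)"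
  using orth by (rule pairwise_orthogonal_independent) (use e unit in force)
 hence "card (insert e W) <= DIM('a)" using independent_card_le by blast
 thus ?thesis using cardW eW finW by simp
qed

lemma dim_ge_3: "DIM('a) >= 3"
proof -
 have "independent (insert e W)"
  using orth by (rule pairwise_orthogonal_independent) (use e unit in force)
 hence "card (insert e W) <= DIM('a)" using independent_card_le by blast
 thus ?thesis using cardW eW finW by simp
qed

lemma p_sol: "sol p"
 unfolding sol_def
proof (intro conjI allI p_nonneg)
 have pc: "continuous_on UNIV p"
  using has_derivative_continuous[OF p_deriv] by (simp add: continuous_on_eq_continuous_at)
 obtain c0 where c0: "c0 > 0" "ALL x. c0*(norm (perp e x))^2 <= p x" using p_bounds by blast
 have bl: "bounded_linear Gp" using linear_Gp by (simp add: linear_conv_bounded_linear)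
 have tr: "(\<Sum>b\<in>Basis. Gp b \<bullet> b) = 1"
 proof -
  have "Gp j \<bullet> j = c*(2*Iinf j)" if j: "j \<in> W" for j
  proof -
   have "(\<Sum>i\<in>W. 2*Iinf i*(j \<bullet> i)*(j \<bullet> i)) = (\<Sum>i\<in>W. if i = j then 2*Iinf j else 0)"
    by (rule sum.cong[OF refl]) (use j jk in auto)
   thus ?thesis using finW j by (simp add: Gp_inner)
  qed
  moreover have "Gp e \<bullet> e = 0" by (simp add: Gp_inner)
  ultimately have "(\<Sum>b\<in>Basis. Gp b \<bullet> b) = (\<Sum>j\<in>W. c*(2*Iinf j))"
   unfolding trace_frame[OF linear_Gp] by (simp cong: sum.cong)
  thus ?thesis using sum_Iinf by (simp add: sum_distrib_left)
 qed
 have "negligible (span {e})"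
  by (rule negligible_lowdim) (use dim_ge_2 in \<open>simp add: dim_span\<close>)
 hence "span {e} \<in> null_sets lebesgue" by (simp add: negligible_iff_null_sets)
 hence "span {e} \<in> null_sets lborel" using closed_span[of "{e}"] by (auto simp: null_sets_def)
 hence AE: "AE z in lborel. z \<notin> span {e}" by (rule AE_not_in)
 show "EX G. lap p G (indicator {x. 0 < p x})"
 proof (rule exI[of _ Gp], unfold lap_def, intro conjI allI p_deriv)
  fix R
  obtain L where L: "\<And>x. norm (Gp x) <= norm x*L" using bounded_linear.bounded[OF bl] by blast
  show "EX L. ALL y:cball 0 R. ALL z:cball 0 R. norm (Gp y-Gp z) <= L*norm (y-z)"
   using L[of "_-_"] by (intro exI[of _ L]) (simp add: linear_diff[OF linear_Gp, symmetric] mult.commute)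
 next
  have [measurable]: "p \<in> borel_measurable borel" using pc by (rule borel_measurable_continuous_onI)
  show "(indicator {x. 0 < p x} :: 'a => real) \<in> borel_measurable borel" by measurable
 next
  show "EX K. ALL x:cball 0 R. \<bar>indicator {x. 0 < p x} x :: real\<bar> <= K" for R
   by (intro exI[of _ 1]) (auto simp: indicator_def)
 next
  show "AE x in lborel. EX H. (Gp has_derivative H) (at x) \<and> (\<Sum>b\<in>Basis. H b \<bullet> b) = indicator {x. 0 < p x} x"
   using AE
  proof (rule eventually_mono)
   fix x assume x: "x \<notin> span {e}"
   have "perp e x \<noteq> 0"
   proof
    assume "perp e x = 0"
    hence "x = (x \<bullet> e) *. e" by (simp add: perp_def)
    thus False using x by (metis span_base span_mul singletonI)
   qed
   hence "c0*(norm (perp e x))^2 > 0" using c0 by simp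
   hence "p x > 0" using c0(2) by (meson less_le_trans)
   thus "EX H. (Gp has_derivative H) (at x) \<and> (\<Sum>b\<in>Basis. H b \<bullet> b) = indicator {x. 0 < p x} x"
    using bounded_linear_imp_has_derivative[OF bl] tr by auto
  qed
 qed
qed

text \<open>The condition \<open>T z (lam z) <= 0\<close> bounds the weighted squares by
  \<open>z \<bullet> e + lam z/4\<close>. This is the decay of \<open>z \<bullet> j\<close> relative
  to \<open>b j+lam z\<close> that makes the corrections to p lower order.\<close>

lemma lam_sq: "(\<Sum>j\<in>W. (z \<bullet> j)\<^sup>2/(b j+lam z)) <= 3*norm z"
 using lam(2)[of z] lam_le[of z] abs_inner_unit_le[OF e, of z] unfolding T_def by linarith

lemma V_p_diff: "EX K>0. ALL z. \<bar>V z-p z\<bar> <= K*(norm z+norm z * sqrt (norm z))"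
proof -
 obtain K1 where K1: "K1 > 0" "ALL j:W. ALL l>=0. 0 <= Iinf j-I j l \<and> Iinf j-I j l <= K1/(b j+l)" using I_tail by blast
 obtain K2 where K2: "K2 > 0" "ALL t>=0. I0 t <= K2 * sqrt t" using I0_sqrt_bound by blast
 show ?thesis
 proof (rule exI[of _ "c*(3*K1+9*K2)"], intro conjI allI)
  show "c*(3*K1+9*K2) > 0" using c_pos K1 K2 by simp
  fix z
  define l where "l = lam z"
  have l: "0 <= l" "l <= 8*norm z" using lam(1) lam_le by (auto simp: l_def)
  define A where "A = (\<Sum>j\<in>W. (Iinf j-I j l)*(z \<bullet> j)^2)"
  have A: "0 <= A" "A <= 3*K1*norm z"
  proof -
   show "0 <= A" unfolding A_def using K1 l by (intro sum_nonneg mult_nonneg_nonneg) auto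
   have "A <= (\<Sum>j\<in>W. K1*((z \<bullet> j)^2/(b j+l)))" unfolding A_def
   proof (rule sum_mono)
    fix j assume j: "j \<in> W"
    have "(Iinf j-I j l)*(z \<bullet> j)^2 <= (K1/(b j+l))*(z \<bullet> j)^2"
     using K1 l j by (intro mult_right_mono) auto
    thus "(Iinf j-I j l)*(z \<bullet> j)^2 <= K1*((z \<bullet> j)^2/(b j+l))" by simp
   qed
   also have "\<dots> <= K1*(3*norm z)" unfolding sum_distrib_left[symmetric] l_def
    using lam_sq[of z] K1 by (intro mult_left_mono) auto
   finally show "A <= 3*K1*norm z" by simp
  qed
  have I0l: "0 <= I0 l" "I0 l <= 3*K2 * sqrt (norm z)"
  proof -
   show "0 <= I0 l" using I0_mono[of 0 l] l by simp
   have "I0 l <= K2 * sqrt l" using K2 l by blast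
   also have "\<dots> <= K2 * sqrt (9*norm z)" using K2 l by (intro mult_left_mono real_sqrt_le_mono) auto
   also have "sqrt (9*norm z) = 3 * sqrt (norm z)" using real_sqrt_mult[of 9 "norm z"] real_sqrt_unique[of 3 9] by simp
   finally show "I0 l <= 3*K2 * sqrt (norm z)" by simp
  qed
  have I1l: "0 <= I1 l" "I1 l <= (8*norm z)*(3*K2 * sqrt (norm z))"
  proof -
   show "0 <= I1 l" using I1_nonneg[OF l(1)] .
   have "I1 l <= l*I0 l" by (rule I1_le[OF l(1)])
   also have "\<dots> <= (8*norm z)*(3*K2 * sqrt (norm z))" using l I0l by (intro mult_mono) auto
   finally show "I1 l <= (8*norm z)*(3*K2 * sqrt (norm z))" .
  qed
  have I0e: "\<bar>I0 l*(z \<bullet> e)\<bar> <= (3*K2 * sqrt (norm z))*norm z"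
   unfolding abs_mult using I0l abs_inner_unit_le[OF e, of z] by (intro mult_mono) auto
  have "V z-p z = - c*(A+I0 l*(z \<bullet> e)+I1 l/4)"
   unfolding V_def U_def p_def A_def l_def[symmetric] by (simp add: left_diff_distrib sum_subtractf algebra_simps)
  hence "\<bar>V z-p z\<bar> = c*\<bar>A+I0 l*(z \<bullet> e)+I1 l/4\<bar>" using c_pos by (simp add: abs_mult)
  also have "\<dots> <= c*(3*K1*norm z+9*K2*(norm z * sqrt (norm z)))"
   using A I0e I1l c_pos by (intro mult_left_mono) (auto simp: abs_le_iff mult_ac)
  also have "\<dots> <= c*((3*K1+9*K2)*(norm z+norm z * sqrt (norm z)))"
   using K1 K2 c_pos by (intro mult_left_mono) (auto simp: algebra_simps)
  finally show "\<bar>V z-p z\<bar> <= c*(3*K1+9*K2)*(norm z+norm z * sqrt (norm z))" by simp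
 qed
qed

text \<open>The 2-homogeneous dilation of V by m; the value at \<open>m = 0\<close> is the limit, by
  \<open>phi_cont\<close>.\<close>

definition phi :: "'a => real => real" where
 "phi y m = (if m = 0 then p y else m\<^sup>2*V ((1/m) *. y))"

text \<open>The e-component of the gradient of V is \<open>-c*I0 (lam z)\<close>. After dilation by
  m, \<open>Y R m\<close> is therefore, up to sign, the vertical slope of \<open>phi\<close> at
  points whose confocal parameter is \<open>R/m\<close>.\<close>

definition Y :: "real => real => real" where "Y R m = c*m*I0 (R/m)"

lemma phi_sol: assumes "m >= 0" shows "sol (%x. phi (x-h) m)"
proof -
 have "sol (%x. phi x m)"
 proof (cases "m = 0")
  case True thus ?thesis using p_sol by (simp add: phi_def)
 next
  case False thus ?thesis using sol_scale[OF V_sol, of m] assms by (simp add: phi_def)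
 qed
 from sol_translate[OF this, of "- h"] show ?thesis by simp
qed

text \<open>Differentiating the dilation gives \<open>m*(2*V z-G z \<bullet> z)\<close>, in which
  the terms quadratic in the horizontal coordinates cancel.\<close>

lemma phi_deriv:
 assumes m: "m > 0"
 shows "(phi y has_real_derivative-c*(I0 (lam ((1/m) *. y))*(y \<bullet> e)+m*I1 (lam ((1/m) *. y))/2)) (at m)"
proof -
 define z where "z = (1/m) *. y"
 have y: "y = m *. z" using m by (simp add: z_def)
 have 1: "((%m. (1/m) *. y) has_derivative (%h. (- h/m^2) *. y)) (at m)"
  using m by (auto intro!: derivative_eq_intros simp: power2_eq_square inverse_eq_divide)
 have "((%m. V ((1/m) *. y)) has_derivative (%h. G z \<bullet> ((- h/m^2) *. y))) (at m)"
  using has_derivative_compose[OF 1 V_deriv] by (simp add: z_def)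
 hence 2: "((%m. V ((1/m) *. y)) has_real_derivative-(G z \<bullet> y)/m^2) (at m)"
  unfolding has_field_derivative_def by (rule has_derivative_eq_rhs) (auto simp: fun_eq_iff)
 have "((%m. m\<^sup>2*V ((1/m) *. y)) has_real_derivative 2*m*V z+m^2*(- (G z \<bullet> y)/m^2)) (at m)"
  by (rule derivative_eq_intros refl 2 | simp add: z_def)+
 hence 3: "((%m. m\<^sup>2*V ((1/m) *. y)) has_real_derivative m*(2*V z-G z \<bullet> z)) (at m)"
  using m by (simp add: y algebra_simps)
 define S where "S = (\<Sum>j\<in>W. I j (lam z)*(z \<bullet> j)^2)"
 have hV: "V z = c*(S-I0 (lam z)*(z \<bullet> e)-I1 (lam z)/4)" by (simp add: V_def U_def S_def)
 have hG: "G z \<bullet> z = c*(2*S-I0 (lam z)*(z \<bullet> e))"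
  unfolding G_def Gr_inner S_def by (simp add: sum_distrib_left power2_eq_square mult_ac)
 have "m*(2*V z-G z \<bullet> z) = - c*(I0 (lam z)*(m*(z \<bullet> e))+m*I1 (lam z)/2)"
  unfolding hV hG by (simp add: algebra_simps)
 moreover have "m*(z \<bullet> e) = y \<bullet> e" by (simp add: y)
 ultimately have 4: "((%m. m\<^sup>2*V ((1/m) *. y)) has_real_derivative-c*(I0 (lam z)*(y \<bullet> e)+m*I1 (lam z)/2)) (at m)"
  using 3 by simp
 have "(phi y has_real_derivative-c*(I0 (lam z)*(y \<bullet> e)+m*I1 (lam z)/2)) (at m)"
  by (rule has_field_derivative_transform_within_open[OF 4, of "{0<..}"]) (use m in \<open>auto simp: phi_def\<close>)
 thus ?thesis by (simp add: z_def)
qed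

lemma phi_cont: "continuous_on {0..tau} (phi y)"
 unfolding continuous_on_eq_continuous_within
proof
 fix m assume m: "m \<in> {0..tau}"
 show "continuous (at m within {0..tau}) (phi y)"
 proof (cases "m = 0")
  case False
  hence "isCont (phi y) m" using phi_deriv[of m y] m DERIV_isCont by force
  thus ?thesis by (rule continuous_at_imp_continuous_at_within)
 next
  case True
  obtain K where K: "K > 0" "ALL z. \<bar>V z-p z\<bar> <= K*(norm z+norm z * sqrt (norm z))" using V_p_diff by blast
  have "(phi y \<longlongrightarrow> p y) (at 0 within {0..tau})"
  proof (rule LIM_zero_cancel, rule Lim_null_comparison)
   show "\<forall>\<^sub>F t in at 0 within {0..tau}. norm (phi y t-p y) <= K*(t*norm y+sqrt t*(norm y * sqrt (norm y)))"
    unfolding eventually_at_filter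
   proof (rule always_eventually, intro allI impI)
    fix t assume t: "t \<noteq> 0" "t \<in> {0..tau}"
    hence tp: "t > 0" by auto
    define z where "z = (1/t) *. y"
    have y: "y = t *. z" using tp by (simp add: z_def)
    have "phi y t-p y = t^2*(V z-p z)" using tp by (simp add: phi_def z_def[symmetric] y p_scale right_diff_distrib)
    hence "\<bar>phi y t-p y\<bar> = t^2*\<bar>V z-p z\<bar>" by (simp add: abs_mult)
    also have "\<dots> <= t^2*(K*(norm z+norm z * sqrt (norm z)))" using K by (intro mult_left_mono) auto
    also have "\<dots> = K*(t*norm y+sqrt t*(norm y * sqrt (norm y)))"
    proof -
     have nz: "norm y = t*norm z" using tp by (simp add: y)
     define s where "s = sqrt t"
     have s: "s > 0" "t = s^2" using tp by (auto simp: s_def)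
     have "sqrt (norm y) = s * sqrt (norm z)" unfolding nz s_def by (rule real_sqrt_mult)
     thus ?thesis unfolding nz s_def[symmetric] unfolding s(2)
      by (simp add: power2_eq_square algebra_simps)
    qed
    finally show "norm (phi y t-p y) <= K*(t*norm y+sqrt t*(norm y * sqrt (norm y)))" by simp
   qed
   have "((%t. K*(t*norm y+sqrt t*(norm y * sqrt (norm y)))) \<longlongrightarrow> K*(0*norm y+sqrt 0*(norm y * sqrt (norm y)))) (at 0 within {0..tau})"
    by (intro tendsto_intros)
   thus "((%t. K*(t*norm y+sqrt t*(norm y * sqrt (norm y)))) \<longlongrightarrow> 0) (at 0 within {0..tau})" by simp
  qed
  thus ?thesis using True by (simp add: continuous_within phi_def)
 qed
qed

lemma Y_0 [simp]: "Y R 0 = 0"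
 by (simp add: Y_def)

lemma Y_deriv:
 assumes R: "R > 0" and m: "m > 0"
 shows "(Y R has_real_derivative c*(I0 (R/m)-(R/m) * f (R/m))) (at m)"
proof -
 have 1: "((%m. R/m) has_real_derivative-R/m^2) (at m)"
  using m by (auto intro!: derivative_eq_intros simp: power2_eq_square)
 have 2: "(I0 has_real_derivative f (R/m)) (at (R/m))"
  unfolding I0_def[abs_def] using R m by (intro integral_upto_deriv f_cont) auto
 have 3: "((%m. I0 (R/m)) has_real_derivative f (R/m)*(- R/m^2)) (at m)"
  by (rule DERIV_chain'[OF 1 2])
 have "((%m. (c*m)*I0 (R/m)) has_real_derivative c*I0 (R/m)+(f (R/m)*(- R/m^2))*(c*m)) (at m)"
  by (rule DERIV_mult[OF _ 3]) (auto intro!: derivative_eq_intros)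
 thus ?thesis unfolding Y_def[abs_def]
  by (rule DERIV_cong) (use m in \<open>simp add: power2_eq_square algebra_simps\<close>)
qed

lemma Y_cont: assumes R: "R > 0" shows "continuous_on {0..tau} (Y R)"
 unfolding continuous_on_eq_continuous_within
proof
 fix m assume m: "m \<in> {0..tau}"
 show "continuous (at m within {0..tau}) (Y R)"
 proof (cases "m = 0")
  case False
  hence "isCont (Y R) m" using Y_deriv[OF R, of m] m DERIV_isCont by force
  thus ?thesis by (rule continuous_at_imp_continuous_at_within)
 next
  case True
  obtain K where K: "K > 0" "ALL t>=0. I0 t <= K * sqrt t" using I0_sqrt_bound by blast
  have "(Y R \<longlongrightarrow> 0) (at 0 within {0..tau})"
  proof (rule Lim_null_comparison)
   show "\<forall>\<^sub>F t in at 0 within {0..tau}. norm (Y R t) <= c*K * sqrt R * sqrt t"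
    unfolding eventually_at_filter
   proof (rule always_eventually, intro allI impI)
    fix t assume t: "t \<noteq> 0" "t \<in> {0..tau}"
    hence tp: "t > 0" by auto
    have "0 <= I0 (R/t)" "I0 (R/t) <= K * sqrt (R/t)" using K tp R I0_mono[of 0 "R/t"] by auto
    hence "c*t*I0 (R/t) <= c*t*(K * sqrt (R/t))" using c_pos tp by (intro mult_left_mono) auto
    also have "\<dots> = c*K * sqrt R*(t/sqrt t)" by (simp add: real_sqrt_divide)
    also have "t/sqrt t = sqrt t" using tp by (simp add: real_div_sqrt)
    finally show "norm (Y R t) <= c*K * sqrt R * sqrt t"
     unfolding Y_def using \<open>0 \<le> I0 (R / t)\<close> c_pos tp by simp
   qed
   have "((%t. c*K * sqrt R * sqrt t) \<longlongrightarrow> c*K * sqrt R * sqrt 0) (at 0 within {0..tau})" by (intro tendsto_intros)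
   thus "((%t. c*K * sqrt R * sqrt t) \<longlongrightarrow> 0) (at 0 within {0..tau})" by simp
  qed
  thus ?thesis using True by (simp add: continuous_within)
 qed
qed

end

context parab
begin

lemma I0_nonneg: "t >= 0 ==> I0 t >= 0"
 using I0_mono[of 0 t] by simp

lemma lam_ball: assumes "norm y <= 2 * R" "m > 0" shows "lam ((1/m) *. y) <= 16*(R/m)"
proof -
 have "norm ((1/m) *. y) <= 2*(R/m)" using assms by (simp add: divide_right_mono)
 thus ?thesis using lam_le[of "(1/m) *. y"] by linarith
qed

abbreviation phi_lip :: "real => bool" where
 "phi_lip tau \<equiv>
    ALL R>0. ALL y. norm y <= 2 * R --> (ALL m m'. 0 <= m --> m <= m' --> m' <= tau * R -->
     \<bar>phi y m'-phi y m\<bar> <= 320 * R*(Y R m'-Y R m))"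

text \<open>With \<open>t = R/m\<close> one has \<open>lam <= 16*t\<close> and
  \<open>I0 (16*t) <= 16*I0 t\<close>. The derivative of \<open>phi\<close> is thus at most
  \<open>c*160*R*I0 t\<close>, where \<open>160 = 16*2 + 256/2\<close>. Slow variation makes the
  derivative of Y at least \<open>c*I0 t/2\<close>, which doubles the constant.\<close>

lemma phi_lip_m:
 "EX tau>0. tau <= 1 \<and> phi_lip tau"
proof -
 obtain s0 where s0: "s0 >= 1" "ALL s>=s0. s * f s <= 1/2*I0 s" using slow_variation[of "1/2"] by auto
 show ?thesis
 proof (rule exI[of _ "1/s0"], intro conjI allI impI)
  show "1/s0 > 0" "1/s0 <= 1" using s0 by auto
  fix R :: real and y :: 'a and m m' :: real
  assume R: "R > 0" and y: "norm y <= 2 * R" and m: "0 <= m" "m <= m'" "m' <= 1/s0 * R"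
  show "\<bar>phi y m'-phi y m\<bar> <= 320 * R*(Y R m'-Y R m)"
  proof (rule derivative_domination[OF phi_cont Y_cont[OF R] phi_deriv Y_deriv[OF R] _ m])
   fix m assume m: "0 < m" "m < 1/s0 * R"
   define t where "t = R/m"
   have t: "t >= s0" "t > 0" "m*t = R" using m s0 R by (auto simp: t_def field_simps)
   define l where "l = lam ((1/m) *. y)"
   have l: "0 <= l" "l <= 16*t" using lam(1) lam_ball[OF y m(1)] by (auto simp: l_def t_def)
   have I0l: "I0 l <= 16*I0 t" using I0_mono[OF l] I0_scale[of t 16] t by linarith
   have I0t: "I0 t >= 0" "I0 l >= 0" using I0_nonneg t l by auto
   have "I1 l <= l*I0 l" by (rule I1_le[OF l(1)])
   also have "\<dots> <= (16*t)*(16*I0 t)" using l I0l I0t t by (intro mult_mono) auto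
   finally have "m*I1 l <= m*((16*t)*(16*I0 t))" using m by (intro mult_left_mono) auto
   also have "\<dots> = 256*(m*t)*I0 t" by simp
   finally have A: "m*I1 l <= 256 * R*I0 t" unfolding t(3) .
   have "\<bar>y \<bullet> e\<bar> <= 2 * R" using abs_inner_unit_le[OF e, of y] y by linarith
   hence "\<bar>I0 l*(y \<bullet> e)\<bar> <= (16*I0 t)*(2 * R)" unfolding abs_mult using I0l I0t by (intro mult_mono) auto
   moreover have "m*I1 l >= 0" using I1_nonneg[OF l(1)] m by simp
   ultimately have "\<bar>I0 l*(y \<bullet> e)+m*I1 l/2\<bar> <= 160*(R*I0 t)"
    using A unfolding abs_le_iff mult.assoc mult.left_commute[of _ R] mult.commute[of "I0 t" R] mult.left_commute[of 16 R] mult.commute[of "I0 t" "2 * R"] mult.assoc by linarith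
   hence "c*\<bar>I0 l*(y \<bullet> e)+m*I1 l/2\<bar> <= c*(160*(R*I0 t))" using c_pos by (intro mult_left_mono) auto
   also have "c*(160*(R*I0 t)) = 320 * R*(c*(1/2*I0 t))" by simp
   also have "\<dots> <= 320 * R*(c*(I0 t-t * f t))"
    using s0(2) t R c_pos by (intro mult_left_mono) force+
   finally show "\<bar>- c*(I0 (lam ((1/m) *. y))*(y \<bullet> e)+m*I1 (lam ((1/m) *. y))/2)\<bar>
         <= 320 * R*(c*(I0 (R/m)-R/m * f (R/m)))"
    unfolding l_def[symmetric] t_def[symmetric] using c_pos by (simp add: abs_mult)
  qed
 qed
qed

text \<open>Evaluate T at \<open>s = eta^2/8*t\<close>. There all \<open>b j+s\<close> are at most
  \<open>2*s\<close>, so the sum is at least \<open>4*t\<close>, more than the linear terms can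
  cancel; T would be positive beyond its zero.\<close>

lemma lam_lower:
 assumes eta: "0 < eta" "eta <= 1" and t: "eta\<^sup>2/8*t >= (\<Sum>j\<in>W. b j)" "t > 0"
  and z: "norm z <= 2*t" "norm (perp e z) >= eta*t"
 shows "lam z >= eta^2/8*t"
proof (rule ccontr)
 define kp where "kp = eta^2/8"
 have eta2: "eta\<^sup>2 <= 1" using eta by (simp add: power_le_one)
 have kp: "kp > 0" "kp <= 1/8" using eta eta2 by (auto simp: kp_def)
 assume "\<not> ?thesis"
 hence l: "lam z < kp*t" by (simp add: kp_def)
 have "(eta*t)\<^sup>2 <= (norm (perp e z))^2" using z eta t by (intro power_mono) auto
 hence "(eta*t)\<^sup>2/(2 * kp*t) <= (\<Sum>j\<in>W. (z \<bullet> j)\<^sup>2)/(2 * kp*t)"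
  unfolding perp_frame using kp t by (intro divide_right_mono) auto
 also have "\<dots> <= (\<Sum>j\<in>W. (z \<bullet> j)\<^sup>2/(b j + kp*t))" unfolding sum_divide_distrib
 proof (rule sum_mono)
  fix j assume j: "j \<in> W"
  have "b j <= (\<Sum>j\<in>W. b j)" using finW j b by (intro member_le_sum) (auto intro: less_imp_le)
  hence "b j + kp*t <= 2 * kp*t" using t(1) unfolding kp_def[symmetric] by linarith
  thus "(z \<bullet> j)\<^sup>2/(2 * kp*t) <= (z \<bullet> j)^2/(b j + kp*t)"
   using kp t b[OF j] by (intro divide_left_mono mult_pos_pos add_pos_pos) auto
 qed
 also have "(eta*t)\<^sup>2/(2 * kp*t) = 4*t" using eta t by (simp add: kp_def power2_eq_square)
 finally have "T z (kp*t) >= 4*t-z \<bullet> e-kp*t/4" by (simp add: T_def)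
 moreover have "z \<bullet> e <= 2*t" using abs_inner_unit_le[OF e, of z] z by linarith
 moreover have "T z (kp*t) + kp*t/4 <= T z (lam z)+lam z/4" using T_decr[of "lam z" "kp*t" z] l lam(1) by simp
 moreover have "kp*t <= 1/8*t" using kp t by (intro mult_right_mono) auto
 ultimately show False using lam(2)[of z] l t(2) by linarith
qed

abbreviation phi_affine :: "real => real => real => bool" where
 "phi_affine eps eta tau \<equiv>
    ALL R>0. ALL y. norm y <= 2 * R --> norm (perp e y) >= eta * R -->
     (ALL m m'. 0 <= m --> m <= m' --> m' <= tau * R -->
     \<bar>(phi y m'+(y \<bullet> e)*Y R m')-(phi y m+(y \<bullet> e)*Y R m)\<bar> <= (eps * R)*(Y R m'-Y R m))"

text \<open>Away from the axis \<open>lam\<close> is comparable to \<open>t = R/m\<close>, so slow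
  variation lets \<open>I0 (lam)\<close> be replaced by \<open>I0 t\<close>, and \<open>I1\<close>
  and \<open>t * f t\<close> are negligible. To first order, a change of m then adds a multiple of
  the height \<open>y \<bullet> e\<close>.\<close>

lemma phi_affine_m:
 assumes eps: "eps > 0" and eta: "0 < eta" "eta <= 1"
 shows "EX tau>0. tau <= 1 \<and> phi_affine eps eta tau"
proof -
 define kp where "kp = eta^2/8"
 have kp: "kp > 0" using eta by (auto simp: kp_def)
 \<comment> \<open>Collects \<open>30 + 2/kp\<close> from replacing \<open>I0 l\<close> by
   \<open>I0 t\<close>, \<open>257/2\<close> from the \<open>I1\<close> term and 2 from
   \<open>t * f t\<close>.\<close>
 define B where "B = 161+2/kp"
 have B: "B > 0" using kp by (simp add: B_def add_pos_pos)
 define eps' where "eps' = min (1/2) (eps/(2*B))"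
 have eps': "eps' > 0" "eps' <= 1/2" "eps'*B <= eps/2"
 proof -
  show "eps' > 0" "eps' <= 1/2" using eps B by (auto simp: eps'_def)
  have "eps'*B <= (eps/(2*B))*B" using B by (intro mult_right_mono) (auto simp: eps'_def)
  thus "eps'*B <= eps/2" using B by simp
 qed
 obtain s0 where s0: "s0 >= 1" "ALL s>=s0. s * f s <= eps'*I0 s" using slow_variation[OF eps'(1)] by auto
 \<comment> \<open>One threshold for all requirements: t itself, \<open>kp*t\<close> and
   \<open>eps'*t\<close> must exceed \<open>s0\<close>, and \<open>kp*t\<close> must exceed all
   \<open>b j\<close>.\<close>
 define s1 where "s1 = s0/kp+(\<Sum>j\<in>W. b j)/kp+s0/eps'+s0"
 have sb: "(\<Sum>j\<in>W. b j) >= 0" using b by (intro sum_nonneg) (auto intro: less_imp_le)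
 have parts: "s0/kp >= 0" "(\<Sum>j\<in>W. b j)/kp >= 0" "s0/eps' >= 0" using s0 kp eps' sb by auto
 have s1: "s1 >= s0" "s1 >= s0/kp" "s1 >= (\<Sum>j\<in>W. b j)/kp" "s1 >= s0/eps'"
  using parts s0(1) unfolding s1_def by linarith+
 have s11: "s1 >= 1" using s1(1) s0(1) by linarith
 show ?thesis
 proof (rule exI[of _ "1/s1"], intro conjI allI impI)
  show "1/s1 > 0" "1/s1 <= 1" using s11 by auto
  fix R :: real and y :: 'a and m m' :: real
  assume R: "R > 0" and y: "norm y <= 2 * R" "norm (perp e y) >= eta * R" and m: "0 <= m" "m <= m'" "m' <= 1/s1 * R"
  show "\<bar>(phi y m'+(y \<bullet> e)*Y R m')-(phi y m+(y \<bullet> e)*Y R m)\<bar> <= (eps * R)*(Y R m'-Y R m)"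
  proof (rule derivative_domination[OF _ Y_cont[OF R] _ Y_deriv[OF R] _ m])
   show "continuous_on {0..1/s1*R} (%m. phi y m+(y \<bullet> e)*Y R m)"
    by (intro continuous_intros phi_cont Y_cont R)
   show "((%m. phi y m+(y \<bullet> e)*Y R m) has_real_derivative
         - c*(I0 (lam ((1/m) *. y))*(y \<bullet> e)+m*I1 (lam ((1/m) *. y))/2)+(y \<bullet> e)*(c*(I0 (R/m)-(R/m) * f (R/m)))) (at m)" if "0 < m" for m
    using that R by (intro DERIV_add DERIV_cmult phi_deriv Y_deriv)
   fix m assume m: "0 < m" "m < 1/s1 * R"
   define t where "t = R/m"
   have t: "t >= s1" "t > 0" "m*t = R" using m s11 R by (auto simp: t_def field_simps)
   define z where "z = (1/m) *. y"
   define l where "l = lam z"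
   have l: "0 <= l" "l <= 16*t" using lam(1) lam_ball[OF y(1) m(1)] by (auto simp: l_def t_def z_def)
   have tk: "kp*t >= s0" "kp*t >= (\<Sum>j\<in>W. b j)" "eps'*t >= s0"
   proof -
    have "s0/kp <= t" "(\<Sum>j\<in>W. b j)/kp <= t" "s0/eps' <= t" using s1 t(1) by linarith+
    thus "kp*t >= s0" "kp*t >= (\<Sum>j\<in>W. b j)" "eps'*t >= s0"
     using kp eps' by (simp_all add: pos_divide_le_eq mult.commute)
   qed
   have lk: "l >= kp*t" unfolding l_def kp_def
   proof (rule lam_lower[OF eta])
    show "eta\<^sup>2/8*t >= (\<Sum>j\<in>W. b j)" using tk by (simp add: kp_def)
    show "norm z <= 2*t" using y m by (simp add: z_def t_def divide_right_mono)
    have "norm (perp e z) = norm (perp e y)/m" using m by (simp add: z_def perp_scaleR)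
    thus "norm (perp e z) >= eta*t" using y(2) m by (simp add: t_def divide_right_mono)
   qed (use t in auto)
   have I0t: "I0 t >= 0" "I0 l >= 0" using I0_nonneg t l by auto
   have sv: "t * f t <= eps'*I0 t" using s0(2) t(1) s1(1) by auto
   have d1: "\<bar>I0 t-I0 l\<bar> <= (15+1/kp)*(eps'*I0 t)"
   proof (cases "l <= t")
    case True
    have lp: "l >= s0" "l > 0" using lk tk(1) s0(1) by linarith+
    have "I0 t-I0 l <= f l*(t-l)" by (rule I0_diff_le[OF l(1) True])
    also have "\<dots> <= f l*(l/kp)"
    proof -
     have "t <= l/kp" using lk kp by (simp add: pos_le_divide_eq mult.commute)
     thus ?thesis using f_pos[OF l(1)] l(1) by (intro mult_left_mono) auto
    qed
    also have "\<dots> = (1/kp)*(l * f l)" by simp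
    also have "\<dots> <= (1/kp)*(eps'*I0 t)"
    proof -
     have "l * f l <= eps'*I0 l" using s0(2) lp(1) by auto
     also have "\<dots> <= eps'*I0 t" using I0_mono[OF l(1) True] eps' by (intro mult_left_mono) auto
     finally show ?thesis using kp by (intro mult_left_mono) auto
    qed
    finally have "I0 t-I0 l <= (1/kp)*(eps'*I0 t)" .
    moreover have "15*(eps'*I0 t) >= 0" using eps' I0t by simp
    ultimately show ?thesis using I0_mono[OF l(1) True] by (simp add: distrib_right)
   next
    case False
    have "I0 l-I0 t <= f t*(l-t)" by (rule I0_diff_le) (use False t in auto)
    also have "\<dots> <= f t*(15*t)" using f_pos[of t] l t by (intro mult_left_mono) auto
    also have "\<dots> = 15*(t * f t)" by simp
    also have "\<dots> <= 15*(eps'*I0 t)" using sv by linarith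
    finally have "I0 l-I0 t <= 15*(eps'*I0 t)" .
    moreover have "(1/kp)*(eps'*I0 t) >= 0" using eps' I0t kp by simp
    ultimately show ?thesis using I0_mono[of t l] False t by (simp add: distrib_right)
   qed
   have d2: "I1 l <= 257*(eps'*(t*I0 t))"
   proof -
    have s016: "s0 <= 16*t" using t s1(1) by linarith
    have "I1 (16*t)-I1 s0 <= (16*(eps'*I0 t))*(16*t-s0)"
    proof (rule I1_diff_le)
     fix s assume s: "s0 <= s" "s <= 16*t"
     have "s * f s <= eps'*I0 s" using s0(2) s by auto
     also have "\<dots> <= eps'*(16*I0 t)"
      using I0_mono[of s "16*t"] I0_scale[of t 16] s s0(1) t eps' by (intro mult_left_mono) auto
     finally show "s * f s <= 16*(eps'*I0 t)" by simp
    qed (use s0 s016 in auto)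
    also have "\<dots> <= (16*(eps'*I0 t))*(16*t)" using eps' I0t s0(1) by (intro mult_left_mono) auto
    finally have 1: "I1 (16*t)-I1 s0 <= 256*(eps'*(t*I0 t))" by (simp add: mult_ac)
    have "I1 s0 <= s0*I0 s0" using I1_le[of s0] s0(1) by simp
    also have "\<dots> <= (eps'*t)*I0 t" using tk(3) I0_mono[of s0 t] s0(1) t(1) s1(1) I0_nonneg[of s0]
     by (intro mult_mono) auto
    finally have "I1 s0 <= eps'*(t*I0 t)" by simp
    with 1 I1_mono[OF l] show ?thesis by linarith
   qed
   have ye: "\<bar>y \<bullet> e\<bar> <= 2 * R" using abs_inner_unit_le[OF e, of y] y(1) by linarith
   have t1: "\<bar>(I0 t-I0 l)*(y \<bullet> e)\<bar> <= ((15+1/kp)*(eps'*I0 t))*(2 * R)"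
    unfolding abs_mult by (rule mult_mono[OF d1 ye]) (use kp eps' I0t in auto)
   have t2: "m*I1 l <= 257*(eps'*(R*I0 t))"
   proof -
    have "m*I1 l <= m*(257*(eps'*(t*I0 t)))" using d2 m by (intro mult_left_mono) auto
    also have "\<dots> = 257*(eps'*((m*t)*I0 t))" by simp
    finally show ?thesis unfolding t(3) .
   qed
   have t3: "\<bar>(t * f t)*(y \<bullet> e)\<bar> <= (eps'*I0 t)*(2 * R)"
    unfolding abs_mult by (rule mult_mono) (use sv ye f_pos[of t] t eps' I0t in auto)
   define E where "E = eps'*I0 t * R"
   have E: "E >= 0" using eps' I0t R by (simp add: E_def)
   have "\<bar>(I0 t-I0 l)*(y \<bullet> e)-m*I1 l/2-(t * f t)*(y \<bullet> e)\<bar> <= B*E"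
   proof -
    have "\<bar>(I0 t-I0 l)*(y \<bullet> e)\<bar> <= ((15+1/kp)*2)*E" using t1 by (simp only: E_def mult_ac)
    moreover have "((15+1/kp)*2)*E = 30*E+2/kp*E" by (simp add: distrib_right)
    moreover have "m*I1 l <= 257*E" using t2 by (simp only: E_def mult_ac)
    moreover have "\<bar>(t * f t)*(y \<bullet> e)\<bar> <= 2*E" using t3 by (simp only: E_def mult_ac)
    moreover have "B*E = 161*E+2/kp*E" by (simp add: B_def algebra_simps)
    moreover have "m*I1 l >= 0" using m I1_nonneg[OF l(1)] by simp
    ultimately show ?thesis using E unfolding abs_le_iff by linarith
   qed
   also have "B*E = (eps'*B)*(I0 t * R)" by (simp add: E_def)
   also have "\<dots> <= eps/2*(I0 t * R)" using eps'(3) I0t R by (intro mult_right_mono) auto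
   finally have "c*\<bar>(I0 t-I0 l)*(y \<bullet> e)-m*I1 l/2-(t * f t)*(y \<bullet> e)\<bar> <= c*(eps/2*(I0 t * R))"
    using c_pos by (intro mult_left_mono) auto
   also have "\<dots> = (eps * R)*(c*(1/2*I0 t))" by simp
   also have "\<dots> <= (eps * R)*(c*(I0 t-t * f t))"
   proof -
    have "eps'*I0 t <= 1/2*I0 t" using eps' I0t by (intro mult_right_mono) auto
    hence "1/2*I0 t <= I0 t-t * f t" using sv by linarith
    thus ?thesis using eps R c_pos by (intro mult_left_mono) auto
   qed
   finally have fin: "c*\<bar>(I0 t-I0 l)*(y \<bullet> e)-m*I1 l/2-(t * f t)*(y \<bullet> e)\<bar> <= (eps * R)*(c*(I0 t-t * f t))" .
   have "- c*(I0 l*(y \<bullet> e)+m*I1 l/2)+(y \<bullet> e)*(c*(I0 t-t * f t)) = c*((I0 t-I0 l)*(y \<bullet> e)-m*I1 l/2-(t * f t)*(y \<bullet> e))"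
    by (simp add: algebra_simps)
   hence "\<bar>- c*(I0 l*(y \<bullet> e)+m*I1 l/2)+(y \<bullet> e)*(c*(I0 t-t * f t))\<bar> = c*\<bar>(I0 t-I0 l)*(y \<bullet> e)-m*I1 l/2-(t * f t)*(y \<bullet> e)\<bar>"
    using c_pos by (simp add: abs_mult)
   with fin show "\<bar>- c*(I0 (lam ((1/m) *. y))*(y \<bullet> e)+m*I1 (lam ((1/m) *. y))/2)+(y \<bullet> e)*(c*(I0 (R/m)-(R/m) * f (R/m)))\<bar>
         <= eps * R*(c*(I0 (R/m)-R/m * f (R/m)))"
    unfolding z_def[symmetric] l_def[symmetric] t_def[symmetric] by simp
  qed
 qed
qed

text \<open>The tail \<open>Iinf j-I j\<close> is of order \<open>1/(b j+lam z)\<close>. One square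
  root of this weight tames \<open>z \<bullet> j\<close> through \<open>lam_sq\<close>, the other is
  bounded by \<open>1/sqrt (b j)\<close>.\<close>

lemma gradient_diff:
 "EX K>0. ALL z d. d \<bullet> e = 0 --> \<bar>(G z-Gp z) \<bullet> d\<bar> <= K * sqrt (norm z)*norm d"
proof -
 obtain K where K: "K > 0" "ALL j:W. ALL l>=0. 0 <= Iinf j-I j l \<and> Iinf j-I j l <= K/(b j+l)" using I_tail by blast
 define S where "S = (\<Sum>j\<in>W. 1/sqrt (b j))"
 have S: "S >= 0" unfolding S_def by (intro sum_nonneg) (auto intro: less_imp_le[OF b])
 show ?thesis
 proof (rule exI[of _ "2 * c*K*2*S+1"], intro conjI allI impI)
  show "2 * c*K*2*S+1 > 0" using c_pos K S by (simp add: add_nonneg_pos)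
  fix z d :: 'a assume d: "d \<bullet> e = 0"
  define l where "l = lam z"
  have l: "l >= 0" using lam(1) by (simp add: l_def)
  have eq: "(G z-Gp z) \<bullet> d = - (2 * c*(\<Sum>j\<in>W. (Iinf j-I j l)*(z \<bullet> j)*(d \<bullet> j)))"
   unfolding inner_diff_left G_def Gr_inner Gp_inner l_def using d
   by (simp add: sum_distrib_left algebra_simps sum_subtractf[symmetric] sum_negf[symmetric])
  have "\<bar>\<Sum>j\<in>W. (Iinf j-I j l)*(z \<bullet> j)*(d \<bullet> j)\<bar> <= (\<Sum>j\<in>W. \<bar>(Iinf j-I j l)*(z \<bullet> j)*(d \<bullet> j)\<bar>)" by (rule sum_abs)
  also have "\<dots> <= (\<Sum>j\<in>W. (K*(2 * sqrt (norm z))*norm d)*(1/sqrt (b j)))"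
  proof (rule sum_mono)
   fix j assume j: "j \<in> W"
   define s where "s = b j+l"
   have s: "s > 0" "b j <= s" using bs[OF j l] l by (auto simp: s_def)
   have "(z \<bullet> j)\<^sup>2/s <= (\<Sum>j\<in>W. (z \<bullet> j)\<^sup>2/(b j+l))"
    unfolding s_def using finW j bs[OF _ l] by (intro member_le_sum) (auto intro!: divide_nonneg_pos)
   also have "\<dots> <= 3*norm z" using lam_sq[of z] by (simp add: l_def)
   also have "\<dots> <= 4*norm z" by simp
   finally have "sqrt ((z \<bullet> j)^2/s) <= sqrt (4*norm z)" by (rule real_sqrt_le_mono)
   hence "\<bar>z \<bullet> j\<bar>/sqrt s <= 2 * sqrt (norm z)" by (simp add: real_sqrt_divide real_sqrt_mult)
   hence "(\<bar>z \<bullet> j\<bar>/sqrt s)*(1/sqrt s) <= (2 * sqrt (norm z))*(1/sqrt (b j))"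
    using s b[OF j] by (intro mult_mono divide_left_mono) auto
   moreover have "(\<bar>z \<bullet> j\<bar>/sqrt s)*(1/sqrt s) = \<bar>z \<bullet> j\<bar>/s" using s by simp
   ultimately have zj: "\<bar>z \<bullet> j\<bar>/s <= (2 * sqrt (norm z))*(1/sqrt (b j))" by linarith
   have "\<bar>Iinf j-I j l\<bar> <= K/s" using K(2) j l by (auto simp: s_def)
   hence "\<bar>(Iinf j-I j l)*(z \<bullet> j)*(d \<bullet> j)\<bar> <= (K/s)*\<bar>z \<bullet> j\<bar>*norm d"
    unfolding abs_mult using K(1) s abs_inner_j[OF j, of d] by (intro mult_mono) auto
   also have "\<dots> = K*(\<bar>z \<bullet> j\<bar>/s)*norm d" by simp
   also have "\<dots> <= K*((2 * sqrt (norm z))*(1/sqrt (b j)))*norm d"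
    using zj K by (intro mult_right_mono mult_left_mono) auto
   finally show "\<bar>(Iinf j-I j l)*(z \<bullet> j)*(d \<bullet> j)\<bar> <= (K*(2 * sqrt (norm z))*norm d)*(1/sqrt (b j))" by simp
  qed
  also have "\<dots> = (K*(2 * sqrt (norm z))*norm d)*S" by (simp add: S_def sum_distrib_left)
  finally have "2 * c*\<bar>\<Sum>j\<in>W. (Iinf j-I j l)*(z \<bullet> j)*(d \<bullet> j)\<bar> <= 2 * c*((K*(2 * sqrt (norm z))*norm d)*S)"
   using c_pos by (intro mult_left_mono) auto
  hence "\<bar>(G z-Gp z) \<bullet> d\<bar> <= 2 * c*((K*(2 * sqrt (norm z))*norm d)*S)"
   unfolding eq abs_minus abs_mult[of "2 * c"] using c_pos by simp
  also have "\<dots> = (2 * c*K*2*S)*(sqrt (norm z)*norm d)" by simp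
  also have "\<dots> <= (2 * c*K*2*S+1)*(sqrt (norm z)*norm d)" by (intro mult_right_mono) auto
  finally show "\<bar>(G z-Gp z) \<bullet> d\<bar> <= (2 * c*K*2*S+1) * sqrt (norm z)*norm d" by simp
 qed
qed

abbreviation phi_shift :: "real => bool" where
 "phi_shift K \<equiv>
    ALL R m y d. R > 0 --> 0 <= m --> d \<bullet> e = 0 --> norm y <= 2 * R --> norm (y-d) <= 2 * R -->
     \<bar>(phi (y-d) m-phi y m)-(p (y-d)-p y)\<bar> <= K * sqrt (m * R)*norm d"

text \<open>Mean value theorem for \<open>phi - p\<close> along the segment from y to
  \<open>y-d\<close>. Dilating \<open>gradient_diff\<close> turns the square root of the norm into
  \<open>sqrt (m * R)\<close>, small against R when m is a small multiple of R.\<close>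

lemma phi_shift_diff:
 "EX K>0. phi_shift K"
proof -
 obtain K where K: "K > 0" "ALL z d. d \<bullet> e = 0 --> \<bar>(G z-Gp z) \<bullet> d\<bar> <= K * sqrt (norm z)*norm d" using gradient_diff by blast
 show ?thesis
 proof (rule exI[of _ "2*K"], intro conjI allI impI)
  show "2*K > 0" using K by simp
  fix R m :: real and y d :: 'a
  assume R: "R > 0" and m: "0 <= m" and d: "d \<bullet> e = 0" and y: "norm y <= 2 * R" "norm (y-d) <= 2 * R"
  show "\<bar>(phi (y-d) m-phi y m)-(p (y-d)-p y)\<bar> <= 2*K * sqrt (m * R)*norm d"
  proof (cases "m = 0")
   case True thus ?thesis by (simp add: phi_def)
  next
   case False
   hence mp: "m > 0" using m by simp
   define x where "x s = (1/m) *. (y-s *. d)" for s :: real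
   define F where "F s = m^2*(V (x s)-p (x s))" for s
   have xd: "(x has_derivative (%h. (- h/m) *. d)) (at s)" for s
    unfolding x_def[abs_def] by (auto intro!: derivative_eq_intros)
   have Fd: "(F has_derivative (%h. h*(- m*((G (x s)-Gp (x s)) \<bullet> d)))) (at s)" for s
   proof -
    have "(F has_derivative (%h. m\<^sup>2*(G (x s) \<bullet> ((- h/m) *. d)-Gp (x s) \<bullet> ((- h/m) *. d)))) (at s)"
     unfolding F_def[abs_def]
     by (intro derivative_intros has_derivative_compose[OF xd V_deriv] has_derivative_compose[OF xd p_deriv])
    thus ?thesis
     by (rule has_derivative_eq_rhs) (use mp in \<open>auto simp: fun_eq_iff inner_diff_left power2_eq_square algebra_simps\<close>)
   qed
   have "F differentiable_on {0..1}" unfolding differentiable_on_def differentiable_def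
    using Fd has_derivative_at_withinI by blast
   obtain s where s: "0 < s" "s < 1" "F 1-F 0 = (1-0)*(- m*((G (x s)-Gp (x s)) \<bullet> d))"
    using mvt[of 0 1 F "%s h. h*(- m*((G (x s)-Gp (x s)) \<bullet> d))"] Fd
     has_derivative_continuous[OF Fd] by (auto simp: continuous_at_imp_continuous_on)
   have "y-s *. d = (1-s) *. y+s *. (y-d)" by (simp add: algebra_simps)
   hence "norm (y-s *. d) <= (1-s)*norm y+s*norm (y-d)"
    using s norm_triangle_ineq[of "(1-s) *. y" "s *. (y-d)"] by simp
   also have "\<dots> <= (1-s)*(2 * R)+s*(2 * R)" using s y by (intro add_mono mult_left_mono) auto
   also have "\<dots> = 2 * R" by (simp add: algebra_simps)
   finally have "norm (x s) <= 4 * R/m" using mp R by (simp add: x_def divide_right_mono)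
   hence "sqrt (norm (x s)) <= sqrt (4 * R/m)" by (rule real_sqrt_le_mono)
   hence "K * sqrt (norm (x s))*norm d <= K * sqrt (4 * R/m)*norm d" using K by (intro mult_right_mono mult_left_mono) auto
   moreover have "\<bar>(G (x s)-Gp (x s)) \<bullet> d\<bar> <= K * sqrt (norm (x s))*norm d" using K(2) d by blast
   ultimately have "m*\<bar>(G (x s)-Gp (x s)) \<bullet> d\<bar> <= m*(K * sqrt (4 * R/m)*norm d)" using mp by (intro mult_left_mono) auto
   also have "m * sqrt (4 * R/m) = 2 * sqrt (m * R)"
   proof -
    have "m * sqrt (4 * R/m) = sqrt (m^2) * sqrt (4 * R/m)" using mp by simp
    also have "\<dots> = sqrt (4*(m * R))" unfolding real_sqrt_mult[symmetric] using mp by (simp add: power2_eq_square)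
    also have "\<dots> = 2 * sqrt (m * R)" by (simp add: real_sqrt_mult)
    finally show ?thesis .
   qed
   hence "m*(K * sqrt (4 * R/m)*norm d) = 2*K * sqrt (m * R)*norm d"
    by (metis mult.assoc mult.commute)
   finally have "\<bar>F 1-F 0\<bar> <= 2*K * sqrt (m * R)*norm d" unfolding s(3) using mp by (simp add: abs_mult)
   moreover have "F 1-F 0 = (phi (y-d) m-phi y m)-(p (y-d)-p y)"
    using mp by (simp add: F_def x_def phi_def p_scale right_diff_distrib power_divide)
   ultimately show ?thesis by simp
  qed
 qed
qed

lemma Y_slope_mono: assumes "0 <= s" "s <= t" shows "I0 s-s * f s <= I0 t-t * f t"
proof -
 have "f t*(t-s) <= I0 t-I0 s" by (rule I0_diff_ge[OF assms])
 moreover have "s * f t <= s * f s" using f_antimono[OF assms] assms by (intro mult_left_mono) auto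
 ultimately show ?thesis by (simp add: algebra_simps)
qed

lemma Y_mono: assumes "R > 0" "0 <= m" "m <= m'" shows "Y R m <= Y R m'"
proof (rule DERIV_nonneg_imp_increasing_open[OF assms(3)])
 fix t assume t: "m < t" "t < m'"
 have "I0 (R/t)-R/t * f (R/t) >= 0" using I0_ge[of "R/t"] assms t by simp
 thus "EX y. (Y R has_real_derivative y) (at t) \<and> 0 <= y"
  using assms t c_pos by (intro exI[of _ "c*(I0 (R/t)-R/t * f (R/t))"] conjI Y_deriv mult_nonneg_nonneg) auto
qed (use Y_cont[OF assms(1), of m'] assms in \<open>auto intro: continuous_on_subset\<close>)

text \<open>The derivative of Y in m is c times \<open>I0 t-t * f t\<close> at
  \<open>t = R/m\<close>, and this expression increases in t. Increments can thus be transported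
  from large radii to smaller ones.\<close>

lemma Y_increment_mono:
 assumes R: "0 < R" "R <= R'" and m: "0 <= m" "0 <= m'"
 shows "\<bar>Y R m'-Y R m\<bar> <= \<bar>Y R' m'-Y R' m\<bar>"
proof -
 have *: "\<bar>Y R m'-Y R m\<bar> <= 1*(Y R' m'-Y R' m)" if m: "0 <= m" "m <= m'" for m m'
 proof (rule derivative_domination[OF Y_cont Y_cont Y_deriv Y_deriv _ m order_refl])
  fix m :: real assume m: "0 < m" "m < m'"
  have "0 <= I0 (R/m)-R/m * f (R/m)" using I0_ge[of "R/m"] R m by simp
  moreover have "I0 (R/m)-R/m * f (R/m) <= I0 (R'/m)-R'/m * f (R'/m)"
   using R m by (intro Y_slope_mono divide_right_mono) auto
  ultimately show "\<bar>c*(I0 (R/m)-R/m * f (R/m))\<bar> <= 1*(c*(I0 (R'/m)-R'/m * f (R'/m)))"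
   using c_pos by (simp add: abs_mult)
 qed (use R in auto)
 show ?thesis using *[of m m'] *[of m' m] m by (cases "m <= m'") (auto simp: abs_minus_commute)
qed

abbreviation Y_increasing :: "real => real => bool" where
 "Y_increasing k tau \<equiv>
    ALL R>0. ALL m m'. 0 <= m --> m <= tau * R --> 0 <= m' --> m' <= tau * R --> k*\<bar>m'-m\<bar> <= \<bar>Y R m'-Y R m\<bar>"

text \<open>By monotonicity in t, the derivative in m is at least its value k at \<open>s0\<close>,
  positive by slow variation.\<close>

lemma Y_increment_lower:
 "EX k>0. EX tau>0. tau <= 1 \<and> Y_increasing k tau"
proof -
 obtain s0 where s0: "s0 >= 1" "ALL s>=s0. s * f s <= 1/2*I0 s" using slow_variation[of "1/2"] by auto
 define k where "k = c*(I0 s0-s0 * f s0)"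
 have "I0 s0 > 0" using I0_pos s0 by simp
 hence k: "k > 0" unfolding k_def using s0 c_pos by (intro mult_pos_pos) force+
 have *: "\<bar>k*m'-k*m\<bar> <= 1*(Y R m'-Y R m)" if R: "R > 0" and m: "0 <= m" "m <= m'" "m' <= 1/s0 * R" for m m' R
 proof (rule derivative_domination[OF _ Y_cont[OF R] _ Y_deriv[OF R] _ m])
  show "continuous_on {0..1/s0*R} (%m. k*m)" by (intro continuous_intros)
  show "((%m. k*m) has_real_derivative k) (at m)" for m by (auto intro!: derivative_eq_intros)
  fix m :: real assume m: "0 < m" "m < 1/s0 * R"
  have "I0 s0-s0 * f s0 <= I0 (R/m)-R/m * f (R/m)"
   using s0 m by (intro Y_slope_mono) (auto simp: field_simps)
  thus "\<bar>k\<bar> <= 1*(c*(I0 (R/m)-R/m * f (R/m)))" using k c_pos by (simp add: k_def)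
 qed auto
 show ?thesis
 proof (rule exI[of _ k], intro conjI k, rule exI[of _ "1/s0"], intro conjI allI impI)
  show "1/s0 > 0" "1/s0 <= 1" using s0 by auto
  fix R m m' :: real assume "R > 0" "0 <= m" "m <= 1/s0 * R" "0 <= m'" "m' <= 1/s0 * R"
  thus "k*\<bar>m'-m\<bar> <= \<bar>Y R m'-Y R m\<bar>" using *[of R m m'] *[of R m' m] k
   by (cases "m <= m'") (auto simp: abs_minus_commute right_diff_distrib[symmetric] abs_mult)
 qed
qed

section \<open>Sizes and horizontal shifts: first order expansion of the family\<close>

definition v :: "real => 'a => 'a => real" where "v m h x = phi (x-h) m"

lemma v_sol: "m >= 0 ==> sol (v m h)"
 using phi_sol[of m h] by (simp add: v_def[abs_def])

definition adm :: "real => real => 'a => bool" where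
 "adm r m h \<longleftrightarrow> 0 <= m \<and> m <= r \<and> h \<bullet> e = 0 \<and> norm h <= r"

lemma adm_mono: "adm r m h ==> r <= r' ==> adm r' m h"
 by (auto simp: adm_def)

abbreviation v_expands :: "real => real => real => bool" where
 "v_expands eps eta tau \<equiv>
    ALL R m h m' h' x. R > 0 --> adm (tau * R) m h --> adm (tau * R) m' h' --> norm x <= R --> norm (perp e x) >= eta * R -->
     \<bar>v m' h' x-v m h x-(p (x-h')-p (x-h))+(Y R m'-Y R m)*(x \<bullet> e)\<bar> <= eps * R*(\<bar>Y R m'-Y R m\<bar>+norm (h'-h))"

text \<open>A change of size at the shifted point is governed by \<open>phi_affine_m\<close>, a
  change of shift at fixed size by \<open>phi_shift_diff\<close>. The two parameters decouple to
  first order into a height slope and a shift of the quadratic p.\<close>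

lemma v_expansion:
 assumes eps: "eps > 0" and eta: "0 < eta" "eta <= 1"
 shows "EX tau>0. tau <= 1 \<and> v_expands eps eta tau"
proof -
 obtain tau1 where t1: "tau1 > 0" "tau1 <= 1" "phi_affine eps (eta/2) tau1"
  using phi_affine_m[OF eps, of "eta/2"] eta by auto
 obtain K where K: "K > 0" "phi_shift K" using phi_shift_diff by blast
 \<comment> \<open>The bound \<open>eta/2\<close> keeps shifted points off the axis;
   \<open>(eps/K)^2\<close> makes \<open>K * sqrt (m * R)\<close> at most
   \<open>eps * R\<close>.\<close>
 define tau where "tau = min tau1 (min (eta/2) ((eps/K)^2))"
 have tau: "tau > 0" "tau <= tau1" "tau <= eta/2" "tau <= (eps/K)^2" using t1 eta eps K by (auto simp: tau_def)
 show ?thesis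
 proof (rule exI[of _ tau], intro conjI allI impI)
  show "tau > 0" "tau <= 1" using tau t1 by auto
  fix R m m' :: real and h h' x :: 'a
  assume R: "R > 0" and a: "adm (tau * R) m h" and a': "adm (tau * R) m' h'" and x: "norm x <= R" "norm (perp e x) >= eta * R"
  have tauR: "tau * R <= tau1 * R" "tau * R <= eta/2 * R" using tau R by (auto intro!: mult_right_mono)
  have "tau1 * R <= 1 * R" using t1 R by (intro mult_right_mono) auto
  hence nh: "norm h <= R" "norm h' <= R" "norm h' <= eta/2 * R" using a a' tauR unfolding adm_def by linarith+
  define y where "y = x-h'"
  have y: "norm y <= 2 * R" using norm_triangle_ineq4[of x h'] x nh unfolding y_def by linarith
  have y': "norm (x-h) <= 2 * R" using norm_triangle_ineq4[of x h] x nh by linarith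
  have "norm (perp e x) <= norm (perp e y)+norm (perp e h')"
   using norm_triangle_ineq[of "perp e y" "perp e h'"] by (simp add: y_def perp_diff)
  hence py: "norm (perp e y) >= (eta/2) * R" using norm_perp_le[OF e, of h'] nh x(2) by linarith
  have mm: "0 <= m" "0 <= m'" "m <= tau1 * R" "m' <= tau1 * R" using a a' tauR by (auto simp: adm_def)
  have ye: "y \<bullet> e = x \<bullet> e" using a' by (simp add: y_def adm_def inner_diff_left)
  have 1: "\<bar>(phi y m'+(y \<bullet> e)*Y R m')-(phi y m+(y \<bullet> e)*Y R m)\<bar> <= (eps * R)*\<bar>Y R m'-Y R m\<bar>"
  proof (cases "m <= m'")
   case True
   have "Y R m <= Y R m'" using Y_mono[OF R] a True by (auto simp: adm_def)
   thus ?thesis using t1(3)[rule_format, of R y m m'] R y py mm True by simp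
  next
   case False
   hence "Y R m' <= Y R m" using Y_mono[OF R, of m' m] a' by (auto simp: adm_def)
   moreover have "\<bar>(phi y m+(y \<bullet> e)*Y R m)-(phi y m'+(y \<bullet> e)*Y R m')\<bar> <= (eps * R)*(Y R m-Y R m')"
    using t1(3)[rule_format, of R y m' m] R y py mm False by simp
   ultimately show ?thesis by (simp add: abs_minus_commute)
  qed
  have "(x-h)-(h'-h) = x-h'" by simp
  moreover have "(h'-h) \<bullet> e = 0" "0 <= m" using a a' by (auto simp: adm_def inner_diff_left)
  ultimately have 2: "\<bar>(phi (x-h') m-phi (x-h) m)-(p (x-h')-p (x-h))\<bar> <= K * sqrt (m * R)*norm (h'-h)"
   using K(2)[rule_format, of R m "h'-h" "x-h"] R y y' by (simp add: y_def)
  have "m * R <= (tau * R) * R" using a R by (intro mult_right_mono) (auto simp: adm_def)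
  also have "\<dots> <= ((eps/K)^2 * R) * R" using tau R by (intro mult_right_mono) auto
  also have "\<dots> = (eps/K * R)^2" by (simp add: power2_eq_square)
  finally have "sqrt (m * R) <= eps/K * R" using eps K R by (intro real_le_lsqrt) auto
  hence "K * sqrt (m * R) <= K*(eps/K * R)" using K by (intro mult_left_mono) auto
  hence "K * sqrt (m * R)*norm (h'-h) <= eps * R*norm (h'-h)" using K by (intro mult_right_mono) auto
  hence 3: "\<bar>(phi y m-phi (x-h) m)-(p y-p (x-h))\<bar> <= eps * R*norm (h'-h)" using 2 unfolding y_def by linarith
  have "v m' h' x-v m h x-(p (x-h')-p (x-h))+(Y R m'-Y R m)*(x \<bullet> e)
      = ((phi y m'+(y \<bullet> e)*Y R m')-(phi y m+(y \<bullet> e)*Y R m))+((phi y m-phi (x-h) m)-(p y-p (x-h)))"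
   unfolding v_def y_def[symmetric] ye by (simp add: algebra_simps)
  thus "\<bar>v m' h' x-v m h x-(p (x-h')-p (x-h))+(Y R m'-Y R m)*(x \<bullet> e)\<bar> <= eps * R*(\<bar>Y R m'-Y R m\<bar>+norm (h'-h))"
   using 1 3 abs_triangle_ineq unfolding distrib_left by (smt (verit))
 qed
qed

lemma Gp_bounded: "EX B>0. ALL x d. \<bar>Gp x \<bullet> d\<bar> <= B*norm x*norm d"
proof -
 have "bounded_linear Gp" using linear_Gp by (simp add: linear_conv_bounded_linear)
 then obtain B where B: "B > 0" "ALL x. norm (Gp x) <= norm x*B" using bounded_linear.pos_bounded by blast
 have "\<bar>Gp x \<bullet> d\<bar> <= B*norm x*norm d" for x d
  using Cauchy_Schwarz_ineq2[of "Gp x" d] mult_right_mono[of "norm (Gp x)" "norm x*B" "norm d"] B by (simp add: mult_ac)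
 thus ?thesis using B by blast
qed

abbreviation v_lip :: "real => real => bool" where
 "v_lip K tau \<equiv>
    ALL R m h m' h' x. R > 0 --> adm (tau * R) m h --> adm (tau * R) m' h' --> norm x <= R -->
     \<bar>v m' h' x-v m h x\<bar> <= K * R*(\<bar>Y R m'-Y R m\<bar>+norm (h'-h))"

lemma v_lipschitz:
 "EX K>0. EX tau>0. tau <= 1 \<and> v_lip K tau"
proof -
 obtain tau where t1: "tau > 0" "tau <= 1" "phi_lip tau"
  using phi_lip_m by blast
 obtain K where K: "K > 0" "phi_shift K" using phi_shift_diff by blast
 obtain B where B: "B > 0" "ALL x d. \<bar>Gp x \<bullet> d\<bar> <= B*norm x*norm d" using Gp_bounded by blast
 obtain c0 C0 where C0: "C0 > 0" "ALL x. c0*(norm (perp e x))^2 <= p x \<and> p x <= C0*(norm (perp e x))^2" using p_bounds by blast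
 define L where "L = 320+K+2*B+2*C0"
 have L: "L > 0" using K B C0 by (simp add: L_def)
 show ?thesis
 proof (rule exI[of _ L], intro conjI L, rule exI[of _ tau], intro conjI allI impI t1(1,2))
  fix R m m' :: real and h h' x :: 'a
  assume R: "R > 0" and a: "adm (tau * R) m h" and a': "adm (tau * R) m' h'" and x: "norm x <= R"
  have "tau * R <= 1 * R" using t1 R by (intro mult_right_mono) auto
  hence nh: "norm h <= R" "norm h' <= R" "m <= R" using a a' unfolding adm_def by linarith+
  define d where "d = h'-h"
  define y where "y = x-h"
  have y: "norm (x-h') <= 2 * R" using norm_triangle_ineq4[of x h'] x nh by linarith
  have y': "norm y <= 2 * R" using norm_triangle_ineq4[of x h] x nh unfolding y_def by linarith
  have yd: "y-d = x-h'" by (simp add: y_def d_def)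
  have nd: "norm d <= 2 * R" using norm_triangle_ineq4[of h' h] nh unfolding d_def by linarith
  have 1: "\<bar>phi (x-h') m'-phi (x-h') m\<bar> <= 320 * R*\<bar>Y R m'-Y R m\<bar>"
  proof (cases "m <= m'")
   case True
   have "Y R m <= Y R m'" using Y_mono[OF R] a True by (auto simp: adm_def)
   thus ?thesis using t1(3) R y a a' True by (auto simp: adm_def)
  next
   case False
   hence "Y R m' <= Y R m" using Y_mono[OF R, of m' m] a' by (auto simp: adm_def)
   moreover have "\<bar>phi (x-h') m-phi (x-h') m'\<bar> <= 320 * R*(Y R m-Y R m')"
    using t1(3) R y a a' False by (auto simp: adm_def)
   ultimately show ?thesis by (simp add: abs_minus_commute)
  qed
  have "d \<bullet> e = 0" "0 <= m" using a a' by (auto simp: adm_def inner_diff_left d_def)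
  hence 2: "\<bar>(phi (x-h') m-phi y m)-(p (x-h')-p y)\<bar> <= K * sqrt (m * R)*norm d"
   using K(2)[rule_format, of R m d y] R y y' by (simp add: yd)
  have "sqrt (m * R) <= sqrt (R^2)" using nh R by (intro real_sqrt_le_mono) (simp add: power2_eq_square)
  hence "K * sqrt (m * R)*norm d <= K * R*norm d" using R K by (intro mult_right_mono mult_left_mono) auto
  moreover have "\<bar>p (x-h')-p y\<bar> <= (2*B+2*C0) * R*norm d"
  proof -
   have "p (x-h')-p y = p d-Gp y \<bullet> d" using p_expand[of y "- d"] by (simp add: yd)
   moreover have "\<bar>Gp y \<bullet> d\<bar> <= B*(2 * R)*norm d"
    using B y' by (meson mult_left_mono mult_right_mono less_imp_le norm_ge_zero order_trans)
   moreover have "p d <= C0*(2 * R)*norm d"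
   proof -
    have "p d <= C0*(norm (perp e d))^2" using C0 by blast
    also have "\<dots> <= C0*(norm d)^2" using C0 norm_perp_le[OF e, of d] by (intro mult_left_mono power_mono) auto
    also have "\<dots> <= C0*(2 * R)*norm d" unfolding power2_eq_square mult.assoc[symmetric]
     using C0 nd by (intro mult_right_mono mult_left_mono) auto
    finally show ?thesis .
   qed
   ultimately show ?thesis using p_nonneg[of d] by (simp add: abs_le_iff algebra_simps)
  qed
  ultimately have "\<bar>v m' h' x-v m h x\<bar> <= 320 * R*\<bar>Y R m'-Y R m\<bar>+(K+2*B+2*C0) * R*norm d"
   using 1 2 unfolding v_def y_def[symmetric] by (simp add: abs_le_iff distrib_right)
  also have "\<dots> <= L * R*\<bar>Y R m'-Y R m\<bar>+L * R*norm d"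
   using K B C0 R by (intro add_mono mult_right_mono) (auto simp: L_def)
  finally show "\<bar>v m' h' x-v m h x\<bar> <= L * R*(\<bar>Y R m'-Y R m\<bar>+norm (h'-h))" by (simp add: d_def distrib_left)
 qed
qed

text \<open>In the frame \<open>Gp\<close> is diagonal with entries \<open>2 * c * Iinf j\<close>,
  positive on W. A horizontal shift can therefore realize every horizontal slope.\<close>

lemma Gp_solve: "EX C>0. ALL g. EX h. h \<bullet> e = 0 \<and> norm h <= C*norm g \<and> (ALL x. Gp x \<bullet> h = g \<bullet> x-(g \<bullet> e)*(x \<bullet> e))"
proof -
 define C where "C = 1+(\<Sum>j\<in>W. 1/(2 * c*Iinf j))"
 have pos: "j \<in> W ==> 2 * c*Iinf j > 0" for j using c_pos Iinf_pos by simp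
 have C: "C > 0" unfolding C_def using pos by (intro add_pos_nonneg sum_nonneg) (auto intro: less_imp_le)
 show ?thesis
 proof (rule exI[of _ C], intro conjI C allI)
  fix g
  define h where "h = (\<Sum>j\<in>W. ((g \<bullet> j)/(2 * c*Iinf j)) *. j)"
  have hj: "h \<bullet> j = (g \<bullet> j)/(2 * c*Iinf j)" if "j \<in> W" for j
  proof -
   have "h \<bullet> j = (\<Sum>i\<in>W. if i = j then (g \<bullet> j)/(2 * c*Iinf j) else 0)"
    unfolding h_def inner_sum_left by (rule sum.cong[OF refl]) (use that jk in auto)
   thus ?thesis using finW that by simp
  qed
  have he: "h \<bullet> e = 0" by (simp add: h_def inner_sum_left)
  have "norm h <= (\<Sum>j\<in>W. norm (((g \<bullet> j)/(2 * c*Iinf j)) *. j))" unfolding h_def by (rule norm_sum)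
  also have "\<dots> <= (\<Sum>j\<in>W. (1/(2 * c*Iinf j))*norm g)"
  proof (rule sum_mono)
   fix j assume j: "j \<in> W"
   have "norm (((g \<bullet> j)/(2 * c*Iinf j)) *. j) = \<bar>g \<bullet> j\<bar>/(2 * c*Iinf j)" using unit[OF j] pos[OF j] by simp
   also have "\<dots> <= norm g/(2 * c*Iinf j)" using abs_inner_j[OF j, of g] pos[OF j] by (intro divide_right_mono) auto
   finally show "norm (((g \<bullet> j)/(2 * c*Iinf j)) *. j) <= (1/(2 * c*Iinf j))*norm g" by simp
  qed
  also have "\<dots> <= C*norm g" unfolding sum_distrib_right[symmetric] C_def by (intro mult_right_mono) auto
  finally have nh: "norm h <= C*norm g" .
  have "Gp x \<bullet> h = g \<bullet> x-(g \<bullet> e)*(x \<bullet> e)" for x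
  proof -
   have "Gp x \<bullet> h = (\<Sum>j\<in>W. (2 * c*Iinf j)*(x \<bullet> j)*(h \<bullet> j))"
    unfolding Gp_inner sum_distrib_left by (simp add: mult_ac)
   also have "\<dots> = (\<Sum>j\<in>W. (g \<bullet> j)*(x \<bullet> j))"
   proof (rule sum.cong[OF refl])
    fix j assume j: "j \<in> W"
    define q where "q = 2 * c*Iinf j"
    have "q \<noteq> 0" using pos[OF j] unfolding q_def by linarith
    thus "(2 * c*Iinf j)*(x \<bullet> j)*(h \<bullet> j) = (g \<bullet> j)*(x \<bullet> j)"
     unfolding hj[OF j] q_def[symmetric] by simp
   qed
   finally show ?thesis using inner_frame[of g x] by linarith
  qed
  thus "EX h. h \<bullet> e = 0 \<and> norm h <= C*norm g \<and> (ALL x. Gp x \<bullet> h = g \<bullet> x-(g \<bullet> e)*(x \<bullet> e))"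
   using he nh by blast
 qed
qed

lemma v_zero_iff:
 assumes "m > 0" "h \<bullet> e = 0"
 shows "v m h x = 0 \<longleftrightarrow> (\<Sum>j\<in>W. ((x-h) \<bullet> j)\<^sup>2/b j) <= m*(x \<bullet> e)"
proof -
 have "v m h x = 0 \<longleftrightarrow> T ((1/m) *. (x-h)) 0 <= 0"
  using assms V_zero_iff[of "(1/m) *. (x-h)"] by (simp add: v_def phi_def)
 also have "T ((1/m) *. (x-h)) 0 = (1/m^2)*((\<Sum>j\<in>W. ((x-h) \<bullet> j)\<^sup>2/b j)-m*(x \<bullet> e))"
 proof -
  have "(((1/m) *. (x-h)) \<bullet> j)\<^sup>2/(b j+0) = (1/m^2)*(((x-h) \<bullet> j)^2/b j)" for j by (simp add: power_divide)
  moreover have "((1/m) *. (x-h)) \<bullet> e = (1/m^2)*(m*(x \<bullet> e))" using assms by (simp add: inner_diff_left power2_eq_square)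
  ultimately show ?thesis by (simp only: T_def sum_distrib_left[symmetric] right_diff_distrib)
 qed
 finally show ?thesis using assms by (simp add: mult_le_0_iff zero_le_divide_iff divide_le_0_iff)
qed

lemma v_zero_tube:
 assumes m: "m >= 0" and h: "h \<bullet> e = 0" and 0: "v m h x = 0"
 shows "(norm (perp e (x-h)))\<^sup>2 <= (\<Sum>j\<in>W. b j)*m*norm x"
proof (cases "m = 0")
 case True
 obtain c0 C0 where c0: "c0 > 0" "ALL x. c0*(norm (perp e x))^2 <= p x \<and> p x <= C0*(norm (perp e x))^2" using p_bounds by blast
 have "p (x-h) = 0" using 0 True by (simp add: v_def phi_def)
 hence "c0*(norm (perp e (x-h)))^2 <= 0" using c0(2) by metis
 thus ?thesis using c0 True by (simp add: mult_le_0_iff)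
next
 case False
 define B where "B = (\<Sum>j\<in>W. b j)"
 have bB: "j \<in> W ==> b j <= B" for j unfolding B_def using finW b by (intro member_le_sum) (auto intro: less_imp_le)
 have B: "B >= 0" unfolding B_def using b by (intro sum_nonneg) (auto intro: less_imp_le)
 have "((x-h) \<bullet> j)\<^sup>2 <= B*(((x-h) \<bullet> j)^2/b j)" if j: "j \<in> W" for j
 proof -
  have "b j*(((x-h) \<bullet> j)^2/b j) <= B*(((x-h) \<bullet> j)^2/b j)"
   using bB[OF j] b[OF j] by (intro mult_right_mono) auto
  thus ?thesis using b[OF j] by simp
 qed
 hence "(norm (perp e (x-h)))\<^sup>2 <= B*(\<Sum>j\<in>W. ((x-h) \<bullet> j)\<^sup>2/b j)"
  unfolding perp_frame sum_distrib_left by (rule sum_mono)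
 also have "\<dots> <= B*(m*(x \<bullet> e))" using v_zero_iff[of m h x] False m h 0 B by (intro mult_left_mono) auto
 also have "\<dots> <= B*(m*norm x)" using abs_inner_unit_le[OF e, of x] B m by (intro mult_left_mono) auto
 finally show ?thesis by (simp add: B_def)
qed

end

section \<open>Improvement of approximation\<close>

text \<open>If E more than doubles at one step, the second alternative fails there, and the first
  one forces more than doubling at the next step as well. Contraction then holds for ever, and
  against the bound \<open>G*q^j\<close> with \<open>kp*q < 1\<close> it forces the value to be
  zero.\<close>

lemma dichotomy_growth:
 fixes E :: "nat => real"
 assumes E: "\<And>j. E j >= 0" and kp: "0 < kp" "kp < 1/2" "kp*q < 1" "q > 0"
  and bd: "\<And>j. E j <= G*q ^ j"
  and alt: "\<And>j. E (Suc j) <= kp*E (Suc (Suc j)) \<or> E (Suc j) <= 2*E j"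
 shows "E n <= E 0*2 ^ n"
proof (induction n)
 case (Suc n)
 show ?case
 proof (rule ccontr)
  assume "\<not> ?thesis"
  hence a: "2*E n < E (Suc n)" using Suc by simp
  have P: "2*E (n+i) < E (Suc (n+i)) \<and> E (Suc n) <= kp ^ i*E (Suc (n+i))" for i
  proof (induction i)
   case 0 thus ?case using a by simp
  next
   case (Suc i)
   define x y where "x = E (Suc (n+i))" and "y = E (Suc (Suc (n+i)))"
   have 1: "x <= kp*y" using alt[of "n+i"] Suc by (auto simp: x_def y_def)
   have xp: "x > 0" using Suc E[of "n+i"] by (simp add: x_def)
   have "y >= 0" using E by (simp add: y_def)
   moreover from this have "y \<noteq> 0" using 1 xp by auto
   ultimately have "kp*y < 1/2*y" using kp by (intro mult_strict_right_mono) auto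
   hence 2: "2*x < y" using 1 by simp
   have "kp ^ i*x <= kp ^ i*(kp*y)" using 1 kp by (intro mult_left_mono) auto
   thus ?case using 2 Suc by (simp add: x_def y_def mult_ac)
  qed
  have up: "E (Suc n) <= G*q ^ Suc n*(kp*q) ^ i" for i
  proof -
   have "E (Suc n) <= kp ^ i*E (Suc (n+i))" using P by simp
   also have "\<dots> <= kp ^ i*(G*q ^ (Suc (n+i)))" using bd[of "Suc (n+i)"] kp by (intro mult_left_mono) auto
   finally show ?thesis by (simp add: power_add power_mult_distrib mult_ac)
  qed
  have "(%i. G*q ^ Suc n*(kp*q) ^ i) \<longlonglongrightarrow> G*q ^ Suc n*0"
   by (intro tendsto_intros LIMSEQ_power_zero) (use kp in \<open>simp add: abs_mult\<close>)
  hence "E (Suc n) <= 0" using up by (intro LIMSEQ_le_const) auto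
  thus False using a E[of n] by simp
 qed
qed simp

lemma abs_le_of_symmetric:
 fixes f :: "'a::real_vector => real"
 assumes "\<bar>f x\<bar> <= X" "\<bar>f (- x)\<bar> <= X" shows "\<bar>f x-f (- x)\<bar> <= 2*X" "\<bar>f x + f (- x)\<bar> <= 2*X"
 using assms by linarith+

context parab
begin

lemma p_shift_diff: "p (x-h')-p (x-h) = - (Gp x \<bullet> (h'-h))+(p h'-p h)"
 using p_expand[of x "- h'"] p_expand[of x "- h"] by (simp add: inner_diff_right)

lemma Gp_diag: "Gp d \<bullet> d = 2 * p d"
 unfolding Gp_inner p_def by (simp add: power2_eq_square sum_distrib_left mult_ac)

abbreviation slopes :: "real => real => bool" where
 "slopes C tau \<equiv>
    ALL R m h m' h' X. R > 0 --> adm (tau * R) m h --> adm (tau * R) m' h' -->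
     (ALL x. norm x <= R --> norm (perp e x) >= 1/2 * R --> \<bar>v m' h' x-v m h x\<bar> <= X) -->
     R*(\<bar>Y R m'-Y R m\<bar>+norm (h'-h)) <= C*X"

text \<open>Closeness of two members at scale R determines their parameters. In the difference of
  the values at x and -x the constant \<open>p h'-p h\<close> drops out, leaving the linear part,
  which is tested in the direction of the shift and then in a direction with a vertical
  component.\<close>

lemma slope_bound:
 "EX C>0. EX tau>0. tau <= 1 \<and> slopes C tau"
proof -
 obtain B where B: "B > 0" "ALL x d. \<bar>Gp x \<bullet> d\<bar> <= B*norm x*norm d" using Gp_bounded by blast
 obtain c0 C0 where c0: "c0 > 0" "ALL x. c0*(norm (perp e x))^2 <= p x \<and> p x <= C0*(norm (perp e x))^2" using p_bounds by blast
 define C1 where "C1 = 2+(1+2*B)/(2 * c0)"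
 have C1: "C1 > 0" using B c0 by (auto simp: C1_def intro!: add_pos_nonneg)
 \<comment> \<open>The expansion error is itself proportional to the unknown \<open>R*S\<close>;
   this value lets half of it be absorbed on the left.\<close>
 define eps where "eps = 1/(2*C1)"
 have eps: "eps > 0" using C1 by (simp add: eps_def)
 obtain tau where tau: "tau > 0" "tau <= 1" "v_expands eps (1/2) tau"
  using v_expansion[OF eps, of "1/2"] by auto
 show ?thesis
 proof (rule exI[of _ "2*C1"], rule conjI, use C1 in simp, rule exI[of _ tau], intro conjI allI impI tau(1,2))
  fix R m m' X :: real and h h' :: 'a
  assume R: "R > 0" and a: "adm (tau * R) m h" and a': "adm (tau * R) m' h'"
   and X: "ALL x. norm x <= R --> norm (perp e x) >= 1/2 * R --> \<bar>v m' h' x-v m h x\<bar> <= X"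
  define D where "D = Y R m'-Y R m"
  define d where "d = h'-h"
  define S where "S = \<bar>D\<bar>+norm d"
  define Z where "Z = X+eps * R*S"
  have key: "\<bar>Gp x \<bullet> d+D*(x \<bullet> e)\<bar> <= Z" if x: "norm x <= R" "norm (perp e x) >= 1/2 * R" for x
  proof -
   define A where "A y = - (Gp y \<bullet> d)+(p h'-p h)-D*(y \<bullet> e)" for y
   have A: "\<bar>A y\<bar> <= Z" if y: "norm y <= R" "norm (perp e y) >= 1/2 * R" for y
   proof -
    have 1: "\<bar>v m' h' y-v m h y-(p (y-h')-p (y-h))+D*(y \<bullet> e)\<bar> <= eps * R*S"
     unfolding D_def S_def d_def by (rule tau(3)[rule_format, OF R a a' y])
    have 2: "\<bar>v m' h' y-v m h y\<bar> <= X" using X y by blast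
    have "p (y-h')-p (y-h)-D*(y \<bullet> e) = A y" by (simp add: A_def p_shift_diff d_def)
    thus ?thesis using 1 2 unfolding Z_def by linarith
   qed
   have "\<bar>A x-A (- x)\<bar> <= 2*Z"
    using A[of x] A[of "- x"] x by (intro abs_le_of_symmetric) (auto simp: perp_minus)
   moreover have "A x-A (- x) = - 2*(Gp x \<bullet> d+D*(x \<bullet> e))" by (simp add: A_def linear_neg[OF linear_Gp] algebra_simps)
   ultimately show ?thesis by (simp add: abs_mult)
  qed
  obtain j where j: "j \<in> W" using cardW by (metis card.empty ex_in_conv not_numeral_le_zero)
  have Rj: "norm (R *. j) <= R" "norm (perp e (R *. j)) = R" using R unit[OF j] j by (auto simp: perp_def)
  have Z: "Z >= 0" using key[of "R *. j"] Rj R abs_ge_zero[of "Gp (R *. j) \<bullet> d+D*((R *. j) \<bullet> e)"] by linarith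
  have de: "d \<bullet> e = 0" using a a' by (simp add: d_def adm_def inner_diff_left)
  hence pd: "perp e d = d" by (simp add: perp_def)
  have s1: "2 * c0*(R*norm d) <= Z"
  proof (cases "d = 0")
   case False
   define x where "x = (R/norm d) *. d"
   have "norm x <= R" "norm (perp e x) >= 1/2 * R" "x \<bullet> e = 0" using R False de by (auto simp: x_def perp_scaleR pd)
   from key[OF this(1,2)] this(3) have "\<bar>Gp x \<bullet> d\<bar> <= Z" by simp
   moreover have "Gp x \<bullet> d = (R/norm d)*(2 * p d)" by (simp add: x_def linear_cmul[OF linear_Gp] Gp_diag)
   moreover have "(R/norm d)*(2 * p d) >= (R/norm d)*(2*(c0*(norm d)^2))"
    using c0(2) pd R by (intro mult_left_mono) (metis, auto intro!: divide_nonneg_nonneg)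
   moreover have "(R/norm d)*(2*(c0*(norm d)^2)) = 2 * c0*(R*norm d)" using False by (simp add: power2_eq_square)
   ultimately show ?thesis by linarith
  qed (use Z in simp)
  have s2: "R*\<bar>D\<bar> <= 2*Z+2*B*(R*norm d)"
  proof -
   define x where "x = (R/2) *. e+(R/2) *. j"
   have "perp e x = (R/2) *. j" using j by (simp add: x_def perp_def inner_add_left)
   moreover have nx: "norm x <= R" using norm_triangle_ineq[of "(R/2) *. e" "(R/2) *. j"] R e unit[OF j] by (simp add: x_def)
   ultimately have "\<bar>Gp x \<bullet> d+D*(x \<bullet> e)\<bar> <= Z" using R unit[OF j] by (intro key) auto
   moreover have "x \<bullet> e = R/2" using j by (simp add: x_def inner_add_left)
   moreover have "\<bar>Gp x \<bullet> d\<bar> <= B * R*norm d"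
    using B nx by (meson mult_left_mono mult_right_mono less_imp_le norm_ge_zero order_trans)
   ultimately have "\<bar>D*(R/2)\<bar> <= Z+B * R*norm d" by (simp only:)
   thus ?thesis using R by (simp add: abs_mult mult_ac)
  qed
  have "R*norm d <= Z/(2 * c0)" using s1 c0 by (simp add: pos_le_divide_eq mult.commute)
  hence "(1+2*B)*(R*norm d) <= (1+2*B)*(Z/(2 * c0))" using B by (intro mult_left_mono) auto
  hence "R*S <= 2*Z+(1+2*B)*(Z/(2 * c0))" using s2 by (simp add: S_def algebra_simps)
  also have "\<dots> = C1*Z" by (simp add: C1_def algebra_simps add_divide_distrib)
  also have "C1*Z = C1*X+(C1*eps)*(R*S)" by (simp add: Z_def algebra_simps)
  also have "C1*eps = 1/2" using C1 by (simp add: eps_def)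
  finally show "R*(\<bar>Y R m'-Y R m\<bar>+norm (h'-h)) <= 2*C1*X" by (simp add: S_def D_def d_def)
 qed
qed

abbreviation non_constant :: "real => bool" where
 "non_constant tau \<equiv>
    ALL R m h m' h' a. R > 0 --> adm (tau * R) m h --> adm (tau * R) m' h' -->
     (ALL x. norm x <= R --> norm (perp e x) >= 1/2 * R --> \<bar>v m' h' x-v m h x-a\<bar> <= 3/4*\<bar>a\<bar>) --> a = 0"

text \<open>In the sum of the values at \<open>R *. j\<close> and \<open>-(R *. j)\<close> the
  linear parts cancel and only \<open>2*(p h'-p h)\<close> remains. For small shifts this is far
  below the size of a, because p is quadratic. So no two members differ by nearly a nonzero
  constant.\<close>

lemma no_constant_difference:
 "EX tau>0. tau <= 1 \<and> non_constant tau"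
proof -
 obtain B where B: "B > 0" "ALL x d. \<bar>Gp x \<bullet> d\<bar> <= B*norm x*norm d" using Gp_bounded by blast
 obtain C tau1 where C: "C > 0" "tau1 > 0" "tau1 <= 1" "slopes C tau1" using slope_bound by blast
 define eps where "eps = 1/(32*C)"
 have eps: "eps > 0" using C by (simp add: eps_def)
 obtain tau2 where tau2: "tau2 > 0" "tau2 <= 1" "v_expands eps (1/2) tau2"
  using v_expansion[OF eps, of "1/2"] by auto
 \<comment> \<open>The bound \<open>eps/B\<close> makes the shifts small enough for
   \<open>p h'-p h\<close>, a product of their sum and difference, to be at most
   \<open>eps*(R*S)\<close>.\<close>
 define tau where "tau = min tau1 (min tau2 (eps/B))"
 have tau: "tau > 0" "tau <= tau1" "tau <= tau2" "tau <= eps/B" using C tau2 eps B by (auto simp: tau_def)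
 show ?thesis
 proof (rule exI[of _ tau], intro conjI allI impI)
  show "tau > 0" "tau <= 1" using tau C by auto
  fix R m m' a :: real and h h' :: 'a
  assume R: "R > 0" and a: "adm (tau * R) m h" and a': "adm (tau * R) m' h'"
   and X: "ALL x. norm x <= R --> norm (perp e x) >= 1/2 * R --> \<bar>v m' h' x-v m h x-a\<bar> <= 3/4*\<bar>a\<bar>"
  have tR: "tau * R <= tau1 * R" "tau * R <= tau2 * R" "tau * R <= eps/B * R" using mult_right_mono[OF tau(2), of R] mult_right_mono[OF tau(3), of R] mult_right_mono[OF tau(4), of R] R by auto
  note a1 = adm_mono[OF a tR(1)] adm_mono[OF a' tR(1)] and a2 = adm_mono[OF a tR(2)] adm_mono[OF a' tR(2)]
  define D where "D = Y R m'-Y R m"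
  define d where "d = h'-h"
  define S where "S = \<bar>D\<bar>+norm d"
  have "R*S <= C*(2*\<bar>a\<bar>)" unfolding S_def D_def d_def
  proof (rule C(4)[rule_format, OF R a1])
   fix x assume "norm x <= R" "1/2 * R <= norm (perp e x)"
   with X have "\<bar>v m' h' x-v m h x-a\<bar> <= 3/4*\<bar>a\<bar>" by blast
   thus "\<bar>v m' h' x-v m h x\<bar> <= 2*\<bar>a\<bar>" by linarith
  qed
  hence "eps*(R*S) <= eps*(C*(2*\<bar>a\<bar>))" using eps by (intro mult_left_mono) auto
  also have "\<dots> = \<bar>a\<bar>/16" using C by (simp add: eps_def)
  finally have RS: "eps*(R*S) <= \<bar>a\<bar>/16" .
  have ph: "\<bar>p h'-p h\<bar> <= eps*(R*S)"
  proof -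
   have "p h'-p h = 1/2*(Gp (h'+h) \<bullet> d)"
   proof -
    have "Gp (h'+h) \<bullet> d = Gp h' \<bullet> h'-Gp h \<bullet> h" unfolding d_def linear_add[OF linear_Gp] inner_add_left inner_diff_right
     using Gp_sym[of h h'] by simp
    thus ?thesis by (simp add: Gp_diag)
   qed
   hence "\<bar>p h'-p h\<bar> <= 1/2*(B*norm (h'+h)*norm d)" using B(2)[rule_format, of "h'+h" d] by linarith
   also have "\<dots> <= 1/2*(B*(2*(eps/B * R))*S)"
   proof -
    have "norm (h'+h) <= 2*(eps/B * R)" using norm_triangle_ineq[of h' h] a a' tR unfolding adm_def by linarith
    thus ?thesis using B eps R by (intro mult_left_mono mult_mono) (auto simp: S_def)
   qed
   also have "\<dots> = eps*(R*S)" using B by simp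
   finally show ?thesis .
  qed
  obtain j where j: "j \<in> W" using cardW by (metis card.empty ex_in_conv not_numeral_le_zero)
  have Rj: "norm (R *. j) <= R" "norm (perp e (R *. j)) >= 1/2 * R" "(R *. j) \<bullet> e = 0" using R unit[OF j] j by (auto simp: perp_def)
  define x where "x = R *. j"
  note Rj = Rj[folded x_def]
  have Rm: "norm (- x) <= R" "norm (perp e (- x)) >= 1/2 * R" "(- x) \<bullet> e = 0" using Rj by (auto simp: perp_minus)
  have 1: "\<bar>v m' h' x-v m h x-(p (x-h')-p (x-h))\<bar> <= eps*(R*S)"
   using tau2(3)[rule_format, OF R a2 Rj(1,2)] Rj(3) by (simp add: S_def D_def d_def mult.assoc)
  have 2: "\<bar>v m' h' (- x)-v m h (- x)-(p (- x-h')-p (- x-h))\<bar> <= eps*(R*S)"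
   using tau2(3)[rule_format, OF R a2 Rm(1,2)] Rm(3) by (simp add: S_def D_def d_def mult.assoc)
  have 3: "\<bar>v m' h' x-v m h x-a\<bar> <= 3/4*\<bar>a\<bar>" using X Rj by blast
  have 4: "\<bar>v m' h' (- x)-v m h (- x)-a\<bar> <= 3/4*\<bar>a\<bar>" using X Rm by blast
  have 5: "p (x-h')-p (x-h)+(p (- x-h')-p (- x-h)) = 2*(p h'-p h)"
   unfolding p_shift_diff by (simp add: linear_neg[OF linear_Gp])
  have "\<bar>(v m' h' x-v m h x)+(v m' h' (- x)-v m h (- x))\<bar> <= 4*(eps*(R*S))" using 1 2 5 ph by (smt (verit))
  moreover have "\<bar>(v m' h' x-v m h x)+(v m' h' (- x)-v m h (- x))-2*a\<bar> <= 3/2*\<bar>a\<bar>" using 3 4 by linarith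
  ultimately show "a = 0" using RS by linarith
 qed
qed

end

section \<open>One step of the improvement\<close>

locale expansion = parab e W b for e :: "'a::euclidean_space" and W :: "'a set" and b +
 fixes u :: "'a => real"
 assumes u_sol: "sol u" and u_mono: "t >= 0 ==> u (x+t *. e) <= u x"
  and u_growth: "EX K>0. EX R0>=1. ALL R>=R0. ALL x. norm x <= R --> \<bar>u x-p x\<bar> <= K*(R * sqrt R)"
  and u_tube: "dlt > 0 ==> EX R0>0. ALL R>=R0. ALL x. norm x <= R --> u x = 0 --> norm (perp e x) <= dlt * R"
begin

definition close :: "real => real => real => bool" where
 "close r R X \<longleftrightarrow> (EX m h. adm r m h \<and> (ALL x. norm x <= R --> \<bar>u x-v m h x\<bar> <= X))"

abbreviation improves :: "real => real => real => real => real => bool" where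
 "improves K1 A K tau R0 \<equiv>
    ALL R>=R0. ALL M. M <= 2*K1*(K * R * sqrt (K * R)) --> close (tau*(K * R)) (K * R) M -->
    close (tau * R) R (A/K^2*M) \<or> (EX B>0. close (tau * R) R B \<and> \<not> close (tau*(R/K)) (R/K) (B/2))"

text \<open>The affine part of \<open>u - v m h\<close> on the ball of radius R is removed by
  changing h for the horizontal slope and m for the vertical one. What remains is of order
  \<open>M/K^2\<close>, except for a constant \<open>a'\<close>. If \<open>a'\<close> dominates, it
  still dominates at radius \<open>R/K\<close>: a better approximation there would differ from the
  present one by nearly \<open>a'\<close>, against \<open>no_constant_difference\<close>. The factor
  A is independent of K, so K can later be chosen large.\<close>

lemma improvement_step:
 assumes K1: "K1 > 0" and Rg: "ALL R>=Rg. ALL x. norm x <= R --> \<bar>u x-p x\<bar> <= K1*(R * sqrt R)"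
 shows "EX A>0. ALL K>=12. ALL tau0>0. EX tau>0. tau <= tau0 \<and> (EX R0>=1. improves K1 A K tau R0)"
proof -
 obtain Ca where Ca: "Ca > 0" "affine_const TYPE('a) Ca"
  using diff_affine_approx[OF dim_ge_3] by blast
 obtain Cs taus where Cs: "Cs > 0" "taus > 0" "taus <= 1" "slopes Cs taus" using slope_bound by blast
 obtain Lv taul where Lv: "Lv > 0" "taul > 0" "taul <= 1" "v_lip Lv taul" using v_lipschitz by blast
 obtain Ch where Ch: "Ch > 0" "ALL g. EX h. h \<bullet> e = 0 \<and> norm h <= Ch*norm g \<and> (ALL x. Gp x \<bullet> h = g \<bullet> x-(g \<bullet> e)*(x \<bullet> e))"
  using Gp_solve by blast
 obtain ky tauy where ky: "ky > 0" "tauy > 0" "tauy <= 1" "Y_increasing ky tauy"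
  using Y_increment_lower by blast
 obtain tauc where tauc: "tauc > 0" "tauc <= 1" "non_constant tauc"
  using no_constant_difference by blast
 define A1 where "A1 = 145*Ca+12*(1+Ch)*Ca"
 define A2 where "A2 = 1+Lv*(1+Ch)*Ca"
 define A3 where "A3 = 3*A1+A2"
 have A: "A1 > 0" "A2 > 0" "A3 > 0" using Ca Ch Lv by (auto simp: A1_def A2_def A3_def intro!: add_pos_pos)
 define Bb where "Bb = (\<Sum>j\<in>W. b j)"
 have Bb: "Bb >= 0" unfolding Bb_def using b by (intro sum_nonneg) (auto intro: less_imp_le)
 show ?thesis
 proof (rule exI[of _ "9*A3"], rule conjI, use A in simp, intro allI impI)
  fix K tau0 :: real assume K: "K >= 12" and tau0: "tau0 > 0"
  obtain eta0 where eta0: "eta0 > 0" "eta0 <= 1" "near_axis e (1/K^2) eta0"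
   using diff_near_axis[OF dim_ge_2 e, of "1/K^2"] K by auto
  \<comment> \<open>The bound \<open>1/(2*K)\<close> leaves the region used at radius
    \<open>R/K\<close> outside the excluded tube at radius R.\<close>
  define eta1 where "eta1 = min eta0 (1/(2*K))"
  have eta1: "eta1 > 0" "eta1 <= eta0" "eta1 <= 1/(2*K)" "eta1 <= 1" using eta0 K by (auto simp: eta1_def)
  define eta where "eta = 3*eta1/K"
  have eta: "eta > 0" "eta <= 1" using eta1 K by (auto simp: eta_def pos_divide_le_eq)
  \<comment> \<open>The exponential makes the logarithmic error at most \<open>1/K^2\<close>, the
    order of the quadratic Taylor error.\<close>
  define dlt where "dlt = min (1/16) (min (eta/2) (exp (- (K^2*(1/eta) ^ DIM('a)))))"
  have dlt: "dlt > 0" "dlt <= 1/16" "eta+2*dlt <= 2*eta" "dlt <= exp (- (K^2*(1/eta) ^ DIM('a)))" using eta by (auto simp: dlt_def)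
  have lndlt: "(1/eta) ^ DIM('a)/ln (1/dlt) <= 1/K^2"
  proof -
   have "ln dlt <= - (K^2*(1/eta) ^ DIM('a))" using dlt by (metis ln_exp ln_mono exp_gt_zero)
   hence l: "K\<^sup>2*(1/eta) ^ DIM('a) <= ln (1/dlt)" using dlt by (simp add: ln_div)
   have "0 < K\<^sup>2*(1/eta) ^ DIM('a)" using K eta by simp
   thus ?thesis using l K by (simp add: pos_divide_le_eq pos_le_divide_eq mult.commute)
  qed
  obtain tauv where tauv: "tauv > 0" "tauv <= 1" "v_expands (1/K) (eta1/2) tauv"
   using v_expansion[of "1/K" "eta1/2"] K eta1 by auto
  define tau where "tau = min tau0 (min taus (min taul (min tauy (min tauc tauv))))"
  have tau: "tau > 0" "tau <= tau0" "tau <= taus" "tau <= taul" "tau <= tauy" "tau <= tauc" "tau <= tauv"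
   using tau0 Cs Lv ky tauc tauv by (auto simp: tau_def)
  obtain Rt where Rt: "Rt > 0" "ALL R>=Rt. ALL x. norm x <= R --> u x = 0 --> norm (perp e x) <= dlt * R" using u_tube[OF dlt(1)] by blast
  define C4 where "C4 = 3*Cs*K1*(1+1/ky)+12*Ca*K1"
  have C4: "C4 > 0" using Cs K1 ky Ca by (auto simp: C4_def intro!: add_pos_pos mult_pos_pos)
  define C5 where "C5 = C4*(2+Ch+2/ky)"
  have C5: "C5 > 0" using C4 Ch ky by (auto simp: C5_def intro!: add_pos_pos mult_pos_pos)
  \<comment> \<open>All parameters and slopes will be of order \<open>s = sqrt (K * R)\<close>. Once
    \<open>s <= gam * R\<close>, they are admissible at the smaller radius \<open>R/K\<close> and
    the zero set of \<open>v m h\<close> lies in the prescribed tube.\<close>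
  define gam where "gam = min (tau/(K*C5)) (min (dlt*K/(6*C4)) (dlt^2*K/(36*((Bb+1)*C4))))"
  have gam: "gam > 0" "gam <= tau/(K*C5)" "gam <= dlt*K/(6*C4)" "gam <= dlt^2*K/(36*((Bb+1)*C4))"
   using tau K C5 C4 dlt Bb by (auto simp: gam_def intro!: divide_pos_pos mult_pos_pos)
  define R0 where "R0 = max 1 (max \<bar>Rg\<bar> (max Rt (K/gam^2)))"
  show "EX tau>0. tau <= tau0 \<and> (EX R0>=1. improves K1 (9*A3) K tau R0)"
  proof (rule exI[of _ tau], intro conjI tau(1,2), rule exI[of _ R0], intro conjI allI impI)
   show "R0 >= 1" by (simp add: R0_def)
   fix R M assume R0: "R >= R0" and M: "M <= 2*K1*(K * R * sqrt (K * R))" and cl: "close (tau*(K * R)) (K * R) M"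
   have R: "R >= 1" "R >= Rg" "R >= Rt" "R >= K/gam^2" "R > 0" using R0 by (auto simp: R0_def)
   obtain m h where mh: "adm (tau*(K * R)) m h" "ALL x. norm x <= K * R --> \<bar>u x-v m h x\<bar> <= M" using cl by (auto simp: close_def)
   have KR: "K * R >= 12 * R" using K R by (intro mult_right_mono) auto
   have M0: "M >= 0" using mh(2)[rule_format, of 0] KR R by auto
   define s where "s = sqrt (K * R)"
   have s: "s > 0" "s * s = K * R" using KR R K by (auto simp: s_def)
   have sgam: "s <= gam * R"
   proof -
    have "K <= gam^2 * R" using R(4) gam(1) by (simp add: pos_divide_le_eq mult.commute)
    hence "K * R <= (gam^2 * R) * R" using R by (intro mult_right_mono) auto
    also have "\<dots> = (gam * R)^2" by (simp add: power2_eq_square)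
    finally show ?thesis unfolding s_def using gam R by (intro real_le_lsqrt) auto
   qed
   have sgam': "s <= x * R" if "gam <= x" for x
    using sgam mult_right_mono[OF that, of R] R by linarith
   have sb: "C5 * s <= tau*(R/K)" "C4 * s <= dlt*(K * R)/6" "(Bb+1)*(C4 * s) <= dlt^2*(K * R)/36"
   proof -
    have "C5 * s <= C5*((tau/(K*C5)) * R)" using C5 by (intro mult_left_mono sgam' gam(2)) auto
    thus "C5 * s <= tau*(R/K)" using C5 by simp
    have "C4 * s <= C4*((dlt*K/(6*C4)) * R)" using C4 by (intro mult_left_mono sgam' gam(3)) auto
    thus "C4 * s <= dlt*(K * R)/6" using C4 by simp
    define q where "q = (Bb+1)*C4"
    have q: "q > 0" using Bb C4 by (simp add: q_def)
    have "q * s <= q*((dlt^2*K/(36*q)) * R)" using q by (intro mult_left_mono sgam' gam(4)[folded q_def]) auto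
    also have "\<dots> = dlt^2*(K * R)/36" using q by simp
    finally show "(Bb+1)*(C4 * s) <= dlt^2*(K * R)/36" by (simp add: q_def mult.assoc)
   qed
   have tKR: "tau*(K * R) <= taus*(K * R)" "tau*(K * R) <= tauy*(K * R)" using tau KR R by (auto intro!: mult_right_mono)
   have Y0: "0 <= Y r m" if "r > 0" for r using Y_mono[OF that, of 0 m] mh(1) by (auto simp: adm_def)
   \<comment> \<open>Comparison with p itself, the member with parameters 0. Both u and
     \<open>v m h\<close> are within order \<open>(K * R)^(3/2)\<close> of p, so by
     \<open>slope_bound\<close> the parameters are of order s.\<close>
   have small: "Y (K * R) m+norm h <= 3*Cs*K1 * s" 
   proof -
    have "(K * R)*(\<bar>Y (K * R) m-Y (K * R) 0\<bar>+norm (h-0)) <= Cs*(3*K1*(K * R * s))"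
    proof (rule Cs(4)[rule_format])
     show "K * R > 0" using KR R by linarith
     show "adm (taus*(K * R)) 0 0" using Cs KR R by (auto simp: adm_def)
     show "adm (taus*(K * R)) m h" using adm_mono[OF mh(1) tKR(1)] .
     fix x :: 'a assume x: "norm x <= K * R"
     have "\<bar>u x-p x\<bar> <= K1*(K * R * s)" unfolding s_def using Rg[rule_format, of "K * R" x] x KR R by auto
     moreover have "\<bar>u x-v m h x\<bar> <= 2*(K1*(K * R * s))" using mh(2) x M by (force simp: s_def)
     moreover have "v 0 0 x = p x" by (simp add: v_def phi_def)
     ultimately show "\<bar>v m h x-v 0 0 x\<bar> <= 3*K1*(K * R * s)" by linarith
    qed
    hence "(K * R)*(Y (K * R) m+norm h) <= (K * R)*(3*Cs*K1 * s)" using Y0[of "K * R"] KR R by (simp add: mult_ac)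
    moreover have "K * R > 0" using KR R by linarith
    ultimately show ?thesis by (simp only: mult_le_cancel_left_pos)
   qed
   have KRp: "K * R > 0" using KR R by linarith
   have c1: "3*Cs*K1 * s <= C4 * s" "(3*Cs*K1 * s)/ky <= C4 * s"
    using Cs K1 ky Ca s by (auto simp: C4_def algebra_simps)
   have mb: "0 <= m" "m <= C4 * s" "norm h <= C4 * s" "h \<bullet> e = 0" "Y (2 * R) m <= C4 * s"
   proof -
    show "0 <= m" "h \<bullet> e = 0" using mh(1) by (auto simp: adm_def)
    show "norm h <= C4 * s" using small Y0[OF KRp] c1 by linarith
    have "ky*\<bar>m-0\<bar> <= \<bar>Y (K * R) m-Y (K * R) 0\<bar>"
     by (rule ky(4)[rule_format]) (use mh(1) tKR KRp ky in \<open>auto simp: adm_def\<close>)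
    hence "ky*m <= Y (K * R) m" using mh(1) Y0[OF KRp] by (simp add: adm_def)
    hence "ky*m <= 3*Cs*K1 * s" using small norm_ge_zero[of h] by linarith
    hence "m <= (3*Cs*K1 * s)/ky" using ky by (simp add: pos_le_divide_eq mult.commute)
    thus "m <= C4 * s" using c1 by linarith
    have "\<bar>Y (2 * R) m-Y (2 * R) 0\<bar> <= \<bar>Y (K * R) m-Y (K * R) 0\<bar>"
     by (rule Y_increment_mono) (use R KR mh(1) in \<open>auto simp: adm_def\<close>)
    hence "Y (2 * R) m <= Y (K * R) m" using Y0[OF KRp] by simp
    thus "Y (2 * R) m <= C4 * s" using small norm_ge_zero[of h] c1 by linarith
   qed
   \<comment> \<open>The affine approximation uses data up to \<open>6*rho = K * R\<close>, and
     \<open>K >= 12\<close> ensures \<open>rho >= 2 * R\<close>.\<close>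
   define rho where "rho = K * R/6"
   have rho: "rho > 0" "6*rho = K * R" "rho >= 2 * R" using KRp KR by (auto simp: rho_def)
   have tube: "norm (perp e x) <= 2*dlt*rho" if x: "norm x <= 2*rho" and z: "u x = 0 \<or> v m h x = 0" for x
    using z
   proof
    assume "u x = 0"
    hence "norm (perp e x) <= dlt*(2*rho)" using Rt(2)[rule_format, of "2*rho" x] x rho R by linarith
    thus ?thesis by simp
   next
    assume vz: "v m h x = 0"
    have "(norm (perp e (x-h)))\<^sup>2 <= (Bb*m)*norm x" using v_zero_tube[OF mb(1,4) vz] by (simp add: Bb_def)
    also have "\<dots> <= ((Bb+1)*(C4 * s))*(K * R)"
     using mb Bb x rho KRp by (intro mult_mono) auto
    also have "\<dots> <= (dlt^2*(K * R)/36)*(K * R)" using sb(3) KRp by (intro mult_right_mono) auto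
    also have "\<dots> = (dlt*rho)^2" by (simp add: rho_def power2_eq_square)
    finally have "norm (perp e (x-h)) <= dlt*rho" by (rule power2_le_imp_le) (use dlt rho in simp)
    moreover have "norm (perp e h) <= dlt*rho" using norm_perp_le[OF e, of h] mb sb(2) by (simp add: rho_def)
    moreover have "norm (perp e x) <= norm (perp e (x-h))+norm (perp e h)"
     using norm_triangle_ineq[of "perp e (x-h)" "perp e h"] by (simp add: perp_diff)
    ultimately show ?thesis by linarith
   qed
   have "EX a g. \<bar>a\<bar> <= M \<and> norm g <= Ca*M/rho \<and>
       (ALL x. norm x <= rho --> norm (perp e x) >= (eta+2*dlt)*rho -->
         \<bar>(u x-v m h x)-(a+g \<bullet> x)\<bar> <= Ca*M*((norm x/rho)^2+(1/eta) ^ DIM('a)/ln (1/dlt)))"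
    by (rule Ca(2)[unfolded affine_const_def, rule_format, OF u_sol v_sol[OF mb(1)] e rho(1) dlt(1,2) eta])
      (use mh(2) rho tube in auto)
   then obtain a g where ag: "\<bar>a\<bar> <= M" "norm g <= Ca*M/rho"
    "ALL x. norm x <= rho --> norm (perp e x) >= (eta+2*dlt)*rho -->
         \<bar>(u x-v m h x)-(a+g \<bullet> x)\<bar> <= Ca*M*((norm x/rho)^2+(1/eta) ^ DIM('a)/ln (1/dlt))" by blast
   have aff: "\<bar>(u x-v m h x)-(a+g \<bullet> x)\<bar> <= 145*Ca*(M/K^2)" if x: "norm x <= 2 * R" "norm (perp e x) >= eta1 * R" for x
   proof -
    have "(eta+2*dlt)*rho <= (2*eta)*rho" using dlt rho by (intro mult_right_mono) auto
    also have "\<dots> = eta1 * R" using K by (simp add: eta_def rho_def)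
    finally have "\<bar>(u x-v m h x)-(a+g \<bullet> x)\<bar> <= Ca*M*((norm x/rho)^2+(1/eta) ^ DIM('a)/ln (1/dlt))"
     using ag(3) x rho by auto
    \<comment> \<open>The ratio \<open>2 * R/rho\<close> is \<open>12/K\<close>, whence 144; the
      second term is the logarithmic error.\<close>
    also have "\<dots> <= Ca*M*(144/K^2+1/K^2)"
    proof -
     have "norm x/rho <= (2 * R)/rho" using x rho by (intro divide_right_mono) auto
     also have "\<dots> = 12/K" using R K by (simp add: rho_def)
     finally have "(norm x/rho)\<^sup>2 <= (12/K)^2" using rho by (intro power_mono) auto
     hence "(norm x/rho)\<^sup>2 <= 144/K^2" by (simp add: power_divide)
     thus ?thesis using lndlt Ca M0 by (intro mult_left_mono add_mono) auto
    qed
    also have "\<dots> = 145*Ca*(M/K^2)" by (simp add: add_divide_distrib[symmetric])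
    finally show ?thesis .
   qed
   have gb: "norm g <= 6*Ca*M/(K * R)" "norm g <= C4 * s"
   proof -
    show 1: "norm g <= 6*Ca*M/(K * R)" using ag(2) by (simp add: rho_def mult_ac)
    have "6*Ca*M/(K * R) <= 6*Ca*(2*K1*(K * R * s))/(K * R)"
     using M Ca KRp by (intro divide_right_mono mult_left_mono) (auto simp: s_def)
    also have "\<dots> = 12*Ca*K1 * s" using K R by simp
    also have "\<dots> <= C4 * s" using Cs K1 ky s by (intro mult_right_mono) (auto simp: C4_def)
    finally show "norm g <= C4 * s" using 1 by linarith
   qed
   obtain h1 where h1: "h1 \<bullet> e = 0" "norm h1 <= Ch*norm g" "ALL x. Gp x \<bullet> h1 = g \<bullet> x-(g \<bullet> e)*(x \<bullet> e)" using Ch(2) by blast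
   define h' where "h' = h-h1"
   have ge: "\<bar>g \<bullet> e\<bar> <= norm g" by (rule abs_inner_unit_le[OF e])
   have C5e: "C5 * s = 2*(C4 * s)+Ch*(C4 * s)+2*(C4 * s)/ky" by (simp add: C5_def algebra_simps)
   have C4s: "C4 * s > 0" "Ch*(C4 * s) > 0" "2*(C4 * s)/ky > 0" using C4 s Ch ky by auto
   have RK: "R/K > 0" "R/K <= R" using R K by (auto simp: pos_divide_le_eq)
   have tRK: "tau*(R/K) <= tau * R" using RK tau by (intro mult_left_mono) auto
   have h': "h' \<bullet> e = 0" "norm h' <= tau*(R/K)"
   proof -
    show "h' \<bullet> e = 0" using h1 mb by (simp add: h'_def inner_diff_left)
    have "Ch*norm g <= Ch*(C4 * s)" using gb Ch by (intro mult_left_mono) auto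
    hence "norm h' <= C5 * s" using norm_triangle_ineq4[of h h1] h1(2) mb(3) C4s C5e unfolding h'_def by linarith
    thus "norm h' <= tau*(R/K)" using sb(1) by linarith
   qed
   \<comment> \<open>The value of Y that would cancel the vertical slope. It may be negative, while
     Y is nonnegative; in that case \<open>m' = 0\<close> is taken and the slope \<open>sig\<close>
     remains.\<close>
   define tg where "tg = Y (2 * R) m-g \<bullet> e"
   define mu where "mu = tau*(R/K)"
   have mu: "mu > 0" unfolding mu_def by (rule mult_pos_pos[OF tau(1) RK(1)])
   have muy: "mu <= tauy*(2 * R)"
   proof -
    have "mu <= tau*(2 * R)" unfolding mu_def using tau RK R by (intro mult_left_mono) auto
    also have "\<dots> <= tauy*(2 * R)" using tau R by (intro mult_right_mono) auto
    finally show ?thesis .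
   qed
   have "EX m'. 0 <= m' \<and> m' <= mu \<and> Y (2 * R) m' = max 0 tg"
   proof -
    have "Y (2 * R) 0 <= max 0 tg" by simp
    moreover have "max 0 tg <= Y (2 * R) mu"
    proof -
     have "ky*\<bar>mu-0\<bar> <= \<bar>Y (2 * R) mu-Y (2 * R) 0\<bar>"
      by (rule ky(4)[rule_format]) (use mu muy ky R in auto)
     moreover have "Y (2 * R) mu >= 0" using Y_mono[of "2 * R" 0 mu] R mu by simp
     ultimately have 1: "ky*mu <= Y (2 * R) mu" using mu by simp
     have "tg <= 2*(C4 * s)" using mb(5) ge gb(2) unfolding tg_def by linarith
     moreover have "2*(C4 * s) <= ky*mu"
     proof -
      have "2*(C4 * s)/ky <= mu" using C5e C4s sb(1) unfolding mu_def by linarith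
      thus ?thesis using ky by (simp add: pos_divide_le_eq mult.commute)
     qed
     ultimately show ?thesis using 1 C4s by linarith
    qed
    ultimately show ?thesis using IVT'[of "Y (2 * R)" 0 "max 0 tg" mu] Y_cont[of "2 * R" mu] R mu by auto
   qed
   then obtain m' where m': "0 <= m'" "m' <= mu" "Y (2 * R) m' = max 0 tg" by blast
   have adm': "adm (tau*(R/K)) m' h'" using m' h' by (auto simp: adm_def mu_def)
   have adm0: "adm (tau*(R/K)) m h" using mb sb(1) C5e C4s by (auto simp: adm_def)
   define D where "D = Y (2 * R) m'-Y (2 * R) m"
   have D: "\<bar>D\<bar> <= norm g" unfolding D_def m'(3) tg_def using ge Y0[of "2 * R"] R by linarith
   define S where "S = \<bar>D\<bar>+norm (h'-h)"
   have S: "S <= (1+Ch)*norm g" using D h1(2) by (simp add: S_def h'_def distrib_right)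
   have RS: "R*S <= 6*(1+Ch)*Ca*(M/K)"
   proof -
    have "R*S <= R*((1+Ch)*(6*Ca*M/(K * R)))"
     using R Ch by (intro mult_left_mono order_trans[OF S] gb(1)) auto
    also have "\<dots> = 6*(1+Ch)*Ca*(M/K)" using R by simp
    finally show ?thesis .
   qed
   have tR2: "tau*(R/K) <= tauv*(2 * R)" "tau*(R/K) <= taul*(2 * R)" "tau*(R/K) <= tauc*(R/K)"
   proof -
    have "R/K <= 2 * R" using RK R by linarith
    thus "tau*(R/K) <= tauv*(2 * R)" "tau*(R/K) <= taul*(2 * R)" "tau*(R/K) <= tauc*(R/K)"
     using tau RK R by (simp_all only: mult_mono less_imp_le order_less_le_trans[OF tau(1)] order_refl)
   qed
   define kp0 where "kp0 = p h'-p h"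
   define sig where "sig = g \<bullet> e+D"
   have sig: "sig >= 0" "m' \<noteq> 0 ==> sig = 0"
   proof -
    show "sig >= 0" unfolding sig_def D_def m'(3) tg_def by linarith
    assume "m' \<noteq> 0"
    have "ky*\<bar>m'-0\<bar> <= \<bar>Y (2 * R) m'-Y (2 * R) 0\<bar>"
     by (rule ky(4)[rule_format]) (use m' muy ky R in auto)
    moreover have "ky*\<bar>m'-0\<bar> > 0" using \<open>m' \<noteq> 0\<close> ky by simp
    moreover have "Y (2 * R) m' >= 0" unfolding m'(3) by simp
    ultimately have "Y (2 * R) m' > 0" by simp
    thus "sig = 0" unfolding sig_def D_def m'(3) tg_def by linarith
   qed
   define a' where "a' = a-kp0"
   define Q where "Q = M/K^2"
   have Q: "Q >= 0" using M0 by (simp add: Q_def)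
   have e1: "\<bar>(u x-v m' h' x)-(a'+sig*(x \<bullet> e))\<bar> <= A1*Q" if x: "norm x <= 2 * R" "norm (perp e x) >= eta1 * R" for x
   proof -
    have "\<bar>v m' h' x-v m h x-(p (x-h')-p (x-h))+D*(x \<bullet> e)\<bar> <= (1/K)*(2 * R)*S"
     unfolding D_def S_def
     by (rule tauv(3)[rule_format, OF _ adm_mono[OF adm0 tR2(1)] adm_mono[OF adm' tR2(1)]]) (use x R in auto)
    also have "\<dots> = 2/K*(R*S)" by simp
    also have "\<dots> <= 2/K*(6*(1+Ch)*Ca*(M/K))" using RS K by (intro mult_left_mono) auto
    also have "\<dots> = 12*(1+Ch)*Ca*Q" by (simp add: Q_def power2_eq_square)
    finally have 1: "\<bar>v m' h' x-v m h x-(p (x-h')-p (x-h))+D*(x \<bullet> e)\<bar> <= 12*(1+Ch)*Ca*Q" .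
    have 2: "p (x-h')-p (x-h) = g \<bullet> x-(g \<bullet> e)*(x \<bullet> e) + kp0"
     unfolding p_shift_diff using h1(3) by (simp add: h'_def kp0_def)
    have 3: "\<bar>(u x-v m h x)-(a+g \<bullet> x)\<bar> <= 145*Ca*Q" using aff[OF x] by (simp add: Q_def)
    have "A1*Q = 145*Ca*Q+12*(1+Ch)*Ca*Q" by (simp add: A1_def algebra_simps)
    moreover have "sig*(x \<bullet> e) = (g \<bullet> e)*(x \<bullet> e)+D*(x \<bullet> e)" by (simp add: sig_def distrib_right)
    ultimately show ?thesis using 1 3 unfolding 2 a'_def by linarith
   qed
   \<comment> \<open>The remaining slope is nonnegative by construction. For \<open>m' = 0\<close>
     the model is constant along e while u decreases, so comparing two points at heights R and -R
     bounds \<open>sig * R\<close> by the error.\<close>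
   have sigR: "sig * R <= A1*Q"
   proof (cases "m' = 0")
    case False thus ?thesis using sig A Q by simp
   next
    case True
    obtain j where j: "j \<in> W" using cardW by (metis card.empty ex_in_conv not_numeral_le_zero)
    define x y where "x = R *. j+R *. e" and "y = R *. j-R *. e"
    have px: "perp e x = R *. j" "perp e y = R *. j" "x \<bullet> e = R" "y \<bullet> e = - R"
     using j by (simp_all add: x_def y_def perp_def inner_add_left inner_diff_left)
    have etaR: "eta1 * R <= R" using eta1 R by (simp add: mult_le_cancel_right1)
    have nx: "norm x <= 2 * R" "norm y <= 2 * R"
     using norm_triangle_ineq[of "R *. j" "R *. e"] norm_triangle_ineq4[of "R *. j" "R *. e"] R e unit[OF j] by (auto simp: x_def y_def)
    have 1: "\<bar>(u x-v m' h' x)-(a'+sig * R)\<bar> <= A1*Q"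
     using e1[of x] nx px etaR R unit[OF j] by simp
    have 2: "\<bar>(u y-v m' h' y)-(a'-sig * R)\<bar> <= A1*Q"
     using e1[of y] nx px etaR R unit[OF j] by simp
    have "(2 * R) *. e = R *. e+R *. e" by (simp add: scaleR_add_left[symmetric])
    hence xy: "x = y+(2 * R) *. e" by (simp add: x_def y_def)
    have "u x <= u y" unfolding xy by (rule u_mono) (use R in simp)
    moreover have "v m' h' x = v m' h' y"
     unfolding v_def phi_def True using p_shift[of "y-h'" "2 * R"] unfolding xy by (simp add: algebra_simps)
    ultimately show ?thesis using 1 2 by linarith
   qed
   have e2: "\<bar>(u x-v m' h' x)-a'\<bar> <= 3*A1*Q" if x: "norm x <= 2 * R" "norm (perp e x) >= eta1 * R" for x
   proof -
    have "\<bar>sig*(x \<bullet> e)\<bar> <= sig*(2 * R)" unfolding abs_mult using sig abs_inner_unit_le[OF e, of x] x by (intro mult_mono) auto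
    thus ?thesis using e1[OF x] sigR by linarith
   qed
   \<comment> \<open>A crude bound on the whole ball, needed only inside the tube, where
     \<open>diff_near_axis\<close> multiplies it by \<open>1/K^2\<close>.\<close>
   have e3: "\<bar>u x-v m' h' x\<bar> <= A2*M" if x: "norm x <= 2 * R" for x
   proof -
    have "\<bar>v m' h' x-v m h x\<bar> <= Lv*(2 * R)*S" unfolding S_def D_def
     by (rule Lv(4)[rule_format, OF _ adm_mono[OF adm0 tR2(2)] adm_mono[OF adm' tR2(2)]]) (use x R in auto)
    also have "\<dots> = 2*Lv*(R*S)" by simp
    also have "\<dots> <= 2*Lv*(6*(1+Ch)*Ca*(M/K))" using RS Lv by (intro mult_left_mono) auto
    also have "\<dots> <= 2*Lv*(6*(1+Ch)*Ca*(M/12))"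
     using K M0 Lv Ch Ca by (intro mult_left_mono divide_left_mono) auto
    also have "\<dots> = Lv*(1+Ch)*Ca*M" by simp
    finally have "\<bar>v m' h' x-v m h x\<bar> <= Lv*(1+Ch)*Ca*M" .
    moreover have "norm x <= K * R" using x KR R by linarith
    ultimately show ?thesis using mh(2)[rule_format, of x] by (simp add: A2_def distrib_right)
   qed
   have e4: "\<bar>u x-v m' h' x\<bar> <= \<bar>a'\<bar>+A3*Q" if x: "norm x <= R" for x
   proof -
    have "\<bar>u x-v m' h' x\<bar> <= (\<bar>a'\<bar>+3*A1*Q)+(1/K^2)*(A2*M)"
    proof (rule eta0(3)[rule_format, OF u_sol v_sol[OF m'(1)] R(5)])
     fix x :: 'a assume x: "norm x <= 2 * R" "eta0 * R <= norm (perp e x)"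
     have "eta1 * R <= eta0 * R" using eta1 R by (intro mult_right_mono) auto
     thus "\<bar>u x-v m' h' x\<bar> <= \<bar>a'\<bar>+3*A1*Q" using e2[of x] x by linarith
    qed (use e3 A Q x in auto)
    also have "(1/K^2)*(A2*M) = A2*Q" by (simp add: Q_def)
    finally show ?thesis by (simp add: A3_def distrib_right)
   qed
   have admR: "adm (tau * R) m' h'" by (rule adm_mono[OF adm' tRK])
   show "close (tau * R) R (9*A3/K^2*M) \<or> (EX B>0. close (tau * R) R B \<and> \<not> close (tau*(R/K)) (R/K) (B/2))"
   proof (cases "\<bar>a'\<bar> <= 8*A3*Q")
    case True
    have "9*A3/K^2*M = 9*A3*Q" by (simp add: Q_def)
    hence "close (tau * R) R (9*A3/K^2*M)" unfolding close_def using admR e4 True by (intro exI[of _ m'] exI[of _ h']) force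
    thus ?thesis ..
   next
    case False
    have A3Q: "A3*Q >= 0" "A1*Q >= 0" "A2*Q >= 0" using A Q by auto
    have A3e: "A3*Q = 3*A1*Q+A2*Q" by (simp add: A3_def distrib_right)
    \<comment> \<open>The constant plus an error of at most one eighth of it. At radius
      \<open>R/K\<close>, half of B and the error off the axis add up to at most
      \<open>9/16 + 1/8\<close> of \<open>a'\<close>, below the 3/4 of
      \<open>no_constant_difference\<close>.\<close>
    define B where "B = 9/8*\<bar>a'\<bar>"
    have B: "B > 0" using False A3Q by (simp add: B_def) 
    have "close (tau * R) R B" unfolding close_def using admR e4 False by (intro exI[of _ m'] exI[of _ h']) (force simp: B_def)
    moreover have "\<not> close (tau*(R/K)) (R/K) (B/2)"
    proof
     assume "close (tau*(R/K)) (R/K) (B/2)"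
     then obtain m2 h2 where 2: "adm (tau*(R/K)) m2 h2" "ALL x. norm x <= R/K --> \<bar>u x-v m2 h2 x\<bar> <= B/2" by (auto simp: close_def)
     have "a' = 0"
     proof (rule tauc(3)[rule_format, OF RK(1) adm_mono[OF adm' tR2(3)] adm_mono[OF 2(1) tR2(3)]])
      fix x assume x: "norm x <= R/K" "1/2*(R/K) <= norm (perp e x)"
      have "eta1 * R <= 1/(2*K) * R" using eta1 R by (intro mult_right_mono) auto
      hence "eta1 * R <= norm (perp e x)" using x by simp
      moreover have "norm x <= 2 * R" using x RK R by linarith
      ultimately have "\<bar>(u x-v m' h' x)-a'\<bar> <= 3*A1*Q" by (intro e2)
      moreover have "\<bar>u x-v m2 h2 x\<bar> <= B/2" using 2 x by blast
      ultimately show "\<bar>v m2 h2 x-v m' h' x-a'\<bar> <= 3/4*\<bar>a'\<bar>"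
       using False A3Q A3e unfolding B_def by linarith
     qed
     thus False using B by (simp add: B_def)
    qed
    ultimately show ?thesis using B by blast
   qed
  qed
 qed
qed

end

section \<open>Iteration over scales\<close>

lemma geometric_increments:
 fixes a :: "nat => 'b::banach"
 assumes r: "0 <= r" "r <= 1/2" and inc: "\<And>j. norm (a (Suc j)-a j) <= C*r ^ j"
 shows "norm (a (j+n)-a j) <= 2*C*r ^ j" and "convergent a"
proof -
 have C: "C >= 0" using order_trans[OF norm_ge_zero inc[of 0]] by simp
 have b: "norm (a (j+n)-a j) <= 2*C*r ^ j*(1-r ^ n)" for j n
 proof (induction n)
  case (Suc n)
  have "norm (a (j+Suc n)-a j) <= norm (a (Suc (j+n))-a (j+n))+norm (a (j+n)-a j)"
   using norm_triangle_ineq[of "a (Suc (j+n))-a (j+n)" "a (j+n)-a j"] by simp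
  also have "\<dots> <= C*r ^ (j+n)+2*C*r ^ j*(1-r ^ n)" by (intro add_mono inc Suc)
  also have "C*r ^ (j+n) <= (C*r ^ j*r ^ n)*(2*(1-r))"
   using C r mult_left_mono[of 1 "2*(1-r)" "C*r ^ j*r ^ n"] by (simp add: power_add)
  finally show ?case by (simp add: algebra_simps)
 qed simp
 have b2: "norm (a (j+n)-a j) <= 2*C*r ^ j" for j n
 proof -
  have "2*C*r ^ j*(1-r ^ n) <= 2*C*r ^ j*1" using C r by (intro mult_left_mono) auto
  thus ?thesis using b[of j n] by simp
 qed
 thus "norm (a (j+n)-a j) <= 2*C*r ^ j" .
 have "Cauchy a"
 proof (rule CauchyI)
  fix e :: real assume e: "e > 0"
  have "(%j. 2*C*r ^ j) \<longlonglongrightarrow> 2*C*0" by (intro tendsto_intros LIMSEQ_power_zero) (use r in simp)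
  hence "\<forall>\<^sub>F j in sequentially. 2*C*r ^ j < e/2" by (rule order_tendstoD) (use e in simp)
  then obtain J where J: "2*C*r ^ J < e/2" by (auto simp: eventually_sequentially)
  have "norm (a m-a n) < e" if mn: "m >= J" "n >= J" for m n
  proof -
   have "norm (a m-a J) <= 2*C*r ^ J" "norm (a n-a J) <= 2*C*r ^ J"
    using b2[of J "m-J"] b2[of J "n-J"] mn by simp_all
   thus ?thesis using norm_triangle_ineq4[of "a m-a J" "a n-a J"] J by simp
  qed
  thus "EX M. ALL m>=M. ALL n>=M. norm (a m-a n) < e" by blast
 qed
 thus "convergent a" by (simp add: Cauchy_convergent_iff)
qed

context expansion
begin

lemma close_mono: "close r R X ==> X <= X' ==> close r R X'"
 unfolding close_def by (meson order_trans)

text \<open>The optimal distances along radii \<open>K^j * Rb\<close> satisfy the alternative of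
  \<open>dichotomy_growth\<close>; the growth bound of order 3/2 excludes permanent expansion, so
  the distances at most double from scale to scale.\<close>

lemma decay_rate:
 assumes K0: "tau0 > 0"
 shows "EX K>=K0. K >= 12 \<and> (EX tau>0. tau <= tau0/K \<and> (EX Rb>=1. EX C>0. ALL j. close (tau*(K ^ j * Rb)) (K ^ j * Rb) (C*2 ^ j)))"
proof -
 obtain K1 Rg where K1: "K1 > 0" "Rg >= 1" and Rg: "ALL R>=Rg. ALL x. norm x <= R --> \<bar>u x-p x\<bar> <= K1*(R * sqrt R)"
  using u_growth by blast
 obtain A where A: "A > 0" "ALL K>=12. ALL tau0>0. EX tau>0. tau <= tau0 \<and> (EX R0>=1. improves K1 A K tau R0)"
  using improvement_step[OF K1(1) Rg] by blast
 \<comment> \<open>Makes \<open>A/K^2 < 1/2\<close> and, because \<open>K > A^2\<close>, also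
   \<open>A/K^2 * K^(3/2) < 1\<close>.\<close>
 define K where "K = max K0 12+2*A+A^2"
 have K: "K >= K0" "K >= 12" "K > 2*A" "K > A\<^sup>2" using A(1) zero_le_power2[of A] max.cobounded1[of K0 12] max.cobounded2[of 12 K0] unfolding K_def by linarith+
 define kp where "kp = A/K^2"
 have kp: "kp > 0" "kp < 1/2" "kp*(K * sqrt K) < 1"
 proof -
  show "kp > 0" using A K by (simp add: kp_def)
  have "2*A < K*1" using K by simp
  also have "\<dots> <= K*K" using K by (intro mult_left_mono) auto
  finally show "kp < 1/2" using K by (simp add: kp_def pos_divide_less_eq power2_eq_square)
  have sK: "sqrt K > A" using K A by (intro real_less_rsqrt) auto
  have s2: "sqrt K * sqrt K = K" "sqrt K > 0" using K by auto
  have "A*(K * sqrt K) < sqrt K*(K * sqrt K)" using sK K by (intro mult_strict_right_mono) auto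
  also have "\<dots> = K^2" using s2 by (simp add: power2_eq_square)
  finally show "kp*(K * sqrt K) < 1" using K by (simp add: kp_def pos_divide_less_eq)
 qed
 have "tau0/K > 0" using K0 K by simp
 then obtain tau R0 where tau: "tau > 0" "tau <= tau0/K" "R0 >= 1" and step: "improves K1 A K tau R0"
  using A(2) K(2) by blast
 define Rb where "Rb = max R0 Rg"
 have Rb: "Rb >= R0" "Rb >= Rg" "Rb >= 1" using K1 by (auto simp: Rb_def)
 define r where "r j = K ^ j * Rb" for j :: nat
 have Kj: "K ^ j >= 1" for j using K by (simp add: one_le_power)
 have r: "r j >= Rb" "r j > 0" for j
 proof -
  show "r j >= Rb" unfolding r_def using Kj[of j] Rb mult_right_mono[of 1 "K ^ j" Rb] by simp
  thus "r j > 0" using Rb by linarith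
 qed
 have rS: "r (Suc j) = K*r j" "r (Suc j)/K = r j" for j using K by (simp_all add: r_def)
 define S where "S j = {X. X >= 0 \<and> close (tau*r j) (r j) X}" for j
 define E where "E j = Inf (S j)" for j
 define g where "g j = K1*(r j * sqrt (r j))" for j
 have g0: "g j >= 0" for j using K1 r(2)[of j] by (simp add: g_def)
 have gS: "g j \<in> S j" for j
 proof -
  have "close (tau*r j) (r j) (g j)" unfolding close_def
  proof (intro exI[of _ 0] conjI allI impI)
   have "0 <= tau*r j" using tau r(2)[of j] by (intro mult_nonneg_nonneg) auto
   thus "adm (tau*r j) 0 0" by (simp add: adm_def)
   fix x :: 'a assume "norm x <= r j"
   thus "\<bar>u x-v 0 0 x\<bar> <= g j" using Rg[rule_format, of "r j" x] r(1)[of j] Rb by (simp add: v_def phi_def g_def)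
  qed
  thus ?thesis using g0 by (simp add: S_def)
 qed
 have bdd: "bdd_below (S j)" for j by (rule bdd_belowI[of _ 0]) (simp add: S_def)
 have Ele: "X \<in> S j ==> E j <= X" for X j unfolding E_def by (rule cInf_lower[OF _ bdd])
 have Ege: "(\<And>X. X \<in> S j ==> Z <= X) ==> Z <= E j" for Z j unfolding E_def by (rule cInf_greatest) (use gS in blast)+
 have E0: "E j >= 0" for j by (rule Ege) (simp add: S_def)
 have alt: "E (Suc j) <= kp*E (Suc (Suc j)) \<or> E (Suc j) <= 2*E j" for j
 proof (rule disjCI)
  assume n: "\<not> E (Suc j) <= 2*E j"
  have main: "E (Suc j) <= kp*M" if M: "M \<in> S (Suc (Suc j))" "M <= 2*g (Suc (Suc j))" for M
  proof -
   define R where "R = r (Suc j)"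
   have RR: "K * R = r (Suc (Suc j))" "R/K = r j" unfolding R_def by (rule rS(1)[symmetric], rule rS(2))
   have "close (tau * R) R (A/K^2*M) \<or> (EX B>0. close (tau * R) R B \<and> \<not> close (tau*(R/K)) (R/K) (B/2))"
   proof (rule step[rule_format])
    show "R0 <= R" using r(1)[of "Suc j"] Rb by (simp add: R_def)
    show "M <= 2*K1*(K * R * sqrt (K * R))" using M by (simp add: RR g_def)
    show "close (tau*(K * R)) (K * R) M" using M by (simp add: RR S_def)
   qed
   thus ?thesis
   proof
    assume "close (tau * R) R (A/K^2*M)"
    moreover have "0 <= A/K^2*M" using M kp unfolding kp_def S_def by (intro mult_nonneg_nonneg) auto
    ultimately have "kp*M \<in> S (Suc j)" unfolding S_def kp_def R_def by blast
    thus ?thesis by (rule Ele)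
   next
    assume "EX B>0. close (tau * R) R B \<and> \<not> close (tau*(R/K)) (R/K) (B/2)"
    then obtain B where B: "B > 0" "close (tau * R) R B" "\<not> close (tau*r j) (r j) (B/2)" unfolding RR by blast
    have "E (Suc j) <= B" by (rule Ele) (use B in \<open>simp add: S_def R_def\<close>)
    moreover have "B/2 <= E j"
    proof (rule Ege, rule ccontr)
     fix X assume X: "X \<in> S j" "\<not> B/2 <= X"
     hence "close (tau*r j) (r j) X" by (simp add: S_def)
     hence "close (tau*r j) (r j) (B/2)" by (rule close_mono) (use X in simp)
     thus False using B by simp
    qed
    ultimately show ?thesis using n by simp
   qed
  qed
  have "E (Suc j)/kp <= E (Suc (Suc j))"
  proof (rule Ege)
   fix M assume M: "M \<in> S (Suc (Suc j))"
   show "E (Suc j)/kp <= M"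
   \<comment> \<open>\<open>improvement_step\<close> needs M of order 3/2. Larger M are no obstacle,
     since \<open>g\<close> itself is an admissible distance and already gives a stronger
     bound.\<close>
   proof (cases "M <= 2*g (Suc (Suc j))")
    case True thus ?thesis using main[OF M] kp by (simp add: pos_divide_le_eq mult.commute)
   next
    case False
    have "E (Suc j) <= kp*g (Suc (Suc j))" by (rule main[OF gS]) (use g0 in simp)
    hence "E (Suc j)/kp <= g (Suc (Suc j))" using kp by (simp add: pos_divide_le_eq mult.commute)
    thus ?thesis using False g0[of "Suc (Suc j)"] by linarith
   qed
  qed
  thus "E (Suc j) <= kp*E (Suc (Suc j))" using kp by (simp add: pos_divide_le_eq mult.commute)
 qed
 have "E j <= (K1*(Rb * sqrt Rb))*(K * sqrt K) ^ j" for j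
 proof -
  have "g j = (K1*(Rb * sqrt Rb))*(K * sqrt K) ^ j"
   by (simp add: g_def r_def real_sqrt_mult real_sqrt_power power_mult_distrib mult_ac)
  thus ?thesis using Ele[OF gS[of j]] by simp
 qed
 from dichotomy_growth[OF E0 kp(1-3) _ this alt] K have Eg: "E n <= E 0*2 ^ n" for n by simp
 have cl: "close (tau*(K ^ j * Rb)) (K ^ j * Rb) ((E 0+1)*2 ^ j)" for j
 proof -
  have "E j < (E 0+1)*2 ^ j" using Eg[of j] zero_less_power[of "2::real" j] unfolding distrib_right by linarith
  then obtain X where X: "X \<in> S j" "X < (E 0+1)*2 ^ j" unfolding E_def using cInf_lessD[of "S j"] gS by blast
  hence "close (tau*r j) (r j) X" by (simp add: S_def)
  thus ?thesis unfolding r_def[symmetric] by (rule close_mono) (use X in simp)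
 qed
 have "E 0+1 > 0" using E0[of 0] by simp
 thus ?thesis using K tau Rb cl by blast
qed

text \<open>Consecutive approximations differ by order \<open>2^j\<close> on a ball of radius
  \<open>K^j * Rb\<close>, hence their slopes and shifts by order \<open>(2/K)^j\<close>. The
  parameters converge, and the limit is as good as each approximation up to a constant
  factor.\<close>

lemma asymptotic_profile:
 "EX K>=K0. K >= 12 \<and> (EX Rb>=1. EX C>0. EX m>=0. EX h. h \<bullet> e = 0 \<and> (ALL j. ALL x. norm x <= K ^ j * Rb --> \<bar>u x-v m h x\<bar> <= C*2 ^ j))"
proof -
 obtain Cs taus where Cs: "Cs > 0" "taus > 0" "taus <= 1" "slopes Cs taus" using slope_bound by blast
 obtain Lv taul where Lv: "Lv > 0" "taul > 0" "taul <= 1" "v_lip Lv taul" using v_lipschitz by blast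
 obtain ky tauy where ky: "ky > 0" "tauy > 0" "tauy <= 1" "Y_increasing ky tauy"
  using Y_increment_lower by blast
 define tau0 where "tau0 = min taus (min taul tauy)"
 have tau0: "tau0 > 0" "tau0 <= taus" "tau0 <= taul" "tau0 <= tauy" using Cs Lv ky by (auto simp: tau0_def)
 obtain K tau Rb C1 where K: "K >= K0" "K >= 12" and tau: "tau > 0" "tau <= tau0/K" and Rb: "Rb >= 1" and C1: "C1 > 0"
  and cl: "ALL j. close (tau*(K ^ j * Rb)) (K ^ j * Rb) (C1*2 ^ j)" using decay_rate[OF tau0(1)] by blast
 define r where "r j = K ^ j * Rb" for j :: nat
 have r: "r j > 0" "r j <= r (Suc j)" for j
 proof -
  show 1: "r j > 0" using K Rb by (simp add: r_def)
  have "1*r j <= K*r j" using K 1 by (intro mult_right_mono) auto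
  thus "r j <= r (Suc j)" by (simp add: r_def mult_ac)
 qed
 have rmono: "i <= j ==> r i <= r j" for i j by (rule lift_Suc_mono_le[of r]) (use r in auto)
 obtain m h where mh: "\<And>j. adm (tau*r j) (m j) (h j)" "\<And>j x. norm x <= r j ==> \<bar>u x-v (m j) (h j) x\<bar> <= C1*2 ^ j"
 proof -
  have "EX t. adm (tau*r j) (fst t) (snd t) \<and> (ALL x. norm x <= r j --> \<bar>u x-v (fst t) (snd t) x\<bar> <= C1*2 ^ j)" for j
   using cl[rule_format, of j] unfolding close_def r_def[symmetric] by (elim exE) (rule exI[of _ "(_, _)"], simp)
  hence "ALL j. EX t. adm (tau*r j) (fst t) (snd t) \<and> (ALL x. norm x <= r j --> \<bar>u x-v (fst t) (snd t) x\<bar> <= C1*2 ^ j)" by blast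
  from choice[OF this] obtain t where t: "ALL j. adm (tau*r j) (fst (t j)) (snd (t j)) \<and> (ALL x. norm x <= r j --> \<bar>u x-v (fst (t j)) (snd (t j)) x\<bar> <= C1*2 ^ j)" by blast
  show ?thesis by (rule that[of "%j. fst (t j)" "%j. snd (t j)"]) (use t in auto)
 qed
 have tr: "tau*r (Suc j) <= tau0*r j" "tau*r j <= tau0*r j" for j
 proof -
  have "tau*K <= tau0" using tau K by (simp add: pos_le_divide_eq)
  \<comment> \<open>With \<open>tau <= tau0/K\<close>, parameters admissible at scale
    \<open>r (Suc j)\<close> are admissible at \<open>r j\<close>, so two consecutive members can be
    compared on one ball.\<close>
  hence "(tau*K)*r j <= tau0*r j" using r(1)[of j] by (intro mult_right_mono) auto
  thus 1: "tau*r (Suc j) <= tau0*r j" by (simp add: r_def mult_ac)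
  have "tau*r j <= tau*r (Suc j)" using r(2)[of j] tau by (intro mult_left_mono) auto
  thus "tau*r j <= tau0*r j" using 1 by linarith
 qed
 have t0: "tau0*r j <= taus*r j" "tau0*r j <= taul*r j" "tau0*r j <= tauy*r j" for j
  using tau0 r(1)[of j] by (auto intro!: mult_right_mono)
 define q where "q = 2/K"
 have q: "0 <= q" "q <= 1/2" using K by (auto simp: q_def pos_divide_le_eq)
 define C2 where "C2 = 3*Cs*C1/Rb"
 have C2: "C2 > 0" using Cs C1 Rb by (simp add: C2_def)
 have rq: "r j*(C2*q ^ j) = 3*Cs*C1*2 ^ j" for j
  using K Rb by (simp add: r_def C2_def q_def power_divide)
 have inc: "\<bar>Y (r j) (m (Suc j))-Y (r j) (m j)\<bar>+norm (h (Suc j)-h j) <= C2*q ^ j" for j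
 proof -
  have "r j*(\<bar>Y (r j) (m (Suc j))-Y (r j) (m j)\<bar>+norm (h (Suc j)-h j)) <= Cs*(3*C1*2 ^ j)"
  proof (rule Cs(4)[rule_format, OF r(1)])
   show "adm (taus*r j) (m j) (h j)" by (rule adm_mono[OF mh(1)]) (use tr[of j] t0[of j] in linarith)
   show "adm (taus*r j) (m (Suc j)) (h (Suc j))" by (rule adm_mono[OF mh(1)]) (use tr[of j] t0[of j] in linarith)
   fix x :: 'a assume x: "norm x <= r j"
   hence "norm x <= r (Suc j)" using r(2)[of j] by linarith
   thus "\<bar>v (m (Suc j)) (h (Suc j)) x-v (m j) (h j) x\<bar> <= 3*C1*2 ^ j"
    using mh(2)[of x j] mh(2)[of x "Suc j"] x by simp
  qed
  also have "\<dots> = r j*(C2*q ^ j)" unfolding rq by simp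
  finally show ?thesis using r(1)[of j] by (simp only: mult_le_cancel_left_pos)
 qed
 have hinc: "norm (h (Suc j)-h j) <= C2*q ^ j" for j using inc[of j] by linarith
 have yinc: "\<bar>Y (r j) (m (Suc j))-Y (r j) (m j)\<bar> <= C2*q ^ j" for j using inc[of j] norm_ge_zero[of "h (Suc j)-h j"] by linarith
 have minc: "norm (m (Suc j)-m j) <= (C2/ky)*q ^ j" for j
 proof -
  have "ky*\<bar>m (Suc j)-m j\<bar> <= \<bar>Y (r j) (m (Suc j))-Y (r j) (m j)\<bar>"
   by (rule ky(4)[rule_format, OF r(1)]) (use mh(1)[of j] mh(1)[of "Suc j"] tr[of j] t0[of j] in \<open>auto simp: adm_def\<close>)
  also have "\<dots> <= C2*q ^ j" by (rule yinc)
  finally show ?thesis using ky by (simp add: pos_le_divide_eq mult.commute)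
 qed
 obtain m' where m': "m \<longlonglongrightarrow> m'" using geometric_increments(2)[OF q minc] by (auto simp: convergent_def)
 obtain h' where h': "h \<longlonglongrightarrow> h'" using geometric_increments(2)[OF q hinc] by (auto simp: convergent_def)
 define B where "B = m 0+norm (h 0)+2*(C2/ky)+2*C2"
 have mB: "0 <= m j" "m j <= B" "norm (h j) <= B" "h j \<bullet> e = 0" for j
 proof -
  show "0 <= m j" "h j \<bullet> e = 0" using mh(1)[of j] by (auto simp: adm_def)
  have "\<bar>m j-m 0\<bar> <= 2*(C2/ky)"
   using geometric_increments(1)[OF q minc, of 0 j] unfolding add_0 power_0 mult_1_right real_norm_def .
  moreover have "norm (h j-h 0) <= 2*C2"
   using geometric_increments(1)[OF q hinc, of 0 j] unfolding add_0 power_0 mult_1_right .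
  moreover have "norm (h j) <= norm (h j-h 0)+norm (h 0)" using norm_triangle_ineq[of "h j-h 0" "h 0"] by simp
  moreover have "m 0 >= 0" "C2/ky >= 0" using mh(1)[of 0] C2 ky by (auto simp: adm_def)
  ultimately show "m j <= B" "norm (h j) <= B" using C2 norm_ge_zero[of "h 0"] unfolding B_def by linarith+
 qed
 have lim: "0 <= m'" "m' <= B" "norm h' <= B" "h' \<bullet> e = 0"
 proof -
  show "0 <= m'" by (rule LIMSEQ_le_const[OF m']) (use mB in blast)
  show "m' <= B" by (rule LIMSEQ_le_const2[OF m']) (use mB in blast)
  show "norm h' <= B" by (rule LIMSEQ_le_const2[OF tendsto_norm[OF h']]) (use mB in blast)
  have "(%j. h j \<bullet> e) \<longlonglongrightarrow> h' \<bullet> e" by (intro tendsto_intros h')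
  thus "h' \<bullet> e = 0" using mB(4) by (simp add: LIMSEQ_const_iff)
 qed
 have hl: "norm (h'-h j) <= 2*C2*q ^ j" for j
 proof (rule LIMSEQ_le_const2)
  show "(%n. norm (h (j+n)-h j)) \<longlonglongrightarrow> norm (h'-h j)"
   using LIMSEQ_ignore_initial_segment[OF h', of j] by (intro tendsto_intros) (simp add: add.commute)
 qed (use geometric_increments(1)[OF q hinc] in blast)
 \<comment> \<open>All later increments are needed at the fixed radius \<open>r j\<close>;
   \<open>Y_increment_mono\<close> bounds them by the increments at their own, larger radii.\<close>
 have yl: "\<bar>Y (r j) m'-Y (r j) (m j)\<bar> <= 2*C2*q ^ j" for j
 proof -
  define a where "a n = Y (r j) (m (j+n))" for n
  have "norm (a (Suc n)-a n) <= (C2*q ^ j)*q ^ n" for n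
  proof -
   have "\<bar>Y (r j) (m (Suc (j+n)))-Y (r j) (m (j+n))\<bar> <= \<bar>Y (r (j+n)) (m (Suc (j+n)))-Y (r (j+n)) (m (j+n))\<bar>"
    by (rule Y_increment_mono) (use r(1) rmono[of j "j+n"] mB in auto)
   thus ?thesis using yinc[of "j+n"] by (simp add: a_def power_add mult_ac)
  qed
  from geometric_increments(1)[OF q this, of 0] have "norm (a n-a 0) <= 2*(C2*q ^ j)" for n by simp
  moreover have "a \<longlonglongrightarrow> Y (r j) m'" unfolding a_def
  proof (rule continuous_on_tendsto_compose[OF Y_cont[OF r(1), of B]])
   show "(%n. m (j+n)) \<longlonglongrightarrow> m'" using LIMSEQ_ignore_initial_segment[OF m', of j] by (simp add: add.commute)
  qed (use lim mB in auto)
  hence "(%n. norm (a n-a 0)) \<longlonglongrightarrow> norm (Y (r j) m'-a 0)" by (intro tendsto_intros)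
  ultimately have "norm (Y (r j) m'-a 0) <= 2*(C2*q ^ j)" by (intro LIMSEQ_le_const2) auto
  thus ?thesis by (simp add: a_def)
 qed
 \<comment> \<open>The limit parameters are fixed numbers, hence admissible at all large scales;
   smaller scales are absorbed in the factor \<open>2^j0\<close>.\<close>
 obtain j0 where j0: "B <= tau0*r j0"
 proof -
  obtain n where "B/(tau0 * Rb) < K ^ n" using real_arch_pow[of K] K by auto
  hence "B < K ^ n*(tau0 * Rb)" using tau0 Rb by (simp add: pos_divide_less_eq)
  thus ?thesis using that[of n] by (simp add: r_def mult_ac)
 qed
 define C where "C = C1+Lv*(4*(3*Cs*C1))"
 have C: "C > 0" using C1 Lv Cs by (simp add: C_def add_pos_pos)
 have big: "\<bar>u x-v m' h' x\<bar> <= C*2 ^ j" if j: "j >= j0" and x: "norm x <= r j" for j x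
 proof -
  have "tau0*r j0 <= tau0*r j" using rmono[OF j] tau0 by (intro mult_left_mono) auto
  hence Bl: "B <= taul*r j" using j0 t0[of j] by linarith
  have "\<bar>v m' h' x-v (m j) (h j) x\<bar> <= Lv*r j*(\<bar>Y (r j) m'-Y (r j) (m j)\<bar>+norm (h'-h j))"
   by (rule Lv(4)[rule_format, OF r(1) _ _ x]) (use lim mB[of j] Bl in \<open>auto simp: adm_def intro: order_trans\<close>)
  also have "\<dots> <= Lv*r j*(4*(C2*q ^ j))" using yl[of j] hl[of j] Lv r(1)[of j] by (intro mult_left_mono) auto
  also have "\<dots> = Lv*(4*(r j*(C2*q ^ j)))" by simp
  also have "\<dots> = Lv*(4*(3*Cs*C1))*2 ^ j" unfolding rq by simp
  finally show ?thesis using mh(2)[OF x] unfolding C_def distrib_right by linarith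
 qed
 have all: "\<bar>u x-v m' h' x\<bar> <= (C*2 ^ j0)*2 ^ j" if x: "norm x <= K ^ j * Rb" for j x
 proof (cases "j >= j0")
  case True
  have "C*2 ^ j*1 <= C*2 ^ j*2 ^ j0" using C by (intro mult_left_mono) auto
  thus ?thesis using big[OF True, of x] x by (simp add: r_def mult_ac)
 next
  case False
  have "norm x <= r j0" using x rmono[of j j0] False by (simp add: r_def)
  hence "\<bar>u x-v m' h' x\<bar> <= C*2 ^ j0" by (intro big) auto
  also have "\<dots> <= C*2 ^ j0*2 ^ j" using C mult_left_mono[of 1 "2 ^ j" "C*2 ^ j0"] by simp
  finally show ?thesis .
 qed
 have "C*2 ^ j0 > 0" using C by simp
 thus ?thesis using K Rb lim all by blast
qed

end

section \<open>Liouville argument\<close>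

definition avg_lipschitz_const :: "'a::euclidean_space itself => real => bool" where
 "avg_lipschitz_const _ C \<longleftrightarrow>
    (ALL (D::'a => real) x x' rho. continuous_on UNIV D --> rho > 0 --> (ALL z. \<bar>D z\<bar> <= 1) -->
     norm (x'-x) <= rho --> \<bar>avg D x' rho-avg D x rho\<bar> <= C*(norm (x'-x)/rho))"

lemma avg_lipschitz:
 "EX C>0. avg_lipschitz_const TYPE('a::euclidean_space) C"
proof -
 obtain C where C: "C > 0" "taylor_const TYPE('a) C"
  using avg_taylor by blast
 show ?thesis unfolding avg_lipschitz_const_def
 proof (rule exI[of _ "2*C"], intro conjI allI impI)
  show "2*C > 0" using C by simp
  fix D :: "'a => real" and x x' :: 'a and rho :: real
  assume D: "continuous_on UNIV D" and rho: "rho > 0" and b: "ALL z. \<bar>D z\<bar> <= 1" and xx: "norm (x'-x) <= rho"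
  obtain a g where ag: "norm g <= C*1/rho" "ALL y. norm (y-x) <= rho --> \<bar>avg D y rho-(a+g \<bullet> (y-x))\<bar> <= C*1*(norm (y-x)/rho)^2"
   using C(2)[unfolded taylor_const_def, rule_format, of D rho x 1] D rho b by auto
  have 1: "avg D x rho = a" using ag(2)[rule_format, of x] rho by simp
  define q where "q = norm (x'-x)/rho"
  have q: "0 <= q" "q <= 1" using xx rho by (auto simp: q_def)
  have "q\<^sup>2 <= q" using q by (simp add: power2_eq_square mult_left_le)
  hence "C*q^2 <= C*q" using C by (intro mult_left_mono) auto
  moreover have "\<bar>g \<bullet> (x'-x)\<bar> <= C*q"
  proof -
   have "\<bar>g \<bullet> (x'-x)\<bar> <= norm g*norm (x'-x)" by (rule Cauchy_Schwarz_ineq2)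
   also have "\<dots> <= (C*1/rho)*norm (x'-x)" using ag by (intro mult_right_mono) auto
   finally show ?thesis by (simp add: q_def)
  qed
  moreover have "\<bar>avg D x' rho-(a+g \<bullet> (x'-x))\<bar> <= C*q^2" using ag(2)[rule_format, OF xx] by (simp add: q_def)
  ultimately show "\<bar>avg D x' rho-avg D x rho\<bar> <= 2*C*(norm (x'-x)/rho)" unfolding 1 q_def[symmetric] by linarith
 qed
qed

text \<open>The weights of the disjoint sets where the difference is positive and negative add up to at
 most one and vary slowly, so their product is at most about one quarter.\<close>

definition sign_decay_ratio :: "'a::euclidean_space itself => real => bool" where
 "sign_decay_ratio _ kp \<longleftrightarrow>
    (ALL (u::'a => real) v R P M x x'. sol u --> sol v --> R > 0 -->
     (ALL z. norm z <= kp * R --> u z-v z <= P) --> (ALL z. norm z <= kp * R --> v z-u z <= M) --> 0 <= P --> 0 <= M -->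
     norm x <= R --> norm x' <= R --> max 0 (u x-v x)*max 0 (v x'-u x') <= P*M/3)"

lemma sign_product_decay:
 "EX kp>1. sign_decay_ratio TYPE('a::euclidean_space) kp"
proof -
 obtain C where C: "C > 0" "avg_lipschitz_const TYPE('a) C" using avg_lipschitz by blast
 define L where "L = 24*C+2"
 have L: "L >= 2" "L > 24*C" using C by (auto simp: L_def)
 show ?thesis unfolding sign_decay_ratio_def
 proof (rule exI[of _ "1+L"], intro conjI allI impI)
  show "1 < 1+L" using L by simp
  fix u v :: "'a => real" and R P M :: real and x x' :: 'a
  assume u: "sol u" and v: "sol v" and R: "R > 0" and P: "ALL z. norm z <= (1+L) * R --> u z-v z <= P"
   and M: "ALL z. norm z <= (1+L) * R --> v z-u z <= M" and P0: "0 <= P" and M0: "0 <= M" and x: "norm x <= R" "norm x' <= R"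
  define rho where "rho = L * R"
  have rho: "rho > 0" "\<bar>rho\<bar> = rho" using L R by (auto simp: rho_def)
  note [continuous_intros] = sol_continuous[OF u] sol_continuous[OF v]
  have key: "max 0 (u x-v x)*max 0 (v x'-u x') <= P*M/3+eps*(P+M+1)" if eps: "eps > 0" "eps <= 1" for eps
  proof -
   \<comment> \<open>Continuous substitutes for the indicators of the sets where the difference is
     positive and negative. Their supports are still disjoint, so the sum is at most 1.\<close>
   define p m where "p z = min 1 (max 0 (u z-v z)/eps)" and "m z = min 1 (max 0 (v z-u z)/eps)" for z
   have cont: "continuous_on UNIV p" "continuous_on UNIV m"
    unfolding p_def[abs_def] m_def[abs_def] using eps by (auto intro!: continuous_intros)
   have pb: "0 <= p z" "p z <= 1" "0 <= m z" "m z <= 1" "p z+m z <= 1" for z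
    using eps by (auto simp: p_def m_def max_def min_def)
   have wb: "0 <= avg p y rho" "0 <= avg m y rho" for y
    using avg_mono[of "%_. 0" p y rho] avg_mono[of "%_. 0" m y rho] cont pb by (auto simp: avg_const)
   have sum1: "avg p x rho+avg m x rho <= 1"
   proof -
    have "avg (%z. p z+m z) x rho <= avg (%_. 1) x rho"
     by (rule avg_mono) (use cont pb in \<open>auto intro!: continuous_intros\<close>)
    thus ?thesis using avg_add[OF cont, of x rho] by (simp add: avg_const)
   qed
   \<comment> \<open>The two centres differ by at most \<open>2 * R\<close>, while the averaging
     radius is \<open>L * R\<close>; the choice of L makes the resulting change at most
     1/12.\<close>
   have near: "avg m x' rho <= avg m x rho+1/12"
   proof -
    have d: "norm (x'-x) <= 2 * R" using norm_triangle_ineq4[of x' x] x by linarith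
    have "2 * R <= rho" unfolding rho_def using L R by (intro mult_right_mono) auto
    hence "\<bar>avg m x' rho-avg m x rho\<bar> <= C*(norm (x'-x)/rho)"
     using C(2)[unfolded avg_lipschitz_const_def, rule_format, of m rho x' x] cont pb rho d by auto
    also have "\<dots> <= C*(2 * R/rho)" using d C rho by (intro mult_left_mono divide_right_mono) auto
    also have "\<dots> = 2*C/L" using R L by (simp add: rho_def)
    also have "\<dots> <= 1/12" using L by (simp add: pos_divide_le_eq)
    finally show ?thesis by linarith
   qed
   have ball: "norm z <= (1+L) * R" if "norm (z-y) <= \<bar>rho\<bar>" "norm y <= R" for y z
    using norm_triangle_ineq[of "z-y" y] that rho by (simp add: rho_def distrib_right)
   have A: "max 0 (u x-v x) <= P*avg p x rho+eps"
   proof -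
    have "max 0 (u x-v x) <= avg (%x. max 0 (u x-v x)) x rho" using diff_pos[OF u v, of rho] rho by simp
    also have "\<dots> <= avg (%z. P * p z+eps) x rho"
    proof (rule avg_mono)
     fix z assume "norm (z-x) <= \<bar>rho\<bar>"
     hence "u z-v z <= P" using P ball x by blast
     moreover have "P * p z >= 0" using P0 pb by simp
     moreover have "u z-v z <= eps \<or> p z = 1" using eps by (auto simp: p_def min_def max_def field_simps)
     ultimately show "max 0 (u z-v z) <= P * p z+eps" using eps P0 by auto
    qed (auto intro!: continuous_intros cont)
    also have "\<dots> = P*avg p x rho+eps"
     using avg_add[of "%z. P * p z" "%_. eps" x rho] cont by (simp add: avg_const avg_cmult continuous_intros)
    finally show ?thesis .
   qed
   have B: "max 0 (v x'-u x') <= M*avg m x' rho+eps"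
   proof -
    have "max 0 (v x'-u x') <= avg (%x. max 0 (v x-u x)) x' rho" using diff_pos[OF v u, of rho] rho by simp
    also have "\<dots> <= avg (%z. M*m z+eps) x' rho"
    proof (rule avg_mono)
     fix z assume "norm (z-x') <= \<bar>rho\<bar>"
     hence "v z-u z <= M" using M ball x by blast
     moreover have "M*m z >= 0" using M0 pb by simp
     moreover have "v z-u z <= eps \<or> m z = 1" using eps by (auto simp: m_def min_def max_def field_simps)
     ultimately show "max 0 (v z-u z) <= M*m z+eps" using eps M0 by auto
    qed (auto intro!: continuous_intros cont)
    also have "\<dots> = M*avg m x' rho+eps"
     using avg_add[of "%z. M*m z" "%_. eps" x' rho] cont by (simp add: avg_const avg_cmult continuous_intros)
    finally show ?thesis .
   qed
   define a c where "a = avg p x rho" and "c = avg m x' rho"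
   have ac: "0 <= a" "0 <= c" "a <= 1" "a + c <= 13/12" using wb(1)[of x] wb(2)[of x] wb(2)[of x'] sum1 near unfolding a_def c_def by linarith+
   have c1: "c <= 1"
   proof -
    have "avg m x' rho <= avg (%_. 1) x' rho" by (rule avg_mono) (use cont pb in auto)
    thus ?thesis by (simp add: avg_const c_def)
   qed
   \<comment> \<open>The product is at most a quarter of the squared sum,
     \<open>(13/12)^2/4\<close>, below 1/3.\<close>
   have acp: "a * c <= 1/3"
   proof -
    have "4*(a * c) <= (a + c)^2" using zero_le_power2[of "a-c"] by (simp add: power2_eq_square algebra_simps)
    also have "\<dots> <= (13/12)^2" using ac by (intro power_mono) auto
    finally show ?thesis by (simp add: power2_eq_square)
   qed
   have "max 0 (u x-v x)*max 0 (v x'-u x') <= (P*a+eps)*(M * c+eps)"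
    using A B P0 ac eps by (intro mult_mono) (auto simp: a_def c_def)
   also have "\<dots> = P*M*(a * c)+eps*(P*a+M * c+eps)" by (simp add: algebra_simps)
   also have "\<dots> <= P*M*(1/3)+eps*(P*1+M*1+1)"
    using acp c1 ac P0 M0 eps by (intro add_mono mult_left_mono) auto
   finally show ?thesis by simp
  qed
  show "max 0 (u x-v x)*max 0 (v x'-u x') <= P*M/3"
  proof (rule field_le_epsilon)
   fix d :: real assume d: "d > 0"
   define eps where "eps = min 1 (d/(P+M+1))"
   have "eps*(P+M+1) <= (d/(P+M+1))*(P+M+1)" using P0 M0 by (intro mult_right_mono) (auto simp: eps_def)
   also have "\<dots> = d" using P0 M0 by simp
   finally show "max 0 (u x-v x)*max 0 (v x'-u x') <= P*M/3+d"
    using key[of eps] d P0 M0 by (simp add: eps_def)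
  qed
 qed
qed

definition comparison_ratio :: "'a::euclidean_space itself => real => bool" where
 "comparison_ratio _ kp \<longleftrightarrow>
    (ALL (u::'a => real) v K r C. sol u --> sol v --> K >= kp --> r > 0 -->
     (ALL j. ALL x. norm x <= K ^ j*r --> \<bar>u x-v x\<bar> <= C*2 ^ j) --> (ALL x. u x <= v x) \<or> (ALL x. v x <= u x))"

text \<open>An elementary substitute for a monotonicity formula for two disjoint phases. The product
  of the maxima of the positive and the negative part loses a factor 9 from one scale to the next,
  while growth \<open>2^j\<close> lets it increase by 4 only; so it vanishes.\<close>

lemma sol_comparison:
 "EX kp>1. comparison_ratio TYPE('a::euclidean_space) kp"
proof -
 obtain kp where kp: "kp > 1" and dec: "sign_decay_ratio TYPE('a) kp" using sign_product_decay by blast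
 show ?thesis unfolding comparison_ratio_def
 \<comment> \<open>Two applications of the factor 1/3 per scale give 1/9; one application would lose
   against 4.\<close>
 proof (rule exI[of _ "kp * kp"], intro conjI allI impI)
  show "kp * kp > 1" using kp by (simp add: less_1_mult)
  fix u v :: "'a => real" and K r C :: real
  assume u: "sol u" and v: "sol v" and K: "K >= kp * kp" and r: "r > 0" and bd: "ALL j. ALL x. norm x <= K ^ j*r --> \<bar>u x-v x\<bar> <= C*2 ^ j"
  have K1: "K > 1" using K kp less_1_mult[OF kp kp] by linarith
  show "(ALL x. u x <= v x) \<or> (ALL x. v x <= u x)"
  proof (rule ccontr)
   assume "\<not> ?thesis"
   then obtain a b where ab: "u a > v a" "v b > u b" by (meson not_le)
   define Pf where "Pf x x' = max 0 (u x-v x)*max 0 (v x'-u x')" for x x'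
   define Q where "Q R X = (ALL x x'. norm x <= R --> norm x' <= R --> Pf x x' <= X)" for R X
   have step: "Q R (X/3)" if R: "R > 0" and Q: "Q (kp * R) X" for R X
   proof -
    have kR: "cball (0::'a) (kp * R) \<noteq> {}" using mult_pos_pos[of kp R] R kp by (simp add: cball_eq_empty not_less)
    have cont: "continuous_on (cball 0 (kp * R)) (%x. max 0 (u x-v x))" "continuous_on (cball 0 (kp * R)) (%x. max 0 (v x-u x))"
     by (auto intro!: continuous_intros intro: continuous_on_subset[OF sol_continuous[OF u]] continuous_on_subset[OF sol_continuous[OF v]])
    obtain y where y: "norm y <= kp * R" "ALL z:cball 0 (kp * R). max 0 (u z-v z) <= max 0 (u y-v y)"
     using continuous_attains_sup[OF compact_cball kR cont(1)] by auto
    obtain y' where y': "norm y' <= kp * R" "ALL z:cball 0 (kp * R). max 0 (v z-u z) <= max 0 (v y'-u y')"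
     using continuous_attains_sup[OF compact_cball kR cont(2)] by auto
    have X: "Pf y y' <= X" using Q y y' by (simp add: Q_def)
    show ?thesis unfolding Q_def
    proof (intro allI impI)
     fix x x' :: 'a assume x: "norm x <= R" "norm x' <= R"
     have "Pf x x' <= max 0 (u y-v y)*max 0 (v y'-u y')/3" unfolding Pf_def
      by (rule dec[unfolded sign_decay_ratio_def, rule_format, OF u v R _ _ _ _ x]) (use y y' in force)+
     thus "Pf x x' <= X/3" using X by (simp add: Pf_def)
    qed
   qed
   have Kstep: "Q R (X/9)" if R: "R > 0" and Q: "Q (K * R) X" for R X
   proof -
    have "kp*(kp * R) <= K * R" using K R by (simp add: mult.assoc[symmetric] mult_right_mono)
    hence "Q (kp*(kp * R)) X" using Q unfolding Q_def by (meson order_trans)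
    hence "Q (kp * R) (X/3)" by (rule step[rotated]) (use kp R in simp)
    hence "Q R (X/3/3)" by (rule step[OF R])
    thus ?thesis by simp
   qed
   have iter: "Q (K ^ n * R) X ==> R > 0 ==> Q R (X/9 ^ n)" for n R X
   proof (induction n arbitrary: X)
    case (Suc n)
    have "Q (K*(K ^ n * R)) X" using Suc.prems(1) by (simp add: mult.assoc)
    hence "Q (K ^ n * R) (X/9)" by (rule Kstep[rotated]) (use Suc.prems K1 in simp)
    from Suc.IH[OF this Suc.prems(2)] show ?case by simp
   qed simp
   obtain i where i: "norm a <= K ^ i*r" "norm b <= K ^ i*r"
   proof -
    obtain i where "max (norm a) (norm b)/r < K ^ i" using real_arch_pow[OF K1] by blast
    thus ?thesis using r that[of i] by (simp add: pos_divide_less_eq)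
   qed
   have "Pf a b <= (C^2*4 ^ i)*(4/9) ^ n" for n
   proof -
    have "Q (K ^ n*(K ^ i*r)) ((C*2 ^ (n+i))^2)" unfolding Q_def
    proof (intro allI impI)
     fix x x' :: 'a assume "norm x <= K ^ n*(K ^ i*r)" "norm x' <= K ^ n*(K ^ i*r)"
     hence "\<bar>u x-v x\<bar> <= C*2 ^ (n+i)" "\<bar>u x'-v x'\<bar> <= C*2 ^ (n+i)"
      using bd[rule_format, of x "n+i"] bd[rule_format, of x' "n+i"] by (simp_all add: power_add mult_ac)
     thus "Pf x x' <= (C*2 ^ (n+i))^2" unfolding Pf_def power2_eq_square by (intro mult_mono) auto
    qed
    hence "Q (K ^ i*r) ((C*2 ^ (n+i))^2/9 ^ n)" by (rule iter) (use K1 r in simp)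
    hence "Pf a b <= (C*2 ^ (n+i))^2/9 ^ n" using i by (simp add: Q_def)
    also have "(2::real) ^ (n+i)*2 ^ (n+i) = 4 ^ n*4 ^ i" by (simp add: power_add power_mult_distrib[symmetric] mult_ac)
    hence "(C*2 ^ (n+i))\<^sup>2/9 ^ n = (C^2*4 ^ i)*(4/9) ^ n"
     by (simp add: power2_eq_square power_divide mult_ac)
    finally show ?thesis .
   qed
   moreover have "(%n. (C^2*4 ^ i)*(4/9::real) ^ n) \<longlonglongrightarrow> (C^2*4 ^ i)*0" by (intro tendsto_intros LIMSEQ_power_zero) simp
   ultimately have "Pf a b <= 0" by (intro LIMSEQ_le_const) auto
   moreover have "Pf a b > 0" using ab by (simp add: Pf_def)
   ultimately show False by simp
  qed
 qed
qed

section \<open>Sliding the model vertically\<close>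

context parab
begin

lemma v_slide_deriv:
 assumes m: "m > 0"
 shows "((%s. v m h (x-s *. e)) has_real_derivative m * c*I0 (lam ((1/m) *. (x-s *. e-h)))) (at s)"
proof -
 define y where "y s = (1/m) *. (x-s *. e-h)" for s :: real
 have 1: "(y has_derivative (%k. (- k/m) *. e)) (at s)"
  unfolding y_def[abs_def] by (auto intro!: derivative_eq_intros simp: fun_eq_iff)
 have 2: "((%s. m\<^sup>2*V (y s)) has_derivative (%k. m\<^sup>2*(G (y s) \<bullet> ((- k/m) *. e)))) (at s)"
  by (intro derivative_intros has_derivative_compose[OF 1 V_deriv])
 have "G (y s) \<bullet> e = - (c*I0 (lam (y s)))" unfolding G_def Gr_inner by simp
 hence "((%s. m\<^sup>2*V (y s)) has_real_derivative m * c*I0 (lam (y s))) (at s)"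
  unfolding has_field_derivative_def
  by (intro has_derivative_eq_rhs[OF 2]) (use m in \<open>auto simp: fun_eq_iff power2_eq_square\<close>)
 thus ?thesis using m by (simp add: v_def phi_def y_def)
qed

text \<open>The increment of \<open>I0\<close> from s to \<open>K * s\<close> is at most
  \<open>(K-1)*(s * f s)\<close>, and slow variation with \<open>1/(K-1)\<close> bounds this by
  \<open>I0 s\<close>.\<close>

lemma I0_doubling: assumes K: "K > 1" shows "EX s0>0. ALL t>=s0. ALL n. I0 (K ^ n*t) <= 2 ^ n*I0 t"
proof -
 obtain s0 where s0: "s0 >= 1" "ALL s>=s0. s * f s <= 1/(K-1)*I0 s" using slow_variation[of "1/(K-1)"] K by auto
 have "I0 (K ^ n*t) <= 2 ^ n*I0 t" if t: "t >= s0" for t n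
 proof (induction n)
  case (Suc n)
  define s where "s = K ^ n*t"
  have "1*t <= s" unfolding s_def using K t s0 by (intro mult_right_mono one_le_power) auto
  hence s: "s >= s0" "s > 0" using t s0 by auto
  have "I0 (K * s)-I0 s <= f s*(K * s-s)" using s K by (intro I0_diff_le) auto
  also have "\<dots> = (K-1)*(s * f s)" by (simp add: algebra_simps)
  also have "\<dots> <= (K-1)*(1/(K-1)*I0 s)" using s0(2) s K by (intro mult_left_mono) auto
  also have "\<dots> = I0 s" using K by simp
  finally have "I0 (K * s) <= 2*I0 s" by simp
  thus ?case using Suc by (simp add: s_def mult_ac)
 qed simp
 thus ?thesis using s0 by (intro exI[of _ s0]) auto
qed

end

context expansion
begin

text \<open>Every vertical translate of the limit profile still has growth \<open>2^j\<close>
  relative to u, so \<open>sol_comparison\<close> orders it with u. The translates increase with the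
  height t; at the infimum of those lying above u, both inequalities hold by continuity.\<close>

theorem coincidence_set_quadratic:
 assumes below: "\<And>x. x \<bullet> e < 0 ==> u x > 0" and int: "interior {x. u x = 0} \<noteq> {}"
 shows "EX m>0. EX a. {x. u x = 0} = {x. (\<Sum>j\<in>W. ((x-a) \<bullet> j)\<^sup>2/b j) <= m*((x-a) \<bullet> e)}"
proof -
 obtain kp where kp: "kp > 1" and cmp: "comparison_ratio TYPE('a) kp"
  using sol_comparison by blast
 obtain K r C m h where K: "K >= kp" "K >= 12" and r: "r >= 1" and C: "C > 0" and m: "m >= 0" and h: "h \<bullet> e = 0"
  and bd: "ALL j. ALL x. norm x <= K ^ j*r --> \<bar>u x-v m h x\<bar> <= C*2 ^ j"
  using asymptotic_profile[of kp] by blast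
 have rp: "r > 0" using r by simp
 obtain x0 where x0: "x0 \<in> interior {x. u x = 0}" using int by blast
 then obtain d where d: "d > 0" "cball x0 d \<subseteq> {x. u x = 0}" by (auto simp: mem_interior_cball)
 have "x0 \<in> cball x0 d" using d(1) by simp
 hence ux0: "u x0 = 0" using d(2) by blast
 \<comment> \<open>For \<open>m = 0\<close> the profile is a translate of p. If u lay below it, u
   would vanish on the axis at negative heights; if u lay above it, its zero set would be contained
   in a line and have no interior.\<close>
 have mp: "m > 0"
 proof (rule ccontr)
  assume "\<not> m > 0"
  hence m0: "m = 0" using m by simp
  obtain c0 C0 where c0: "c0 > 0" "ALL x. c0*(norm (perp e x))^2 <= p x \<and> p x <= C0*(norm (perp e x))^2" using p_bounds by blast
  consider "ALL x. u x <= v m h x" | "ALL x. v m h x <= u x"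
   using cmp[unfolded comparison_ratio_def, rule_format, OF u_sol v_sol[OF m] K(1) rp] bd by blast
  thus False
  proof cases
   case 1
   have "p (- e) = 0" using p_shift[of 0 "- 1"] by (simp add: p_def)
   hence "v m h (h-e) = 0" by (simp add: v_def phi_def m0)
   hence "u (h-e) <= 0" using 1 by metis
   moreover have "u (h-e) > 0" by (rule below) (simp add: inner_diff_left h)
   ultimately show False by simp
  next
   case 2
   obtain j where j: "j \<in> W" using cardW by (metis card.empty ex_in_conv not_numeral_le_zero)
   have z: "perp e (y-h) = 0" if "u y = 0" for y
   proof -
    have "p (y-h) <= 0" using 2 that by (metis m0 v_def phi_def)
    hence "c0*(norm (perp e (y-h)))^2 <= 0" using c0(2) by (meson order_trans)
    thus ?thesis using c0 by (simp add: mult_le_0_iff)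
   qed
   have "u (x0+d *. j) = 0" using d unit[OF j] by (auto simp: dist_norm subset_iff)
   from z[OF this] z[OF ux0] have "perp e (d *. j) = 0" by (simp add: perp_add perp_diff)
   thus False using d j unit[OF j] by (auto simp: perp_def)
  qed
 qed
 define w where "w t x = v m h (x-t *. e)" for t x
 have w_sol: "sol (w t)" for t using sol_translate[OF v_sol[OF m], of h "- t *. e"] by (simp add: w_def[abs_def])
 have w_cont: "isCont (%t. w t x) t" for t x unfolding w_def by (rule DERIV_isCont[OF v_slide_deriv[OF mp]])
 have w_mono: "w s x <= w t x" if "s <= t" for s t x unfolding w_def
  by (rule DERIV_nonneg_imp_nondecreasing[OF that]) (use v_slide_deriv[OF mp, of h x] mp c_pos I0_nonneg lam(1) in \<open>metis mult_nonneg_nonneg less_imp_le\<close>)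
 have order: "(ALL x. u x <= w t x) \<or> (ALL x. w t x <= u x)" for t
 proof -
  obtain s0 where s0: "s0 > 0" "ALL t>=s0. ALL n. I0 (K ^ n*t) <= 2 ^ n*I0 t" using I0_doubling[of K] K by auto
  \<comment> \<open>Chosen so that for x in the j-th ball and all intermediate heights the confocal
    parameter is at most \<open>K^j*t1\<close>; \<open>I0_doubling\<close> then bounds the vertical
    derivative by order \<open>2^j\<close>.\<close>
  define t1 where "t1 = max s0 (8*(r+norm h+\<bar>t\<bar>)/m)"
  have t1: "t1 >= s0" "t1 > 0" "8*(r+norm h+\<bar>t\<bar>)/m <= t1" using s0 by (auto simp: t1_def)
  define L where "L = \<bar>t\<bar>*(m * c*I0 t1)"
  have wv: "\<bar>w t x-v m h x\<bar> <= L*2 ^ j" if x: "norm x <= K ^ j*r" for j x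
  proof -
   define B where "B = m * c*(2 ^ j*I0 t1)"
   have der: "\<bar>m * c*I0 (lam ((1/m) *. (x-s *. e-h)))\<bar> <= B" if s: "\<bar>s\<bar> <= \<bar>t\<bar>" for s
   proof -
    have Kj: "K ^ j >= 1" using K by (intro one_le_power) auto
    have "norm (x-s *. e-h) <= norm x+\<bar>s\<bar>+norm h"
     using norm_triangle_ineq4[of "x-s *. e" h] norm_triangle_ineq4[of x "s *. e"] e by simp
    also have "\<dots> <= K ^ j*r+K ^ j*\<bar>t\<bar>+K ^ j*norm h"
     using x s mult_right_mono[OF Kj, of "\<bar>t\<bar>"] mult_right_mono[OF Kj, of "norm h"] by simp
    also have "\<dots> = K ^ j*(r+norm h+\<bar>t\<bar>)" by (simp add: algebra_simps)
    finally have "norm ((1/m) *. (x-s *. e-h)) <= K ^ j*(r+norm h+\<bar>t\<bar>)/m" using mp by (simp add: divide_right_mono)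
    hence "lam ((1/m) *. (x-s *. e-h)) <= 8*(K ^ j*(r+norm h+\<bar>t\<bar>)/m)" using lam_le[of "(1/m) *. (x-s *. e-h)"] by linarith
    also have "\<dots> = K ^ j*(8*(r+norm h+\<bar>t\<bar>)/m)" by simp
    also have "\<dots> <= K ^ j*t1" using t1(3) Kj by (intro mult_left_mono) auto
    finally have "I0 (lam ((1/m) *. (x-s *. e-h))) <= I0 (K ^ j*t1)" using lam(1) by (intro I0_mono) auto
    also have "\<dots> <= 2 ^ j*I0 t1" using s0(2) t1(1) by blast
    finally have "m * c*I0 (lam ((1/m) *. (x-s *. e-h))) <= B" unfolding B_def using mp c_pos by (intro mult_left_mono) auto
    moreover have "0 <= m * c*I0 (lam ((1/m) *. (x-s *. e-h)))" using mp c_pos I0_nonneg lam(1) by (intro mult_nonneg_nonneg) auto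
    ultimately show ?thesis by simp
   qed
   have "norm (v m h (x-t *. e)-v m h (x-0 *. e)) <= B*norm (t-0)"
   proof (rule field_differentiable_bound[where S = "{- \<bar>t\<bar>..\<bar>t\<bar>}"])
    fix s assume "s \<in> {- \<bar>t\<bar>..\<bar>t\<bar>}"
    hence s: "\<bar>s\<bar> <= \<bar>t\<bar>" by auto
    show "((%s. v m h (x-s *. e)) has_field_derivative m * c*I0 (lam ((1/m) *. (x-s *. e-h)))) (at s within {- \<bar>t\<bar>..\<bar>t\<bar>})"
     by (rule has_field_derivative_at_within[OF v_slide_deriv[OF mp]])
    show "norm (m * c*I0 (lam ((1/m) *. (x-s *. e-h)))) <= B" using der[OF s] by simp
   qed auto
   thus ?thesis by (simp add: w_def B_def L_def mult_ac)
  qed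
  have "\<bar>u x-w t x\<bar> <= (C+L)*2 ^ j" if x: "norm x <= K ^ j*r" for j x
   using wv[OF x] bd[rule_format, OF x] unfolding distrib_right by linarith
  thus ?thesis using cmp[unfolded comparison_ratio_def, rule_format, OF u_sol w_sol K(1) rp] by blast
 qed
 define S where "S = {t. ALL x. u x <= w t x}"
 \<comment> \<open>The vertex of a translate at negative height is a zero of it, while u is positive
   there.\<close>
 have neg: "t \<notin> S" if "t < 0" for t
 proof
  assume t: "t \<in> S"
  have "v m h h = 0" using v_zero_iff[OF mp h, of h] h by simp
  hence "w t (h+t *. e) = 0" by (simp add: w_def)
  hence "u (h+t *. e) <= 0" using t unfolding S_def by (metis mem_Collect_eq)
  moreover have "u (h+t *. e) > 0" by (rule below) (use that h in \<open>simp add: inner_add_left\<close>)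
  ultimately show False by simp
 qed
 have bdd: "bdd_below S" using neg by (intro bdd_belowI[of _ 0]) (meson not_le)
 \<comment> \<open>Raised above the zero \<open>x0\<close> of u, the translate is positive at
   \<open>x0\<close>, so it cannot lie below u.\<close>
 have ne: "S \<noteq> {}"
 proof -
  define t where "t = x0 \<bullet> e+1"
  have "(x0-t *. e) \<bullet> e = - 1" by (simp add: t_def inner_diff_left)
  moreover have "0 <= (\<Sum>j\<in>W. ((x0-t *. e-h) \<bullet> j)\<^sup>2/b j)" by (intro sum_nonneg divide_nonneg_pos b) auto
  ultimately have "w t x0 \<noteq> 0" unfolding w_def using v_zero_iff[OF mp h, of "x0-t *. e"] mp by simp
  moreover have "w t x0 >= 0" using sol_nonneg[OF w_sol] .
  ultimately have "\<not> w t x0 <= u x0" using ux0 by simp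
  hence "t \<in> S" using order[of t] by (auto simp: S_def)
  thus ?thesis by blast
 qed
 define t where "t = Inf S"
 have above: "s \<in> S" if ts: "s > t" for s
 proof -
  obtain s' where "s' \<in> S" "s' < s" using cInf_lessD[OF ne ts[unfolded t_def]] by blast
  thus ?thesis using w_mono[of s' s] by (auto simp: S_def intro: order_trans)
 qed
 have under: "w s x <= u x" if "s < t" for s x
 proof -
  have "s \<notin> S" using that cInf_lower[OF _ bdd, of s] by (auto simp: t_def)
  thus ?thesis using order[of s] by (auto simp: S_def)
 qed
 have uw: "u x = w t x" for x
 proof (rule antisym)
  have "((%s. w s x) \<longlongrightarrow> w t x) (at_right t)" using w_cont[of t x] by (auto simp: isCont_def intro: filterlim_at_split[THEN iffD1, THEN conjunct2])
  thus "u x <= w t x" by (rule tendsto_lowerbound) (use above in \<open>auto simp: eventually_at_filter S_def\<close>)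
  have "((%s. w s x) \<longlongrightarrow> w t x) (at_left t)" using w_cont[of t x] by (auto simp: isCont_def intro: filterlim_at_split[THEN iffD1, THEN conjunct1])
  thus "w t x <= u x" by (rule tendsto_upperbound) (use under in \<open>auto simp: eventually_at_filter\<close>)
 qed
 define a where "a = h+t *. e"
 have "u x = 0 \<longleftrightarrow> (\<Sum>j\<in>W. ((x-a) \<bullet> j)\<^sup>2/b j) <= m*((x-a) \<bullet> e)" for x
 proof -
  have A: "x-t *. e-h = x-a" and B: "(x-t *. e) \<bullet> e = (x-a) \<bullet> e" using h by (simp_all add: a_def inner_diff_left inner_add_left)
  show ?thesis by (simp only: uw w_def v_zero_iff[OF mp h] A B)
 qed
 thus ?thesis using mp by blast
qed

end

section \<open>Prescribing the blow-down\<close>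

lemma sqrt_prod: "sqrt (\<Prod>j\<in>A. g j) = (\<Prod>j\<in>A. sqrt (g j))"
 by (induction A rule: infinite_finite_induct) (simp_all add: real_sqrt_mult)

context parab
begin

text \<open>In this form each factor lies in \<open>{0..1}\<close>, the expression remains bounded
  when some \<open>b j\<close> tend to zero, and \<open>c * f\<close> is visibly invariant under a
  common scaling of b and s.\<close>

lemma cf_eq: assumes s: "s >= 0" shows "c * f s = (1/4)*(\<Prod>j\<in>W. sqrt (b j/(b j+s)))"
proof -
 have 0: "(\<Prod>j\<in>W. b j) > 0" using prod_pos[of 0] by simp
 have cc: "c = sqrt (\<Prod>j\<in>W. b j)/4" using 0 by (simp add: c_def f_def)
 have pr: "(\<Prod>j\<in>W. sqrt (b j/(b j+s))) = sqrt (\<Prod>j\<in>W. b j)/sqrt (\<Prod>j\<in>W. b j+s)"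
  by (simp add: real_sqrt_divide prod_dividef sqrt_prod)
 show ?thesis unfolding f_def cc pr by simp
qed

lemma I_deriv: "j \<in> W ==> l > 0 ==> (I j has_real_derivative f l/(b j+l)) (at l)"
 unfolding I_def[abs_def] by (rule integral_upto_deriv[OF fj_cont])

lemma I_lim: assumes j: "j \<in> W" shows "(%n. I j (real n)) \<longlonglongrightarrow> Iinf j"
proof -
 obtain K where K: "K > 0" "ALL j:W. ALL l>=0. 0 <= Iinf j-I j l \<and> Iinf j-I j l <= K/(b j+l)" using I_tail by blast
 have "(%n. K/(b j+real n)) \<longlonglongrightarrow> 0" by real_asymp
 hence "(%n. Iinf j-I j (real n)) \<longlonglongrightarrow> 0"
  by (rule tendsto_sandwich[OF _ _ tendsto_const[of 0], rotated 2]) (use K j in auto)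
 from tendsto_diff[OF tendsto_const[of "Iinf j"] this] show ?thesis by simp
qed

lemma factor_le: assumes "j \<in> W" "s >= 0" shows "0 <= sqrt (b j/(b j+s))" "sqrt (b j/(b j+s)) <= 1"
 using b[OF assms(1)] assms(2) by (auto simp: divide_le_eq)

text \<open>Two of the factors in \<open>cf_eq\<close> are at most \<open>sqrt (1/s)\<close> when
  all b are at most 1, so the tail of the integral is of order \<open>1/l\<close> independently of
  b. This gives the uniform convergence behind \<open>mass_continuous\<close>.\<close>

lemma I_tail_uniform:
 assumes j: "j \<in> W" and b1: "\<And>i. i \<in> W ==> b i <= 1" and l: "l >= 1"
 shows "\<bar>2 * c*Iinf j-2 * c*I j l\<bar> <= 1/(2*l)"
proof -
 have "EX i:W. EX k:W. i \<noteq> k"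
 proof (rule ccontr)
  assume "\<not> ?thesis"
  hence "W \<subseteq> {j}" using j by blast
  hence "card W <= 1" by (metis card_mono card_1_singleton_iff finite.emptyI finite_insert is_singletonI is_singleton_altdef)
  thus False using cardW by simp
 qed
 then obtain i k where ik: "i \<in> W" "k \<in> W" "i \<noteq> k" by blast
 have fb: "2 * c * f s <= 1/(2 * s)" if s: "s > 0" for s
 proof -
  have "(\<Prod>j\<in>W. sqrt (b j/(b j+s))) <= (\<Prod>j\<in>W. if j \<in> {i,k} then sqrt (1/s) else 1)"
  proof (rule prod_mono, intro conjI)
   fix j assume j: "j \<in> W"
   show "0 <= sqrt (b j/(b j+s))" using factor_le[OF j] s by simp
   have "b j/(b j+s) <= 1/s" using b[OF j] b1[OF j] s by (simp add: field_simps) (smt (verit) mult_left_le mult.commute mult_le_cancel_left1)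
   thus "sqrt (b j/(b j+s)) <= (if j \<in> {i,k} then sqrt (1/s) else 1)" using factor_le[OF j, of s] s by auto
  qed
  also have "\<dots> = (\<Prod>j\<in>{i,k}. sqrt (1/s))"
   by (subst prod.inter_restrict[symmetric]) (use finW ik in \<open>auto simp: Int_absorb1\<close>)
  also have "\<dots> = 1/s" using ik s by simp
  finally show ?thesis using cf_eq[of s] s by simp
 qed
 have mono: "2 * c*(I j m-I j l) <= 1/(2*l)" if m: "m >= l" for m
 proof -
  have "- (1/(2*l))-2 * c*I j l <= - (1/(2*m))-2 * c*I j m"
  proof (rule DERIV_nonneg_imp_nondecreasing[OF m])
   fix s assume s: "l <= s" "s <= m"
   hence sp: "s > 0" using l by simp
   have "((%s. - (1/(2 * s))) has_real_derivative 1/(2 * s^2)) (at s)"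
    using sp by (auto intro!: derivative_eq_intros simp: power2_eq_square)
   from DERIV_diff[OF this DERIV_cmult[OF I_deriv[OF j sp], of "2 * c"]]
   have "((%s. - (1/(2 * s))-2 * c*I j s) has_real_derivative 1/(2 * s^2)-2 * c*(f s/(b j+s))) (at s)" .
   moreover have "2 * c*(f s/(b j+s)) <= 1/(2 * s^2)"
   proof -
    have "2 * c*(f s/(b j+s)) = (2 * c * f s)/(b j+s)" by simp
    also have "\<dots> <= (1/(2 * s))/s" using fb[OF sp] b[OF j] sp by (intro frac_le) auto
    finally show ?thesis by (simp add: power2_eq_square)
   qed
   ultimately show "EX y. ((%s. - (1/(2 * s))-2 * c*I j s) has_real_derivative y) (at s) \<and> 0 <= y"
    by (intro exI conjI) auto
  qed
  moreover have "1/(2*m) >= 0" using m l by simp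
  ultimately show ?thesis unfolding right_diff_distrib by linarith
 qed
 have "2 * c*(Iinf j-I j l) <= 1/(2*l)"
 proof (rule LIMSEQ_le_const2)
  show "(%n. 2 * c*(I j (real n)-I j l)) \<longlonglongrightarrow> 2 * c*(Iinf j-I j l)" by (intro tendsto_intros I_lim j)
  show "EX N. ALL n>=N. 2 * c*(I j (real n)-I j l) <= 1/(2*l)"
  proof -
   obtain N where "l <= real N" using real_arch_simple by blast
   thus ?thesis by (intro exI[of _ N]) (auto intro!: mono)
  qed
 qed
 moreover have "0 <= Iinf j-I j l" using I_tail j l by fastforce
 hence "0 <= 2 * c*(Iinf j-I j l)" using c_pos by simp
 ultimately show ?thesis by (simp add: right_diff_distrib)
qed

text \<open>The factor with index k alone bounds the integrand by a function with an arctangent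
  primitive, giving \<open>2 * c * Iinf i <= 4 * sqrt (b k/b i)\<close>. A direction whose semi-axis
  dominates another one thus receives little of the trace.\<close>

lemma Iinf_ratio_bound:
 assumes i: "i \<in> W" and k: "k \<in> W" "k \<noteq> i" and le: "b k <= b i"
 shows "(2 * c*Iinf i)\<^sup>2*b i <= 16*b k"
proof -
 \<comment> \<open>A primitive of \<open>1/(sqrt (s+b k)*(b i+s+b k))\<close>. The additional
   \<open>b k\<close> in the denominator costs only a factor 2, because
   \<open>b k <= b i\<close>.\<close>
 define H where "H s = (2/sqrt (b i))*arctan (sqrt ((s+b k)/b i))" for s
 have bi: "b i > 0" and bk: "b k > 0" using b i k by auto
 have Hd: "(H has_real_derivative 1/(sqrt (s+b k)*(b i+(s+b k)))) (at s)" if s: "s >= 0" for s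
 proof -
  have p: "s+b k > 0" "(s+b k)/b i > 0" using s bk bi by auto
  have 1: "((%s. sqrt ((s+b k)/b i)) has_real_derivative (1/b i)*(inverse (sqrt ((s+b k)/b i))/2)) (at s)"
   using p by (auto intro!: derivative_eq_intros)
  have 2: "(H has_real_derivative (2/sqrt (b i))*(inverse (1+(sqrt ((s+b k)/b i))^2)*((1/b i)*(inverse (sqrt ((s+b k)/b i))/2)))) (at s)"
   unfolding H_def[abs_def] by (intro DERIV_cmult DERIV_chain2[OF DERIV_arctan 1])
  define A B where "A = sqrt (b i)" and "B = sqrt (s+b k)"
  have AB: "A > 0" "B > 0" "b i = A*A" "s+b k = B*B" using bi p by (auto simp: A_def B_def)
  have q: "sqrt ((s+b k)/b i) = B/A" by (simp add: A_def B_def real_sqrt_divide)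
  define N where "N = A*A+B*B"
  have ne: "N > 0" unfolding N_def using AB by (intro add_pos_pos mult_pos_pos) auto
  have "1+(B/A)^2 = N/(A*A)" using AB by (simp add: N_def add_divide_distrib power2_eq_square)
  hence inv: "inverse (1+(B/A)^2) = A*A/N" by simp
  have "(2/sqrt (b i))*(inverse (1+(sqrt ((s+b k)/b i))^2)*((1/b i)*(inverse (sqrt ((s+b k)/b i))/2)))
      = 1/(sqrt (s+b k)*(b i+(s+b k)))"
   unfolding q unfolding A_def[symmetric] B_def[symmetric] unfolding AB(3,4) inv N_def[symmetric] using AB(1,2) ne
   by (simp add: field_simps)
  with 2 show ?thesis by simp
 qed
 have bnd: "2 * c*I i l <= 4 * sqrt (b k/b i)" if l: "l >= 0" for l
 proof -
  have "sqrt (b k)*H 0-2 * c*I i 0 <= sqrt (b k)*H l-2 * c*I i l"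
  proof (rule DERIV_nonneg_imp_increasing_open[OF l])
   fix s assume s: "0 < s" "s < l"
   have "((%s. sqrt (b k)*H s-2 * c*I i s) has_real_derivative
          sqrt (b k)*(1/(sqrt (s+b k)*(b i+(s+b k))))-2 * c*(f s/(b i+s))) (at s)"
    using s by (intro DERIV_diff DERIV_cmult Hd I_deriv i) auto
   moreover have "2 * c*(f s/(b i+s)) <= sqrt (b k)*(1/(sqrt (s+b k)*(b i+(s+b k))))"
   proof -
    have "(\<Prod>j\<in>W. sqrt (b j/(b j+s))) = sqrt (b k/(b k+s))*(\<Prod>j\<in>W - {k}. sqrt (b j/(b j+s)))"
     by (rule prod.remove[OF finW k(1)])
    also have "\<dots> <= sqrt (b k/(b k+s))*1"
     using factor_le s factor_le(1)[OF k(1), of s] by (intro mult_left_mono prod_le_1) auto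
    finally have "2 * c * f s <= 1/2*(sqrt (b k)/sqrt (s+b k))" using cf_eq[of s] s by (simp add: real_sqrt_divide add.commute)
    hence "2 * c * f s/(b i+s) <= 1/2*(sqrt (b k)/sqrt (s+b k))/(b i+s)"
     using bi s by (intro divide_right_mono) auto
    also have "\<dots> = (sqrt (b k)/sqrt (s+b k))/(2*(b i+s))" by simp
    also have "\<dots> <= (sqrt (b k)/sqrt (s+b k))/(b i+(s+b k))"
     using bi bk s le by (intro divide_left_mono mult_pos_pos add_pos_pos) auto
    finally show ?thesis by simp
   qed
   ultimately show "EX y. ((%s. sqrt (b k)*H s-2 * c*I i s) has_real_derivative y) (at s) \<and> 0 <= y"
    by (intro exI conjI) auto
  next
   have "continuous_on {0..l} H"
    by (rule continuous_at_imp_continuous_on) (use Hd DERIV_isCont in \<open>fastforce\<close>)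
   moreover have "continuous_on {0..l} (I i)" unfolding I_def
    by (rule indefinite_integral_continuous_1) (auto intro!: integrable_continuous_interval intro: continuous_on_subset[OF fj_cont[OF i]])
   ultimately show "continuous_on {0..l} (%s. sqrt (b k)*H s-2 * c*I i s)" by (intro continuous_intros)
  qed
  moreover have "H 0 >= 0" using bi bk by (simp add: H_def)
  moreover have "H l <= (2/sqrt (b i))*2"
   unfolding H_def using arctan_ubound[of "sqrt ((l+b k)/b i)"] pi_less_4 bi by (intro mult_left_mono) auto
  hence "sqrt (b k)*H l <= sqrt (b k)*((2/sqrt (b i))*2)" using bk by (intro mult_left_mono) auto
  moreover have "sqrt (b k)*H 0 >= 0" using \<open>H 0 \<ge> 0\<close> bk by simp
  ultimately have "2 * c*I i l <= sqrt (b k)*((2/sqrt (b i))*2)" unfolding I_0 by linarith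
  thus ?thesis by (simp add: real_sqrt_divide mult.commute)
 qed
 have "2 * c*Iinf i <= 4 * sqrt (b k/b i)"
  by (rule LIMSEQ_le_const2[OF tendsto_mult[OF tendsto_const I_lim[OF i]]]) (use bnd in auto)
 moreover have "2 * c*Iinf i >= 0" using c_pos Iinf_pos[OF i] by simp
 ultimately have "(2 * c*Iinf i)\<^sup>2 <= (4 * sqrt (b k/b i))^2" by (rule power_mono)
 also have "\<dots> = 16*b k/b i" using bi bk by (simp add: power_mult_distrib)
 finally show ?thesis using bi by (simp add: pos_le_divide_eq)
qed

end

section \<open>Realizing a given quadratic form\<close>

context frame
begin

text \<open>The coefficient of the blow-down in direction j as a function of the semi-axis
  parameters, which are encoded as the coordinates of a vector so that Brouwer's theorem applies in
  the ambient space. It is invariant under scaling of these parameters.\<close>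

definition mass :: "'a => 'a => real" where
 "mass j x = 2 * parab.c W (%j. x \<bullet> j) * parab.Iinf W (%j. x \<bullet> j) j"

text \<open>The integrals over \<open>{0..n}\<close> are continuous in the parameters and converge
  uniformly by \<open>I_tail_uniform\<close>.\<close>

lemma mass_continuous:
 assumes j: "j \<in> W" and S: "\<And>x i. x \<in> S ==> i \<in> W ==> 0 < x \<bullet> i \<and> x \<bullet> i <= 1"
 shows "continuous_on S (mass j)"
proof -
 define g where "g n x = integral {0..real n} (%s. (1/2)*(\<Prod>i\<in>W. sqrt (x \<bullet> i/(x \<bullet> i+s)))/(x \<bullet> j+s))" for n and x :: 'a
 have P: "parab e W (%j. x \<bullet> j)" if "x \<in> S" for x by unfold_locales (use S that in blast)
 have geq: "g n x = 2 * parab.c W (%j. x \<bullet> j) * parab.I W (%j. x \<bullet> j) j (real n)" if x: "x \<in> S" for n x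
 proof -
  interpret P: parab e W "%j. x \<bullet> j" by (rule P[OF x])
  have "2*P.c*P.I j (real n) = integral {0..real n} (%s. 2*P.c*(P.f s/(x \<bullet> j+s)))"
   unfolding P.I_def by (rule Henstock_Kurzweil_Integration.integral_mult_right[symmetric])
  also have "\<dots> = g n x" unfolding g_def
  proof (rule integral_cong)
   fix s assume "s \<in> {0..real n}"
   thus "2*P.c*(P.f s/(x \<bullet> j+s)) = (1/2)*(\<Prod>i\<in>W. sqrt (x \<bullet> i/(x \<bullet> i+s)))/(x \<bullet> j+s)"
   proof -
    assume "s \<in> {0..real n}"
    hence "2*P.c*P.f s = (1/2)*(\<Prod>i\<in>W. sqrt (x \<bullet> i/(x \<bullet> i+s)))" using P.cf_eq[of s] by simp
    thus ?thesis unfolding times_divide_eq_right[of _ _ "x \<bullet> j+s"] by (simp only:)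
   qed
  qed
  finally show ?thesis by simp
 qed
 show ?thesis
 proof (rule uniform_limit_theorem[where F = sequentially and f = g])
  show "\<forall>\<^sub>F n in sequentially. continuous_on S (g n)"
  proof (rule always_eventually, intro allI)
   fix n
   have "continuous_on (S \<times> cbox 0 (real n)) (%(x, s). (1/2)*(\<Prod>i\<in>W. sqrt (x \<bullet> i/(x \<bullet> i+s)))/(x \<bullet> j+s))"
    unfolding case_prod_beta
    by (intro continuous_intros) (use S j in \<open>fastforce simp: add_pos_nonneg order_less_imp_not_eq2\<close>)+
   from integral_continuous_on_param[OF this] show "continuous_on S (g n)" by (simp add: g_def[abs_def])
  qed
  show "uniform_limit S g (mass j) sequentially"
  proof (rule uniform_limitI)
   fix eps :: real assume eps: "eps > 0"
   obtain N where N: "1/eps < real N" using reals_Archimedean2 by blast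
   show "\<forall>\<^sub>F n in sequentially. ALL x:S. dist (g n x) (mass j x) < eps"
   proof (rule eventually_sequentiallyI[of "N+1"], rule ballI)
    fix n x assume n: "N+1 <= n" and x: "x \<in> S"
    interpret P: parab e W "%j. x \<bullet> j" by (rule P[OF x])
    have "\<bar>2*P.c*P.Iinf j-2*P.c*P.I j (real n)\<bar> <= 1/(2*real n)"
     by (rule P.I_tail_uniform[OF j]) (use S x n in auto)
    hence "dist (g n x) (mass j x) <= 1/(2*real n)" unfolding geq[OF x] mass_def dist_real_def by (simp add: abs_minus_commute)
    also have "\<dots> < eps"
    proof -
     have "1/eps < real n" using N n by simp
     hence "1 < eps*real n" using eps by (simp add: pos_divide_less_eq mult.commute)
     thus ?thesis using n by (simp add: pos_divide_less_eq)
    qed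
    finally show "dist (g n x) (mass j x) < eps" .
   qed
  qed
 qed simp
qed

text \<open>Brouwer's theorem solves the variational inequality for \<open>mass - q\<close> on a truncated simplex.
 Unless \<open>mass = q\<close>, every coordinate is of order \<open>dlt\<close>: those where \<open>mass - q\<close> is not
 maximal lie on the truncation, the others by the ratio bound.\<close>

theorem prescribed_mass:
 assumes q: "\<And>j. j \<in> W ==> q j > 0" and q1: "(\<Sum>j\<in>W. q j) = 1"
 shows "EX b. (ALL j:W. b j > 0) \<and> (ALL j:W. 2 * parab.c W b * parab.Iinf W b j = q j)"
proof -
 define n where "n = real (card W)"
 have n: "n >= 2" using cardW by (simp add: n_def)
 have Wne: "W \<noteq> {}" using cardW by auto
 define q0 where "q0 = Min (q ` W)"
 have q0: "q0 > 0" "\<And>j. j \<in> W ==> q0 <= q j" using Wne finW q by (auto simp: q0_def)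
 \<comment> \<open>M bounds all coordinates relative to \<open>dlt\<close> by the ratio bound with
   \<open>mass >= q0\<close>; then \<open>dlt\<close> is such that n coordinates of size
   \<open>M*dlt\<close> sum to 1/2, contradicting the sum 1.\<close>
 define M where "M = 1+16/q0^2"
 have M: "M >= 1" using q0 by (simp add: M_def)
 define dlt where "dlt = 1/(2*n*M)"
 have dlt: "dlt > 0" "n*(M*dlt) = 1/2" using n M by (auto simp: dlt_def)
 have dltn: "dlt <= 1/n"
 proof -
  have "n*1 <= n*(2*M)" using n M by (intro mult_left_mono) auto
  thus ?thesis unfolding dlt_def using n by (intro divide_left_mono) (auto simp: mult_ac)
 qed
 define sv where "sv = (\<Sum>j\<in>W. j)"
 define S where "S = {x. e \<bullet> x = 0} \<inter> (\<Inter>j\<in>W. {x. j \<bullet> x >= dlt}) \<inter> {x. sv \<bullet> x = 1}"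
 have Siff: "x \<in> S \<longleftrightarrow> x \<bullet> e = 0 \<and> (ALL j:W. dlt <= x \<bullet> j) \<and> (\<Sum>j\<in>W. x \<bullet> j) = 1" for x
  by (auto simp: S_def sv_def inner_sum_left inner_commute[of x])
 have cS: "convex S" "closed S"
  unfolding S_def by (auto intro!: convex_Int convex_INT convex_hyperplane convex_halfspace_ge closed_Int closed_INT closed_hyperplane closed_halfspace_ge)
 have Sb: "0 < x \<bullet> j \<and> x \<bullet> j <= 1" if x: "x \<in> S" and j: "j \<in> W" for x j
 proof -
  have x': "ALL j:W. dlt <= x \<bullet> j" "(\<Sum>j\<in>W. x \<bullet> j) = 1" using x by (auto simp: Siff)
  have "x \<bullet> j <= (\<Sum>j\<in>W. x \<bullet> j)" by (rule member_le_sum[OF j _ finW]) (use x' dlt in fastforce)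
  thus ?thesis using x' j dlt by fastforce
 qed
 have "bounded S"
 proof (rule boundedI)
  fix x assume x: "x \<in> S"
  have "x = (\<Sum>j\<in>W. (x \<bullet> j) *. j)" using expand[of x] x by (simp add: Siff)
  hence "norm x <= (\<Sum>j\<in>W. norm ((x \<bullet> j) *. j))" by (metis norm_sum)
  also have "\<dots> <= (\<Sum>j\<in>W. 1)" by (rule sum_mono) (use Sb[OF x] unit in fastforce)
  finally show "norm x <= n" by (simp add: n_def)
 qed
 hence comp: "compact S" using cS by (simp add: compact_eq_bounded_closed)
 have pick: "(\<Sum>i\<in>W. (a i *. i) \<bullet> j) = a j" if "j \<in> W" for a j
 proof -
  have "(\<Sum>i\<in>W. (a i *. i) \<bullet> j) = (\<Sum>i\<in>W. if i = j then a j else 0)"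
   by (rule sum.cong[OF refl]) (use that jk in auto)
  thus ?thesis using finW that by simp
 qed
 have Sne: "S \<noteq> {}"
 proof -
  define x where "x = (\<Sum>i\<in>W. (1/n) *. i)"
  have xj: "x \<bullet> j = 1/n" if "j \<in> W" for j unfolding x_def inner_sum_left by (rule pick[OF that])
  have "x \<bullet> e = 0" by (simp add: x_def inner_sum_left)
  moreover have "(\<Sum>j\<in>W. x \<bullet> j) = 1" using xj n by (simp add: n_def)
  ultimately have "x \<in> S" using xj dltn by (simp add: Siff)
  thus ?thesis by blast
 qed
 define d where "d x j = mass j x-q j" for x j
 \<comment> \<open>Fixed points of the projected step \<open>x + d\<close> are exactly the solutions
   of the variational inequality on S. Since S meets the boundary of the orthant nowhere, the masses
   are continuous on it.\<close>
 define \<Phi> where "\<Phi> x = closest_point S (x+(\<Sum>j\<in>W. d x j *. j))" for x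
 have cont: "continuous_on S \<Phi>"
  unfolding \<Phi>_def
 proof (rule continuous_on_compose2[OF continuous_on_closest_point[OF cS Sne, of UNIV]])
  show "continuous_on S (%x. x+(\<Sum>j\<in>W. d x j *. j))"
   unfolding d_def by (intro continuous_intros mass_continuous) (use Sb in auto)
 qed simp
 have "\<Phi> ` S \<subseteq> S" unfolding \<Phi>_def using closest_point_in_set[OF cS(2) Sne] by auto
 then obtain x where x: "x \<in> S" "\<Phi> x = x" using brouwer[OF comp cS(1) Sne cont] by (auto simp: image_subset_iff_funcset)
 have vi: "(\<Sum>j\<in>W. d x j *. j) \<bullet> (y-x) <= 0" if "y \<in> S" for y
  using closest_point_dot[OF cS that, of "x+(\<Sum>j\<in>W. d x j *. j)"] x(2) by (simp add: \<Phi>_def)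
 have P: "parab e W (%j. x \<bullet> j)" by unfold_locales (use Sb x in blast)
 interpret P: parab e W "%j. x \<bullet> j" by (rule P)
 have mass: "mass j x = 2*P.c*P.Iinf j" for j by (simp add: mass_def)
 have sum0: "(\<Sum>j\<in>W. d x j) = 0"
  using P.sum_Iinf q1 unfolding d_def mass sum_subtractf by (simp add: sum_distrib_left[symmetric] mult_ac)
 \<comment> \<open>If coordinate k were above the truncation, its excess could be moved to i, an
   admissible direction in which the linear form of the variational inequality increases.\<close>
 have trunc: "x \<bullet> k = dlt" if ik: "i \<in> W" "k \<in> W" "d x k < d x i" for i k
 proof (rule ccontr)
  assume "x \<bullet> k \<noteq> dlt"
  hence s: "x \<bullet> k-dlt > 0" using x(1) ik by (fastforce simp: Siff)
  define s where "s = x \<bullet> k-dlt"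
  have ne: "i \<noteq> k" using ik by auto
  define y where "y = x+s *. i-s *. k"
  have yj: "y \<bullet> j = (if j = i then x \<bullet> i+s else if j = k then dlt else x \<bullet> j)" if "j \<in> W" for j
   using that ik ne jk[of i j] jk[of k j] by (auto simp: y_def inner_add_left inner_diff_left s_def)
  have "y \<in> S" unfolding Siff
  proof (intro conjI ballI)
   show "y \<bullet> e = 0" using x ik by (simp add: y_def inner_add_left inner_diff_left Siff)
   show "dlt <= y \<bullet> j" if "j \<in> W" for j using yj[OF that] x(1) that ik s by (auto simp: Siff s_def add_increasing2)
   have "i \<bullet> sv = 1" "k \<bullet> sv = 1" using ik pick[of i "%_. 1"] pick[of k "%_. 1"] by (simp_all add: sv_def inner_sum_right inner_commute)
   moreover have "x \<bullet> sv = 1" using x(1) by (simp add: Siff sv_def inner_sum_right)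
   ultimately have "y \<bullet> sv = 1" by (simp add: y_def inner_add_left inner_diff_left)
   thus "(\<Sum>j\<in>W. y \<bullet> j) = 1" by (simp add: sv_def inner_sum_right)
  qed
  have pd: "(\<Sum>j\<in>W. d x j *. j) \<bullet> i = d x i" if "i \<in> W" for i
   unfolding inner_sum_left by (rule pick[OF that])
  from vi[OF \<open>y \<in> S\<close>] have "s*d x i-s*d x k <= 0"
   using pd[OF ik(1)] pd[OF ik(2)] by (simp add: y_def inner_diff_right inner_add_right)
  hence "s*(d x i-d x k) <= 0" by (simp add: right_diff_distrib)
  thus False using s ik by (simp add: s_def mult_le_0_iff)
 qed
 have "d x j = 0" if j: "j \<in> W" for j
 proof (rule ccontr)
  assume nz: "d x j \<noteq> 0"
  \<comment> \<open>The differences sum to zero, since both families have sum 1; a nonzero entry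
    therefore forces entries of both signs.\<close>
  have "EX a:W. d x a > 0"
  proof (rule ccontr)
   assume "\<not> ?thesis"
   hence "ALL a:W. d x a <= 0" by force
   hence "ALL a:W. - d x a = 0" using sum0 sum_nonneg_eq_0_iff[OF finW, of "%a. - d x a"] by (simp add: sum_negf)
   hence "ALL a:W. d x a = 0" by simp
   thus False using nz j by blast
  qed
  moreover have "EX a:W. d x a < 0"
  proof (rule ccontr)
   assume "\<not> ?thesis"
   hence "ALL a:W. d x a >= 0" by force
   hence "ALL a:W. d x a = 0" using sum0 sum_nonneg_eq_0_iff[OF finW, of "d x"] by auto
   thus False using nz j by blast
  qed
  ultimately obtain a k where a: "a \<in> W" "d x a > 0" and k: "k \<in> W" "d x k < 0" by blast
  have xk: "x \<bullet> k = dlt" by (rule trunc[OF a(1) k(1)]) (use a k in simp)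
  have le: "x \<bullet> i <= M*dlt" if i: "i \<in> W" for i
  proof (cases "d x i > 0")
   case False
   have "x \<bullet> i = dlt" by (rule trunc[OF a(1) i]) (use a False in simp)
   thus ?thesis using M dlt by simp
  next
   case True
   have ne: "k \<noteq> i" using k True by auto
   have "(2*P.c*P.Iinf i)\<^sup>2*(x \<bullet> i) <= 16*(x \<bullet> k)"
    by (rule P.Iinf_ratio_bound[OF i k(1) ne]) (use xk x(1) i in \<open>auto simp: Siff\<close>)
   moreover have "q0\<^sup>2 <= (2*P.c*P.Iinf i)^2" using True q0(2)[OF i] q0(1) by (intro power_mono) (auto simp: d_def mass)
   hence "q0\<^sup>2*(x \<bullet> i) <= (2*P.c*P.Iinf i)^2*(x \<bullet> i)" using Sb[OF x(1) i] by (intro mult_right_mono) auto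
   ultimately have "x \<bullet> i <= 16*dlt/q0^2" using q0 xk by (simp add: pos_le_divide_eq mult.commute)
   also have "\<dots> <= M*dlt" using dlt by (simp add: M_def distrib_right)
   finally show ?thesis .
  qed
  have "(\<Sum>i\<in>W. x \<bullet> i) <= (\<Sum>i\<in>W. M*dlt)" by (rule sum_mono[OF le])
  also have "\<dots> = 1/2" using dlt by (simp add: n_def)
  finally show False using x(1) by (simp add: Siff)
 qed
 hence "ALL j:W. 2*P.c*P.Iinf j = q j" by (simp add: d_def mass)
 thus ?thesis using Sb[OF x(1)] by blast
qed

end

section \<open>Diagonalization and conclusion\<close>

text \<open>A maximizer j of the quadratic form on the unit sphere of V is an eigenvector, its
  orthogonal complement in V is again invariant, and induction on the dimension applies.\<close>

lemma symmetric_eigenbasis: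
 fixes f :: "'a::euclidean_space => 'a"
 assumes f: "linear f" and sym: "\<And>x y. f x \<bullet> y = x \<bullet> f y" and V: "subspace V" "\<And>x. x \<in> V ==> f x \<in> V"
 shows "EX W. finite W \<and> W \<subseteq> V \<and> pairwise orthogonal W \<and> (ALL j:W. norm j = 1 \<and> (EX l. f j = l *. j)) \<and> V \<subseteq> span W"
 using V
proof (induction "dim V" arbitrary: V rule: less_induct)
 case (less V)
 show ?case
 proof (cases "V \<subseteq> {0}")
  case True
  thus ?thesis by (intro exI[of _ "{}"]) (auto simp: pairwise_def)
 next
  case False
  then obtain z where z: "z \<in> V" "z \<noteq> 0" by blast
  define C where "C = V \<inter> sphere 0 1"
  have "compact C" unfolding C_def using closed_subspace[OF less.prems(1)] compact_sphere by (intro closed_Int_compact)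
  moreover have "C \<noteq> {}"
  proof -
   have "(1/norm z) *. z \<in> C" using z less.prems by (auto simp: C_def subspace_scale)
   thus ?thesis by blast
  qed
  moreover have "continuous_on C (%x. x \<bullet> f x)"
   by (intro continuous_intros linear_continuous_on) (use f in \<open>simp add: linear_conv_bounded_linear\<close>)
  ultimately obtain j where j: "j \<in> C" "\<And>x. x \<in> C ==> x \<bullet> f x <= j \<bullet> f j"
   using continuous_attains_sup by metis
  have jV: "j \<in> V" "norm j = 1" "j \<bullet> j = 1" using j by (auto simp: C_def norm_eq_1)
  define l where "l = j \<bullet> f j"
  have quad: "y \<bullet> f y <= l*(y \<bullet> y)" if y: "y \<in> V" for y
  proof (cases "y = 0")
   case False
   define r where "r = norm y"
   have r: "r > 0" "y \<bullet> y = r*r" using False by (auto simp: r_def power2_norm_eq_inner[symmetric] power2_eq_square)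
   have "(1/r) *. y \<in> C" using y less.prems False by (auto simp: C_def subspace_scale r_def)
   hence "((1/r) *. y) \<bullet> f ((1/r) *. y) <= l" unfolding l_def by (rule j(2))
   hence "(y \<bullet> f y)/(r*r) <= l" using linear_cmul[OF f] by simp
   thus ?thesis using r by (simp add: pos_divide_le_eq)
  qed (use linear_0[OF f] in simp)
  have fjh: "f j \<bullet> h = 0" if h: "h \<in> V" "j \<bullet> h = 0" for h
  proof (rule ccontr)
   assume nz: "f j \<bullet> h \<noteq> 0"
   define A B where "A = f j \<bullet> h" and "B = l*(h \<bullet> h)-h \<bullet> f h"
   \<comment> \<open>Maximality along the line \<open>j + t *. h\<close>: the term linear in t must
     be dominated by the quadratic one for every t, which forces \<open>A = 0\<close>; the test
     value below is \<open>t = A/(B+1)\<close>.\<close>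
   have ineq: "2*t*A <= t*t*B" for t
   proof -
    have i1: "(j+t *. h) \<bullet> f (j+t *. h) <= l*((j+t *. h) \<bullet> (j+t *. h))"
     by (rule quad) (use jV h less.prems in \<open>auto intro: subspace_add subspace_scale\<close>)
    have E1: "(j+t *. h) \<bullet> f (j+t *. h) = l+2*t*A+t*t*(h \<bullet> f h)"
     using sym[of j h] by (simp add: linear_add[OF f] linear_cmul[OF f] inner_add_left inner_add_right l_def A_def inner_commute[of h "f j"] algebra_simps)
    have E2: "(j+t *. h) \<bullet> (j+t *. h) = 1+t*t*(h \<bullet> h)"
     using jV h by (simp add: inner_add_left inner_add_right inner_commute[of h j])
    show ?thesis using i1 unfolding E1 E2 B_def by (simp add: algebra_simps)
   qed
   have B: "B >= 0" using quad[OF h(1)] by (simp add: B_def)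
   define t where "t = A/(B+1)"
   have "2*t*A = 2*(A*A)/(B+1)" by (simp add: t_def)
   moreover have "t*t*B <= t*t*(B+1)" by (intro mult_left_mono) auto
   moreover have "t*t*(B+1) = A*A/(B+1)" using B by (simp add: t_def)
   moreover have "A \<noteq> 0" using nz by (simp add: A_def)
   hence "A*A > 0" using not_real_square_gt_zero[of A] by blast
   hence "A*A/(B+1) > 0" using B by (intro divide_pos_pos) auto
   ultimately show False using ineq[of t] by simp
  qed
  define h where "h = f j-l *. j"
  have "h \<in> V" unfolding h_def using jV less.prems by (intro subspace_diff subspace_scale) auto
  moreover have jh: "j \<bullet> h = 0" using jV by (simp add: h_def inner_diff_right l_def)
  ultimately have "f j \<bullet> h = 0" by (rule fjh)
  hence "h \<bullet> h = 0" using jh by (simp add: h_def inner_diff_left)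
  hence fj: "f j = l *. j" by (simp add: h_def)
  define V' where "V' = V \<inter> {x. j \<bullet> x = 0}"
  have V': "subspace V'" unfolding V'_def using less.prems(1) by (intro subspace_inter subspace_hyperplane)
  have "j \<notin> V'" "V' \<subseteq> V" using jV by (auto simp: V'_def)
  hence "V' \<subset> V" using jV by blast
  hence "span V' \<subset> span V" using V' less.prems(1) by (metis span_eq_iff)
  hence "dim V' < dim V" by (rule dim_psubset)
  moreover have "f x \<in> V'" if "x \<in> V'" for x
   using that less.prems(2) sym[of j x] fj by (auto simp: V'_def)
  ultimately obtain W where W: "finite W" "W \<subseteq> V'" "pairwise orthogonal W" "ALL j:W. norm j = 1 \<and> (EX l. f j = l *. j)" "V' \<subseteq> span W"
   using less.hyps[OF _ V'] by blast
  show ?thesis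
  proof (intro exI[of _ "insert j W"] conjI)
   show "finite (insert j W)" "insert j W \<subseteq> V" using W jV by (auto simp: V'_def)
   show "pairwise orthogonal (insert j W)" unfolding pairwise_insert
    using W by (auto simp: V'_def orthogonal_def inner_commute)
   show "ALL j:insert j W. norm j = 1 \<and> (EX l. f j = l *. j)" using W jV fj by blast
   show "V \<subseteq> span (insert j W)"
   proof
    fix x assume x: "x \<in> V"
    have "x-(j \<bullet> x) *. j \<in> V'" using x jV less.prems by (auto simp: V'_def inner_diff_right intro: subspace_diff subspace_scale)
    thus "x \<in> span (insert j W)" using W(5) by (auto simp: span_insert)
   qed
  qed
 qed
qed

section \<open>From coordinates to frames and back\<close>

lemma Basis_vec_real: "(Basis :: (real^'n) set) = (%i. axis i 1) ` UNIV"
 by (auto simp: Basis_vec_def)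

lemma sum_Basis_vec: "(\<Sum>b\<in>(Basis::(real^'n) set). g b) = (\<Sum>i\<in>UNIV. g (axis i 1))"
 unfolding Basis_vec_real by (subst sum.reindex) (auto simp: inj_on_def axis_eq_axis)

lemma has_derivative_grad:
 fixes u :: "real^'n => real"
 assumes "u differentiable (at x)"
 shows "(u has_derivative (%h. grad u x \<bullet> h)) (at x)"
proof -
 have d: "(u has_derivative frechet_derivative u (at x)) (at x)" using assms by (simp add: frechet_derivative_works)
 hence lin: "linear (frechet_derivative u (at x))" by (rule has_derivative_linear)
 have "frechet_derivative u (at x) = (%h. grad u x \<bullet> h)"
 proof
  fix h :: "real^'n"
  have "h = (\<Sum>i\<in>UNIV. h $ i *. axis i 1)"
   by (metis (no_types) basis_expansion scalar_mult_eq_scaleR sum.cong)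
  hence "frechet_derivative u (at x) h = frechet_derivative u (at x) (\<Sum>i\<in>UNIV. h $ i *. axis i 1)" by simp
  also have "\<dots> = (\<Sum>i\<in>UNIV. h $ i * frechet_derivative u (at x) (axis i 1))"
   by (simp add: linear_sum[OF lin] linear_cmul[OF lin])
  finally show "frechet_derivative u (at x) h = grad u x \<bullet> h" by (simp add: grad_def inner_vec_def mult.commute)
 qed
 thus ?thesis using d by simp
qed

lemma global_solution_sol:
 fixes u :: "real^'n => real"
 assumes u: "global_solution u"
 shows "sol u"
 unfolding sol_def
proof (intro conjI exI[of _ "grad u"])
 show "ALL x. 0 <= u x" using u by (simp add: global_solution_def)
 have diff: "u differentiable (at x)" for x using u by (simp add: global_solution_def C11_loc_def)
 show "lap u (grad u) (indicator {x. 0 < u x})" unfolding lap_def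
 proof (intro conjI allI has_derivative_grad diff)
  fix R
  show "EX L. ALL y:cball 0 R. ALL z:cball 0 R. norm (grad u y-grad u z) <= L*norm (y-z)"
   using u by (simp add: global_solution_def C11_loc_def dist_norm)
  have "continuous_on UNIV u" using has_derivative_continuous[OF has_derivative_grad[OF diff]] by (simp add: continuous_on_eq_continuous_at)
  hence [measurable]: "u \<in> borel_measurable borel" by (rule borel_measurable_continuous_onI)
  show "(indicator {x. 0 < u x} :: real^'n => real) \<in> borel_measurable borel" by measurable
  show "EX K. ALL x:cball 0 R. \<bar>indicator {x. 0 < u x} x :: real\<bar> <= K" by (intro exI[of _ 1]) (auto simp: indicator_def)
  have "AE x in lborel. EX H. (grad u has_derivative H) (at x) \<and> (\<Sum>i\<in>UNIV. H (axis i 1) $ i) = indicator {y. u y > 0} x"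
   using u unfolding global_solution_def by (simp add: AE_completion_iff)
  thus "AE x in lborel. EX H. (grad u has_derivative H) (at x) \<and> (\<Sum>b\<in>Basis. H b \<bullet> b) = indicator {x. 0 < u x} x"
   by (simp add: sum_Basis_vec inner_axis)
 qed
qed

text \<open>The frame vectors, taken as rows with e in position k, form an orthogonal matrix whose
  transpose is the required map. Only its determinant has to be corrected to 1.\<close>

lemma frame_paraboloid:
 fixes e :: "real^'n"
 assumes "frame e W" and b: "\<And>j. j \<in> W ==> b j > 0" and m: "m > 0" and card: "card W+1 = CARD('n)"
 shows "paraboloid {x. (\<Sum>j\<in>W. ((x-a) \<bullet> j)\<^sup>2/b j) <= m*((x-a) \<bullet> e)}"
proof -
 interpret frame e W by fact
 fix k :: 'n
 have "card (UNIV - {k}) = card W" using card by (simp add: card_Diff_singleton)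
 then obtain g where g: "bij_betw g (UNIV - {k}) W" using finite_same_card_bij[of "UNIV - {k}" W] finW by auto
 have gW: "i \<noteq> k ==> g i \<in> W" for i using g by (auto simp: bij_betw_def)
 have "UNIV - {k} \<noteq> {}"
 proof
  assume "UNIV - {k} = {}"
  hence "W = {}" using g unfolding bij_betw_def by (metis image_empty)
  thus False using cardW by simp
 qed
 then obtain i0 where i0: "i0 \<noteq> k" by blast
 define col where "col i = (if i = k then e else g i)" for i
 define A where "A sig = (\<chi> i. if i = i0 then sig *s col i else col i)" for sig
 have "col i \<bullet> col j = (if i = j then 1 else 0)" for i j
 proof -
  have "g i = g j \<longleftrightarrow> i = j" if "i \<noteq> k" "j \<noteq> k" using g that by (auto simp: bij_betw_def inj_on_def)
  thus ?thesis using gW jk[of "g i" "g j"] by (auto simp: col_def)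
 qed
 hence orthA: "orthogonal_matrix (A sig)" if "sig * sig = 1" for sig
  unfolding orthogonal_matrix_orthonormal_rows using that
  by (auto simp: row_def A_def norm_eq_1 orthogonal_def scalar_mult_eq_scaleR cong: if_cong)
 have det: "det (A sig) = sig*det (A 1)" for sig
  using det_row_mul[of i0 sig col col] unfolding A_def by (simp only: vector_smult_lid if_cancel)
 \<comment> \<open>Multiplying a horizontal row by the determinant, which is 1 or -1, yields a
   rotation. The set does not change because horizontal coordinates enter through squares
   only.\<close>
 define sig where "sig = det (A 1)"
 have sig: "sig * sig = 1" using det_orthogonal_matrix[OF orthA[of 1]] by (auto simp: sig_def)
 have rot: "rotation_matrix (transpose (A sig))"
  using orthA[OF sig] det[of sig] sig by (simp add: rotation_matrix_def orthogonal_matrix_transpose det_transpose sig_def)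
 define B where "B = A sig"
 have inv: "B *v (transpose B *v x) = x" "transpose B *v (B *v x) = x" for x
  using orthA[OF sig] by (simp_all add: B_def matrix_vector_mul_assoc orthogonal_matrix_def del: transpose_matrix_vector)
 have Bk: "(B *v z) $ k = z \<bullet> e" for z
  using i0 by (simp add: B_def A_def matrix_vector_mul_component col_def inner_commute)
 have Bi: "((B *v z) $ i)\<^sup>2 = (z \<bullet> g i)^2" if "i \<noteq> k" for z i
  using that sig by (auto simp: B_def A_def matrix_vector_mul_component col_def inner_commute scalar_mult_eq_scaleR power_mult_distrib power2_eq_square[of sig])
 \<comment> \<open>Division of the inequality by m moves the size into the semi-axes.\<close>
 define s where "s i = sqrt (m*b (g i))" for i
 have s: "s i > 0" "(s i)\<^sup>2 = m*b (g i)" if "i \<noteq> k" for i using m b[OF gW[OF that]] by (auto simp: s_def)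
 have sum: "(\<Sum>i\<in>UNIV - {k}. ((B *v z) $ i)\<^sup>2/(s i)^2) = (\<Sum>j\<in>W. (z \<bullet> j)\<^sup>2/b j)/m" for z
 proof -
  have "(\<Sum>i\<in>UNIV - {k}. ((B *v z) $ i)\<^sup>2/(s i)^2) = (\<Sum>i\<in>UNIV - {k}. (z \<bullet> g i)\<^sup>2/(m*b (g i)))"
   by (rule sum.cong) (auto simp: Bi s)
  also have "\<dots> = (\<Sum>j\<in>W. (z \<bullet> j)\<^sup>2/(m*b j))" by (rule sum.reindex_bij_betw[OF g, of "%j. (z \<bullet> j)\<^sup>2/(m*b j)"])
  finally show ?thesis by (simp add: sum_divide_distrib mult.commute)
 qed
 define Z where "Z = {x. x $ k >= 0 \<and> (\<Sum>j\<in>UNIV - {k}. (x $ j)\<^sup>2/(s j)^2) <= x $ k}"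
 have iff: "B *v z \<in> Z \<longleftrightarrow> (\<Sum>j\<in>W. (z \<bullet> j)\<^sup>2/b j) <= m*(z \<bullet> e)" for z
 proof -
  have "0 <= (\<Sum>j\<in>W. (z \<bullet> j)\<^sup>2/b j)" using b by (intro sum_nonneg divide_nonneg_pos) auto
  hence "0 <= (\<Sum>j\<in>W. (z \<bullet> j)\<^sup>2/b j)/m" using m by simp
  moreover have "(\<Sum>j\<in>W. (z \<bullet> j)\<^sup>2/b j)/m <= z \<bullet> e \<longleftrightarrow> (\<Sum>j\<in>W. (z \<bullet> j)\<^sup>2/b j) <= m*(z \<bullet> e)"
   using m by (simp add: pos_divide_le_eq mult.commute)
  ultimately show ?thesis unfolding Z_def mem_Collect_eq sum Bk by linarith
 qed
 have "{x. (\<Sum>j\<in>W. ((x-a) \<bullet> j)\<^sup>2/b j) <= m*((x-a) \<bullet> e)} = (%x. a+transpose B *v x) ` Z"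
 proof (intro set_eqI iffI)
  fix y assume "y \<in> {x. (\<Sum>j\<in>W. ((x-a) \<bullet> j)\<^sup>2/b j) <= m*((x-a) \<bullet> e)}"
  hence "B *v (y-a) \<in> Z" by (simp add: iff)
  moreover have "y = a+transpose B *v (B *v (y-a))" by (simp add: inv del: transpose_matrix_vector)
  ultimately show "y \<in> (%x. a+transpose B *v x) ` Z" by blast
 next
  fix y assume "y \<in> (%x. a+transpose B *v x) ` Z"
  then obtain x where x: "x \<in> Z" "y = a+transpose B *v x" by blast
  have "B *v (y-a) = x" using x by (simp add: inv del: transpose_matrix_vector)
  thus "y \<in> {x. (\<Sum>j\<in>W. ((x-a) \<bullet> j)\<^sup>2/b j) <= m*((x-a) \<bullet> e)}" using x(1) iff[of "y-a"] by simp
 qed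
 thus ?thesis unfolding paraboloid_def
  by (intro exI[of _ k] exI[of _ a] exI[of _ "transpose B"] exI[of _ s] conjI) (use rot s in \<open>auto simp: B_def Z_def\<close>)
qed

theorem theorem1p2:
  fixes u :: "real^'n \<Rightarrow> real" and k :: 'n and Q :: "real^'n^'n"
  assumes "CARD('n) \<ge> 3"
    and "xN_monotone k Q u"
  shows "paraboloid (coincidence_set u)"
proof -
 define e :: "real^'n" where "e = axis k 1"
 note x = assms(2)[unfolded xN_monotone_def]
 have gs: "global_solution u" and int: "interior (coincidence_set u) \<noteq> {}" and sub: "coincidence_set u \<subseteq> {x. x $ k >= 0}"
  and dec: "\<And>x. frechet_derivative u (at x) (axis k 1) <= 0"
  and Qk: "\<And>i. Q $ k $ i = 0" "\<And>i. Q $ i $ k = 0" and Qt: "transpose Q = Q"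
  and Qpos: "\<And>v. v $ k = 0 ==> v \<noteq> 0 ==> v \<bullet> (Q *v v) > 0" and trQ: "trace Q = 1"
  and lim: "C1alpha_loc_tendsto (%r x. u (r *. x)/r^2) (%x. (1/2)*(x \<bullet> (Q *v x))) (1/2)"
  using x by auto
 have ek: "x \<bullet> e = x $ k" for x by (simp add: e_def inner_axis)
 have u: "sol u" by (rule global_solution_sol[OF gs])
 have linQ: "linear ((*v) Q)" by (rule matrix_vector_mul_linear)
 have symQ: "(Q *v x) \<bullet> y = x \<bullet> (Q *v y)" for x y
  using dot_lmul_matrix[of x Q y] Qt by (metis inner_commute transpose_matrix_vector)
 have V: "subspace {x. e \<bullet> x = 0}" by (rule subspace_hyperplane)
 have QV: "Q *v x \<in> {x. e \<bullet> x = 0}" for x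
  using Qk(1) by (simp add: inner_commute[of e] ek matrix_vector_mult_def)
 \<comment> \<open>Q maps into the horizontal hyperplane, so an eigenbasis of that hyperplane exists
   and together with e forms a frame.\<close>
 obtain W where W: "finite W" "W \<subseteq> {x. e \<bullet> x = 0}" "pairwise orthogonal W" "ALL j:W. norm j = 1 \<and> (EX l. Q *v j = l *. j)" "{x. e \<bullet> x = 0} \<subseteq> span W"
  using symmetric_eigenbasis[OF linQ symQ V QV] by blast
 have ne: "norm e = 1" by (simp add: e_def)
 hence ee: "e \<bullet> e = 1" by (simp add: norm_eq_1)
 have eW: "e \<notin> W" using W(2) ee by auto
 have orth: "pairwise orthogonal (insert e W)"
  unfolding pairwise_insert using W by (auto simp: orthogonal_def inner_commute)
 have sp: "span (insert e W) = UNIV"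
 proof -
  have "x \<in> span (insert e W)" for x
  proof -
   have "x-(e \<bullet> x) *. e \<in> span W" using W(5) ee by (auto simp: inner_diff_right)
   thus ?thesis by (auto simp: span_insert)
  qed
  thus ?thesis by blast
 qed
 have "independent (insert e W)"
  using orth by (rule pairwise_orthogonal_independent) (use ne W(4) in force)
 hence "card (insert e W) = DIM(real^'n)"
  using sp by (metis basis_card_eq_dim dim_UNIV subset_UNIV)
 hence cW: "card W+1 = CARD('n)" using W(1) eW by simp
 have fr: "frame e W" by unfold_locales (use ne W eW cW assms(1) orth sp in auto)
 interpret frame e W by (rule fr)
 define q where "q j = j \<bullet> (Q *v j)" for j
 have qpos: "q j > 0" if "j \<in> W" for j
  unfolding q_def by (rule Qpos) (use that W in \<open>auto simp: inner_commute[of e] ek\<close>)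
 have Qj: "Q *v j = q j *. j" if j: "j \<in> W" for j
 proof -
  obtain l where "Q *v j = l *. j" using W(4) j by blast
  thus ?thesis using jj[OF j] by (simp add: q_def)
 qed
 have Qe: "Q *v e = 0" using Qk(2) by (simp add: e_def matrix_vector_mult_basis column_def vec_eq_iff)
 have q1: "(\<Sum>j\<in>W. q j) = 1"
 proof -
  have "(\<Sum>b\<in>Basis. (Q *v b) \<bullet> b) = trace Q"
   by (simp add: sum_Basis_vec inner_axis trace_def matrix_vector_mult_basis column_def)
  thus ?thesis using trace_frame[OF linQ] trQ Qe by (simp add: q_def inner_commute)
 qed
 \<comment> \<open>The eigenvalues of Q are positive with sum 1, so they can be prescribed as the
   coefficients of the blow-down of a model solution.\<close>
 obtain b where bq: "ALL j:W. b j > 0" "ALL j:W. 2 * parab.c W b * parab.Iinf W b j = q j"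
  using prescribed_mass[OF qpos q1] by blast
 interpret parab e W b by unfold_locales (use bq in blast)
 \<comment> \<open>The blow-down of the model is the blow-down of u; from here on u can be compared
   with the explicit family.\<close>
 have pQ: "p x = (1/2)*(x \<bullet> (Q *v x))" for x
 proof -
  have "Q *v x = (\<Sum>j\<in>W. (x \<bullet> j) *. (q j *. j))"
   by (subst (1) expand[of x, symmetric])
    (simp add: linear_add[OF linQ] linear_sum[OF linQ] linear_cmul[OF linQ] Qe Qj cong: sum.cong)
  hence "x \<bullet> (Q *v x) = (\<Sum>j\<in>W. q j*(x \<bullet> j)^2)" by (simp add: inner_sum_right power2_eq_square mult_ac)
  also have "\<dots> = (\<Sum>j\<in>W. (2 * c*Iinf j)*(x \<bullet> j)^2)"
  proof (rule sum.cong[OF refl])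
   fix j assume "j \<in> W"
   hence "2 * c*Iinf j = q j" using bq(2) by blast
   thus "q j*(x \<bullet> j)^2 = (2 * c*Iinf j)*(x \<bullet> j)^2" by (simp only:)
  qed
  finally show ?thesis by (simp add: p_def sum_distrib_left mult.assoc)
 qed
 have below: "u x > 0" if "x \<bullet> e < 0" for x
 proof -
  have "u x \<noteq> 0" using sub that by (auto simp: coincidence_set_def ek)
  thus ?thesis using sol_nonneg[OF u, of x] by simp
 qed
 have mono: "u (x+t *. e) <= u x" if t: "t >= 0" for x t
 proof -
  have "u (x+t *. e) <= u (x+0 *. e)"
  proof (rule DERIV_nonpos_imp_nonincreasing[OF t])
   fix s
   have 1: "((%s. x+s *. e) has_derivative (%h. h *. e)) (at s)" by (auto intro!: derivative_eq_intros)
   have "u differentiable (at y)" for y using gs by (simp add: global_solution_def C11_loc_def)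
   hence du: "(u has_derivative frechet_derivative u (at y)) (at y)" for y by (simp add: frechet_derivative_works)
   from has_derivative_compose[OF 1 du]
   have "((%s. u (x+s *. e)) has_derivative (%h. frechet_derivative u (at (x+s *. e)) (h *. e))) (at s)" .
   hence "((%s. u (x+s *. e)) has_real_derivative frechet_derivative u (at (x+s *. e)) e) (at s)"
    unfolding has_field_derivative_def
    by (rule has_derivative_eq_rhs) (simp add: fun_eq_iff linear_cmul[OF has_derivative_linear[OF du]])
   thus "EX y. ((%s. u (x+s *. e)) has_real_derivative y) (at s) \<and> y <= 0" using dec by (auto simp: e_def)
  qed
  thus ?thesis by simp
 qed
 obtain c0 C0 where c0: "c0 > 0" "ALL x. c0*(norm (perp e x))^2 <= p x \<and> p x <= C0*(norm (perp e x))^2" using p_bounds by blast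
 interpret pr: profile e u p c0 C0
 proof
  fix eps :: real assume eps: "eps > 0"
  have "\<forall>\<^sub>F r in at_top. ALL x:cball 0 1. ALL y:cball (0::real^'n) 1. \<bar>u (r *. x)/r^2-(1/2)*(x \<bullet> (Q *v x))\<bar> <= eps"
   using lim[unfolded C1alpha_loc_tendsto_def, rule_format, OF zero_less_one eps] by (rule eventually_mono) blast
  then obtain r0 where r0: "\<And>r x. r >= r0 ==> norm x <= 1 ==> \<bar>u (r *. x)/r^2-p x\<bar> <= eps"
   unfolding eventually_at_top_linorder pQ by (metis mem_cball_0)
  show "EX R0>0. ALL R>=R0. ALL x. norm x <= R --> \<bar>u x-p x\<bar> <= eps * R^2"
  proof (intro exI[of _ "max 1 r0"] conjI allI impI)
   fix R :: real and x :: "real^'n" assume R: "R >= max 1 r0" and x: "norm x <= R"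
   have Rp: "R > 0" using R by simp
   define y where "y = (1/R) *. x"
   have xy: "x = R *. y" using Rp by (simp add: y_def)
   have "norm y <= 1" using x Rp by (simp add: y_def)
   hence 1: "\<bar>u (R *. y)/R^2-p y\<bar> <= eps" using R by (intro r0) auto
   have "u x-p x = (u (R *. y)/R^2-p y) * R^2" using Rp by (simp add: xy p_scale left_diff_distrib)
   hence "\<bar>u x-p x\<bar> = \<bar>u (R *. y)/R^2-p y\<bar> * R^2" by (simp add: abs_mult)
   also have "\<dots> <= eps * R^2" using 1 by (intro mult_right_mono) auto
   finally show "\<bar>u x-p x\<bar> <= eps * R^2" .
  qed simp
 qed (use dim_ge_3 e u p_sol mono c0 p_shift below in auto)
 \<comment> \<open>The growth and tube hypotheses of this locale are conclusions of
   \<open>profile\<close>, applied with p as the common blow-down.\<close>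
 interpret expansion e W b u
  by unfold_locales (use u mono pr.w_growth pr.u_zero_tube in auto)
 obtain m a where "m > 0" "{x. u x = 0} = {x. (\<Sum>j\<in>W. ((x-a) \<bullet> j)\<^sup>2/b j) <= m*((x-a) \<bullet> e)}"
  using coincidence_set_quadratic[OF below] int[unfolded coincidence_set_def] by blast
 thus ?thesis unfolding coincidence_set_def using frame_paraboloid[OF fr _ _ cW, of b m a] bq(1) by simp
qed

end
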